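(* (Soundness of forward mode.) Let $e^p$ be a purely primal expression of Linear B, $\theta=(x_1,\dots,x_n)$ an enumeration of its free primal variables, $\phi=(x_1\mapsto\dot y_1,\dots,x_n\mapsto\dot y_n)$ an injective renaming of these variables into tangent variables of the same types, and $\theta'=(\dot y_1,\dots,\dot y_n)$. Then $$\mathcal F_\theta(\delta^{\mathtt B}(e^p))\;\sim\;\delta_{\theta'}(\mathcal F^{\mathrm{Jax}}_\phi(e^p)).$$ (If $x_i:\tau_i$ and $e^p$ has primal type $\tau$, both sides are $\lambda LL$ terms of type ${!\mathsf p(\tau)}\otimes\S((\&_i\mathsf t(\tau_i))\multimap\mathsf t(\tau))$ in the environment $!x_1:{!\mathsf p(\tau_1)},\dots,!x_n:{!\mathsf p(\tau_n)}$.)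
   Context: **Calculus $\lambda LL$.** Fix function symbols $\underline f$ with arities $n\ge 1$, each denoting a differentiable $f:\mathbb R^n\to\mathbb R$ and coming with symbols $\underline{\partial_i f}$ for its partial derivatives. Types: $A,B::=\mathbb R\mid A\multimap B\mid 1\mid A\otimes B\mid\top\mid A\& B\mid {!A}$. Each variable has a fixed type. Patterns: $p,q::=x\mid {!x}\mid ()\mid (p,q)\mid\langle p,q\rangle$, no variable repeated, typed by $x:A$, $!x:{!A}$ (for $x$ of type $A$), $():1$, $(p,q):A\otimes B$, $\langle p,q\rangle:A\& B$. An environment is a finite set of typed patterns with disjoint variables; $!\Gamma$ means all patterns are of the form $!x$; the comma is variable-disjoint union. Terms: $M,N::=x\mid {!M}\mid\lambda p.M\mid MN\mid ()\mid (M,N)\mid\langle\rangle\mid\langle M,N\rangle\mid\underline r\mid\underline f\mid\dot+\mid\dot*$ ($r\in\mathbb R$). Typing: $x:A\vdash x:A$; $!x:{!A}\vdash x:A$; $!\Gamma\vdash M:A\Rightarrow{!\Gamma}\vdash{!M}:{!A}$; $\Delta\vdash M:B\Rightarrow{!x}:{!A},\Delta\vdash M:B$; $p:A,\Delta\vdash M:B\Rightarrow\Delta\vdash\lambda p.M:A\multimap B$; if $!\Gamma_i,\Delta_i\vdash M_i:A_i$ ($i=1,2$) then $!\Gamma_1\cup{!\Gamma_2},\Delta_1,\Delta_2\vdash M_1M_2:B$ when $A_1=A_2\multimap B$, and $\vdash(M_1,M_2):A_1\otimes A_2$ in that same environment; $\vdash():1$; $\Delta\vdash M:B\Rightarrow():1,\Delta\vdash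 M:B$; $p:A,q:B,\Delta\vdash M:C\Rightarrow(p,q):A\otimes B,\Delta\vdash M:C$; $\Delta\vdash M_1:A_1$ and $\Delta\vdash M_2:A_2\Rightarrow\Delta\vdash\langle M_1,M_2\rangle:A_1\& A_2$; $p_i:A_i,\Delta\vdash M:B\Rightarrow\langle p_1,p_2\rangle:A_1\& A_2,\Delta\vdash M:B$ ($i=1$ or $2$); $\Delta\vdash\langle\rangle:\top$; $\vdash\underline r:\mathbb R$; $\Delta\vdash\underline0:\mathbb R$; $\vdash\underline f:({!\mathbb R}\otimes\dots\otimes{!\mathbb R})\multimap{!\mathbb R}$; $\vdash\dot+:\mathbb R\&\mathbb R\multimap\mathbb R$; $\vdash\dot*:\mathbb R\multimap\mathbb R\multimap\mathbb R$. Reduction $\rightarrow$ is the closure under all term contexts of: $(\lambda p.M)V\to M\{V/p\}$ for $V$ a value for $p$; $\underline f(!\underline{r_1},\dots,!\underline{r_n})\to{!\underline{f(r_1,\dots,r_n)}}$; $\dot+\langle\underline r,\underline s\rangle\to\underline{r+s}$; $\dot*\,\underline r\,\underline s\to\underline{rs}$. A value for $x$ is any term, for $!x$ any $!M$, for $()$ is $()$, for $(p_1,p_2)$ (resp. $\langle p_1,p_2\rangle$) a pair $(V_1,V_2)$ (resp. $\langle V_1,V_2\rangle$) of values for $p_1,p_2$; substitution acts componentwise, with $M\{!N/!x\}=M\{N/x\}$ and $M\{()/()\}=M$. $=_\beta$ is the equivalence closure of $\rightarrow$. **Logical equivalence $\sim$.** On closed terms of the same type: $M\sim_{\mathbb R}N$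 and $M\sim_1N$ iff $M=_\beta N$; $M\sim_{A_1\otimes A_2}N$ iff $M\to^*(M_1,M_2)$, $N\to^*(N_1,N_2)$ with $M_i\sim_{A_i}N_i$; $M\sim_{!A}N$ iff $M\to^*{!M'}$, $N\to^*{!N'}$ with $M'\sim_AN'$; $M\sim_\top N$ always; $M\sim_{A_1\& A_2}N$ iff $(\lambda\langle x_1,x_2\rangle.x_i)M\sim_{A_i}(\lambda\langle x_1,x_2\rangle.x_i)N$ for $i=1,2$; $M\sim_{A\multimap B}N$ iff $MM'\sim_BNN'$ whenever $M'\sim_AN'$. For $\Gamma=p_1:A_1,\dots,p_n:A_n$ and $\Gamma\vdash M,N:A$: $M\sim N$ iff $M\{V_i/p_i\}_i\sim_AN\{V'_i/p_i\}_i$ for all closed values $V_i,V'_i$ for $p_i$ with $V_i\sim_{A_i}V_i'$. **Abbreviations.** $\mathtt{let}\ p=N\ \mathtt{in}\ M:=(\lambda p.M)N$; $\S A:=1\& A$ and $\S M:=\langle(),M\rangle$ for terms and patterns $M$. $n$-ary tuples $\langle M_1,\dots,M_n\rangle$ (and $A_1\&\dots\& A_n$, and tuple patterns) are right-nested; the $1$-ary tuple is its component; the empty tuple is $\langle\rangle$, the empty $\&$ is $\top$, and the empty tuple pattern is a fresh variable of type $\top$. For types $H$ built from $\mathbb R,\top,\&$: $\underline0_{\mathbb R}=\underline0$, $\underline0_\top=\langle\rangle$, $\underline0_{H\& H'}=\langle\underline0_H,\underline0_{H'}\rangle$; $\dot+_{\mathbb R}=\dot+$, $\dot+_\top=\lambda\langle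 h,h'\rangle.\langle\rangle$, $\dot+_{H\& K}=\lambda\langle\langle h,k\rangle,\langle h',k'\rangle\rangle.\langle\dot+_H\langle h,h'\rangle,\dot+_K\langle k,k'\rangle\rangle$; for a variable $x:\mathbb R$: $\dot*_{\mathbb R}x=\dot*x$, $\dot*_\top x=\lambda h.\langle\rangle$, $\dot*_{H\& K}x=\lambda\langle h,k\rangle.\langle(\dot*_Hx)h,(\dot*_Kx)k\rangle$. $M\dot+N$ means $\dot+\langle M,N\rangle$, $x\dot*u$ means $\dot*\,x\,u$. **Linear A.** Types $\tau,\sigma::=\mathbb R\mid1\mid\tau\otimes\sigma$. There are primal variables $x,z,\dots$ and tangent variables $\dot x,\dot y,\dots$, with fixed types. Judgments $\Gamma;\dot\Gamma\vdash e:(\tau;\sigma)$ ($\Gamma$ primal context, $\dot\Gamma$ tangent context; comma = disjoint union, $\cup$ = union): - $x:\tau;\dot y:\sigma\vdash(x;\dot y):(\tau;\sigma)$; - $\Gamma_1;\dot\Gamma_1\vdash e_1:(\tau_1;\sigma_1)$ and $\Gamma_2,x:\tau_1;\dot\Gamma_2,\dot y:\sigma_1\vdash e_2:(\tau;\sigma)$ give $\Gamma_1\cup\Gamma_2;\dot\Gamma_1,\dot\Gamma_2\vdash\mathtt{let}\,(x;\dot y)=e_1\,\mathtt{in}\,e_2:(\tau;\sigma)$; - $;\vdash\otimes():(1;1)$; $;\vdash\dot\otimes():(1;1)$; - $\Gamma;\dot\Gamma\vdash e:(\tau;\sigma)$ gives $\Gamma,z:1;\dot\Gamma\vdash\mathtt{let}\otimes()=z\,\mathtt{in}\,e:(\tau;\sigma)$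 and $\Gamma;\dot\Gamma,\dot z:1\vdash\mathtt{let}\,\dot\otimes()=\dot z\,\mathtt{in}\,e:(\tau;\sigma)$; - $;\dot x_1:\tau_1,\dot x_2:\tau_2\vdash\dot\otimes(\dot x_1,\dot x_2):(1;\tau_1\otimes\tau_2)$; $\Gamma;\dot\Gamma,\dot x_1:\tau_1,\dot x_2:\tau_2\vdash e:(\tau;\sigma)$ gives $\Gamma;\dot\Gamma,\dot z:\tau_1\otimes\tau_2\vdash\mathtt{let}\,\dot\otimes(\dot x_1,\dot x_2)=\dot z\,\mathtt{in}\,e:(\tau;\sigma)$; - $;\vdash\dot0_\tau:(1;\tau)$; $;\dot x:\tau,\dot y:\tau\vdash\dot x\,\dot+\,\dot y:(1;\tau)$; $x:\mathbb R;\dot y:\tau\vdash x\,\dot*\,\dot y:(1;\tau)$; $;\vdash\underline r:(\mathbb R;1)$; $x_1:\mathbb R,\dots,x_n:\mathbb R;\vdash\underline f(x_1,\dots,x_n):(\mathbb R;1)$; $;\dot x:\tau\vdash\mathrm{dup}(\dot x):(1;\tau\otimes\tau)$; $\Gamma;\dot\Gamma\vdash e:(\tau;\sigma)$ gives $\Gamma;\dot\Gamma\vdash\mathrm{drop}(e):(1;1)$. $FV(e)$, $FV^t(e)$ are the free primal, resp. tangent, variables. **Syntactic sugar** (fresh auxiliary variables): $\mathtt{let}\,x=e_1\,\mathtt{in}\,e_2:=\mathtt{let}\,(x;\dot y)=e_1\,\mathtt{in}\,\mathtt{let}\,\dot\otimes()=\dot y\,\mathtt{in}\,e_2$; $\mathtt{let}\,\dot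 y=e_1\,\mathtt{in}\,e_2:=\mathtt{let}\,(x;\dot y)=e_1\,\mathtt{in}\,\mathtt{let}\otimes()=x\,\mathtt{in}\,e_2$; expression $x:=\mathtt{let}\,\dot y=\dot\otimes()\,\mathtt{in}\,(x;\dot y)$; expression $\dot y:=\mathtt{let}\,x=\otimes()\,\mathtt{in}\,(x;\dot y)$; $(e_1;e_2):=\mathtt{let}\,x=e_1\,\mathtt{in}\,\mathtt{let}\,\dot y=e_2\,\mathtt{in}\,(x;\dot y)$; $e_1\dot+e_2:=\mathtt{let}\,\dot x=e_1\,\mathtt{in}\,\mathtt{let}\,\dot y=e_2\,\mathtt{in}\,\dot x\dot+\dot y$. **Purely primal expressions of Linear B** (typed $\Gamma;\vdash e^p:(\tau;1)$): $e^p::=x\mid\mathtt{let}\,x=e_1^p\,\mathtt{in}\,e_2^p\mid\underline r\mid\underline f(x_1,\dots,x_n)\mid\mathrm{drop}(e^p)\mid\otimes()\mid\mathtt{let}\otimes()=z\,\mathtt{in}\,e^p$. **$\mathcal F^{\mathrm{Jax}}_\phi$** ($\phi$ defined on $FV(e^p)$): $x\mapsto(x;\phi(x))$; $\underline r\mapsto(\underline r;\dot0_{\mathbb R})$; $\otimes()\mapsto(\otimes();\dot\otimes())$; $\underline f(x_1,\dots,x_n)\mapsto\mathtt{let}\,w_1=\underline{\partial_1f}(x_1,\dots,x_n)\,\mathtt{in}\cdots\mathtt{let}\,w_n=\underline{\partial_nf}(x_1,\dots,x_n)\,\mathtt{in}\,(\underline f(x_1,\dots,x_n);\,w_1\dot*\phi(x_1)\,\dot+\cdots\dot+\,w_n\dot*\phi(x_n))$;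 $\mathrm{drop}(e)\mapsto\mathrm{drop}(\mathcal F^{\mathrm{Jax}}_\phi(e))$; $\mathtt{let}\otimes()=z\,\mathtt{in}\,e\mapsto\mathtt{let}\otimes()=z\,\mathtt{in}\,\mathtt{let}\,\dot\otimes()=\phi(z)\,\mathtt{in}\,\mathcal F^{\mathrm{Jax}}_{\phi}(e)$; for $\mathtt{let}\,x=e_1\,\mathtt{in}\,e_2$, let $z_1,\dots,z_k$ be the free variables common to $e_1$ and $\mathtt{e_2}$ (other than $x$) and $\phi_i$ the restriction of $\phi$ to the remaining free variables of $e_i$: the result is $\mathtt{let}\,\dot a_1=\mathrm{dup}(\phi(z_1))\,\mathtt{in}\,\mathtt{let}\,\dot\otimes(\dot w_1,\dot v_1)=\dot a_1\,\mathtt{in}\cdots\mathtt{let}\,\dot a_k=\mathrm{dup}(\phi(z_k))\,\mathtt{in}\,\mathtt{let}\,\dot\otimes(\dot w_k,\dot v_k)=\dot a_k\,\mathtt{in}\,\mathtt{let}\,(x;\dot y)=\mathcal F^{\mathrm{Jax}}_{\phi_1,\{z_i\to\dot w_i\}}(e_1)\,\mathtt{in}\,\mathcal F^{\mathrm{Jax}}_{\phi_2,\{z_i\to\dot v_i\},x\to\dot y}(e_2)$. **Translation of types.** $\mathsf p(\mathbb R)=\mathbb R$, $\mathsf p(1)=1$, $\mathsf p(\tau\otimes\sigma)={!\mathsf p(\tau)}\otimes{!\mathsf p(\sigma)}$; $\mathsf t(\mathbb R)=\mathbb R$, $\mathsf t(1)=\top$, $\mathsf t(\tau\otimes\sigma)=\mathsf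 t(\tau)\&\mathsf t(\sigma)$; $\mathsf t$ is also defined on $\lambda LL$ types by $\mathsf t(\mathbb R)=\mathbb R$, $\mathsf t(1)=\top$, $\mathsf t({!D}\otimes{!E})=\mathsf t(D)\&\mathsf t(E)$. **Translation $\delta$.** For $\Gamma;\dot\Gamma\vdash e:(\tau;\sigma)$ and an enumeration $\theta$ of $\dot\Gamma=FV^t(e)$; primal variables $x:\tau'$ are used as $\lambda LL$ variables of type $\mathsf p(\tau')$. Write $u_\theta=\langle u_{\dot y}\rangle_{\dot y\in\theta}$ for a tuple (pattern) of fresh variables $u_{\dot y}:\mathsf t(\sigma')$, for $\dot y:\sigma'$ in $\theta$. - $\delta_\theta((x;\dot y))=(!x,\S(\lambda u_\theta.u_{\dot y}))$; - $\delta_\theta(\mathtt{let}\,(x;\dot y)=e_1\,\mathtt{in}\,e_2)=\mathtt{let}\,(!x,\S f)=\delta_{\theta_1}(e_1)\,\mathtt{in}\,\mathtt{let}\,(!z,\S g)=\delta_{\dot y,\theta_2}(e_2)\,\mathtt{in}\,(!z,\S(\lambda u_\theta.\,g\langle f\,u_{\theta_1},u_{\dot w}\rangle_{\dot w\in\theta_2}))$, where $\theta_i=\theta\cap FV^t(e_i)$ and the argument of $g$ is the tuple with first component $f\,u_{\theta_1}$ followed by $u_{\dot w}$, $\dot w\in\theta_2$; - $\delta_\theta(\otimes())=\delta_\theta(\dot\otimes())=(!(),\S(\lambda y^\top.\langle\rangle))$; $\delta_\theta(\mathtt{let}\otimes()=z\,\mathtt{in}\,e)=\mathtt{let}\,()=z\,\mathtt{in}\,\delta_\theta(e)$;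 - $\delta_\theta(\mathtt{let}\,\dot\otimes()=\dot z\,\mathtt{in}\,e)=\mathtt{let}\,(!x,\S f)=\delta_{\theta\setminus\dot z}(e)\,\mathtt{in}\,(!x,\S(\lambda u_\theta.f\,u_{\theta\setminus\dot z}))$; - $\delta_\theta(\dot\otimes(\dot x_1,\dot x_2))=(!(),\S(\lambda u_\theta.\langle u_{\dot x_1},u_{\dot x_2}\rangle))$; - $\delta_\theta(\mathtt{let}\,\dot\otimes(\dot x_1,\dot x_2)=\dot z\,\mathtt{in}\,e)=\mathtt{let}\,(!x,\S f)=\delta_{\dot x_1,\dot x_2,\theta\setminus\dot z}(e)\,\mathtt{in}\,(!x,\S(\lambda u_\theta[\langle x_1,x_2\rangle/u_{\dot z}].\,f\langle x_1,x_2,u_{\dot w}\rangle_{\dot w\in\theta\setminus\dot z}))$, where $u_\theta[\langle x_1,x_2\rangle/u_{\dot z}]$ is $u_\theta$ with $u_{\dot z}$ replaced by $\langle x_1,x_2\rangle$; - $\delta_\theta(\underline r)=(!\underline r,\S(\lambda y^\top.\langle\rangle))$; $\delta_\theta(\underline f(x_1,\dots,x_n))=(\underline f(!x_1,\dots,!x_n),\S(\lambda y^\top.\langle\rangle))$; $\delta_\theta(\dot0_\sigma)=(!(),\S(\lambda y^\top.\underline0_{\mathsf t(\sigma)}))$; - for $\dot y_1,\dot y_2,\dot y:\tau$: $\delta_\theta(\dot y_1\dot+\dot y_2)=(!(),\S(\lambda u_\theta.\dot+_{\mathsf t(\tau)}\langle u_{\dot y_1},u_{\dot y_2}\rangle))$;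 $\delta_\theta(x\dot*\dot y)=(!(),\S(\lambda u_\theta.(\dot*_{\mathsf t(\tau)}x)u_{\dot y}))$; $\delta_\theta(\mathrm{dup}(\dot y))=(!(),\S(\lambda u_\theta.\langle u_{\dot y},u_{\dot y}\rangle))$; - $\delta_\theta(\mathrm{drop}(e))=\mathtt{let}\,(!x,\S f)=\delta_\theta(e)\,\mathtt{in}\,(!(),\S(\lambda y.\mathtt{let}\ z=f\,y\ \mathtt{in}\,\langle\rangle))$. **Translation $\delta^{\mathtt B}$ of purely primal expressions**: $x\mapsto{!x}$; $\mathtt{let}\,x=e_1\,\mathtt{in}\,e_2\mapsto\mathtt{let}\,{!x}=\delta^{\mathtt B}(e_1)\,\mathtt{in}\,\delta^{\mathtt B}(e_2)$; $\underline r\mapsto{!\underline r}$; $\underline f(x_1,\dots,x_n)\mapsto\underline f(!x_1,\dots,!x_n)$; $\mathrm{drop}(e)\mapsto\mathtt{let}\,{!x}=\delta^{\mathtt B}(e)\,\mathtt{in}\,{!()}$; $\otimes()\mapsto{!()}$; $\mathtt{let}\otimes()=z\,\mathtt{in}\,e\mapsto\mathtt{let}\,()=z\,\mathtt{in}\,\delta^{\mathtt B}(e)$. **Forward transformation $\mathcal F_\theta$ in $\lambda LL$**, on terms $P,Q::={!x}\mid{!\underline r}\mid{!()}\mid\underline f(!x_1,\dots,!x_n)\mid\mathtt{let}\,{!x}=Q\,\mathtt{in}\,P\mid\mathtt{let}\,()=z\,\mathtt{in}\,P$, with $\theta$ an enumeration of $FV(P)$; $u_\theta=\langle u_x\rangle_{x\in\theta}$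 with $u_x:\mathsf t(E)$ for $x:E$: - $\mathcal F_\theta(!x)=(!x,\S(\lambda u.u))$; $\mathcal F_\theta(!\underline r)=(!\underline r,\S(\lambda u^\top.\underline0))$; $\mathcal F_\theta(!())=(!(),\S(\lambda u^\top.\langle\rangle))$; - $\mathcal F_\theta(\underline f(!x_1,\dots,!x_n))=\mathtt{let}\,{!y_1}=\underline{\partial_1f}(!x_1,\dots,!x_n)\,\mathtt{in}\cdots\mathtt{let}\,{!y_n}=\underline{\partial_nf}(!x_1,\dots,!x_n)\,\mathtt{in}\,(\underline f(!x_1,\dots,!x_n),\S(\lambda u_\theta.(y_1\dot*u_{x_1})\dot+\cdots\dot+(y_n\dot*u_{x_n})))$; - $\mathcal F_\theta(\mathtt{let}\,{!x}=Q\,\mathtt{in}\,P)=\mathtt{let}\,(!x,\S f)=\mathcal F_{\theta\cap FV(Q)}(Q)\,\mathtt{in}\,\mathtt{let}\,(!y,\S g)=\mathcal F_{x,\theta\cap FV(P)}(P)\,\mathtt{in}\,(!y,\S(\lambda u_\theta.\,g\langle f\,u_{\theta\cap FV(Q)},u_z\rangle_{z\in\theta\cap FV(P)}))$; if $x\notin FV(P)$, then $x$ is omitted from the index and the component $f\,u_{\theta\cap FV(Q)}$ from the argument of $g$; - $\mathcal F_\theta(\mathtt{let}\,()=z\,\mathtt{in}\,P)=\mathtt{let}\,()=z\,\mathtt{in}\,\mathtt{let}\,(!y,\S g)=\mathcal F_{\theta\cap FV(P)}(P)\,\mathtt{in}\,(!y,\S(\lambda u_\theta.g\,u_{\theta\cap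 FV(P)}))$. *)

theory Defs
  imports "HOL-Analysis.L2_Norm"
begin

section \<open>Function symbols\<close>

text \<open>
  Points of \<open>\<real>\<^sup>n\<close> are real lists of length \<open>n\<close>, since the arity varies with the symbol;
  differentiability is total (Frechet) differentiability with respect to the Euclidean norm.
  Argument positions are counted from 0: \<open>part S f i\<close> is the symbol of the partial derivative
  with respect to argument number \<open>i < arity S f\<close>.
\<close>

record 'f signat =
  arity :: "'f \<Rightarrow> nat"
  den :: "'f \<Rightarrow> real list \<Rightarrow> real"
  part :: "'f \<Rightarrow> nat \<Rightarrow> 'f"

definition differentiable_Rn :: "nat \<Rightarrow> (real list \<Rightarrow> real) \<Rightarrow> bool" where
  "differentiable_Rn n F \<longleftrightarrow>
     (\<forall>x. length x = n \<longrightarrow>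
       (\<exists>c. length c = n \<and>
         (\<forall>\<epsilon>>0. \<exists>\<delta>>0. \<forall>h. length h = n \<and> L2_set (\<lambda>i. h ! i) {..<n} < \<delta> \<longrightarrow>
            \<bar>F (map2 (+) x h) - F x - (\<Sum>i<n. c ! i * h ! i)\<bar> \<le> \<epsilon> * L2_set (\<lambda>i. h ! i) {..<n})))"

definition wf_signat :: "'f signat \<Rightarrow> bool" where
  "wf_signat S \<longleftrightarrow>
     (\<forall>f. arity S f \<ge> 1 \<and> differentiable_Rn (arity S f) (den S f)) \<and>
     (\<forall>f i. i < arity S f \<longrightarrow>
        arity S (part S f i) = arity S f \<and>
        (\<forall>x. length x = arity S f \<longrightarrow>
           ((\<lambda>s. den S f (x[i := s])) has_real_derivative den S (part S f i) x) (at (x ! i))))"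

definition fresh_index :: "nat set \<Rightarrow> nat" where
  "fresh_index I = Suc (Max (insert 0 I))"


section \<open>The calculus \<open>\<lambda>LL\<close>\<close>

datatype ty =
    TReal
  | Lolli ty ty
  | TOne
  | Tensor ty ty
  | TTop
  | TWith ty ty
  | OfCourse ty

text \<open>A variable carries its type, so every pattern has exactly one type.\<close>

datatype var = Var (vidx: nat) (vty: ty)

datatype pat =
    PVar var
  | PBang var
  | PUnit
  | PPair pat pat
  | PWith pat pat

primrec pvars :: "pat \<Rightarrow> var list" where
  "pvars (PVar x) = [x]"
| "pvars (PBang x) = [x]"
| "pvars PUnit = []"
| "pvars (PPair p q) = pvars p @ pvars q"
| "pvars (PWith p q) = pvars p @ pvars q"

abbreviation pset :: "pat \<Rightarrow> var set" where
  "pset p \<equiv> set (pvars p)"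

abbreviation wf_pat :: "pat \<Rightarrow> bool" where
  "wf_pat p \<equiv> distinct (pvars p)"

primrec pty :: "pat \<Rightarrow> ty" where
  "pty (PVar x) = vty x"
| "pty (PBang x) = OfCourse (vty x)"
| "pty PUnit = TOne"
| "pty (PPair p q) = Tensor (pty p) (pty q)"
| "pty (PWith p q) = TWith (pty p) (pty q)"

datatype 'f tm =
    V var
  | Bang "'f tm"
  | Lam pat "'f tm"
  | App "'f tm" "'f tm"
  | Unit
  | Pair "'f tm" "'f tm"
  | Empty
  | WPair "'f tm" "'f tm"
  | Num real
  | Fn 'f
  | Plus
  | Times

fun fv :: "'f tm \<Rightarrow> var set" where
  "fv (V x) = {x}"
| "fv (Bang M) = fv M"
| "fv (Lam p M) = fv M - pset p"
| "fv (App M N) = fv M \<union> fv N"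
| "fv (Pair M N) = fv M \<union> fv N"
| "fv (WPair M N) = fv M \<union> fv N"
| "fv _ = {}"

fun bv :: "'f tm \<Rightarrow> var set" where
  "bv (Bang M) = bv M"
| "bv (Lam p M) = pset p \<union> bv M"
| "bv (App M N) = bv M \<union> bv N"
| "bv (Pair M N) = bv M \<union> bv N"
| "bv (WPair M N) = bv M \<union> bv N"
| "bv _ = {}"

subsection \<open>Renaming of bound variables\<close>

text \<open>
  Terms are meant up to \<open>\<alpha>\<close>-equivalence, which is generated by applying to an abstraction a
  type-preserving permutation of the variables that fixes its free variables.  The datatype of
  terms is not quotiented; instead, typing, \<open>reds\<close> and \<open>beta_eq\<close> are closed under \<open>alpha\<close>.
\<close>

primrec perm_pat :: "(var \<Rightarrow> var) \<Rightarrow> pat \<Rightarrow> pat" where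
  "perm_pat \<pi> (PVar x) = PVar (\<pi> x)"
| "perm_pat \<pi> (PBang x) = PBang (\<pi> x)"
| "perm_pat \<pi> PUnit = PUnit"
| "perm_pat \<pi> (PPair p q) = PPair (perm_pat \<pi> p) (perm_pat \<pi> q)"
| "perm_pat \<pi> (PWith p q) = PWith (perm_pat \<pi> p) (perm_pat \<pi> q)"

primrec perm :: "(var \<Rightarrow> var) \<Rightarrow> 'f tm \<Rightarrow> 'f tm" where
  "perm \<pi> (V x) = V (\<pi> x)"
| "perm \<pi> (Bang M) = Bang (perm \<pi> M)"
| "perm \<pi> (Lam p M) = Lam (perm_pat \<pi> p) (perm \<pi> M)"
| "perm \<pi> (App M N) = App (perm \<pi> M) (perm \<pi> N)"
| "perm \<pi> (Pair M N) = Pair (perm \<pi> M) (perm \<pi> N)"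
| "perm \<pi> (WPair M N) = WPair (perm \<pi> M) (perm \<pi> N)"
| "perm \<pi> Unit = Unit"
| "perm \<pi> Empty = Empty"
| "perm \<pi> (Num r) = Num r"
| "perm \<pi> (Fn f) = Fn f"
| "perm \<pi> Plus = Plus"
| "perm \<pi> Times = Times"

inductive alpha :: "'f tm \<Rightarrow> 'f tm \<Rightarrow> bool" where
  alpha_rename: "bij \<pi> \<Longrightarrow> (\<And>x. vty (\<pi> x) = vty x) \<Longrightarrow> (\<And>x. x \<in> fv (Lam p M) \<Longrightarrow> \<pi> x = x) \<Longrightarrow>
     alpha (Lam p M) (perm \<pi> (Lam p M))"
| alpha_refl: "alpha M M"
| alpha_sym: "alpha M N \<Longrightarrow> alpha N M"
| alpha_trans: "alpha M N \<Longrightarrow> alpha N P \<Longrightarrow> alpha M P"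
| alpha_Bang: "alpha M M' \<Longrightarrow> alpha (Bang M) (Bang M')"
| alpha_Lam: "alpha M M' \<Longrightarrow> alpha (Lam p M) (Lam p M')"
| alpha_App: "alpha M M' \<Longrightarrow> alpha N N' \<Longrightarrow> alpha (App M N) (App M' N')"
| alpha_Pair: "alpha M M' \<Longrightarrow> alpha N N' \<Longrightarrow> alpha (Pair M N) (Pair M' N')"
| alpha_WPair: "alpha M M' \<Longrightarrow> alpha N N' \<Longrightarrow> alpha (WPair M N) (WPair M' N')"

subsection \<open>Typing\<close>

text \<open>
  Right-nested tuples.  For \<open>\<otimes>\<close> only non-empty tuples occur, because arities are positive.
\<close>

fun tensor_ty :: "ty list \<Rightarrow> ty" where
  "tensor_ty [] = TOne"
| "tensor_ty [A] = A"
| "tensor_ty (A # B # As) = Tensor A (tensor_ty (B # As))"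

fun tensor_tm :: "'f tm list \<Rightarrow> 'f tm" where
  "tensor_tm [] = Unit"
| "tensor_tm [M] = M"
| "tensor_tm (M # N # Ms) = Pair M (tensor_tm (N # Ms))"

definition evars :: "pat set \<Rightarrow> var set" where
  "evars \<Gamma> = (\<Union>p\<in>\<Gamma>. pset p)"

definition env :: "pat set \<Rightarrow> bool" where
  "env \<Gamma> \<longleftrightarrow> finite \<Gamma> \<and> (\<forall>p\<in>\<Gamma>. wf_pat p) \<and>
     (\<forall>p\<in>\<Gamma>. \<forall>q\<in>\<Gamma>. p \<noteq> q \<longrightarrow> pset p \<inter> pset q = {})"

definition bang_env :: "pat set \<Rightarrow> bool" where
  "bang_env \<Gamma> \<longleftrightarrow> finite \<Gamma> \<and> \<Gamma> \<subseteq> range PBang"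

text \<open>
  \<open>split_env \<Gamma>\<^sub>1 \<Delta>\<^sub>1 \<Gamma>\<^sub>2 \<Delta>\<^sub>2\<close> says that \<open>!\<Gamma>\<^sub>1 \<union> !\<Gamma>\<^sub>2, \<Delta>\<^sub>1, \<Delta>\<^sub>2\<close> is well formed.
\<close>

definition split_env :: "pat set \<Rightarrow> pat set \<Rightarrow> pat set \<Rightarrow> pat set \<Rightarrow> bool" where
  "split_env \<Gamma>\<^sub>1 \<Delta>\<^sub>1 \<Gamma>\<^sub>2 \<Delta>\<^sub>2 \<longleftrightarrow> bang_env \<Gamma>\<^sub>1 \<and> bang_env \<Gamma>\<^sub>2 \<and>
     evars \<Delta>\<^sub>1 \<inter> evars \<Delta>\<^sub>2 = {} \<and> evars (\<Gamma>\<^sub>1 \<union> \<Gamma>\<^sub>2) \<inter> evars (\<Delta>\<^sub>1 \<union> \<Delta>\<^sub>2) = {}"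

inductive typing :: "'f signat \<Rightarrow> pat set \<Rightarrow> 'f tm \<Rightarrow> ty \<Rightarrow> bool" for S where
  ty_alpha: "typing S \<Gamma> M A \<Longrightarrow> alpha M N \<Longrightarrow> typing S \<Gamma> N A"
| ty_var: "typing S {PVar x} (V x) (vty x)"
| ty_bvar: "typing S {PBang x} (V x) (vty x)"
| ty_Bang: "bang_env \<Gamma> \<Longrightarrow> typing S \<Gamma> M A \<Longrightarrow> typing S \<Gamma> (Bang M) (OfCourse A)"
| ty_weak: "x \<notin> evars \<Delta> \<Longrightarrow> typing S \<Delta> M B \<Longrightarrow> typing S (insert (PBang x) \<Delta>) M B"
| ty_Lam: "wf_pat p \<Longrightarrow> pset p \<inter> evars \<Delta> = {} \<Longrightarrow> typing S (insert p \<Delta>) M B \<Longrightarrow>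
     typing S \<Delta> (Lam p M) (Lolli (pty p) B)"
| ty_App: "split_env \<Gamma>\<^sub>1 \<Delta>\<^sub>1 \<Gamma>\<^sub>2 \<Delta>\<^sub>2 \<Longrightarrow>
     typing S (\<Gamma>\<^sub>1 \<union> \<Delta>\<^sub>1) M\<^sub>1 (Lolli A B) \<Longrightarrow> typing S (\<Gamma>\<^sub>2 \<union> \<Delta>\<^sub>2) M\<^sub>2 A \<Longrightarrow>
     typing S (\<Gamma>\<^sub>1 \<union> \<Gamma>\<^sub>2 \<union> \<Delta>\<^sub>1 \<union> \<Delta>\<^sub>2) (App M\<^sub>1 M\<^sub>2) B"
| ty_Pair: "split_env \<Gamma>\<^sub>1 \<Delta>\<^sub>1 \<Gamma>\<^sub>2 \<Delta>\<^sub>2 \<Longrightarrow>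
     typing S (\<Gamma>\<^sub>1 \<union> \<Delta>\<^sub>1) M\<^sub>1 A\<^sub>1 \<Longrightarrow> typing S (\<Gamma>\<^sub>2 \<union> \<Delta>\<^sub>2) M\<^sub>2 A\<^sub>2 \<Longrightarrow>
     typing S (\<Gamma>\<^sub>1 \<union> \<Gamma>\<^sub>2 \<union> \<Delta>\<^sub>1 \<union> \<Delta>\<^sub>2) (Pair M\<^sub>1 M\<^sub>2) (Tensor A\<^sub>1 A\<^sub>2)"
| ty_Unit: "typing S {} Unit TOne"
| ty_unitL: "typing S \<Delta> M B \<Longrightarrow> typing S (insert PUnit \<Delta>) M B"
| ty_pairL: "wf_pat (PPair p q) \<Longrightarrow> pset (PPair p q) \<inter> evars \<Delta> = {} \<Longrightarrow>
     typing S (insert p (insert q \<Delta>)) M C \<Longrightarrow> typing S (insert (PPair p q) \<Delta>) M C"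
| ty_WPair: "typing S \<Delta> M\<^sub>1 A\<^sub>1 \<Longrightarrow> typing S \<Delta> M\<^sub>2 A\<^sub>2 \<Longrightarrow>
     typing S \<Delta> (WPair M\<^sub>1 M\<^sub>2) (TWith A\<^sub>1 A\<^sub>2)"
| ty_withL1: "wf_pat (PWith p\<^sub>1 p\<^sub>2) \<Longrightarrow> pset (PWith p\<^sub>1 p\<^sub>2) \<inter> evars \<Delta> = {} \<Longrightarrow>
     typing S (insert p\<^sub>1 \<Delta>) M B \<Longrightarrow> typing S (insert (PWith p\<^sub>1 p\<^sub>2) \<Delta>) M B"
| ty_withL2: "wf_pat (PWith p\<^sub>1 p\<^sub>2) \<Longrightarrow> pset (PWith p\<^sub>1 p\<^sub>2) \<inter> evars \<Delta> = {} \<Longrightarrow>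
     typing S (insert p\<^sub>2 \<Delta>) M B \<Longrightarrow> typing S (insert (PWith p\<^sub>1 p\<^sub>2) \<Delta>) M B"
| ty_Empty: "env \<Delta> \<Longrightarrow> typing S \<Delta> Empty TTop"
| ty_Num: "typing S {} (Num r) TReal"
| ty_zero: "env \<Delta> \<Longrightarrow> typing S \<Delta> (Num 0) TReal"
| ty_Fn: "typing S {} (Fn f)
     (Lolli (tensor_ty (replicate (arity S f) (OfCourse TReal))) (OfCourse TReal))"
| ty_Plus: "typing S {} Plus (Lolli (TWith TReal TReal) TReal)"
| ty_Times: "typing S {} Times (Lolli TReal (Lolli TReal TReal))"

subsection \<open>Reduction\<close>

fun value_for :: "pat \<Rightarrow> 'f tm \<Rightarrow> bool" where
  "value_for (PVar x) M = True"
| "value_for (PBang x) (Bang M) = True"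
| "value_for PUnit Unit = True"
| "value_for (PPair p q) (Pair M N) = (value_for p M \<and> value_for q N)"
| "value_for (PWith p q) (WPair M N) = (value_for p M \<and> value_for q N)"
| "value_for _ _ = False"

fun bind :: "pat \<Rightarrow> 'f tm \<Rightarrow> (var \<times> 'f tm) list" where
  "bind (PVar x) M = [(x, M)]"
| "bind (PBang x) (Bang M) = [(x, M)]"
| "bind (PPair p q) (Pair M N) = bind p M @ bind q N"
| "bind (PWith p q) (WPair M N) = bind p M @ bind q N"
| "bind _ _ = []"

text \<open>
  Simultaneous substitution that does not rename bound variables; it is used only where no
  capture can occur.
\<close>

primrec subst :: "(var \<Rightarrow> 'f tm option) \<Rightarrow> 'f tm \<Rightarrow> 'f tm" where
  "subst \<sigma> (V x) = (case \<sigma> x of None \<Rightarrow> V x | Some N \<Rightarrow> N)"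
| "subst \<sigma> (Bang M) = Bang (subst \<sigma> M)"
| "subst \<sigma> (Lam p M) = Lam p (subst (\<sigma> |` (- pset p)) M)"
| "subst \<sigma> (App M N) = App (subst \<sigma> M) (subst \<sigma> N)"
| "subst \<sigma> (Pair M N) = Pair (subst \<sigma> M) (subst \<sigma> N)"
| "subst \<sigma> (WPair M N) = WPair (subst \<sigma> M) (subst \<sigma> N)"
| "subst \<sigma> Unit = Unit"
| "subst \<sigma> Empty = Empty"
| "subst \<sigma> (Num r) = Num r"
| "subst \<sigma> (Fn f) = Fn f"
| "subst \<sigma> Plus = Plus"
| "subst \<sigma> Times = Times"

inductive red :: "'f signat \<Rightarrow> 'f tm \<Rightarrow> 'f tm \<Rightarrow> bool" for S where
  red_beta: "wf_pat p \<Longrightarrow> value_for p N \<Longrightarrow> bv M \<inter> fv N = {} \<Longrightarrow>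
     red S (App (Lam p M) N) (subst (map_of (bind p N)) M)"
| red_Fn: "length rs = arity S f \<Longrightarrow>
     red S (App (Fn f) (tensor_tm (map (\<lambda>r. Bang (Num r)) rs))) (Bang (Num (den S f rs)))"
| red_Plus: "red S (App Plus (WPair (Num r) (Num s))) (Num (r + s))"
| red_Times: "red S (App (App Times (Num r)) (Num s)) (Num (r * s))"
| red_Bang: "red S M M' \<Longrightarrow> red S (Bang M) (Bang M')"
| red_Lam: "red S M M' \<Longrightarrow> red S (Lam p M) (Lam p M')"
| red_App1: "red S M M' \<Longrightarrow> red S (App M N) (App M' N)"
| red_App2: "red S N N' \<Longrightarrow> red S (App M N) (App M N')"
| red_Pair1: "red S M M' \<Longrightarrow> red S (Pair M N) (Pair M' N)"
| red_Pair2: "red S N N' \<Longrightarrow> red S (Pair M N) (Pair M N')"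
| red_WPair1: "red S M M' \<Longrightarrow> red S (WPair M N) (WPair M' N)"
| red_WPair2: "red S N N' \<Longrightarrow> red S (WPair M N) (WPair M N')"

text \<open>
  Many-step reduction and \<open>\<beta>\<close>-equality up to \<open>\<alpha>\<close>.  The side condition of \<open>red_beta\<close> can always
  be met after renaming.
\<close>

definition reds :: "'f signat \<Rightarrow> 'f tm \<Rightarrow> 'f tm \<Rightarrow> bool" where
  "reds S = (sup (red S) alpha)\<^sup>*\<^sup>*"

definition beta_eq :: "'f signat \<Rightarrow> 'f tm \<Rightarrow> 'f tm \<Rightarrow> bool" where
  "beta_eq S = equivclp (sup (red S) alpha)"

subsection \<open>Logical equivalence\<close>

definition proj1 :: "ty \<Rightarrow> ty \<Rightarrow> 'f tm" where
  "proj1 A B = Lam (PWith (PVar (Var 0 A)) (PVar (Var 1 B))) (V (Var 0 A))"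

definition proj2 :: "ty \<Rightarrow> ty \<Rightarrow> 'f tm" where
  "proj2 A B = Lam (PWith (PVar (Var 0 A)) (PVar (Var 1 B))) (V (Var 1 B))"

text \<open>
  \<open>leq S A\<close> is meant for closed terms of type \<open>A\<close>.  Since reduction preserves types, the only terms
  whose typing has to be demanded explicitly are those introduced by the quantifiers in the clause
  for \<open>\<multimap>\<close> and in \<open>leq_values\<close> below.
\<close>

fun leq :: "'f signat \<Rightarrow> ty \<Rightarrow> 'f tm \<Rightarrow> 'f tm \<Rightarrow> bool" where
  "leq S TReal M N \<longleftrightarrow> beta_eq S M N"
| "leq S TOne M N \<longleftrightarrow> beta_eq S M N"
| "leq S (Tensor A B) M N \<longleftrightarrow>
     (\<exists>M\<^sub>1 M\<^sub>2 N\<^sub>1 N\<^sub>2. reds S M (Pair M\<^sub>1 M\<^sub>2) \<and> reds S N (Pair N\<^sub>1 N\<^sub>2) \<and>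
        leq S A M\<^sub>1 N\<^sub>1 \<and> leq S B M\<^sub>2 N\<^sub>2)"
| "leq S (OfCourse A) M N \<longleftrightarrow>
     (\<exists>M' N'. reds S M (Bang M') \<and> reds S N (Bang N') \<and> leq S A M' N')"
| "leq S TTop M N \<longleftrightarrow> True"
| "leq S (TWith A B) M N \<longleftrightarrow>
     leq S A (App (proj1 A B) M) (App (proj1 A B) N) \<and>
     leq S B (App (proj2 A B) M) (App (proj2 A B) N)"
| "leq S (Lolli A B) M N \<longleftrightarrow>
     (\<forall>M' N'. typing S {} M' A \<and> typing S {} N' A \<and> leq S A M' N' \<longrightarrow>
        leq S B (App M M') (App N N'))"

definition leq_values :: "'f signat \<Rightarrow> pat \<Rightarrow> 'f tm \<Rightarrow> 'f tm \<Rightarrow> bool" where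
  "leq_values S p W W' \<longleftrightarrow> value_for p W \<and> value_for p W' \<and>
     typing S {} W (pty p) \<and> typing S {} W' (pty p) \<and> leq S (pty p) W W'"

definition bind_all :: "pat list \<Rightarrow> 'f tm list \<Rightarrow> var \<Rightarrow> 'f tm option" where
  "bind_all ps Ws = map_of (concat (map2 bind ps Ws))"

text \<open>\<open>log_equiv S ps A M N\<close>: the terms are typable with \<open>A\<close> in the environment \<open>ps\<close>, and \<open>M \<sim> N\<close>.\<close>

definition log_equiv :: "'f signat \<Rightarrow> pat list \<Rightarrow> ty \<Rightarrow> 'f tm \<Rightarrow> 'f tm \<Rightarrow> bool" where
  "log_equiv S ps A M N \<longleftrightarrow> typing S (set ps) M A \<and> typing S (set ps) N A \<and>
     (\<forall>Ws Ws'. length Ws = length ps \<and> length Ws' = length ps \<and>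
        (\<forall>i<length ps. leq_values S (ps ! i) (Ws ! i) (Ws' ! i)) \<longrightarrow>
        leq S A (subst (bind_all ps Ws) M) (subst (bind_all ps Ws') N))"

subsection \<open>Abbreviations\<close>

definition let_tm :: "pat \<Rightarrow> 'f tm \<Rightarrow> 'f tm \<Rightarrow> 'f tm" where
  "let_tm p N M = App (Lam p M) N"

definition sec_ty :: "ty \<Rightarrow> ty" where "sec_ty A = TWith TOne A"
definition sec_pat :: "pat \<Rightarrow> pat" where "sec_pat p = PWith PUnit p"
definition sec_tm :: "'f tm \<Rightarrow> 'f tm" where "sec_tm M = WPair Unit M"

fun with_ty :: "ty list \<Rightarrow> ty" where
  "with_ty [] = TTop"
| "with_ty [A] = A"
| "with_ty (A # B # As) = TWith A (with_ty (B # As))"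

fun with_tm :: "'f tm list \<Rightarrow> 'f tm" where
  "with_tm [] = Empty"
| "with_tm [M] = M"
| "with_tm (M # N # Ms) = WPair M (with_tm (N # Ms))"

text \<open>The first argument supplies the name of the variable of type \<open>\<top>\<close> used for the empty tuple.\<close>

fun with_pat :: "nat \<Rightarrow> pat list \<Rightarrow> pat" where
  "with_pat m [] = PVar (Var m TTop)"
| "with_pat m [p] = p"
| "with_pat m (p # q # ps) = PWith p (with_pat m (q # ps))"

fun zero_tm :: "ty \<Rightarrow> 'f tm" where
  "zero_tm TReal = Num 0"
| "zero_tm TTop = Empty"
| "zero_tm (TWith H K) = WPair (zero_tm H) (zero_tm K)"
| "zero_tm _ = undefined"

fun plus_tm :: "ty \<Rightarrow> 'f tm" where
  "plus_tm TReal = Plus"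
| "plus_tm TTop = Lam (PWith (PVar (Var 0 TTop)) (PVar (Var 1 TTop))) Empty"
| "plus_tm (TWith H K) =
     Lam (PWith (PWith (PVar (Var 0 H)) (PVar (Var 1 K))) (PWith (PVar (Var 2 H)) (PVar (Var 3 K))))
       (WPair (App (plus_tm H) (WPair (V (Var 0 H)) (V (Var 2 H))))
              (App (plus_tm K) (WPair (V (Var 1 K)) (V (Var 3 K)))))"
| "plus_tm _ = undefined"

text \<open>\<open>times_tm H x\<close> multiplies an element of \<open>H\<close> by the scalar \<open>x\<close>; the bound variables differ from \<open>x\<close>.\<close>

fun times_tm :: "ty \<Rightarrow> var \<Rightarrow> 'f tm" where
  "times_tm TReal x = App Times (V x)"
| "times_tm TTop x = Lam (PVar (Var (Suc (vidx x)) TTop)) Empty"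
| "times_tm (TWith H K) x =
     (let h = Var (vidx x + 1) H; k = Var (vidx x + 2) K
      in Lam (PWith (PVar h) (PVar k)) (WPair (App (times_tm H x) (V h)) (App (times_tm K x) (V k))))"
| "times_tm _ x = undefined"

text \<open>Iterated sums associate to the left; the list of summands is never empty.\<close>

fun sum_tm :: "'f tm list \<Rightarrow> 'f tm" where
  "sum_tm (M # Ms) = foldl (\<lambda>P N. App Plus (WPair P N)) M Ms"
| "sum_tm [] = undefined"

definition vars_from :: "nat \<Rightarrow> ty list \<Rightarrow> var list" where
  "vars_from m As = map (\<lambda>i. Var (m + i) (As ! i)) [0..<length As]"


section \<open>Linear A\<close>

datatype lty = LReal | LOne | LTensor lty lty

datatype pvar = PV (pidx: nat) (plty: lty)
datatype tvar = TV (tidx: nat) (tlty: lty)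

datatype 'f lexp =
    LPair pvar tvar
  | LLet pvar tvar "'f lexp" "'f lexp"
  | LUnitP
  | LUnitT
  | LLetUnitP pvar "'f lexp"
  | LLetUnitT tvar "'f lexp"
  | LTensorT tvar tvar
  | LLetTensorT tvar tvar tvar "'f lexp"
  | LZero lty
  | LPlus tvar tvar
  | LTimes pvar tvar
  | LNum real
  | LFn 'f "pvar list"
  | LDup tvar
  | LDrop "'f lexp"

text \<open>
  \<open>LLet x y e\<^sub>1 e\<^sub>2\<close> is \<open>let (x; y) = e\<^sub>1 in e\<^sub>2\<close>, and \<open>LLetTensorT x\<^sub>1 x\<^sub>2 z e\<close> is
  \<open>let \<otimes>(x\<^sub>1, x\<^sub>2) = z in e\<close> (on tangent variables).
\<close>

fun FVp :: "'f lexp \<Rightarrow> pvar set" where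
  "FVp (LPair x y) = {x}"
| "FVp (LLet x y e1 e2) = FVp e1 \<union> (FVp e2 - {x})"
| "FVp (LLetUnitP z e) = insert z (FVp e)"
| "FVp (LLetUnitT z e) = FVp e"
| "FVp (LLetTensorT x1 x2 z e) = FVp e"
| "FVp (LTimes x y) = {x}"
| "FVp (LFn f xs) = set xs"
| "FVp (LDrop e) = FVp e"
| "FVp _ = {}"

fun FVt :: "'f lexp \<Rightarrow> tvar set" where
  "FVt (LPair x y) = {y}"
| "FVt (LLet x y e1 e2) = FVt e1 \<union> (FVt e2 - {y})"
| "FVt (LLetUnitP z e) = FVt e"
| "FVt (LLetUnitT z e) = insert z (FVt e)"
| "FVt (LTensorT x1 x2) = {x1, x2}"
| "FVt (LLetTensorT x1 x2 z e) = insert z (FVt e - {x1, x2})"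
| "FVt (LPlus x y) = {x, y}"
| "FVt (LTimes x y) = {y}"
| "FVt (LDup y) = {y}"
| "FVt (LDrop e) = FVt e"
| "FVt _ = {}"

inductive ltyping ::
  "'f signat \<Rightarrow> pvar set \<Rightarrow> tvar set \<Rightarrow> 'f lexp \<Rightarrow> lty \<Rightarrow> lty \<Rightarrow> bool" for S where
  lt_Pair: "ltyping S {x} {y} (LPair x y) (plty x) (tlty y)"
| lt_Let: "ltyping S \<Gamma>\<^sub>1 \<Delta>\<^sub>1 e\<^sub>1 (plty x) (tlty y) \<Longrightarrow>
     ltyping S (insert x \<Gamma>\<^sub>2) (insert y \<Delta>\<^sub>2) e\<^sub>2 \<tau> \<sigma> \<Longrightarrow>
     x \<notin> \<Gamma>\<^sub>2 \<Longrightarrow> y \<notin> \<Delta>\<^sub>2 \<Longrightarrow> \<Delta>\<^sub>1 \<inter> \<Delta>\<^sub>2 = {} \<Longrightarrow>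
     ltyping S (\<Gamma>\<^sub>1 \<union> \<Gamma>\<^sub>2) (\<Delta>\<^sub>1 \<union> \<Delta>\<^sub>2) (LLet x y e\<^sub>1 e\<^sub>2) \<tau> \<sigma>"
| lt_UnitP: "ltyping S {} {} LUnitP LOne LOne"
| lt_UnitT: "ltyping S {} {} LUnitT LOne LOne"
| lt_LetUnitP: "ltyping S \<Gamma> \<Delta> e \<tau> \<sigma> \<Longrightarrow> plty z = LOne \<Longrightarrow> z \<notin> \<Gamma> \<Longrightarrow>
     ltyping S (insert z \<Gamma>) \<Delta> (LLetUnitP z e) \<tau> \<sigma>"
| lt_LetUnitT: "ltyping S \<Gamma> \<Delta> e \<tau> \<sigma> \<Longrightarrow> tlty z = LOne \<Longrightarrow> z \<notin> \<Delta> \<Longrightarrow>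
     ltyping S \<Gamma> (insert z \<Delta>) (LLetUnitT z e) \<tau> \<sigma>"
| lt_TensorT: "x\<^sub>1 \<noteq> x\<^sub>2 \<Longrightarrow>
     ltyping S {} {x\<^sub>1, x\<^sub>2} (LTensorT x\<^sub>1 x\<^sub>2) LOne (LTensor (tlty x\<^sub>1) (tlty x\<^sub>2))"
| lt_LetTensorT: "ltyping S \<Gamma> (insert x\<^sub>1 (insert x\<^sub>2 \<Delta>)) e \<tau> \<sigma> \<Longrightarrow>
     x\<^sub>1 \<noteq> x\<^sub>2 \<Longrightarrow> x\<^sub>1 \<notin> \<Delta> \<Longrightarrow> x\<^sub>2 \<notin> \<Delta> \<Longrightarrow> tlty z = LTensor (tlty x\<^sub>1) (tlty x\<^sub>2) \<Longrightarrow> z \<notin> \<Delta> \<Longrightarrow>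
     ltyping S \<Gamma> (insert z \<Delta>) (LLetTensorT x\<^sub>1 x\<^sub>2 z e) \<tau> \<sigma>"
| lt_Zero: "ltyping S {} {} (LZero \<tau>) LOne \<tau>"
| lt_Plus: "x \<noteq> y \<Longrightarrow> tlty x = \<tau> \<Longrightarrow> tlty y = \<tau> \<Longrightarrow> ltyping S {} {x, y} (LPlus x y) LOne \<tau>"
| lt_Times: "plty x = LReal \<Longrightarrow> ltyping S {x} {y} (LTimes x y) LOne (tlty y)"
| lt_Num: "ltyping S {} {} (LNum r) LReal LOne"
| lt_Fn: "length xs = arity S f \<Longrightarrow> distinct xs \<Longrightarrow> \<forall>x\<in>set xs. plty x = LReal \<Longrightarrow>
     ltyping S (set xs) {} (LFn f xs) LReal LOne"
| lt_Dup: "ltyping S {} {x} (LDup x) LOne (LTensor (tlty x) (tlty x))"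
| lt_Drop: "ltyping S \<Gamma> \<Delta> e \<tau> \<sigma> \<Longrightarrow> ltyping S \<Gamma> \<Delta> (LDrop e) LOne LOne"

text \<open>The two types of a well-typed expression, needed to type the variables introduced below.\<close>

primrec ety :: "'f lexp \<Rightarrow> lty \<times> lty" where
  "ety (LPair x y) = (plty x, tlty y)"
| "ety (LLet x y e1 e2) = ety e2"
| "ety LUnitP = (LOne, LOne)"
| "ety LUnitT = (LOne, LOne)"
| "ety (LLetUnitP z e) = ety e"
| "ety (LLetUnitT z e) = ety e"
| "ety (LTensorT x1 x2) = (LOne, LTensor (tlty x1) (tlty x2))"
| "ety (LLetTensorT x1 x2 z e) = ety e"
| "ety (LZero \<tau>) = (LOne, \<tau>)"
| "ety (LPlus x y) = (LOne, tlty x)"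
| "ety (LTimes x y) = (LOne, tlty y)"
| "ety (LNum r) = (LReal, LOne)"
| "ety (LFn f xs) = (LReal, LOne)"
| "ety (LDup x) = (LOne, LTensor (tlty x) (tlty x))"
| "ety (LDrop e) = (LOne, LOne)"

subsection \<open>Syntactic sugar\<close>

definition fresh_p :: "pvar set \<Rightarrow> nat" where
  "fresh_p X = fresh_index (pidx ` X)"

definition fresh_t :: "tvar set \<Rightarrow> nat" where
  "fresh_t Y = fresh_index (tidx ` Y)"

text \<open>\<open>let x = e\<^sub>1 in e\<^sub>2\<close> with a primal, respectively a tangent, variable\<close>

definition let_p :: "pvar \<Rightarrow> 'f lexp \<Rightarrow> 'f lexp \<Rightarrow> 'f lexp" where
  "let_p x e1 e2 = (let y = TV (fresh_t (FVt e2)) LOne in LLet x y e1 (LLetUnitT y e2))"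

definition let_t :: "tvar \<Rightarrow> 'f lexp \<Rightarrow> 'f lexp \<Rightarrow> 'f lexp" where
  "let_t y e1 e2 = (let x = PV (fresh_p (FVp e2)) LOne in LLet x y e1 (LLetUnitP x e2))"

definition exp_p :: "pvar \<Rightarrow> 'f lexp" where
  "exp_p x = (let y = TV 0 LOne in let_t y LUnitT (LPair x y))"

definition pair_exp :: "'f lexp \<Rightarrow> 'f lexp \<Rightarrow> 'f lexp" where
  "pair_exp e1 e2 =
     (let x = PV (fresh_p (FVp e2)) (fst (ety e1)); y = TV 0 (snd (ety e2))
      in let_p x e1 (let_t y e2 (LPair x y)))"

definition plus_exp :: "'f lexp \<Rightarrow> 'f lexp \<Rightarrow> 'f lexp" where
  "plus_exp e1 e2 =
     (let m = fresh_t (FVt e2); x = TV m (snd (ety e1)); y = TV (Suc m) (snd (ety e2))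
      in let_t x e1 (let_t y e2 (LPlus x y)))"

fun sum_exp :: "'f lexp list \<Rightarrow> 'f lexp" where
  "sum_exp (e # es) = foldl plus_exp e es"
| "sum_exp [] = undefined"

subsection \<open>Purely primal expressions of Linear B\<close>

datatype 'f pexp =
    BVar pvar
  | BLet pvar "'f pexp" "'f pexp"
  | BNum real
  | BFn 'f "pvar list"
  | BDrop "'f pexp"
  | BUnit
  | BLetUnit pvar "'f pexp"

primrec desugar :: "'f pexp \<Rightarrow> 'f lexp" where
  "desugar (BVar x) = exp_p x"
| "desugar (BLet x e1 e2) = let_p x (desugar e1) (desugar e2)"
| "desugar (BNum r) = LNum r"
| "desugar (BFn f xs) = LFn f xs"
| "desugar (BDrop e) = LDrop (desugar e)"
| "desugar BUnit = LUnitP"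
| "desugar (BLetUnit z e) = LLetUnitP z (desugar e)"

text \<open>The free variables, without repetition, in order of first occurrence.\<close>

primrec FVs :: "'f pexp \<Rightarrow> pvar list" where
  "FVs (BVar x) = [x]"
| "FVs (BLet x e1 e2) = remdups (FVs e1 @ removeAll x (FVs e2))"
| "FVs (BNum r) = []"
| "FVs (BFn f xs) = remdups xs"
| "FVs (BDrop e) = FVs e"
| "FVs BUnit = []"
| "FVs (BLetUnit z e) = remdups (z # FVs e)"

subsection \<open>Forward mode of JAX\<close>

definition tvars_from :: "nat \<Rightarrow> lty list \<Rightarrow> tvar list" where
  "tvars_from m ts = map (\<lambda>i. TV (m + i) (ts ! i)) [0..<length ts]"

definition rename_by :: "pvar list \<Rightarrow> tvar list \<Rightarrow> (pvar \<Rightarrow> tvar) \<Rightarrow> pvar \<Rightarrow> tvar" where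
  "rename_by zs ws \<phi> z = (case map_of (zip zs ws) z of None \<Rightarrow> \<phi> z | Some w \<Rightarrow> w)"

fun let_dups :: "(pvar \<Rightarrow> tvar) \<Rightarrow> (pvar \<times> tvar \<times> tvar \<times> tvar) list \<Rightarrow> 'f lexp \<Rightarrow> 'f lexp" where
  "let_dups \<phi> [] e = e"
| "let_dups \<phi> ((z, a, w, v) # r) e = let_t a (LDup (\<phi> z)) (LLetTensorT w v a (let_dups \<phi> r e))"

primrec fjax :: "'f signat \<Rightarrow> (pvar \<Rightarrow> tvar) \<Rightarrow> 'f pexp \<Rightarrow> 'f lexp" where
  "fjax S \<phi> (BVar x) = LPair x (\<phi> x)"
| "fjax S \<phi> (BNum r) = pair_exp (LNum r) (LZero LReal)"
| "fjax S \<phi> BUnit = pair_exp LUnitP LUnitT"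
| "fjax S \<phi> (BFn f xs) =
     (let n = length xs;
          m = fresh_p (set xs);
          w = (\<lambda>i. PV (m + i) LReal)
      in foldr (\<lambda>i. let_p (w i) (LFn (part S f i) xs)) [0..<n]
           (pair_exp (LFn f xs) (sum_exp (map (\<lambda>i. LTimes (w i) (\<phi> (xs ! i))) [0..<n]))))"
| "fjax S \<phi> (BDrop e) = LDrop (fjax S \<phi> e)"
| "fjax S \<phi> (BLetUnit z e) = LLetUnitP z (LLetUnitT (\<phi> z) (fjax S \<phi> e))"
| "fjax S \<phi> (BLet x e1 e2) =
     (let zs = filter (\<lambda>z. z \<in> set (FVs e2) \<and> z \<noteq> x) (FVs e1);
          k = length zs;
          m = fresh_t (\<phi> ` set (FVs (BLet x e1 e2)));
          as = tvars_from m (map (\<lambda>z. LTensor (plty z) (plty z)) zs);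
          ws = tvars_from (m + k) (map plty zs);
          vs = tvars_from (m + 2 * k) (map plty zs);
          y = TV (m + 3 * k) (plty x)
      in let_dups \<phi> (zip zs (zip as (zip ws vs)))
           (LLet x y (fjax S (rename_by zs ws \<phi>) e1)
                     (fjax S ((rename_by zs vs \<phi>)(x := y)) e2)))"


section \<open>Translations into \<open>\<lambda>LL\<close>\<close>

primrec pT :: "lty \<Rightarrow> ty" where
  "pT LReal = TReal"
| "pT LOne = TOne"
| "pT (LTensor \<tau> \<sigma>) = Tensor (OfCourse (pT \<tau>)) (OfCourse (pT \<sigma>))"

primrec tT :: "lty \<Rightarrow> ty" where
  "tT LReal = TReal"
| "tT LOne = TTop"
| "tT (LTensor \<tau> \<sigma>) = TWith (tT \<tau>) (tT \<sigma>)"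

fun tL :: "ty \<Rightarrow> ty" where
  "tL TReal = TReal"
| "tL TOne = TTop"
| "tL (Tensor (OfCourse D) (OfCourse E)) = TWith (tL D) (tL E)"
| "tL _ = undefined"

definition pv :: "pvar \<Rightarrow> var" where
  "pv x = Var (pidx x) (pT (plty x))"

text \<open>\<open>lookup \<theta> us y\<close> is \<open>u\<^sub>y\<close> when the tuple \<open>u\<^sub>\<theta>\<close> consists of the variables \<open>us\<close>.\<close>

definition lookup :: "'v list \<Rightarrow> var list \<Rightarrow> 'v \<Rightarrow> var" where
  "lookup \<theta> us y = the (map_of (zip \<theta> us) y)"

text \<open>The pair \<open>(!x, \<section>M)\<close>, as a pattern and as a term\<close>

definition dual_pat :: "var \<Rightarrow> var \<Rightarrow> pat" where
  "dual_pat x f = PPair (PBang x) (sec_pat (PVar f))"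

definition dual_tm :: "'f tm \<Rightarrow> 'f tm \<Rightarrow> 'f tm" where
  "dual_tm N M = Pair (Bang N) (sec_tm M)"

definition tuple_lam :: "nat \<Rightarrow> var list \<Rightarrow> 'f tm \<Rightarrow> 'f tm" where
  "tuple_lam m us M = Lam (with_pat m (map PVar us)) M"

text \<open>
  In each clause \<open>m\<close> exceeds the indices of all primal variables in sight, so that the variables
  with indices from \<open>m\<close> on are fresh.  Occurrences in \<open>\<theta>\<close> of a variable that is rebound in a body
  do not count as free occurrences in that body.
\<close>

primrec delta :: "tvar list \<Rightarrow> 'f lexp \<Rightarrow> 'f tm" where
  "delta \<theta> (LPair x y) =
     (let m = fresh_p {x}; us = vars_from m (map (tT \<circ> tlty) \<theta>)
      in dual_tm (V (pv x)) (tuple_lam m us (V (lookup \<theta> us y))))"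
| "delta \<theta> (LLet x y e1 e2) =
     (let \<theta>1 = filter (\<lambda>w. w \<in> FVt e1) \<theta>;
          \<theta>2 = filter (\<lambda>w. w \<in> FVt e2 - {y}) \<theta>;
          m = fresh_p (insert x (FVp e1 \<union> FVp e2));
          (\<tau>, \<sigma>) = ety e2;
          f = Var m (Lolli (with_ty (map (tT \<circ> tlty) \<theta>1)) (tT (tlty y)));
          z = Var (m + 1) (pT \<tau>);
          g = Var (m + 2) (Lolli (with_ty (map (tT \<circ> tlty) (y # \<theta>2))) (tT \<sigma>));
          us = vars_from (m + 3) (map (tT \<circ> tlty) \<theta>);
          u = (\<lambda>w. V (lookup \<theta> us w))
      in let_tm (dual_pat (pv x) f) (delta \<theta>1 e1)
           (let_tm (dual_pat z g) (delta (y # \<theta>2) e2)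
              (dual_tm (V z) (tuple_lam (m + 3) us
                 (App (V g) (with_tm (App (V f) (with_tm (map u \<theta>1)) # map u \<theta>2)))))))"
| "delta \<theta> LUnitP = dual_tm Unit (Lam (PVar (Var 0 TTop)) Empty)"
| "delta \<theta> LUnitT = dual_tm Unit (Lam (PVar (Var 0 TTop)) Empty)"
| "delta \<theta> (LLetUnitP z e) = let_tm PUnit (V (pv z)) (delta \<theta> e)"
| "delta \<theta> (LLetUnitT z e) =
     (let \<theta>' = filter (\<lambda>w. w \<noteq> z) \<theta>;
          m = fresh_p (FVp e);
          (\<tau>, \<sigma>) = ety e;
          x = Var m (pT \<tau>);
          f = Var (m + 1) (Lolli (with_ty (map (tT \<circ> tlty) \<theta>')) (tT \<sigma>));
          us = vars_from (m + 2) (map (tT \<circ> tlty) \<theta>);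
          u = (\<lambda>w. V (lookup \<theta> us w))
      in let_tm (dual_pat x f) (delta \<theta>' e)
           (dual_tm (V x) (tuple_lam (m + 2) us (App (V f) (with_tm (map u \<theta>'))))))"
| "delta \<theta> (LTensorT x1 x2) =
     (let us = vars_from 0 (map (tT \<circ> tlty) \<theta>); u = (\<lambda>w. V (lookup \<theta> us w))
      in dual_tm Unit (tuple_lam 0 us (WPair (u x1) (u x2))))"
| "delta \<theta> (LLetTensorT x1 x2 z e) =
     (let \<theta>' = filter (\<lambda>w. w \<noteq> z) \<theta>;
          m = fresh_p (FVp e);
          (\<tau>, \<sigma>) = ety e;
          x = Var m (pT \<tau>);
          f = Var (m + 1) (Lolli (with_ty (map (tT \<circ> tlty) (x1 # x2 # \<theta>'))) (tT \<sigma>));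
          v1 = Var (m + 2) (tT (tlty x1));
          v2 = Var (m + 3) (tT (tlty x2));
          us = vars_from (m + 4) (map (tT \<circ> tlty) \<theta>);
          u = (\<lambda>w. V (lookup \<theta> us w));
          ps = map (\<lambda>w. if w = z then PWith (PVar v1) (PVar v2) else PVar (lookup \<theta> us w)) \<theta>
      in let_tm (dual_pat x f) (delta (x1 # x2 # \<theta>') e)
           (dual_tm (V x) (Lam (with_pat (m + 4) ps)
              (App (V f) (with_tm (V v1 # V v2 # map u \<theta>'))))))"
| "delta \<theta> (LZero \<sigma>) = dual_tm Unit (Lam (PVar (Var 0 TTop)) (zero_tm (tT \<sigma>)))"
| "delta \<theta> (LPlus y1 y2) =
     (let us = vars_from 0 (map (tT \<circ> tlty) \<theta>); u = (\<lambda>w. V (lookup \<theta> us w))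
      in dual_tm Unit (tuple_lam 0 us (App (plus_tm (tT (tlty y1))) (WPair (u y1) (u y2)))))"
| "delta \<theta> (LTimes x y) =
     (let m = fresh_p {x}; us = vars_from m (map (tT \<circ> tlty) \<theta>)
      in dual_tm Unit (tuple_lam m us
           (App (times_tm (tT (tlty y)) (pv x)) (V (lookup \<theta> us y)))))"
| "delta \<theta> (LNum r) = dual_tm (Num r) (Lam (PVar (Var 0 TTop)) Empty)"
| "delta \<theta> (LFn f xs) =
     Pair (App (Fn f) (tensor_tm (map (\<lambda>x. Bang (V (pv x))) xs)))
       (sec_tm (Lam (PVar (Var 0 TTop)) Empty))"
| "delta \<theta> (LDup y) =
     (let us = vars_from 0 (map (tT \<circ> tlty) \<theta>); u = V (lookup \<theta> us y)
      in dual_tm Unit (tuple_lam 0 us (WPair u u)))"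
| "delta \<theta> (LDrop e) =
     (let (\<tau>, \<sigma>) = ety e;
          T = with_ty (map (tT \<circ> tlty) \<theta>);
          x = Var 0 (pT \<tau>);
          f = Var 1 (Lolli T (tT \<sigma>));
          y = Var 2 T;
          z = Var 3 (tT \<sigma>)
      in let_tm (dual_pat x f) (delta \<theta> e)
           (dual_tm Unit (Lam (PVar y) (let_tm (PVar z) (App (V f) (V y)) Empty))))"

primrec deltaB :: "'f pexp \<Rightarrow> 'f tm" where
  "deltaB (BVar x) = Bang (V (pv x))"
| "deltaB (BLet x e1 e2) = let_tm (PBang (pv x)) (deltaB e1) (deltaB e2)"
| "deltaB (BNum r) = Bang (Num r)"
| "deltaB (BFn f xs) = App (Fn f) (tensor_tm (map (\<lambda>x. Bang (V (pv x))) xs))"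
| "deltaB (BDrop e) =
     let_tm (PBang (Var 0 (pT (fst (ety (desugar e)))))) (deltaB e) (Bang Unit)"
| "deltaB BUnit = Bang Unit"
| "deltaB (BLetUnit z e) = let_tm PUnit (V (pv z)) (deltaB e)"


section \<open>Forward transformation in \<open>\<lambda>LL\<close>\<close>

text \<open>The inverse of \<open>\<lambda>xs. tensor_tm (map (\<lambda>x. Bang (V x)) xs)\<close> on non-empty lists.\<close>

fun arg_vars :: "'f tm \<Rightarrow> var list" where
  "arg_vars (Bang (V x)) = [x]"
| "arg_vars (Pair (Bang (V x)) M) = x # arg_vars M"
| "arg_vars _ = undefined"

text \<open>The type \<open>E\<close> such that the transformable term \<open>P\<close> has type \<open>!E\<close>.\<close>

fun fwd_ty :: "'f tm \<Rightarrow> ty" where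
  "fwd_ty (Bang (V x)) = vty x"
| "fwd_ty (Bang (Num r)) = TReal"
| "fwd_ty (Bang Unit) = TOne"
| "fwd_ty (App (Fn f) M) = TReal"
| "fwd_ty (App (Lam p P) Q) = fwd_ty P"
| "fwd_ty _ = undefined"

text \<open>
  The last two clauses are those for \<open>let !x = Q in P\<close> and \<open>let () = z in P\<close>.  As in
  \<open>delta\<close>, the variable \<open>x\<close> bound in \<open>P\<close> is not counted as a member of \<open>\<theta> \<inter> FV(P)\<close>.
\<close>

fun fwd :: "'f signat \<Rightarrow> var list \<Rightarrow> 'f tm \<Rightarrow> 'f tm" where
  "fwd S \<theta> (Bang (V x)) =
     (let u = Var 0 (tL (vty x)) in dual_tm (V x) (Lam (PVar u) (V u)))"
| "fwd S \<theta> (Bang (Num r)) = dual_tm (Num r) (Lam (PVar (Var 0 TTop)) (Num 0))"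
| "fwd S \<theta> (Bang Unit) = dual_tm Unit (Lam (PVar (Var 0 TTop)) Empty)"
| "fwd S \<theta> (App (Fn f) M) =
     (let xs = arg_vars M;
          n = length xs;
          m = fresh_index (vidx ` set xs);
          y = (\<lambda>i. Var (m + i) TReal);
          us = vars_from (m + n) (map (tL \<circ> vty) \<theta>);
          u = (\<lambda>x. V (lookup \<theta> us x))
      in foldr (\<lambda>i. let_tm (PBang (y i)) (App (Fn (part S f i)) M)) [0..<n]
           (Pair (App (Fn f) M)
              (sec_tm (tuple_lam (m + n) us
                 (sum_tm (map (\<lambda>i. App (App Times (V (y i))) (u (xs ! i))) [0..<n]))))))"
| "fwd S \<theta> (App (Lam (PBang x) P) Q) =
     (let \<theta>1 = filter (\<lambda>w. w \<in> fv Q) \<theta>;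
          \<theta>2 = filter (\<lambda>w. w \<in> fv P - {x}) \<theta>;
          \<theta>P = (if x \<in> fv P then x # \<theta>2 else \<theta>2);
          m = fresh_index (vidx ` insert x (fv P \<union> fv Q));
          f = Var m (Lolli (with_ty (map (tL \<circ> vty) \<theta>1)) (tL (vty x)));
          y = Var (m + 1) (fwd_ty P);
          g = Var (m + 2) (Lolli (with_ty (map (tL \<circ> vty) \<theta>P)) (tL (fwd_ty P)));
          us = vars_from (m + 3) (map (tL \<circ> vty) \<theta>);
          u = (\<lambda>w. V (lookup \<theta> us w));
          fu = App (V f) (with_tm (map u \<theta>1))
      in let_tm (dual_pat x f) (fwd S \<theta>1 Q)
           (let_tm (dual_pat y g) (fwd S \<theta>P P)
              (dual_tm (V y) (tuple_lam (m + 3) us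
                 (App (V g) (with_tm (if x \<in> fv P then fu # map u \<theta>2 else map u \<theta>2)))))))"
| "fwd S \<theta> (App (Lam PUnit P) (V z)) =
     (let \<theta>' = filter (\<lambda>w. w \<in> fv P) \<theta>;
          m = fresh_index (vidx ` fv P);
          y = Var m (fwd_ty P);
          g = Var (m + 1) (Lolli (with_ty (map (tL \<circ> vty) \<theta>')) (tL (fwd_ty P)));
          us = vars_from (m + 2) (map (tL \<circ> vty) \<theta>);
          u = (\<lambda>w. V (lookup \<theta> us w))
      in let_tm PUnit (V z)
           (let_tm (dual_pat y g) (fwd S \<theta>' P)
              (dual_tm (V y) (tuple_lam (m + 2) us (App (V g) (with_tm (map u \<theta>')))))))"
| "fwd S \<theta> _ = undefined"

end

theory Submission
  imports Defs
begin

text \<open>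
  After substituting closed values for the variables, both terms reduce to a pair
  \<open>(!P, \<section>L)\<close> in which \<open>P\<close> is the value of the expression and \<open>L\<close> is a linear map that, applied
  to a tuple \<open>\<langle>V\<^sub>1, \<dots>, V\<^sub>n\<rangle>\<close>, is \<open>\<beta>\<close>-equal to the derivative of the expression along
  \<open>V\<^sub>1, \<dots>, V\<^sub>n\<close>.  Value and derivative (\<open>pval\<close> and \<open>tval\<close> below) are defined by recursion on the
  expression, without reference to either transformation, and they respect logical equivalence.

  Reduction gets stuck unless inputs of type \<open>\<real>\<close> are numerals and arguments of \<open>L\<close> are tuples,
  which is why normalization of closed typable terms is needed.  Confluence is not: \<open>\<beta>\<close>-equal
  numerals \<open>r\<^sub>i\<close>, \<open>s\<^sub>i\<close> might a priori be distinct, but then \<open>f(r\<^sub>1, \<dots>, r\<^sub>n)\<close> and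
  \<open>f(s\<^sub>1, \<dots>, s\<^sub>n)\<close> are \<open>\<beta>\<close>-equal too, because both are reducts of \<open>\<beta>\<close>-equal terms.
\<close>

section \<open>Closed substitutions and reduction\<close>

text \<open>Logical equivalence survives expansion along \<open>reds\<close> at every type.
  Replacing a term by its reduct inside \<open>leq\<close> is a different matter: at
  \<open>Tensor\<close> and \<open>OfCourse\<close> it would rest on confluence. Tangent types are
  built from \<real>, \<top> and & only, and there \<open>leq\<close> is closed under conversion;
  all contractions inside \<open>leq\<close> are confined to such types. The two sides receive
  different, merely related inputs, so there is no common normal form to aim at. Each side is
  evaluated at its own point, and the results are compared afterwards, on expressions. Evaluation
  uses closed substitutions throughout, so the non-renaming \<open>subst\<close> cannot capture and
  the side condition of \<open>red_beta\<close> holds. Linear maps are specified by relations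
  between inputs and outputs: unpacking a tangent pair makes progress only on a literal
  \<open>WPair\<close>, and a duplication supplies exactly such a pair. The obstacle in typing is
  that the components of an & tuple share one environment, so every component must be able to
  discard the linear maps used by the others.\<close>

definition closed_sub :: "(var \<Rightarrow> 'f tm option) \<Rightarrow> bool" where
  "closed_sub \<sigma> \<longleftrightarrow> (\<forall>x N. \<sigma> x = Some N \<longrightarrow> fv N = {})"

lemma closed_subD: "closed_sub \<sigma> \<Longrightarrow> \<sigma> x = Some N \<Longrightarrow> fv N = {}"
  by (auto simp: closed_sub_def)

lemma closed_sub_restrict: "closed_sub \<sigma> \<Longrightarrow> closed_sub (\<sigma> |` A)"
  by (auto simp: closed_sub_def restrict_map_def split: if_splits)

lemma closed_sub_add: "closed_sub \<sigma> \<Longrightarrow> closed_sub \<tau> \<Longrightarrow> closed_sub (\<sigma> ++ \<tau>)"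
  by (auto simp: closed_sub_def map_add_Some_iff)

lemma closed_sub_upd: "closed_sub \<sigma> \<Longrightarrow> fv N = {} \<Longrightarrow> closed_sub (\<sigma>(x \<mapsto> N))"
  by (auto simp: closed_sub_def)

lemma fv_subst: "closed_sub \<sigma> \<Longrightarrow> fv (subst \<sigma> M) = fv M - dom \<sigma>"
proof (induction M arbitrary: \<sigma>)
  case (V x)
  then show ?case by (auto split: option.splits dest: closed_subD)
next
  case (Lam p M)
  then show ?case by (auto simp: closed_sub_restrict)
qed auto

lemma subst_cong: "(\<And>x. x \<in> fv M \<Longrightarrow> \<sigma> x = \<tau> x) \<Longrightarrow> subst \<sigma> M = subst \<tau> M"
proof (induction M arbitrary: \<sigma> \<tau>)
  case (Lam p M)
  have "subst (\<sigma> |` (- pset p)) M = subst (\<tau> |` (- pset p)) M"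
    using Lam.prems by (intro Lam.IH) (auto simp: restrict_map_def)
  then show ?case by simp
next
  case (Bang M)
  have "subst \<sigma> M = subst \<tau> M" by (rule Bang.IH) (simp add: Bang.prems)
  then show ?case by simp
next
  case (App M N)
  have "subst \<sigma> M = subst \<tau> M" "subst \<sigma> N = subst \<tau> N"
    by (rule App.IH, simp add: App.prems)+
  then show ?case by simp
next
  case (Pair M N)
  have "subst \<sigma> M = subst \<tau> M" "subst \<sigma> N = subst \<tau> N"
    by (rule Pair.IH, simp add: Pair.prems)+
  then show ?case by simp
next
  case (WPair M N)
  have "subst \<sigma> M = subst \<tau> M" "subst \<sigma> N = subst \<tau> N"
    by (rule WPair.IH, simp add: WPair.prems)+
  then show ?case by simp
qed simp_all

lemma subst_none: "subst (\<lambda>_. None) M = M"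
  by (induction M) (auto simp: restrict_map_def)

lemma subst_closed: "fv M = {} \<Longrightarrow> subst \<sigma> M = M"
  using subst_cong[of M \<sigma> "\<lambda>_. None"] by (simp add: subst_none)

text \<open>What \<open>\<sigma>\<close> inserts is closed and hence untouched by
  \<open>\<tau>\<close>, so composing the two is overriding, with the inner substitution taking
  precedence.\<close>

lemma subst_subst:
  "closed_sub \<sigma> \<Longrightarrow> subst \<tau> (subst \<sigma> M) = subst (\<tau> ++ \<sigma>) M"
proof (induction M arbitrary: \<sigma> \<tau>)
  case (V x)
  then show ?case by (auto simp: map_add_def subst_closed dest: closed_subD split: option.splits)
next
  case (Lam p M)
  have "(\<tau> |` (- pset p)) ++ (\<sigma> |` (- pset p)) = (\<tau> ++ \<sigma>) |` (- pset p)"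
    by (rule ext) (auto simp: map_add_def restrict_map_def)
  with Lam show ?case by (simp add: closed_sub_restrict)
qed auto

section \<open>Renaming of bound variables and its interplay with substitution\<close>

lemmas alpha_congs = alpha_refl alpha_Bang alpha_Lam alpha_App alpha_Pair alpha_WPair

lemma pset_perm_pat: "pset (perm_pat \<pi> p) = \<pi> ` pset p"
  by (induction p) auto

lemma fv_perm: "inj \<pi> \<Longrightarrow> fv (perm \<pi> M) = \<pi> ` fv M"
  by (induction M) (auto simp: pset_perm_pat inj_def)

text \<open>\<open>perm\<close> renames free and bound variables alike, so pushing it through a
  substitution conjugates the substitution by \<open>\<pi>\<close>.\<close>

lemma perm_subst:
  "bij \<pi> \<Longrightarrow> perm \<pi> (subst \<sigma> M) = subst (\<lambda>y. map_option (perm \<pi>) (\<sigma> (inv \<pi> y))) (perm \<pi> M)"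
proof (induction M arbitrary: \<sigma>)
  case (V x)
  then show ?case by (auto simp: bij_def split: option.splits)
next
  case (Lam p M)
  have "(\<lambda>y. map_option (perm \<pi>) ((\<sigma> |` (- pset p)) (inv \<pi> y))) =
     (\<lambda>y. map_option (perm \<pi>) (\<sigma> (inv \<pi> y))) |` (- pset (perm_pat \<pi> p))"
    using Lam.prems
    by (intro ext) (auto simp: restrict_map_def pset_perm_pat bij_def image_iff surj_f_inv_f inv_f_f)
  with Lam show ?case by simp
qed auto

lemma alpha_perm:
  "bij \<pi> \<Longrightarrow> (\<And>x. vty (\<pi> x) = vty x) \<Longrightarrow> (\<And>x. x \<in> fv M \<Longrightarrow> \<pi> x = x) \<Longrightarrow> alpha M (perm \<pi> M)"
proof (induction M)
  case (Lam p M)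
  then show ?case by (intro alpha_rename) auto
qed (auto intro: alpha_congs)

lemma fv_alpha: "alpha M N \<Longrightarrow> fv M = fv N"
proof (induction rule: alpha.induct)
  case (alpha_rename \<pi> p M)
  then have "\<pi> ` fv (Lam p M) = fv (Lam p M)" by (metis (no_types, lifting) image_cong image_ident)
  then show ?case using fv_perm[OF bij_is_inj[OF alpha_rename(1)], of "Lam p M"] by simp
qed auto

lemma alpha_subst_pointwise:
  "(\<And>x. rel_option alpha (\<sigma> x) (\<tau> x)) \<Longrightarrow> alpha (subst \<sigma> M) (subst \<tau> M)"
proof (induction M arbitrary: \<sigma> \<tau>)
  case (V x)
  then show ?case by (cases rule: option.rel_cases[of alpha "\<sigma> x" "\<tau> x"]) (auto intro: alpha_refl)
next
  case (Lam p M)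
  have "rel_option alpha ((\<sigma> |` (- pset p)) x) ((\<tau> |` (- pset p)) x)" for x
    using Lam.prems by (auto simp: restrict_map_def)
  then show ?case using Lam.IH by (auto intro: alpha_Lam)
qed (auto intro: alpha_congs)

text \<open>Only the renaming generator needs an argument. Renaming commutes with substitution up to
  conjugation, and a closed substitution, cut down to the free variables fixed by
  \<open>\<pi>\<close>, agrees with its conjugate up to \<open>alpha\<close>.\<close>

lemma alpha_subst: "alpha M N \<Longrightarrow> closed_sub \<sigma> \<Longrightarrow> alpha (subst \<sigma> M) (subst \<sigma> N)"
proof (induction arbitrary: \<sigma> rule: alpha.induct)
  case (alpha_rename \<pi> p M)
  define K where "K = Lam p M"
  \<comment> \<open>Outside \<open>fv K\<close> the permutation may move the domain of
    \<open>\<sigma>\<close>. The cut loses nothing, since \<open>K\<close> and its renaming have the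
    same free variables.\<close>
  define \<sigma>' where "\<sigma>' = \<sigma> |` fv K"
  have fixd: "\<pi> x = x" if "x \<in> fv K" for x using alpha_rename that by (auto simp: K_def)
  have inj: "inj \<pi>" by (rule bij_is_inj) fact
  have fvK: "fv (perm \<pi> K) = fv K" using fv_perm[OF inj, of K] fixd by auto
  have 1: "subst \<sigma> K = subst \<sigma>' K" by (rule subst_cong) (auto simp: \<sigma>'_def)
  have 2: "subst \<sigma> (perm \<pi> K) = subst \<sigma>' (perm \<pi> K)"
    by (rule subst_cong) (auto simp: \<sigma>'_def fvK)
  \<comment> \<open>Images are closed, hence \<open>alpha\<close>-equal to their renamings. Off
    \<open>fv K\<close> both sides are \<open>None\<close>, as \<open>inv \<pi>\<close> maps the
    complement of \<open>fv K\<close> into itself.\<close>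
  have "rel_option alpha (\<sigma>' x) (map_option (perm \<pi>) (\<sigma>' (inv \<pi> x)))" for x
  proof (cases "x \<in> fv K")
    case True
    then have inv: "inv \<pi> x = x" using fixd inj by (metis inv_f_f)
    show ?thesis
    proof (cases "\<sigma>' x")
      case (Some N)
      then have "fv N = {}"
        using alpha_rename.prems by (auto simp: \<sigma>'_def restrict_map_def closed_sub_def split: if_splits)
      then show ?thesis using Some alpha_rename(1,2) by (auto simp: inv intro!: alpha_perm)
    qed (simp add: inv)
  next
    case False
    then have "inv \<pi> x \<notin> fv K" using fixd alpha_rename(1) by (metis bij_inv_eq_iff)
    then show ?thesis using False by (auto simp: \<sigma>'_def)
  qed
  then have "alpha (subst \<sigma>' (perm \<pi> K)) (perm \<pi> (subst \<sigma>' K))"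
    unfolding perm_subst[OF alpha_rename(1)] by (rule alpha_subst_pointwise)
  moreover have "alpha (subst \<sigma>' K) (perm \<pi> (subst \<sigma>' K))"
    using alpha_rename(1,2) fixd alpha_rename.prems
    by (intro alpha_perm) (auto simp: fv_subst \<sigma>'_def closed_sub_restrict)
  ultimately show ?case unfolding K_def[symmetric] 1 2 by (blast intro: alpha_sym alpha_trans)
next
  case (alpha_Lam M M' p)
  then show ?case by (auto intro!: alpha_congs closed_sub_restrict)
next
  case (alpha_sym M N)
  then show ?case by (metis alpha.alpha_sym)
next
  case (alpha_trans M N P)
  then show ?case by (metis alpha.alpha_trans)
qed (auto intro: alpha_congs)

section \<open>Many-step reduction and conversion as congruences\<close>

lemma reds_refl [simp]: "reds S M M"
  by (simp add: reds_def)

lemma reds_trans [trans]: "reds S M N \<Longrightarrow> reds S N P \<Longrightarrow> reds S M P"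
  by (auto simp: reds_def)

lemma red_reds: "red S M N \<Longrightarrow> reds S M N"
  by (auto simp: reds_def)

lemma alpha_reds: "alpha M N \<Longrightarrow> reds S M N"
  by (auto simp: reds_def)

lemma beta_eq_refl [simp]: "beta_eq S M M"
  by (simp add: beta_eq_def)

lemma beta_eq_sym: "beta_eq S M N \<Longrightarrow> beta_eq S N M"
  by (simp add: beta_eq_def equivclp_sym)

lemma beta_eq_trans [trans]: "beta_eq S M N \<Longrightarrow> beta_eq S N P \<Longrightarrow> beta_eq S M P"
  unfolding beta_eq_def by (rule equivclp_trans)

lemma reds_beta_eq: "reds S M N \<Longrightarrow> beta_eq S M N"
  unfolding reds_def beta_eq_def
proof (induction rule: rtranclp_induct)
  case (step N P)
  then show ?case by (meson equivclp_trans r_into_equivclp)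
qed simp

lemma reds_context:
  assumes "\<And>M N. red S M N \<Longrightarrow> red S (C M) (C N)" "\<And>M N. alpha M N \<Longrightarrow> alpha (C M) (C N)"
    and "reds S M N"
  shows "reds S (C M) (C N)"
  using assms(3) unfolding reds_def
proof (induction rule: rtranclp_induct)
  case (step N P)
  then have "sup (red S) alpha (C N) (C P)" using assms(1,2) by (metis sup2CI sup2E)
  then show ?case by (rule rtranclp.rtrancl_into_rtrancl[OF step.IH])
qed simp

lemma beta_eq_context:
  assumes "\<And>M N. red S M N \<Longrightarrow> red S (C M) (C N)" "\<And>M N. alpha M N \<Longrightarrow> alpha (C M) (C N)"
    and "beta_eq S M N"
  shows "beta_eq S (C M) (C N)"
  using assms(3) unfolding beta_eq_def equivclp_def
proof (induction rule: rtranclp_induct)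
  case (step N P)
  have C: "sup (red S) alpha M N \<Longrightarrow> sup (red S) alpha (C M) (C N)" for M N
    using assms(1,2) by (metis sup2CI sup2E)
  have "symclp (sup (red S) alpha) (C N) (C P)"
    using step.hyps(2) C unfolding symclp_def by blast
  then show ?case by (rule rtranclp.rtrancl_into_rtrancl[OF step.IH])
qed simp

lemma reds_App: "reds S M M' \<Longrightarrow> reds S N N' \<Longrightarrow> reds S (App M N) (App M' N')"
proof (rule reds_trans)
  show "reds S M M' \<Longrightarrow> reds S (App M N) (App M' N)"
    by (rule reds_context[of _ "\<lambda>M. App M N"]) (auto intro: red.intros alpha_congs)
  show "reds S N N' \<Longrightarrow> reds S (App M' N) (App M' N')"
    by (rule reds_context[of _ "\<lambda>N. App M' N"]) (auto intro: red.intros alpha_congs)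
qed

lemma reds_Pair: "reds S M M' \<Longrightarrow> reds S N N' \<Longrightarrow> reds S (Pair M N) (Pair M' N')"
proof (rule reds_trans)
  show "reds S M M' \<Longrightarrow> reds S (Pair M N) (Pair M' N)"
    by (rule reds_context[of _ "\<lambda>M. Pair M N"]) (auto intro: red.intros alpha_congs)
  show "reds S N N' \<Longrightarrow> reds S (Pair M' N) (Pair M' N')"
    by (rule reds_context[of _ "\<lambda>N. Pair M' N"]) (auto intro: red.intros alpha_congs)
qed

lemma reds_WPair: "reds S M M' \<Longrightarrow> reds S N N' \<Longrightarrow> reds S (WPair M N) (WPair M' N')"
proof (rule reds_trans)
  show "reds S M M' \<Longrightarrow> reds S (WPair M N) (WPair M' N)"
    by (rule reds_context[of _ "\<lambda>M. WPair M N"]) (auto intro: red.intros alpha_congs)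
  show "reds S N N' \<Longrightarrow> reds S (WPair M' N) (WPair M' N')"
    by (rule reds_context[of _ "\<lambda>N. WPair M' N"]) (auto intro: red.intros alpha_congs)
qed

lemma reds_Bang: "reds S M M' \<Longrightarrow> reds S (Bang M) (Bang M')"
  using reds_context[of S Bang M M'] by (auto intro: red.intros alpha_congs)

lemma reds_Lam: "reds S M M' \<Longrightarrow> reds S (Lam p M) (Lam p M')"
  using reds_context[of S "Lam p" M M'] by (auto intro: red.intros alpha_congs)

lemma beta_eq_App: "beta_eq S M M' \<Longrightarrow> beta_eq S N N' \<Longrightarrow> beta_eq S (App M N) (App M' N')"
proof (rule beta_eq_trans)
  show "beta_eq S M M' \<Longrightarrow> beta_eq S (App M N) (App M' N)"
    by (rule beta_eq_context[of _ "\<lambda>M. App M N"]) (auto intro: red.intros alpha_congs)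
  show "beta_eq S N N' \<Longrightarrow> beta_eq S (App M' N) (App M' N')"
    by (rule beta_eq_context[of _ "\<lambda>N. App M' N"]) (auto intro: red.intros alpha_congs)
qed

lemma beta_eq_Pair: "beta_eq S M M' \<Longrightarrow> beta_eq S N N' \<Longrightarrow> beta_eq S (Pair M N) (Pair M' N')"
proof (rule beta_eq_trans)
  show "beta_eq S M M' \<Longrightarrow> beta_eq S (Pair M N) (Pair M' N)"
    by (rule beta_eq_context[of _ "\<lambda>M. Pair M N"]) (auto intro: red.intros alpha_congs)
  show "beta_eq S N N' \<Longrightarrow> beta_eq S (Pair M' N) (Pair M' N')"
    by (rule beta_eq_context[of _ "\<lambda>N. Pair M' N"]) (auto intro: red.intros alpha_congs)
qed

lemma beta_eq_WPair: "beta_eq S M M' \<Longrightarrow> beta_eq S N N' \<Longrightarrow> beta_eq S (WPair M N) (WPair M' N')"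
proof (rule beta_eq_trans)
  show "beta_eq S M M' \<Longrightarrow> beta_eq S (WPair M N) (WPair M' N)"
    by (rule beta_eq_context[of _ "\<lambda>M. WPair M N"]) (auto intro: red.intros alpha_congs)
  show "beta_eq S N N' \<Longrightarrow> beta_eq S (WPair M' N) (WPair M' N')"
    by (rule beta_eq_context[of _ "\<lambda>N. WPair M' N"]) (auto intro: red.intros alpha_congs)
qed

lemma beta_eq_Bang: "beta_eq S M M' \<Longrightarrow> beta_eq S (Bang M) (Bang M')"
  using beta_eq_context[of S Bang M M'] by (auto intro: red.intros alpha_congs)

lemma dom_bind: "value_for p W \<Longrightarrow> fst ` set (bind p W) = pset p"
  by (induction p W rule: value_for.induct) auto

lemma fv_bind: "x \<in> snd ` set (bind p W) \<Longrightarrow> fv x \<subseteq> fv W"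
  by (induction p W rule: bind.induct) auto

lemma closed_sub_bind: "fv W = {} \<Longrightarrow> closed_sub (map_of (bind p W))"
  using fv_bind[of _ p W] by (force simp: closed_sub_def dest: map_of_SomeD)

text \<open>Reduction also happens under binders, where the substituted terms may be open. Capture
  by the non-renaming \<open>subst\<close> could only remove free variables, hence an inclusion in
  place of the equation \<open>fv_subst\<close>.\<close>

lemma fv_subst_subset:
  "\<forall>x N. \<sigma> x = Some N \<longrightarrow> fv N \<subseteq> U \<Longrightarrow> fv (subst \<sigma> M) \<subseteq> (fv M - dom \<sigma>) \<union> U"
proof (induction M arbitrary: \<sigma>)
  case (V x)
  then show ?case by (auto split: option.splits)
next
  case (Lam p M)
  have "fv (subst (\<sigma> |` (- pset p)) M) \<subseteq> (fv M - dom (\<sigma> |` (- pset p))) \<union> U"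
    using Lam.prems by (intro Lam.IH) (auto simp: restrict_map_def split: if_splits)
  then show ?case by auto
next
  case (Bang M)
  then show ?case by simp
next
  case (App M N)
  have "fv (subst \<sigma> M) \<subseteq> (fv M - dom \<sigma>) \<union> U" "fv (subst \<sigma> N) \<subseteq> (fv N - dom \<sigma>) \<union> U"
    by (rule App.IH, rule App.prems)+
  then show ?case by auto
next
  case (Pair M N)
  have "fv (subst \<sigma> M) \<subseteq> (fv M - dom \<sigma>) \<union> U" "fv (subst \<sigma> N) \<subseteq> (fv N - dom \<sigma>) \<union> U"
    by (rule Pair.IH, rule Pair.prems)+
  then show ?case by auto
next
  case (WPair M N)
  have "fv (subst \<sigma> M) \<subseteq> (fv M - dom \<sigma>) \<union> U" "fv (subst \<sigma> N) \<subseteq> (fv N - dom \<sigma>) \<union> U"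
    by (rule WPair.IH, rule WPair.prems)+
  then show ?case by auto
qed auto

lemma fv_red: "red S M N \<Longrightarrow> fv N \<subseteq> fv M"
proof (induction rule: red.induct)
  case (red_beta p N M)
  have "fv (subst (map_of (bind p N)) M) \<subseteq> (fv M - dom (map_of (bind p N))) \<union> fv N"
    using fv_bind[of _ p N] by (intro fv_subst_subset) (force dest: map_of_SomeD)
  moreover have "dom (map_of (bind p N)) = pset p"
    using red_beta by (simp add: dom_map_of_conv_image_fst dom_bind)
  ultimately show ?case by simp
qed auto

lemma fv_reds: "reds S M N \<Longrightarrow> fv N \<subseteq> fv M"
  unfolding reds_def
proof (induction rule: rtranclp_induct)
  case (step N P)
  then have "red S N P \<or> alpha N P" by simp
  then have "fv P \<subseteq> fv N" by (metis fv_red fv_alpha subset_refl)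
  then show ?case using step.IH by simp
qed simp

lemma reds_closed: "reds S M N \<Longrightarrow> fv M = {} \<Longrightarrow> fv N = {}"
  using fv_reds by blast

text \<open>The form of \<beta> used throughout, in the style of an environment machine: a suspended
  body runs in the environment extended by the bindings of the evaluated argument. Closedness of
  \<open>W\<close> meets the capture condition of \<open>red_beta\<close>.\<close>

lemma reds_beta:
  assumes "closed_sub \<sigma>" "reds S N W" "value_for p W" "wf_pat p" "fv W = {}"
  shows "reds S (App (subst \<sigma> (Lam p M)) N) (subst (\<sigma> ++ map_of (bind p W)) M)"
proof -
  let ?b = "map_of (bind p W)"
  have d: "dom ?b = pset p" using assms by (simp add: dom_map_of_conv_image_fst dom_bind)
  \<comment> \<open>The bindings are defined exactly on \<open>pset p\<close>, so deleting these
    variables first or overriding them afterwards comes to the same.\<close>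
  have eq: "?b ++ (\<sigma> |` (- pset p)) = \<sigma> ++ ?b"
    by (rule ext) (use d in \<open>auto simp: map_add_def restrict_map_def split: option.splits\<close>)
  have "reds S (App (subst \<sigma> (Lam p M)) N) (App (Lam p (subst (\<sigma> |` (- pset p)) M)) W)"
    using assms by (auto intro: reds_App)
  also have "reds S \<dots> (subst ?b (subst (\<sigma> |` (- pset p)) M))"
    using assms by (intro red_reds red_beta) auto
  also have "\<dots> = subst (\<sigma> ++ ?b) M"
    using assms by (simp add: subst_subst closed_sub_restrict eq)
  finally show ?thesis .
qed

text \<open>Both directions are proved together so that the symmetry rule of \<open>alpha\<close>
  can swap them.\<close>

lemma alpha_Bang_inv:
  "alpha M N \<Longrightarrow> (\<forall>M'. M = Bang M' \<longrightarrow> (\<exists>N'. N = Bang N' \<and> alpha M' N')) \<and>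
     (\<forall>N'. N = Bang N' \<longrightarrow> (\<exists>M'. M = Bang M' \<and> alpha M' N'))"
proof (induction rule: alpha.induct)
  case (alpha_sym M N)
  then show ?case by (fast intro: alpha.alpha_sym)
next
  case (alpha_trans M N P)
  then show ?case by (fast intro: alpha.alpha_trans)
qed (auto intro: alpha_refl)

text \<open>No redex has a \<open>Bang\<close> at its root, so every step takes place inside the
  box. This is how the \<open>!\<close> of an input value is stripped later on.\<close>

lemma reds_Bang_inv: "reds S (Bang M) N \<Longrightarrow> \<exists>N'. N = Bang N' \<and> reds S M N'"
  unfolding reds_def
proof (induction rule: rtranclp_induct)
  case (step N P)
  from step.IH obtain N' where N: "N = Bang N'" "(sup (red S) alpha)\<^sup>*\<^sup>* M N'" by blast
  from step.hyps(2) have "red S N P \<or> alpha N P" by simp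
  then have "\<exists>P'. P = Bang P' \<and> sup (red S) alpha N' P'"
  proof
    assume "red S N P"
    then show ?thesis unfolding N by cases auto
  next
    assume "alpha N P"
    then show ?thesis using alpha_Bang_inv[of N P] N by auto
  qed
  then obtain P' where P': "P = Bang P'" "sup (red S) alpha N' P'" by blast
  show ?case using P'(1) rtranclp.rtrancl_into_rtrancl[OF N(2) P'(2)] by blast
qed blast

section \<open>Normalization of closed terms\<close>

text \<open>A reducibility predicate in the style of Tait. Except at \<open>Lolli\<close> it asks
  for a canonical head with computable parts, for & as well; at \<open>Lolli\<close> the arguments
  range over all closed computable terms, typable or not.\<close>

fun computable :: "'f signat \<Rightarrow> ty \<Rightarrow> 'f tm \<Rightarrow> bool" where
  "computable S TReal M \<longleftrightarrow> (\<exists>r. reds S M (Num r))"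
| "computable S TOne M \<longleftrightarrow> reds S M Unit"
| "computable S TTop M \<longleftrightarrow> reds S M Empty"
| "computable S (Tensor A B) M \<longleftrightarrow>
     (\<exists>M\<^sub>1 M\<^sub>2. reds S M (Pair M\<^sub>1 M\<^sub>2) \<and> computable S A M\<^sub>1 \<and> computable S B M\<^sub>2)"
| "computable S (TWith A B) M \<longleftrightarrow>
     (\<exists>M\<^sub>1 M\<^sub>2. reds S M (WPair M\<^sub>1 M\<^sub>2) \<and> computable S A M\<^sub>1 \<and> computable S B M\<^sub>2)"
| "computable S (OfCourse A) M \<longleftrightarrow> (\<exists>M'. reds S M (Bang M') \<and> computable S A M')"
| "computable S (Lolli A B) M \<longleftrightarrow>
     (\<forall>N. fv N = {} \<longrightarrow> computable S A N \<longrightarrow> computable S B (App M N))"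

lemma computable_reds: "reds S M N \<Longrightarrow> computable S A N \<Longrightarrow> computable S A M"
proof (induction A arbitrary: M N)
  case (Lolli A B)
  show ?case unfolding computable.simps
  proof (intro allI impI)
    fix P assume P: "fv P = {}" "computable S A P"
    show "computable S B (App M P)"
    proof (rule Lolli.IH(2))
      show "reds S (App M P) (App N P)" by (rule reds_App[OF Lolli.prems(1) reds_refl])
      show "computable S B (App N P)" using Lolli.prems(2) P by simp
    qed
  qed
qed (simp; meson reds_trans)+

text \<open>The bridge to \<beta>: an argument is reduced to the depth of the pattern and no
  further, and the parts bound to the variables remain computable.\<close>

lemma computable_value:
  "computable S (pty p) N \<Longrightarrow> fv N = {} \<Longrightarrow>
    \<exists>W. reds S N W \<and> value_for p W \<and> (\<forall>(x, M) \<in> set (bind p W). computable S (vty x) M)"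
proof (induction p arbitrary: N)
  case (PVar x)
  then have "reds S N N \<and> value_for (PVar x) N \<and>
      (\<forall>(x, M) \<in> set (bind (PVar x) N). computable S (vty x) M)" by simp
  then show ?case by blast
next
  case (PBang x)
  then obtain M where "reds S N (Bang M)" "computable S (vty x) M" by auto
  then have "reds S N (Bang M) \<and> value_for (PBang x) (Bang M) \<and>
      (\<forall>(x, M) \<in> set (bind (PBang x) (Bang M)). computable S (vty x) M)" by simp
  then show ?case by blast
next
  case PUnit
  then have "reds S N Unit \<and> value_for PUnit (Unit :: 'a tm) \<and>
      (\<forall>(x, M) \<in> set (bind PUnit (Unit :: 'a tm)). computable S (vty x) M)" by simp
  then show ?case by blast
next
  case (PPair p q)
  then obtain M1 M2 where M: "reds S N (Pair M1 M2)" "computable S (pty p) M1" "computable S (pty q) M2"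
    by auto
  then have "fv M1 = {}" "fv M2 = {}" using reds_closed[OF M(1)] PPair.prems by auto
  from PPair.IH(1)[OF M(2) this(1)] PPair.IH(2)[OF M(3) this(2)]
  obtain W1 W2 where W: "reds S M1 W1" "value_for p W1" "\<forall>(x, M) \<in> set (bind p W1). computable S (vty x) M"
    "reds S M2 W2" "value_for q W2" "\<forall>(x, M) \<in> set (bind q W2). computable S (vty x) M" by blast
  have "reds S N (Pair W1 W2)" using M(1) reds_Pair[OF W(1,4)] by (rule reds_trans)
  moreover have "value_for (PPair p q) (Pair W1 W2)" using W by simp
  moreover have "\<forall>(x, M) \<in> set (bind (PPair p q) (Pair W1 W2)). computable S (vty x) M"
    using W by auto
  ultimately show ?case by blast
next
  case (PWith p q)
  then obtain M1 M2 where M: "reds S N (WPair M1 M2)" "computable S (pty p) M1" "computable S (pty q) M2"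
    by auto
  then have "fv M1 = {}" "fv M2 = {}" using reds_closed[OF M(1)] PWith.prems by auto
  from PWith.IH(1)[OF M(2) this(1)] PWith.IH(2)[OF M(3) this(2)]
  obtain W1 W2 where W: "reds S M1 W1" "value_for p W1" "\<forall>(x, M) \<in> set (bind p W1). computable S (vty x) M"
    "reds S M2 W2" "value_for q W2" "\<forall>(x, M) \<in> set (bind q W2). computable S (vty x) M" by blast
  have "reds S N (WPair W1 W2)" using M(1) reds_WPair[OF W(1,4)] by (rule reds_trans)
  moreover have "value_for (PWith p q) (WPair W1 W2)" using W by simp
  moreover have "\<forall>(x, M) \<in> set (bind (PWith p q) (WPair W1 W2)). computable S (vty x) M"
    using W by auto
  ultimately show ?case by blast
qed

text \<open>\<open>red_Fn\<close> fires only on explicit numerals, so a computable argument tuple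
  has to be normalized completely, below every \<open>!\<close>.\<close>

lemma computable_tensor_Num:
  "computable S (tensor_ty (replicate n (OfCourse TReal))) M \<Longrightarrow>
     \<exists>rs. length rs = n \<and> reds S M (tensor_tm (map (\<lambda>r. Bang (Num r)) rs))"
proof (induction n arbitrary: M)
  case 0
  then show ?case by simp
next
  case (Suc n)
  have B: "\<exists>r. reds S M (Bang (Num r))" if "computable S (OfCourse TReal) M" for M :: "'a tm"
    using that by simp (meson reds_Bang reds_trans)
  show ?case
  proof (cases n)
    case 0
    with B[of M] Suc.prems obtain r where "reds S M (Bang (Num r))" by auto
    then show ?thesis using 0 by (intro exI[of _ "[r]"]) simp
  next
    case (Suc k)
    from Suc.prems obtain M1 M2 where M: "reds S M (Pair M1 M2)" "computable S (OfCourse TReal) M1"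
      "computable S (tensor_ty (replicate n (OfCourse TReal))) M2" by (auto simp: Suc)
    from B[OF M(2)] obtain r where r: "reds S M1 (Bang (Num r))" by blast
    from Suc.IH[OF M(3)] obtain rs where rs: "length rs = n"
      "reds S M2 (tensor_tm (map (\<lambda>r. Bang (Num r)) rs))" by blast
    have "reds S M (Pair (Bang (Num r)) (tensor_tm (map (\<lambda>r. Bang (Num r)) rs)))"
      using M(1) reds_Pair[OF r rs(2)] by (rule reds_trans)
    then show ?thesis using rs Suc by (intro exI[of _ "r # rs"]) (cases rs, auto)
  qed
qed

lemma evars_simps [simp]:
  "evars {} = {}" "evars (insert p \<Delta>) = pset p \<union> evars \<Delta>" "evars (\<Gamma> \<union> \<Delta>) = evars \<Gamma> \<union> evars \<Delta>"
  by (auto simp: evars_def)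

lemma typing_fv: "typing S \<Gamma> M A \<Longrightarrow> fv M \<subseteq> evars \<Gamma>"
proof (induction rule: typing.induct)
  case (ty_alpha \<Gamma> M A N)
  then show ?case using fv_alpha by blast
qed auto

lemma computable_Fn:
  "computable S (Lolli (tensor_ty (replicate (arity S f) (OfCourse TReal))) (OfCourse TReal)) (Fn f)"
  unfolding computable.simps(7)
proof (intro allI impI)
  fix N :: "'a tm"
  assume "computable S (tensor_ty (replicate (arity S f) (OfCourse TReal))) N"
  then obtain rs where rs: "length rs = arity S f" "reds S N (tensor_tm (map (\<lambda>r. Bang (Num r)) rs))"
    using computable_tensor_Num by blast
  have "reds S (App (Fn f) N) (App (Fn f) (tensor_tm (map (\<lambda>r. Bang (Num r)) rs)))"
    by (rule reds_App[OF reds_refl rs(2)])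
  also have "reds S \<dots> (Bang (Num (den S f rs)))" by (rule red_reds[OF red_Fn[OF rs(1)]])
  finally show "computable S (OfCourse TReal) (App (Fn f) N)"
    unfolding computable.simps by (blast intro: reds_refl)
qed

lemma computable_Plus: "computable S (Lolli (TWith TReal TReal) TReal) Plus"
  unfolding computable.simps(7)
proof (intro allI impI)
  fix N :: "'a tm"
  assume "computable S (TWith TReal TReal) N"
  then obtain M1 M2 r s where N: "reds S N (WPair M1 M2)" "reds S M1 (Num r)" "reds S M2 (Num s)" by auto
  have "reds S N (WPair (Num r) (Num s))" using N(1) reds_WPair[OF N(2,3)] by (rule reds_trans)
  then have "reds S (App Plus N) (App Plus (WPair (Num r) (Num s)))" by (rule reds_App[OF reds_refl])
  also have "reds S \<dots> (Num (r + s))" by (rule red_reds[OF red_Plus])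
  finally show "computable S TReal (App Plus N)" by auto
qed

lemma computable_Times: "computable S (Lolli TReal (Lolli TReal TReal)) Times"
  unfolding computable.simps(7)
proof (intro allI impI)
  fix M N :: "'a tm"
  assume "computable S TReal M" "computable S TReal N"
  then obtain r s where N: "reds S M (Num r)" "reds S N (Num s)" by auto
  have "reds S (App (App Times M) N) (App (App Times (Num r)) (Num s))"
    by (intro reds_App reds_refl N)
  also have "reds S \<dots> (Num (r * s))" by (rule red_reds[OF red_Times])
  finally show "computable S TReal (App (App Times M) N)" by auto
qed

lemma computable_Lam:
  assumes "closed_sub \<sigma>" "wf_pat p"
    and "\<And>\<tau>. closed_sub \<tau> \<Longrightarrow> dom \<tau> = pset p \<Longrightarrow>
      (\<forall>x N. \<tau> x = Some N \<longrightarrow> computable S (vty x) N) \<Longrightarrow> computable S B (subst (\<sigma> ++ \<tau>) M)"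
  shows "computable S (Lolli (pty p) B) (subst \<sigma> (Lam p M))"
  unfolding computable.simps(7)
proof (intro allI impI)
  fix N :: "'a tm"
  assume N: "fv N = {}" "computable S (pty p) N"
  from computable_value[OF N(2,1)] obtain W where W: "reds S N W" "value_for p W"
    "\<forall>(x, M) \<in> set (bind p W). computable S (vty x) M" by blast
  have fvW: "fv W = {}" using reds_closed[OF W(1) N(1)] .
  have "reds S (App (subst \<sigma> (Lam p M)) N) (subst (\<sigma> ++ map_of (bind p W)) M)"
    by (rule reds_beta[OF assms(1) W(1,2) assms(2) fvW])
  moreover have "computable S B (subst (\<sigma> ++ map_of (bind p W)) M)"
  proof (rule assms(3))
    show "closed_sub (map_of (bind p W))" using fvW by (rule closed_sub_bind)
    show "dom (map_of (bind p W)) = pset p" using W(2) by (simp add: dom_map_of_conv_image_fst dom_bind)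
    show "\<forall>x N. map_of (bind p W) x = Some N \<longrightarrow> computable S (vty x) N"
      using W(3) by (auto dest: map_of_SomeD)
  qed
  ultimately show "computable S B (App (subst \<sigma> (Lam p M)) N)" by (rule computable_reds)
qed

text \<open>The fundamental lemma of the reducibility argument. Environments are read flatly,
  through the variables of their patterns; the left rules for patterns are then immediate, because
  their premises mention no new variables.\<close>

lemma typing_computable:
  "typing S \<Gamma> M A \<Longrightarrow> closed_sub \<sigma> \<Longrightarrow>
     \<forall>x\<in>evars \<Gamma>. \<exists>N. \<sigma> x = Some N \<and> computable S (vty x) N \<Longrightarrow> computable S A (subst \<sigma> M)"
proof (induction arbitrary: \<sigma> rule: typing.induct)
  case (ty_alpha \<Gamma> M A N)
  have "reds S (subst \<sigma> N) (subst \<sigma> M)"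
    by (rule alpha_reds[OF alpha_subst[OF alpha_sym]]) fact+
  then show ?case using ty_alpha.IH[OF ty_alpha.prems] by (rule computable_reds)
next
  case (ty_Bang \<Gamma> M A)
  then have "computable S A (subst \<sigma> M)" by blast
  then show ?case by (auto intro: reds_refl)
next
  case (ty_Lam p \<Delta> M B)
  show ?case
  proof (rule computable_Lam[OF ty_Lam.prems(1) ty_Lam.hyps(1)])
    fix \<tau> :: "var \<Rightarrow> 'a tm option"
    assume \<tau>: "closed_sub \<tau>" "dom \<tau> = pset p" "\<forall>x N. \<tau> x = Some N \<longrightarrow> computable S (vty x) N"
    show "computable S B (subst (\<sigma> ++ \<tau>) M)"
    proof (rule ty_Lam.IH)
      show "closed_sub (\<sigma> ++ \<tau>)" using ty_Lam.prems(1) \<tau>(1) by (rule closed_sub_add)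
      show "\<forall>x\<in>evars (insert p \<Delta>). \<exists>N. (\<sigma> ++ \<tau>) x = Some N \<and> computable S (vty x) N"
      proof
        fix x assume x: "x \<in> evars (insert p \<Delta>)"
        show "\<exists>N. (\<sigma> ++ \<tau>) x = Some N \<and> computable S (vty x) N"
        proof (cases "\<tau> x")
          case None
          then have "x \<notin> pset p" using \<tau>(2) by (metis domIff)
          then have "x \<in> evars \<Delta>" using x by simp
          then show ?thesis using None ty_Lam.prems(2) by (simp add: map_add_def)
        next
          case (Some N)
          then show ?thesis using \<tau>(3) by simp
        qed
      qed
    qed
  qed
next
  case (ty_App \<Gamma>\<^sub>1 \<Delta>\<^sub>1 \<Gamma>\<^sub>2 \<Delta>\<^sub>2 M\<^sub>1 A B M\<^sub>2)
  have "computable S (Lolli A B) (subst \<sigma> M\<^sub>1)"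
    by (rule ty_App.IH(1)[OF ty_App.prems(1)]) (use ty_App.prems(2) in auto)
  moreover have "computable S A (subst \<sigma> M\<^sub>2)"
    by (rule ty_App.IH(2)[OF ty_App.prems(1)]) (use ty_App.prems(2) in auto)
  \<comment> \<open>Computability at \<open>Lolli\<close> speaks of closed arguments only.\<close>
  moreover have "fv (subst \<sigma> M\<^sub>2) = {}"
    using typing_fv[OF ty_App.hyps(3)] ty_App.prems by (auto simp: fv_subst)
  ultimately show ?case by simp
next
  case (ty_Pair \<Gamma>\<^sub>1 \<Delta>\<^sub>1 \<Gamma>\<^sub>2 \<Delta>\<^sub>2 M\<^sub>1 A\<^sub>1 M\<^sub>2 A\<^sub>2)
  have "computable S A\<^sub>1 (subst \<sigma> M\<^sub>1)" "computable S A\<^sub>2 (subst \<sigma> M\<^sub>2)"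
    using ty_Pair.prems by (auto intro!: ty_Pair.IH)
  then show ?case by (auto intro: reds_refl)
next
  case (ty_WPair \<Delta> M\<^sub>1 A\<^sub>1 M\<^sub>2 A\<^sub>2)
  have "computable S A\<^sub>1 (subst \<sigma> M\<^sub>1)" "computable S A\<^sub>2 (subst \<sigma> M\<^sub>2)"
    using ty_WPair.prems by (auto intro!: ty_WPair.IH)
  then show ?case by (auto intro: reds_refl)
next
  case (ty_Fn f)
  show ?case using computable_Fn[of S f] by simp
next
  case ty_Plus
  show ?case using computable_Plus[of S] by simp
next
  case ty_Times
  show ?case using computable_Times[of S] by simp
qed (auto intro: reds_refl)

lemma typing_closed_computable: "typing S {} M A \<Longrightarrow> computable S A M"
  using typing_computable[of S "{}" M A "\<lambda>_. None"] by (simp add: closed_sub_def subst_none)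

lemma typing_closed_fv: "typing S {} M A \<Longrightarrow> fv M = {}"
  using typing_fv[of S "{}" M A] by simp

section \<open>Evaluation to a primal value and a linear map\<close>

lemma pvars_with_pat:
  "pvars (with_pat m ps) = (if ps = [] then [Var m TTop] else concat (map pvars ps))"
  by (induction m ps rule: with_pat.induct) auto

lemma value_for_with: "list_all2 value_for ps Ns \<Longrightarrow> value_for (with_pat m ps) (with_tm Ns)"
proof (induction rule: list_all2_induct)
  case (Cons p ps N Ns)
  then show ?case by (cases ps; cases Ns) auto
qed simp

text \<open>The empty tuple is exceptional: its pattern is a variable of type \<top>, which binds
  \<open>Empty\<close>.\<close>

lemma bind_with:
  "length ps = length Ns \<Longrightarrow> ps \<noteq> [] \<Longrightarrow>
     bind (with_pat m ps) (with_tm Ns) = concat (map2 bind ps Ns)"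
proof (induction ps Ns rule: list_induct2)
  case (Cons p ps N Ns)
  then show ?case by (cases ps; cases Ns) auto
qed simp

lemma fv_with_tm [simp]: "fv (with_tm Ns) = (\<Union>N\<in>set Ns. fv N)"
  by (induction Ns rule: with_tm.induct) auto

lemma subst_with_tm [simp]: "subst \<sigma> (with_tm Ns) = with_tm (map (subst \<sigma>) Ns)"
  by (induction Ns rule: with_tm.induct) auto

lemma beta_eq_with_tm: "list_all2 (beta_eq S) Ms Ns \<Longrightarrow> beta_eq S (with_tm Ms) (with_tm Ns)"
proof (induction rule: list_all2_induct)
  case (Cons M Ms N Ns)
  then show ?case by (cases Ms; cases Ns) (auto intro: beta_eq_WPair)
qed simp

lemma length_vars_from [simp]: "length (vars_from m As) = length As"
  by (simp add: vars_from_def)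

lemma nth_vars_from [simp]: "i < length As \<Longrightarrow> vars_from m As ! i = Var (m + i) (As ! i)"
  by (simp add: vars_from_def)

lemma map_vty_vars_from [simp]: "map vty (vars_from m As) = As"
  by (rule nth_equalityI) auto

lemma distinct_vars_from [simp]: "distinct (vars_from m As)"
  by (simp add: distinct_conv_nth)

lemma vars_from_ge: "v \<in> set (vars_from m As) \<Longrightarrow> m \<le> vidx v"
  by (auto simp: vars_from_def)

lemma vars_from_Nil [simp]: "vars_from m [] = []"
  by (simp add: vars_from_def)

lemma vars_from_eq_Nil [simp]: "vars_from m As = [] \<longleftrightarrow> As = []"
  by (simp add: vars_from_def)

lemma lookup_nth:
  assumes "distinct \<theta>" "length us = length \<theta>" "i < length \<theta>"
  shows "lookup \<theta> us (\<theta> ! i) = us ! i"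
  using assms by (simp add: lookup_def map_of_zip_nth)

lemma lookup_in:
  assumes "length us = length \<theta>" "w \<in> set \<theta>"
  shows "lookup \<theta> us w \<in> set us"
proof -
  obtain u where "map_of (zip \<theta> us) w = Some u"
    using assms by (metis map_of_zip_is_Some)
  then show ?thesis by (auto simp: lookup_def dest!: map_of_SomeD set_zip_rightD)
qed

lemma map_fst_bind: "value_for p W \<Longrightarrow> map fst (bind p W) = pvars p"
  by (induction p W rule: value_for.induct) auto

text \<open>The extended substitution is described only by what it does to variables. The bound
  \<open>n\<close> is kept apart from \<open>m\<close>, the index for the empty tuple, because a
  split pair contributes component names that lie below \<open>m\<close>.\<close>

lemma apply_with_pat:
  assumes "closed_sub \<sigma>" "list_all2 value_for ps Ns" "\<forall>N\<in>set Ns. fv N = {}"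
    and "distinct (concat (map pvars ps))" "\<forall>p\<in>set ps. \<forall>v\<in>pset p. n \<le> vidx v" "n \<le> m"
  obtains \<tau> where "reds S (App (subst \<sigma> (Lam (with_pat m ps) M)) (with_tm Ns)) (subst \<tau> M)"
    and "closed_sub \<tau>"
    and "\<And>p N v K. (p, N) \<in> set (zip ps Ns) \<Longrightarrow> (v, K) \<in> set (bind p N) \<Longrightarrow> \<tau> v = Some K"
    and "\<And>v. vidx v < n \<Longrightarrow> \<tau> v = \<sigma> v"
proof
  let ?p = "with_pat m ps" and ?N = "with_tm Ns"
  let ?b = "map_of (bind ?p ?N)"
  have len: "length ps = length Ns" using assms(2) by (rule list_all2_lengthD)
  have val: "value_for ?p ?N" using assms(2) by (rule value_for_with)
  have wf: "wf_pat ?p" using assms(4) by (simp add: pvars_with_pat)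
  have cl: "fv ?N = {}" using assms(3) by simp
  show "reds S (App (subst \<sigma> (Lam ?p M)) ?N) (subst (\<sigma> ++ ?b) M)"
    by (rule reds_beta[OF assms(1) reds_refl val wf cl])
  show "closed_sub (\<sigma> ++ ?b)" by (rule closed_sub_add[OF assms(1) closed_sub_bind[OF cl]])
  show "(\<sigma> ++ ?b) v = Some K" if "(p, N) \<in> set (zip ps Ns)" "(v, K) \<in> set (bind p N)" for p N v K
  proof -
    have "ps \<noteq> []" using that(1) by auto
    then have "(v, K) \<in> set (bind ?p ?N)" using that len by (auto simp: bind_with)
    then have "?b v = Some K" using wf by (intro map_of_is_SomeI) (simp add: map_fst_bind[OF val])
    then show ?thesis by simp
  qed
  show "(\<sigma> ++ ?b) v = \<sigma> v" if "vidx v < n" for v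
  proof -
    have "v \<notin> pset ?p" using that assms(5,6) by (fastforce simp: pvars_with_pat split: if_splits)
    then have "v \<notin> dom ?b" using dom_bind[OF val] by (simp add: dom_map_of_conv_image_fst)
    then show ?thesis by (simp add: map_add_dom_app_simps(3))
  qed
qed

lemma apply_tuple_lam:
  assumes "closed_sub \<sigma>" "distinct \<theta>" "\<forall>w\<in>set \<theta>. fv (\<rho> w) = {}"
    and "us = vars_from m As" "length As = length \<theta>"
  obtains \<tau> where "reds S (App (subst \<sigma> (tuple_lam m us M)) (with_tm (map \<rho> \<theta>))) (subst \<tau> M)"
    and "closed_sub \<tau>"
    and "\<And>w. w \<in> set \<theta> \<Longrightarrow> \<tau> (lookup \<theta> us w) = Some (\<rho> w)"
    and "\<And>v. vidx v < m \<Longrightarrow> \<tau> v = \<sigma> v"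
proof -
  have len: "length us = length \<theta>" using assms by simp
  obtain \<tau> where \<tau>: "reds S (App (subst \<sigma> (Lam (with_pat m (map PVar us)) M)) (with_tm (map \<rho> \<theta>))) (subst \<tau> M)"
      "closed_sub \<tau>"
      "\<And>p N v K. (p, N) \<in> set (zip (map PVar us) (map \<rho> \<theta>)) \<Longrightarrow> (v, K) \<in> set (bind p N) \<Longrightarrow> \<tau> v = Some K"
      "\<And>v. vidx v < m \<Longrightarrow> \<tau> v = \<sigma> v"
  proof (rule apply_with_pat[OF assms(1), where M = M and n = m and m = m])
    show "list_all2 value_for (map PVar us) (map \<rho> \<theta>)" using len by (simp add: list_all2_conv_all_nth)
    show "\<forall>N\<in>set (map \<rho> \<theta>). fv N = {}" using assms(3) by simp
    have "concat (map pvars (map PVar us)) = us" by (induction us) auto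
    then show "distinct (concat (map pvars (map PVar us)))" using assms(4) by simp
    show "\<forall>p\<in>set (map PVar us). \<forall>v\<in>pset p. m \<le> vidx v" using assms(4) by (auto dest: vars_from_ge)
  qed (blast | simp)+
  show thesis
  proof (rule that[of \<tau>])
    show "\<tau> (lookup \<theta> us w) = Some (\<rho> w)" if w: "w \<in> set \<theta>" for w
    proof -
      obtain i where i: "i < length \<theta>" "w = \<theta> ! i" using w by (metis in_set_conv_nth)
      have "(PVar (us ! i), \<rho> w) \<in> set (zip (map PVar us) (map \<rho> \<theta>))"
        using i len by (auto simp: set_zip intro!: exI[of _ i])
      from \<tau>(3)[OF this] show ?thesis using i len assms(2) by (simp add: lookup_nth)
    qed
  qed (use \<tau> in \<open>simp_all add: tuple_lam_def del: subst.simps\<close>)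
qed

text \<open>A larger relation \<open>G\<close> makes a stronger claim. A relation may also be empty
  on inputs where the map gets stuck, which is how unpacking a tangent pair is specified on literal
  pairs only.\<close>

definition linear_map ::
    "'f signat \<Rightarrow> 'v list \<Rightarrow> 'f tm \<Rightarrow> (('v \<Rightarrow> 'f tm) \<Rightarrow> 'f tm \<Rightarrow> bool) \<Rightarrow> bool" where
  "linear_map S \<theta> L G \<longleftrightarrow> fv L = {} \<and>
     (\<forall>\<rho> T. (\<forall>w\<in>set \<theta>. fv (\<rho> w) = {}) \<longrightarrow> G \<rho> T \<longrightarrow>
        fv T = {} \<and> beta_eq S (App L (with_tm (map \<rho> \<theta>))) T)"

text \<open>The primal result is fixed as a term, whereas the linear map is known only through
  \<open>G\<close>: the two translations produce syntactically different abstractions.\<close>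

definition evals ::
    "'f signat \<Rightarrow> 'f tm \<Rightarrow> 'f tm \<Rightarrow> 'v list \<Rightarrow> (('v \<Rightarrow> 'f tm) \<Rightarrow> 'f tm \<Rightarrow> bool) \<Rightarrow> bool" where
  "evals S M P \<theta> G \<longleftrightarrow> fv P = {} \<and>
     (\<exists>L. reds S M (Pair (Bang P) (WPair Unit L)) \<and> linear_map S \<theta> L G)"

lemma linear_mapD:
  "linear_map S \<theta> L G \<Longrightarrow> \<forall>w\<in>set \<theta>. fv (\<rho> w) = {} \<Longrightarrow> G \<rho> T \<Longrightarrow>
     fv T = {} \<and> beta_eq S (App L (with_tm (map \<rho> \<theta>))) T"
  by (auto simp: linear_map_def)

lemma evals_reds: "reds S M N \<Longrightarrow> evals S N P \<theta> G \<Longrightarrow> evals S M P \<theta> G"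
  unfolding evals_def by (meson reds_trans)

text \<open>The map sees only the values of the assignment on \<open>\<theta>\<close>, and results
  matter up to conversion. Closedness is tracked separately because conversion does not preserve
  free variables.\<close>

lemma evals_mono:
  "evals S M P \<theta> G \<Longrightarrow> (\<And>\<rho> T. \<forall>w\<in>set \<theta>. fv (\<rho> w) = {} \<Longrightarrow> G' \<rho> T \<Longrightarrow>
     \<exists>\<rho>' T'. (\<forall>w\<in>set \<theta>. \<rho>' w = \<rho> w) \<and> G \<rho>' T' \<and> beta_eq S T' T \<and> (fv T' = {} \<longrightarrow> fv T = {})) \<Longrightarrow>
     evals S M P \<theta> G'"
  unfolding evals_def linear_map_def
proof (elim conjE exE, intro conjI exI allI impI, assumption, assumption, assumption)
  fix L \<rho> T
  assume *: "\<And>\<rho> T. \<forall>w\<in>set \<theta>. fv (\<rho> w) = {} \<Longrightarrow> G' \<rho> T \<Longrightarrow>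
     \<exists>\<rho>' T'. (\<forall>w\<in>set \<theta>. \<rho>' w = \<rho> w) \<and> G \<rho>' T' \<and> beta_eq S T' T \<and> (fv T' = {} \<longrightarrow> fv T = {})"
    and L: "\<forall>\<rho> T. (\<forall>w\<in>set \<theta>. fv (\<rho> w) = {}) \<longrightarrow> G \<rho> T \<longrightarrow>
        fv T = {} \<and> beta_eq S (App L (with_tm (map \<rho> \<theta>))) T"
    and \<rho>: "\<forall>w\<in>set \<theta>. fv (\<rho> w) = {}" and "G' \<rho> T"
  from *[OF \<rho> \<open>G' \<rho> T\<close>] obtain \<rho>' T' where \<rho>': "\<forall>w\<in>set \<theta>. \<rho>' w = \<rho> w" "G \<rho>' T'" "beta_eq S T' T"
    "fv T' = {} \<longrightarrow> fv T = {}" by blast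
  have "\<forall>w\<in>set \<theta>. fv (\<rho>' w) = {}" using \<rho> \<rho>'(1) by simp
  then have "fv T' = {} \<and> beta_eq S (App L (with_tm (map \<rho>' \<theta>))) T'" using L \<rho>'(2) by blast
  moreover have "map \<rho>' \<theta> = map \<rho> \<theta>" using \<rho>'(1) by simp
  ultimately show "fv T = {}" "beta_eq S (App L (with_tm (map \<rho> \<theta>))) T"
    using \<rho>'(3,4) by (auto intro: beta_eq_trans)
qed

lemma reds_let:
  assumes "closed_sub \<sigma>" "reds S (subst \<sigma> N) W" "value_for p W" "wf_pat p" "fv W = {}"
  shows "reds S (subst \<sigma> (let_tm p N M)) (subst (\<sigma> ++ map_of (bind p W)) M)"
  unfolding let_tm_def subst.simps(4) by (rule reds_beta[OF assms])

text \<open>Sequencing for \<open>let (!x, \<section>f) = N in M\<close>. The body is treated for an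
  arbitrary \<open>L\<close> satisfying the specification, so nothing about the syntax of the inner
  map leaks out.\<close>

lemma evals_let_dual:
  assumes "closed_sub \<sigma>" "x \<noteq> f" "evals S (subst \<sigma> N) P\<^sub>1 \<theta>\<^sub>1 G\<^sub>1"
    and "\<And>L. linear_map S \<theta>\<^sub>1 L G\<^sub>1 \<Longrightarrow> fv P\<^sub>1 = {} \<Longrightarrow> closed_sub (\<sigma>(f \<mapsto> L, x \<mapsto> P\<^sub>1)) \<Longrightarrow>
      evals S (subst (\<sigma>(f \<mapsto> L, x \<mapsto> P\<^sub>1)) M) P \<theta> G"
  shows "evals S (subst \<sigma> (let_tm (dual_pat x f) N M)) P \<theta> G"
proof -
  from assms(3) obtain L where L: "fv P\<^sub>1 = {}" "reds S (subst \<sigma> N) (Pair (Bang P\<^sub>1) (WPair Unit L))"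
    "linear_map S \<theta>\<^sub>1 L G\<^sub>1" by (auto simp: evals_def)
  have cl: "fv L = {}" using L(3) by (simp add: linear_map_def)
  have "reds S (subst \<sigma> (let_tm (dual_pat x f) N M))
      (subst (\<sigma> ++ map_of (bind (dual_pat x f) (Pair (Bang P\<^sub>1) (WPair Unit L)))) M)"
    using assms(2) L(1) cl
    by (intro reds_let[OF assms(1) L(2)]) (auto simp: dual_pat_def sec_pat_def)
  also have "\<sigma> ++ map_of (bind (dual_pat x f) (Pair (Bang P\<^sub>1) (WPair Unit L))) = \<sigma>(f \<mapsto> L, x \<mapsto> P\<^sub>1)"
    by (simp add: dual_pat_def sec_pat_def)
  finally show ?thesis
    by (rule evals_reds) (intro assms(4) L closed_sub_upd assms(1) cl)
qed

lemma subst_dual_tm: "subst \<sigma> (dual_tm N M) = Pair (Bang (subst \<sigma> N)) (WPair Unit (subst \<sigma> M))"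
  by (simp add: dual_tm_def sec_tm_def)

lemma fv_tuple_lam: "fv (tuple_lam m us M) \<subseteq> fv M - set us"
  by (auto simp: tuple_lam_def pvars_with_pat)

text \<open>Here \<open>\<tau>\<close> is the substitution in force once the tuple has been bound.
  Indices below \<open>m\<close> keep their meaning, which protects primal variables and maps bound
  earlier.\<close>

lemma evals_dual:
  assumes "closed_sub \<sigma>" "subst \<sigma> N = P" "fv P = {}" "distinct \<theta>"
    and "us = vars_from m As" "length As = length \<theta>" "fv M \<subseteq> dom \<sigma> \<union> set us"
    and "\<And>\<rho> T \<tau>. \<forall>w\<in>set \<theta>. fv (\<rho> w) = {} \<Longrightarrow> G \<rho> T \<Longrightarrow> closed_sub \<tau> \<Longrightarrow>
      (\<And>w. w \<in> set \<theta> \<Longrightarrow> \<tau> (lookup \<theta> us w) = Some (\<rho> w)) \<Longrightarrow>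
      (\<And>v. vidx v < m \<Longrightarrow> \<tau> v = \<sigma> v) \<Longrightarrow> fv T = {} \<and> beta_eq S (subst \<tau> M) T"
  shows "evals S (subst \<sigma> (dual_tm N (tuple_lam m us M))) P \<theta> G"
  unfolding evals_def subst_dual_tm
proof (intro conjI exI)
  show "fv P = {}" by fact
  show "reds S (Pair (Bang (subst \<sigma> N)) (WPair Unit (subst \<sigma> (tuple_lam m us M))))
     (Pair (Bang P) (WPair Unit (subst \<sigma> (tuple_lam m us M))))" using assms(2) by simp
  show "linear_map S \<theta> (subst \<sigma> (tuple_lam m us M)) G"
    unfolding linear_map_def
  proof (intro conjI allI impI)
    show "fv (subst \<sigma> (tuple_lam m us M)) = {}"
      using fv_tuple_lam[of m us M] assms(1,7) by (auto simp: fv_subst)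
    fix \<rho> T assume \<rho>: "\<forall>w\<in>set \<theta>. fv (\<rho> w) = {}" "G \<rho> T"
    obtain \<tau> where \<tau>: "reds S (App (subst \<sigma> (tuple_lam m us M)) (with_tm (map \<rho> \<theta>))) (subst \<tau> M)"
        "closed_sub \<tau>" "\<And>w. w \<in> set \<theta> \<Longrightarrow> \<tau> (lookup \<theta> us w) = Some (\<rho> w)"
        "\<And>v. vidx v < m \<Longrightarrow> \<tau> v = \<sigma> v"
      using apply_tuple_lam[OF assms(1,4) \<rho>(1) assms(5,6)] by metis
    from assms(8)[OF \<rho> \<tau>(2,3,4)] show "fv T = {}"
      and "beta_eq S (App (subst \<sigma> (tuple_lam m us M)) (with_tm (map \<rho> \<theta>))) T"
      using reds_beta_eq[OF \<tau>(1)] by (auto intro: beta_eq_trans)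
  qed
qed

text \<open>Composition with an already bound map \<open>g\<close>: its arguments need only be
  convertible to an assignment on which \<open>G'\<close> specifies the map.\<close>

lemma evals_comp:
  assumes "closed_sub \<sigma>" "\<sigma> z = Some P" "\<sigma> g = Some L" "linear_map S \<theta>' L G'" "vidx g < m"
    and "distinct \<theta>" "us = vars_from m As" "length As = length \<theta>"
    and "\<And>a. a \<in> set args \<Longrightarrow> fv a \<subseteq> dom \<sigma> \<union> set us"
    and "\<And>\<rho> T \<tau>. \<forall>w\<in>set \<theta>. fv (\<rho> w) = {} \<Longrightarrow> G \<rho> T \<Longrightarrow> closed_sub \<tau> \<Longrightarrow>
      (\<And>w. w \<in> set \<theta> \<Longrightarrow> \<tau> (lookup \<theta> us w) = Some (\<rho> w)) \<Longrightarrow>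
      (\<And>v. vidx v < m \<Longrightarrow> \<tau> v = \<sigma> v) \<Longrightarrow>
      \<exists>\<rho>'. list_all2 (beta_eq S) (map (subst \<tau>) args) (map \<rho>' \<theta>') \<and>
        (\<forall>w\<in>set \<theta>'. fv (\<rho>' w) = {}) \<and> G' \<rho>' T"
  shows "evals S (subst \<sigma> (dual_tm (V z) (tuple_lam m us (App (V g) (with_tm args))))) P \<theta> G"
proof (rule evals_dual[OF assms(1) _ _ assms(6,7,8)])
  show "subst \<sigma> (V z) = P" using assms(2) by simp
  show "fv P = {}" using assms(1,2) by (rule closed_subD)
  show "fv (App (V g) (with_tm args)) \<subseteq> dom \<sigma> \<union> set us" using assms(3,9) by auto
  fix \<rho> T \<tau>
  assume *: "\<forall>w\<in>set \<theta>. fv (\<rho> w) = {}" "G \<rho> T" "closed_sub \<tau>"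
     "\<And>w. w \<in> set \<theta> \<Longrightarrow> \<tau> (lookup \<theta> us w) = Some (\<rho> w)" "\<And>v. vidx v < m \<Longrightarrow> \<tau> v = \<sigma> v"
  from assms(10)[OF this] obtain \<rho>' where \<rho>': "list_all2 (beta_eq S) (map (subst \<tau>) args) (map \<rho>' \<theta>')"
    "\<forall>w\<in>set \<theta>'. fv (\<rho>' w) = {}" "G' \<rho>' T" by blast
  have "subst \<tau> (App (V g) (with_tm args)) = App L (with_tm (map (subst \<tau>) args))"
    using *(5)[OF assms(5)] assms(3) by simp
  moreover have "beta_eq S \<dots> (App L (with_tm (map \<rho>' \<theta>')))"
    by (rule beta_eq_App[OF beta_eq_refl beta_eq_with_tm[OF \<rho>'(1)]])
  ultimately show "fv T = {} \<and> beta_eq S (subst \<tau> (App (V g) (with_tm args))) T"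
    using linear_mapD[OF assms(4) \<rho>'(2,3)] by (auto intro: beta_eq_trans)
qed

text \<open>With an empty enumeration the map receives the empty tuple, matched by a variable of
  type \<top>; this abstraction is \<open>tuple_lam\<close> without components.\<close>

lemma evals_const:
  assumes "closed_sub \<sigma>" "subst \<sigma> N = P" "fv P = {}" "fv M = {}"
  shows "evals S (subst \<sigma> (dual_tm N (Lam (PVar (Var 0 TTop)) M))) P [] (\<lambda>\<rho> T. T = M)"
proof -
  have "evals S (subst \<sigma> (dual_tm N (tuple_lam 0 [] M))) P [] (\<lambda>\<rho> T. T = M)"
    by (rule evals_dual[OF assms(1,2,3), where As = "[]"]) (use assms(4) in \<open>auto simp: subst_closed\<close>)
  then show ?thesis by (simp add: tuple_lam_def)
qed

text \<open>A map on the tangents \<open>\<theta>'\<close> is extended to \<open>\<theta>\<close> by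
  ignoring the other components. Eliminations of the unit have this shape in both
  translations.\<close>

lemma evals_let_reindex:
  assumes cl: "closed_sub \<sigma>" and d: "evals S (subst \<sigma> N) P \<theta>' G"
    and "x \<noteq> f" "vidx f < m" "set \<theta>' \<subseteq> set \<theta>" and dist: "distinct \<theta>"
    and us: "us = vars_from m As" "length As = length \<theta>"
  shows "evals S (subst \<sigma> (let_tm (dual_pat x f) N (dual_tm (V x) (tuple_lam m us
     (App (V f) (with_tm (map (\<lambda>w. V (lookup \<theta> us w)) \<theta>'))))))) P \<theta> G"
proof (rule evals_let_dual[OF cl assms(3) d])
  let ?args = "map (\<lambda>w. V (lookup \<theta> us w)) \<theta>'"
  fix L assume L: "linear_map S \<theta>' L G" and "fv P = {}" and cl1: "closed_sub (\<sigma>(f \<mapsto> L, x \<mapsto> P))"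
  show "evals S (subst (\<sigma>(f \<mapsto> L, x \<mapsto> P)) (dual_tm (V x) (tuple_lam m us (App (V f) (with_tm ?args))))) P \<theta> G"
  proof (rule evals_comp[OF cl1 _ _ L assms(4) dist us])
    have look: "lookup \<theta> us w \<in> set us" if "w \<in> set \<theta>" for w
      by (rule lookup_in) (use that us in auto)
    show "fv a \<subseteq> dom (\<sigma>(f \<mapsto> L, x \<mapsto> P)) \<union> set us" if "a \<in> set ?args" for a
      using that look subsetD[OF assms(5)] by auto
    fix \<rho> T \<tau>
    assume \<rho>: "\<forall>w\<in>set \<theta>. fv (\<rho> w) = {}" and G: "G \<rho> T"
      and \<tau>: "\<And>w. w \<in> set \<theta> \<Longrightarrow> \<tau> (lookup \<theta> us w) = Some (\<rho> w)"
    have "map (subst \<tau>) ?args = map \<rho> \<theta>'" using \<tau> assms(5) by auto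
    then have "list_all2 (beta_eq S) (map (subst \<tau>) ?args) (map \<rho> \<theta>')"
      by (simp only: list_all2_refl beta_eq_refl)
    then show "\<exists>\<rho>'. list_all2 (beta_eq S) (map (subst \<tau>) ?args) (map \<rho>' \<theta>') \<and>
        (\<forall>w\<in>set \<theta>'. fv (\<rho>' w) = {}) \<and> G \<rho>' T" using \<rho> G assms(5) by blast
  qed (use assms(3) in simp_all)
qed

text \<open>The chain rule, stated once for the \<open>let\<close> of Linear A and for
  \<open>let !x\<close> in the forward transformation. Locating \<open>y\<close> by a case
  distinction covers enumerations with \<open>y\<close> in front as well as those in which the bound
  variable does not occur.\<close>

lemma evals_let_let:
  fixes S :: "'f signat" and \<theta> :: "'v list"
  defines "u \<equiv> \<lambda>\<theta> us w. V (lookup \<theta> us w) :: 'f tm"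
  assumes cl: "closed_sub \<sigma>" and d1: "evals S (subst \<sigma> N\<^sub>1) P\<^sub>1 \<theta>\<^sub>1 G\<^sub>1"
    and d2: "\<And>L. closed_sub (\<sigma>(f \<mapsto> L, x \<mapsto> P\<^sub>1)) \<Longrightarrow>
      evals S (subst (\<sigma>(f \<mapsto> L, x \<mapsto> P\<^sub>1)) N\<^sub>2) P\<^sub>2 \<theta>\<^sub>2 G\<^sub>2"
    and ne: "x \<noteq> f" "z \<noteq> g" "f \<noteq> z" "f \<noteq> g" and lt: "vidx f < m" "vidx g < m"
    and sub: "set \<theta>\<^sub>1 \<subseteq> set \<theta>" "set \<theta>\<^sub>2 \<subseteq> insert y (set \<theta>)"
    and dist: "distinct \<theta>" and us: "us = vars_from m As" "length As = length \<theta>"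
    and args: "args = map (\<lambda>w. if w = y then App (V f) (with_tm (map (u \<theta> us) \<theta>\<^sub>1)) else u \<theta> us w) \<theta>\<^sub>2"
  shows "evals S (subst \<sigma> (let_tm (dual_pat x f) N\<^sub>1 (let_tm (dual_pat z g) N\<^sub>2
     (dual_tm (V z) (tuple_lam m us (App (V g) (with_tm args))))))) P\<^sub>2 \<theta>
     (\<lambda>\<rho> T. \<exists>T\<^sub>1. G\<^sub>1 \<rho> T\<^sub>1 \<and> G\<^sub>2 (\<rho>(y := T\<^sub>1)) T)"
    (is "evals S _ _ _ ?G")
proof (rule evals_let_dual[OF cl ne(1) d1])
  fix L\<^sub>1 assume L1: "linear_map S \<theta>\<^sub>1 L\<^sub>1 G\<^sub>1" and cl1: "closed_sub (\<sigma>(f \<mapsto> L\<^sub>1, x \<mapsto> P\<^sub>1))"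
  let ?\<sigma>1 = "\<sigma>(f \<mapsto> L\<^sub>1, x \<mapsto> P\<^sub>1)"
  show "evals S (subst ?\<sigma>1 (let_tm (dual_pat z g) N\<^sub>2
     (dual_tm (V z) (tuple_lam m us (App (V g) (with_tm args)))))) P\<^sub>2 \<theta> ?G"
  proof (rule evals_let_dual[OF cl1 ne(2) d2[OF cl1]])
    fix L\<^sub>2 assume L2: "linear_map S \<theta>\<^sub>2 L\<^sub>2 G\<^sub>2" and cl2: "closed_sub (?\<sigma>1(g \<mapsto> L\<^sub>2, z \<mapsto> P\<^sub>2))"
    let ?\<sigma>2 = "?\<sigma>1(g \<mapsto> L\<^sub>2, z \<mapsto> P\<^sub>2)"
    have look: "lookup \<theta> us w \<in> set us" if "w \<in> set \<theta>" for w
      by (rule lookup_in) (use that us in auto)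
    show "evals S (subst ?\<sigma>2 (dual_tm (V z) (tuple_lam m us (App (V g) (with_tm args))))) P\<^sub>2 \<theta> ?G"
    proof (rule evals_comp[OF cl2 _ _ L2 lt(2) dist us])
      show "fv a \<subseteq> dom ?\<sigma>2 \<union> set us" if "a \<in> set args" for a
      proof -
        from that obtain w where w: "w \<in> set \<theta>\<^sub>2"
          "a = (if w = y then App (V f) (with_tm (map (u \<theta> us) \<theta>\<^sub>1)) else u \<theta> us w)"
          by (auto simp: args)
        have "\<And>v. v \<in> set \<theta>\<^sub>1 \<Longrightarrow> lookup \<theta> us v \<in> set us" using look sub(1) by blast
        moreover have "w \<noteq> y \<Longrightarrow> lookup \<theta> us w \<in> set us" using look sub(2) w(1) by blast
        ultimately show ?thesis using w(2) by (auto simp: u_def)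
      qed
      fix \<rho> T \<tau>
      assume \<rho>: "\<forall>w\<in>set \<theta>. fv (\<rho> w) = {}" and G: "?G \<rho> T"
        and \<tau>: "\<And>w. w \<in> set \<theta> \<Longrightarrow> \<tau> (lookup \<theta> us w) = Some (\<rho> w)"
          "\<And>v. vidx v < m \<Longrightarrow> \<tau> v = ?\<sigma>2 v"
      from G obtain T\<^sub>1 where T1: "G\<^sub>1 \<rho> T\<^sub>1" "G\<^sub>2 (\<rho>(y := T\<^sub>1)) T" by blast
      have L1\<rho>: "fv T\<^sub>1 = {} \<and> beta_eq S (App L\<^sub>1 (with_tm (map \<rho> \<theta>\<^sub>1))) T\<^sub>1"
        by (rule linear_mapD[OF L1 _ T1(1)]) (use \<rho> sub(1) in auto)
      have \<tau>f: "\<tau> f = Some L\<^sub>1" using \<tau>(2)[OF lt(1)] ne by auto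
      have "map (subst \<tau>) (map (u \<theta> us) \<theta>\<^sub>1) = map \<rho> \<theta>\<^sub>1" using \<tau>(1) sub(1) by (auto simp: u_def)
      then have fu: "subst \<tau> (App (V f) (with_tm (map (u \<theta> us) \<theta>\<^sub>1))) = App L\<^sub>1 (with_tm (map \<rho> \<theta>\<^sub>1))"
        using \<tau>f by (simp only: subst.simps subst_with_tm) simp
      \<comment> \<open>The component for \<open>y\<close> is converted to the inner derivative
        \<open>T\<^sub>1\<close>; all others are copied literally from the assignment.\<close>
      have "list_all2 (beta_eq S) (map (subst \<tau>) args) (map (\<rho>(y := T\<^sub>1)) \<theta>\<^sub>2)"
        unfolding args list_all2_map1 list_all2_map2
      proof (rule list.rel_refl_strong)
        fix w assume "w \<in> set \<theta>\<^sub>2"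
        then show "beta_eq S (subst \<tau> (if w = y then App (V f) (with_tm (map (u \<theta> us) \<theta>\<^sub>1)) else u \<theta> us w))
            ((\<rho>(y := T\<^sub>1)) w)"
          using fu L1\<rho> \<tau>(1)[of w] sub(2) by (cases "w = y") (auto simp: u_def)
      qed
      moreover have "\<forall>w\<in>set \<theta>\<^sub>2. fv ((\<rho>(y := T\<^sub>1)) w) = {}" using \<rho> L1\<rho> sub(2) by auto
      ultimately show "\<exists>\<rho>'. list_all2 (beta_eq S) (map (subst \<tau>) args) (map \<rho>' \<theta>\<^sub>2) \<and>
          (\<forall>w\<in>set \<theta>\<^sub>2. fv (\<rho>' w) = {}) \<and> G\<^sub>2 \<rho>' T" using T1(2) by blast
    qed (use ne in simp_all)
  qed
qed

text \<open>A variable of \<lambda>LL is an index together with a type, so distinct primal variables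
  with equal indices are kept apart only if their translated types differ.\<close>

lemma pT_inject: "pT \<tau> = pT \<sigma> \<longleftrightarrow> \<tau> = \<sigma>"
proof (induction \<tau> arbitrary: \<sigma>)
  case LReal
  then show ?case by (cases \<sigma>) auto
next
  case LOne
  then show ?case by (cases \<sigma>) auto
next
  case (LTensor \<tau>1 \<tau>2)
  then show ?case by (cases \<sigma>) auto
qed

lemma pv_inject [simp]: "pv x = pv y \<longleftrightarrow> x = y"
  by (cases x; cases y) (auto simp: pv_def pT_inject)

lemma vidx_pv [simp]: "vidx (pv x) = pidx x"
  by (simp add: pv_def)

lemma vty_pv [simp]: "vty (pv x) = pT (plty x)"
  by (simp add: pv_def)

lemma fresh_index_gt: "finite I \<Longrightarrow> i \<in> I \<Longrightarrow> i < fresh_index I"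
  by (simp add: fresh_index_def less_Suc_eq_le)

lemma fresh_p_gt: "finite X \<Longrightarrow> x \<in> X \<Longrightarrow> pidx x < fresh_p X"
  by (simp add: fresh_p_def fresh_index_gt)

lemma fresh_t_gt: "finite Y \<Longrightarrow> y \<in> Y \<Longrightarrow> tidx y < fresh_t Y"
  by (simp add: fresh_t_def fresh_index_gt)

lemma finite_FVp [simp]: "finite (FVp e)"
  by (induction e) auto

lemma finite_FVt [simp]: "finite (FVt e)"
  by (induction e) auto

text \<open>The substitution is prescribed only on the free primal variables, since lets also bind
  linear maps, and the enumeration is arbitrary, since constructs pass on restricted or extended
  ones.\<close>

definition denotes ::
    "'f signat \<Rightarrow> (pvar \<Rightarrow> 'f tm) \<Rightarrow> 'f lexp \<Rightarrow> 'f tm \<Rightarrow> ((tvar \<Rightarrow> 'f tm) \<Rightarrow> 'f tm \<Rightarrow> bool) \<Rightarrow> bool" where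
  "denotes S \<pi> e P G \<longleftrightarrow>
     (\<forall>\<sigma> \<theta>. closed_sub \<sigma> \<longrightarrow> (\<forall>x\<in>FVp e. \<sigma> (pv x) = Some (\<pi> x)) \<longrightarrow>
        distinct \<theta> \<longrightarrow> set \<theta> = FVt e \<longrightarrow> evals S (subst \<sigma> (delta \<theta> e)) P \<theta> G)"

lemma denotesI:
  assumes "\<And>\<sigma> \<theta>. closed_sub \<sigma> \<Longrightarrow> (\<And>x. x \<in> FVp e \<Longrightarrow> \<sigma> (pv x) = Some (\<pi> x)) \<Longrightarrow>
     distinct \<theta> \<Longrightarrow> set \<theta> = FVt e \<Longrightarrow> evals S (subst \<sigma> (delta \<theta> e)) P \<theta> G"
  shows "denotes S \<pi> e P G"
  using assms by (simp add: denotes_def)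

lemma denotesD:
  "denotes S \<pi> e P G \<Longrightarrow> closed_sub \<sigma> \<Longrightarrow> (\<And>x. x \<in> FVp e \<Longrightarrow> \<sigma> (pv x) = Some (\<pi> x)) \<Longrightarrow>
     distinct \<theta> \<Longrightarrow> set \<theta> = FVt e \<Longrightarrow> evals S (subst \<sigma> (delta \<theta> e)) P \<theta> G"
  by (simp add: denotes_def)

lemma denotes_cong:
  "denotes S \<pi> e P G \<Longrightarrow> (\<And>x. x \<in> FVp e \<Longrightarrow> \<pi> x = \<pi>' x) \<Longrightarrow> denotes S \<pi>' e P G"
  by (simp add: denotes_def)

lemma denotes_mono:
  assumes "denotes S \<pi> e P G"
    and "\<And>\<rho> T. \<forall>w\<in>FVt e. fv (\<rho> w) = {} \<Longrightarrow> G' \<rho> T \<Longrightarrow>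
     \<exists>\<rho>' T'. (\<forall>w\<in>FVt e. \<rho>' w = \<rho> w) \<and> G \<rho>' T' \<and> beta_eq S T' T \<and> (fv T' = {} \<longrightarrow> fv T = {})"
  shows "denotes S \<pi> e P G'"
proof (rule denotesI)
  fix \<sigma> :: "var \<Rightarrow> 'a tm option" and \<theta> assume *: "closed_sub \<sigma>" "\<And>x. x \<in> FVp e \<Longrightarrow> \<sigma> (pv x) = Some (\<pi> x)"
    "distinct \<theta>" "set \<theta> = FVt e"
  have "evals S (subst \<sigma> (delta \<theta> e)) P \<theta> G"
    by (rule denotesD[OF assms(1)]) (use * in auto)
  then show "evals S (subst \<sigma> (delta \<theta> e)) P \<theta> G'"
    by (rule evals_mono) (unfold *(4), rule assms(2))
qed

section \<open>Denotations of the constructs of Linear A\<close>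

lemma denotes_LPair: "denotes S \<pi> (LPair x y) (\<pi> x) (\<lambda>\<rho> T. T = \<rho> y)"
proof (rule denotesI)
  fix \<sigma> :: "var \<Rightarrow> 'a tm option" and \<theta> assume *: "closed_sub \<sigma>" "\<And>z. z \<in> FVp (LPair x y) \<Longrightarrow> \<sigma> (pv z) = Some (\<pi> z)"
    "distinct \<theta>" "set \<theta> = FVt (LPair x y)"
  let ?us = "vars_from (fresh_p {x}) (map (tT \<circ> tlty) \<theta>)"
  have "evals S (subst \<sigma> (dual_tm (V (pv x)) (tuple_lam (fresh_p {x}) ?us (V (lookup \<theta> ?us y))))) (\<pi> x) \<theta>
      (\<lambda>\<rho> T. T = \<rho> y)"
    by (rule evals_dual[OF *(1) _ _ *(3) refl]) (use * in \<open>auto intro: lookup_in dest: closed_subD\<close>)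
  then show "evals S (subst \<sigma> (delta \<theta> (LPair x y))) (\<pi> x) \<theta> (\<lambda>\<rho> T. T = \<rho> y)"
    by (simp add: Let_def)
qed

text \<open>\<open>delta\<close> always puts \<open>y\<close> in front of the enumeration for the
  body, which enumerates \<open>FVt e2\<close> only if \<open>y\<close> occurs there; linearity
  ensures that it does.\<close>

lemma denotes_LLet:
  assumes d1: "denotes S \<pi> e1 P\<^sub>1 G\<^sub>1" and d2: "denotes S (\<pi>(x := P\<^sub>1)) e2 P\<^sub>2 G\<^sub>2" and y: "y \<in> FVt e2"
  shows "denotes S \<pi> (LLet x y e1 e2) P\<^sub>2 (\<lambda>\<rho> T. \<exists>T\<^sub>1. G\<^sub>1 \<rho> T\<^sub>1 \<and> G\<^sub>2 (\<rho>(y := T\<^sub>1)) T)"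
proof (rule denotesI)
  fix \<sigma> :: "var \<Rightarrow> 'a tm option" and \<theta> assume cl: "closed_sub \<sigma>" and \<sigma>: "\<And>z. z \<in> FVp (LLet x y e1 e2) \<Longrightarrow> \<sigma> (pv z) = Some (\<pi> z)"
    and dist: "distinct \<theta>" and \<theta>: "set \<theta> = FVt (LLet x y e1 e2)"
  define \<theta>1 where "\<theta>1 = filter (\<lambda>w. w \<in> FVt e1) \<theta>"
  define \<theta>2 where "\<theta>2 = filter (\<lambda>w. w \<in> FVt e2 - {y}) \<theta>"
  define m where "m = fresh_p (insert x (FVp e1 \<union> FVp e2))"
  define f where "f = Var m (Lolli (with_ty (map (tT \<circ> tlty) \<theta>1)) (tT (tlty y)))"
  define z where "z = Var (m + 1) (pT (fst (ety e2)))"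
  define g where "g = Var (m + 2) (Lolli (with_ty (map (tT \<circ> tlty) (y # \<theta>2))) (tT (snd (ety e2))))"
  define us where "us = vars_from (m + 3) (map (tT \<circ> tlty) \<theta>)"
  define u where "u = (\<lambda>w. V (lookup \<theta> us w) :: 'a tm)"
  define args where "args = App (V f) (with_tm (map u \<theta>1)) # map u \<theta>2"
  have delta: "delta \<theta> (LLet x y e1 e2) = let_tm (dual_pat (pv x) f) (delta \<theta>1 e1)
     (let_tm (dual_pat z g) (delta (y # \<theta>2) e2) (dual_tm (V z) (tuple_lam (m + 3) us (App (V g) (with_tm args)))))"
    by (simp add: Let_def split_beta \<theta>1_def \<theta>2_def m_def f_def z_def g_def us_def u_def args_def)
  have lt: "pidx w < m" if "w \<in> insert x (FVp e1 \<union> FVp e2)" for w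
    unfolding m_def by (rule fresh_p_gt) (use that in auto)
  \<comment> \<open>The index of \<open>f\<close> lies above all primal indices in sight, so binding
    \<open>f\<close> does not disturb the values of primal variables.\<close>
  have ne: "pv w \<noteq> f" if "w \<in> insert x (FVp e1 \<union> FVp e2)" for w
    using lt[OF that] by (metis f_def less_irrefl var.sel(1) vidx_pv)
  have s1: "set \<theta>1 = FVt e1" and s2: "set (y # \<theta>2) = FVt e2" and d: "distinct \<theta>1" "distinct (y # \<theta>2)"
    using \<theta> y dist by (auto simp: \<theta>1_def \<theta>2_def)
  have args: "args = map (\<lambda>w. if w = y then App (V f) (with_tm (map u \<theta>1)) else u w) (y # \<theta>2)"
    by (auto simp: args_def \<theta>2_def)
  show "evals S (subst \<sigma> (delta \<theta> (LLet x y e1 e2))) P\<^sub>2 \<theta> (\<lambda>\<rho> T. \<exists>T\<^sub>1. G\<^sub>1 \<rho> T\<^sub>1 \<and> G\<^sub>2 (\<rho>(y := T\<^sub>1)) T)"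
    unfolding delta
  proof (rule evals_let_let[OF cl _ _ _ _ _ _ _ _ _ _ dist us_def _ args[unfolded u_def]])
    show "evals S (subst \<sigma> (delta \<theta>1 e1)) P\<^sub>1 \<theta>1 G\<^sub>1"
      by (rule denotesD[OF d1 cl _ d(1) s1]) (simp add: \<sigma>)
    show "evals S (subst (\<sigma>(f \<mapsto> L, pv x \<mapsto> P\<^sub>1)) (delta (y # \<theta>2) e2)) P\<^sub>2 (y # \<theta>2) G\<^sub>2"
      if "closed_sub (\<sigma>(f \<mapsto> L, pv x \<mapsto> P\<^sub>1))" for L
      by (rule denotesD[OF d2 that _ d(2) s2]) (use \<sigma> ne in auto)
    show "pv x \<noteq> f" by (rule ne) simp
  qed (simp_all add: f_def g_def z_def, auto simp: \<theta>1_def \<theta>2_def)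
qed

lemma denotes_LUnitP: "denotes S \<pi> LUnitP Unit (\<lambda>\<rho> T. T = Empty)"
  by (rule denotesI) (auto intro: evals_const)

lemma denotes_LUnitT: "denotes S \<pi> LUnitT Unit (\<lambda>\<rho> T. T = Empty)"
  by (rule denotesI) (auto intro: evals_const)

lemma denotes_LZero: "denotes S \<pi> (LZero LReal) Unit (\<lambda>\<rho> T. T = Num 0)"
  by (rule denotesI) (auto intro: evals_const)

lemma denotes_LNum: "denotes S \<pi> (LNum r) (Num r) (\<lambda>\<rho> T. T = Empty)"
  by (rule denotesI) (auto intro: evals_const)

lemma subst_tensor_tm: "subst \<sigma> (tensor_tm Ms) = tensor_tm (map (subst \<sigma>) Ms)"
  by (induction Ms rule: tensor_tm.induct) auto

lemma fv_tensor_tm: "fv (tensor_tm Ms) = (\<Union>M\<in>set Ms. fv M)"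
  by (induction Ms rule: tensor_tm.induct) auto

lemma reds_Fn_args:
  assumes "length xs = arity S f" "\<And>x. x \<in> set xs \<Longrightarrow> \<sigma> x = Some (Num (r x))"
  shows "reds S (subst \<sigma> (App (Fn f) (tensor_tm (map (\<lambda>x. Bang (V x)) xs))))
     (Bang (Num (den S f (map r xs))))"
proof -
  have "map (subst \<sigma>) (map (\<lambda>x. Bang (V x)) xs) = map (\<lambda>s. Bang (Num s)) (map r xs)"
    using assms(2) by auto
  then have eq: "subst \<sigma> (App (Fn f) (tensor_tm (map (\<lambda>x. Bang (V x)) xs))) =
      App (Fn f) (tensor_tm (map (\<lambda>s. Bang (Num s)) (map r xs)))"
    by (simp only: subst.simps subst_tensor_tm)
  show ?thesis unfolding eq by (intro red_reds red_Fn) (simp add: assms(1))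
qed

lemma denotes_LFn:
  assumes "length xs = arity S f" "\<And>x. x \<in> set xs \<Longrightarrow> \<pi> x = Num (r x)"
  shows "denotes S \<pi> (LFn f xs) (Num (den S f (map r xs))) (\<lambda>\<rho> T. T = Empty)"
proof (rule denotesI)
  fix \<sigma> :: "var \<Rightarrow> 'a tm option" and \<theta> assume *: "closed_sub \<sigma>" "\<And>z. z \<in> FVp (LFn f xs) \<Longrightarrow> \<sigma> (pv z) = Some (\<pi> z)"
    "distinct \<theta>" "set \<theta> = FVt (LFn f xs)"
  \<comment> \<open>\<open>reds_Fn_args\<close> is stated for \<lambda>LL variables; injectivity of
    \<open>pv\<close> lets the numerals be looked up from there.\<close>
  define r' where "r' = (\<lambda>v. r (inv pv v))"
  have r': "r' (pv x) = r x" for x by (simp add: r'_def inv_f_f inj_def)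
  have "reds S (subst \<sigma> (App (Fn f) (tensor_tm (map (\<lambda>x. Bang (V x)) (map pv xs)))))
     (Bang (Num (den S f (map r' (map pv xs)))))"
    by (rule reds_Fn_args) (use assms * in \<open>auto simp: r'\<close>)
  then have "reds S (subst \<sigma> (App (Fn f) (tensor_tm (map (\<lambda>x. Bang (V (pv x))) xs))))
     (Bang (Num (den S f (map r xs))))"
    by (simp add: comp_def r')
  then have "reds S (subst \<sigma> (delta \<theta> (LFn f xs)))
      (subst \<sigma> (dual_tm (Num (den S f (map r xs))) (Lam (PVar (Var 0 TTop)) Empty)))"
    by (simp add: subst_dual_tm sec_tm_def reds_Pair)
  moreover have "\<theta> = []" using *(4) by simp
  ultimately show "evals S (subst \<sigma> (delta \<theta> (LFn f xs))) (Num (den S f (map r xs))) \<theta> (\<lambda>\<rho> T. T = Empty)"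
    by (simp only:) (erule evals_reds, rule evals_const[OF *(1)], auto)
qed

text \<open>Forward mode adds and scales only real tangents, in the derivative of a function symbol;
  there \<open>plus_tm\<close> is the constant \<open>Plus\<close> itself.\<close>

lemma denotes_LPlus:
  assumes "tlty y1 = LReal"
  shows "denotes S \<pi> (LPlus y1 y2) Unit (\<lambda>\<rho> T. T = App Plus (WPair (\<rho> y1) (\<rho> y2)))"
proof (rule denotesI)
  fix \<sigma> :: "var \<Rightarrow> 'a tm option" and \<theta> assume *: "closed_sub \<sigma>" "distinct \<theta>" "set \<theta> = FVt (LPlus y1 y2)"
  let ?us = "vars_from 0 (map (tT \<circ> tlty) \<theta>)"
  let ?M = "App Plus (WPair (V (lookup \<theta> ?us y1)) (V (lookup \<theta> ?us y2)))"
  have "evals S (subst \<sigma> (dual_tm Unit (tuple_lam 0 ?us ?M))) Unit \<theta>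
      (\<lambda>\<rho> T. T = App Plus (WPair (\<rho> y1) (\<rho> y2)))"
    by (rule evals_dual[OF *(1) _ _ *(2) refl]) (use *(3) in \<open>auto intro: lookup_in\<close>)
  then show "evals S (subst \<sigma> (delta \<theta> (LPlus y1 y2))) Unit \<theta>
      (\<lambda>\<rho> T. T = App Plus (WPair (\<rho> y1) (\<rho> y2)))"
    by (simp add: Let_def assms)
qed

lemma denotes_LTimes:
  assumes "tlty y = LReal"
  shows "denotes S \<pi> (LTimes x y) Unit (\<lambda>\<rho> T. T = App (App Times (\<pi> x)) (\<rho> y))"
proof (rule denotesI)
  fix \<sigma> :: "var \<Rightarrow> 'a tm option" and \<theta> assume *: "closed_sub \<sigma>" "\<And>z. z \<in> FVp (LTimes x y) \<Longrightarrow> \<sigma> (pv z) = Some (\<pi> z)"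
    "distinct \<theta>" "set \<theta> = FVt (LTimes x y)"
  let ?m = "fresh_p {x}"
  let ?us = "vars_from ?m (map (tT \<circ> tlty) \<theta>)"
  let ?M = "App (App Times (V (pv x))) (V (lookup \<theta> ?us y))"
  have x: "pidx x < ?m" by (rule fresh_p_gt) auto
  have "fv (\<pi> x) = {}" using * by (auto dest: closed_subD)
  then have "evals S (subst \<sigma> (dual_tm Unit (tuple_lam ?m ?us ?M))) Unit \<theta>
      (\<lambda>\<rho> T. T = App (App Times (\<pi> x)) (\<rho> y))"
    by (intro evals_dual[OF *(1) _ _ *(3) refl]) (use * x in \<open>auto intro: lookup_in\<close>)
  then show "evals S (subst \<sigma> (delta \<theta> (LTimes x y))) Unit \<theta>
      (\<lambda>\<rho> T. T = App (App Times (\<pi> x)) (\<rho> y))"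
    by (simp add: Let_def assms)
qed

lemma denotes_LDup: "denotes S \<pi> (LDup y) Unit (\<lambda>\<rho> T. T = WPair (\<rho> y) (\<rho> y))"
proof (rule denotesI)
  fix \<sigma> :: "var \<Rightarrow> 'a tm option" and \<theta> assume *: "closed_sub \<sigma>" "distinct \<theta>" "set \<theta> = FVt (LDup y)"
  let ?us = "vars_from 0 (map (tT \<circ> tlty) \<theta>)"
  let ?u = "V (lookup \<theta> ?us y)"
  have "evals S (subst \<sigma> (dual_tm Unit (tuple_lam 0 ?us (WPair ?u ?u)))) Unit \<theta>
      (\<lambda>\<rho> T. T = WPair (\<rho> y) (\<rho> y))"
    by (rule evals_dual[OF *(1) _ _ *(2) refl]) (use *(3) in \<open>auto intro: lookup_in\<close>)
  then show "evals S (subst \<sigma> (delta \<theta> (LDup y))) Unit \<theta> (\<lambda>\<rho> T. T = WPair (\<rho> y) (\<rho> y))"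
    by (simp add: Let_def)
qed

lemma evals_let_unit:
  assumes "closed_sub \<sigma>" "\<sigma> z = Some Unit" "evals S (subst \<sigma> M) P \<theta> G"
  shows "evals S (subst \<sigma> (let_tm PUnit (V z) M)) P \<theta> G"
proof -
  have "reds S (subst \<sigma> (let_tm PUnit (V z) M)) (subst (\<sigma> ++ map_of (bind PUnit Unit)) M)"
    by (rule reds_let[OF assms(1)]) (simp_all add: assms(2))
  then show ?thesis using assms(3) by (auto elim: evals_reds)
qed

lemma denotes_LLetUnitP:
  assumes "\<pi> z = Unit" "denotes S \<pi> e P G"
  shows "denotes S \<pi> (LLetUnitP z e) P G"
  by (rule denotesI) (use assms in \<open>auto intro!: evals_let_unit denotesD[OF assms(2)]\<close>)

lemma denotes_LLetUnitT:
  assumes "z \<notin> FVt e" "denotes S \<pi> e P G"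
  shows "denotes S \<pi> (LLetUnitT z e) P G"
proof (rule denotesI)
  fix \<sigma> :: "var \<Rightarrow> 'a tm option" and \<theta> assume cl: "closed_sub \<sigma>" and \<sigma>: "\<And>x. x \<in> FVp (LLetUnitT z e) \<Longrightarrow> \<sigma> (pv x) = Some (\<pi> x)"
    and dist: "distinct \<theta>" and \<theta>: "set \<theta> = FVt (LLetUnitT z e)"
  define \<theta>' where "\<theta>' = filter (\<lambda>w. w \<noteq> z) \<theta>"
  define m where "m = fresh_p (FVp e)"
  define x where "x = Var m (pT (fst (ety e)))"
  define f where "f = Var (m + 1) (Lolli (with_ty (map (tT \<circ> tlty) \<theta>')) (tT (snd (ety e))))"
  define us where "us = vars_from (m + 2) (map (tT \<circ> tlty) \<theta>)"
  define u where "u = (\<lambda>w. V (lookup \<theta> us w) :: 'a tm)"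
  have delta: "delta \<theta> (LLetUnitT z e) = let_tm (dual_pat x f) (delta \<theta>' e)
     (dual_tm (V x) (tuple_lam (m + 2) us (App (V f) (with_tm (map u \<theta>')))))"
    by (simp add: Let_def split_beta \<theta>'_def m_def f_def x_def us_def u_def)
  have s: "set \<theta>' = FVt e" and d: "distinct \<theta>'"
    using \<theta> assms(1) dist by (auto simp: \<theta>'_def)
  have "evals S (subst \<sigma> (delta \<theta>' e)) P \<theta>' G"
    by (rule denotesD[OF assms(2) cl _ d s]) (simp add: \<sigma>)
  then show "evals S (subst \<sigma> (delta \<theta> (LLetUnitT z e))) P \<theta> G"
    unfolding delta u_def
    by (rule evals_let_reindex[OF cl _ _ _ _ dist us_def]) (auto simp: x_def f_def \<theta>'_def)
qed

text \<open>The abstraction binds the whole tuple to one variable instead of a tuple pattern, so its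
  body is run by hand.\<close>

lemma denotes_LDrop:
  assumes "denotes S \<pi> e P G"
  shows "denotes S \<pi> (LDrop e) Unit (\<lambda>\<rho> T. T = Empty)"
proof (rule denotesI)
  fix \<sigma> :: "var \<Rightarrow> 'a tm option" and \<theta> assume cl: "closed_sub \<sigma>" and \<sigma>: "\<And>x. x \<in> FVp (LDrop e) \<Longrightarrow> \<sigma> (pv x) = Some (\<pi> x)"
    and dist: "distinct \<theta>" and \<theta>: "set \<theta> = FVt (LDrop e)"
  define A where "A = with_ty (map (tT \<circ> tlty) \<theta>)"
  define x where "x = Var 0 (pT (fst (ety e)))"
  define f where "f = Var 1 (Lolli A (tT (snd (ety e))))"
  define y where "y = Var 2 A"
  define z where "z = Var 3 (tT (snd (ety e)))"
  define B :: "'a tm" where "B = let_tm (PVar z) (App (V f) (V y)) Empty"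
  have delta: "delta \<theta> (LDrop e) = let_tm (dual_pat x f) (delta \<theta> e) (dual_tm Unit (Lam (PVar y) B))"
    by (simp add: Let_def split_beta A_def f_def x_def y_def z_def B_def)
  show "evals S (subst \<sigma> (delta \<theta> (LDrop e))) Unit \<theta> (\<lambda>\<rho> T. T = Empty)"
    unfolding delta
  proof (rule evals_let_dual[OF cl])
    show "x \<noteq> f" by (simp add: x_def f_def)
    show "evals S (subst \<sigma> (delta \<theta> e)) P \<theta> G"
      by (rule denotesD[OF assms cl _ dist]) (use \<sigma> \<theta> in auto)
    fix L assume L: "linear_map S \<theta> L G" and "fv P = {}" and cl1: "closed_sub (\<sigma>(f \<mapsto> L, x \<mapsto> P))"
    let ?\<sigma>1 = "\<sigma>(f \<mapsto> L, x \<mapsto> P)"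
    have "linear_map S \<theta> (subst ?\<sigma>1 (Lam (PVar y) B)) (\<lambda>\<rho> T. T = Empty)"
      unfolding linear_map_def
    proof (intro conjI allI impI)
      show "fv (subst ?\<sigma>1 (Lam (PVar y) B)) = {}"
        unfolding fv_subst[OF cl1] by (auto simp: B_def let_tm_def)
      fix \<rho> :: "tvar \<Rightarrow> 'a tm" and T :: "'a tm"
      assume \<rho>: "\<forall>w\<in>set \<theta>. fv (\<rho> w) = {}" and T: "T = Empty"
      show "fv T = {}" using T by simp
      let ?W = "with_tm (map \<rho> \<theta>)"
      have W: "fv ?W = {}" using \<rho> by simp
      let ?\<sigma>2 = "?\<sigma>1 ++ map_of (bind (PVar y) ?W)"
      have cl2: "closed_sub ?\<sigma>2" by (rule closed_sub_add[OF cl1 closed_sub_bind[OF W]])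
      have "reds S (App (subst ?\<sigma>1 (Lam (PVar y) B)) ?W) (subst ?\<sigma>2 B)"
        by (rule reds_beta[OF cl1 reds_refl]) (use W in auto)
      \<comment> \<open>Any term is a value for a variable pattern, so \<open>f y\<close> is
        discarded without being evaluated.\<close>
      also have "reds S (subst ?\<sigma>2 B) (subst (?\<sigma>2 ++ map_of (bind (PVar z) (subst ?\<sigma>2 (App (V f) (V y))))) Empty)"
        unfolding B_def
      proof (rule reds_let[OF cl2 reds_refl])
        show "fv (subst ?\<sigma>2 (App (V f) (V y))) = {}"
          unfolding fv_subst[OF cl2] by auto
      qed auto
      finally have "reds S (App (subst ?\<sigma>1 (Lam (PVar y) B)) ?W) Empty"
        by (simp only: subst.simps(8))
      then show "beta_eq S (App (subst ?\<sigma>1 (Lam (PVar y) B)) ?W) T"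
        unfolding T by (rule reds_beta_eq)
    qed
    then show "evals S (subst ?\<sigma>1 (dual_tm Unit (Lam (PVar y) B))) Unit \<theta> (\<lambda>\<rho> T. T = Empty)"
      unfolding evals_def subst_dual_tm subst.simps(7)
      by (intro conjI exI[of _ "subst ?\<sigma>1 (Lam (PVar y) B)"] reds_refl) (simp only: fv.simps)
  qed
qed

lemma distinct_concat_map:
  "distinct \<theta> \<Longrightarrow> (\<And>w. w \<in> set \<theta> \<Longrightarrow> distinct (h w)) \<Longrightarrow>
     (\<And>v w. v \<in> set \<theta> \<Longrightarrow> w \<in> set \<theta> \<Longrightarrow> v \<noteq> w \<Longrightarrow> set (h v) \<inter> set (h w) = {}) \<Longrightarrow>
     distinct (concat (map h \<theta>))"
  by (induction \<theta>) fastforce+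

lemma lookup_eq_iff:
  assumes "distinct \<theta>" "distinct us" "length us = length \<theta>" "v \<in> set \<theta>" "w \<in> set \<theta>"
  shows "lookup \<theta> us v = lookup \<theta> us w \<longleftrightarrow> v = w"
  using assms by (auto simp: in_set_conv_nth lookup_nth nth_eq_iff_index_eq)

text \<open>Index ranges separate the names: the two halves of the split pair lie below
  \<open>m\<close>, the tuple variables do not.\<close>

lemma distinct_split_pats:
  assumes "distinct \<theta>" "us = vars_from m As" "length As = length \<theta>" "v1 \<noteq> v2" "vidx v1 < m" "vidx v2 < m"
  shows "distinct (concat (map pvars (map (\<lambda>w. if w = z then PWith (PVar v1) (PVar v2) else PVar (lookup \<theta> us w)) \<theta>)))"
proof -
  define p where "p = (\<lambda>w. if w = z then PWith (PVar v1) (PVar v2) else PVar (lookup \<theta> us w))"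
  have us: "lookup \<theta> us w \<in> set us" if "w \<in> set \<theta>" for w
    by (rule lookup_in) (use that assms in auto)
  have us_ge: "m \<le> vidx (lookup \<theta> us w)" if "w \<in> set \<theta>" for w
    using us[OF that] unfolding assms(2) by (rule vars_from_ge)
  have "distinct (concat (map (\<lambda>w. pvars (p w)) \<theta>))"
  proof (rule distinct_concat_map[OF assms(1)])
    show "distinct (pvars (p w))" for w by (simp add: p_def assms(4))
    have "v1 \<noteq> lookup \<theta> us w" "v2 \<noteq> lookup \<theta> us w" if "w \<in> set \<theta>" for w
      using us_ge[OF that] assms(5,6) by (metis not_less)+
    moreover have "lookup \<theta> us v \<noteq> lookup \<theta> us w" if "v \<in> set \<theta>" "w \<in> set \<theta>" "v \<noteq> w" for v w
      using that assms by (subst lookup_eq_iff) auto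
    ultimately show "pset (p v) \<inter> pset (p w) = {}" if "v \<in> set \<theta>" "w \<in> set \<theta>" "v \<noteq> w" for v w
      using that unfolding p_def by (auto split: if_splits)
  qed
  then show ?thesis by (simp add: comp_def p_def)
qed

text \<open>The pattern for \<open>z\<close> is itself a pair, and \<beta> fires only if the
  component supplied for it is syntactically a \<open>WPair\<close>. The relation therefore requires
  \<open>\<rho> z\<close> to have this form instead of projecting from it.\<close>

lemma denotes_LLetTensorT:
  assumes d: "denotes S \<pi> e P G" and x: "x1 \<in> FVt e" "x2 \<in> FVt e" "x1 \<noteq> x2" and z: "z \<notin> FVt e - {x1, x2}"
  shows "denotes S \<pi> (LLetTensorT x1 x2 z e) P (\<lambda>\<rho> T. \<exists>a b. \<rho> z = WPair a b \<and> G (\<rho>(x1 := a, x2 := b)) T)"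
proof (rule denotesI)
  let ?G = "\<lambda>\<rho> T. \<exists>a b. \<rho> z = WPair a b \<and> G (\<rho>(x1 := a, x2 := b)) T"
  fix \<sigma> :: "var \<Rightarrow> 'a tm option" and \<theta>
  assume cl: "closed_sub \<sigma>" and \<sigma>: "\<And>x. x \<in> FVp (LLetTensorT x1 x2 z e) \<Longrightarrow> \<sigma> (pv x) = Some (\<pi> x)"
    and dist: "distinct \<theta>" and \<theta>: "set \<theta> = FVt (LLetTensorT x1 x2 z e)"
  define \<theta>' where "\<theta>' = filter (\<lambda>w. w \<noteq> z) \<theta>"
  define m where "m = fresh_p (FVp e)"
  define x where "x = Var m (pT (fst (ety e)))"
  define f where "f = Var (m + 1) (Lolli (with_ty (map (tT \<circ> tlty) (x1 # x2 # \<theta>'))) (tT (snd (ety e))))"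
  define v1 where "v1 = Var (m + 2) (tT (tlty x1))"
  define v2 where "v2 = Var (m + 3) (tT (tlty x2))"
  define us where "us = vars_from (m + 4) (map (tT \<circ> tlty) \<theta>)"
  define u where "u = (\<lambda>w. V (lookup \<theta> us w) :: 'a tm)"
  define p where "p = (\<lambda>w. if w = z then PWith (PVar v1) (PVar v2) else PVar (lookup \<theta> us w))"
  define M where "M = App (V f) (with_tm (V v1 # V v2 # map u \<theta>'))"
  have delta: "delta \<theta> (LLetTensorT x1 x2 z e) = let_tm (dual_pat x f) (delta (x1 # x2 # \<theta>') e)
     (dual_tm (V x) (Lam (with_pat (m + 4) (map p \<theta>)) M))"
    by (simp only: delta.simps Let_def split_beta \<theta>'_def m_def f_def x_def us_def u_def v1_def v2_def
        p_def M_def)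
  have s: "set (x1 # x2 # \<theta>') = FVt e" and d': "distinct (x1 # x2 # \<theta>')"
    using \<theta> x z dist by (auto simp: \<theta>'_def)
  have z\<theta>: "z \<in> set \<theta>" using \<theta> by simp
  have us: "lookup \<theta> us w \<in> set us" if "w \<in> set \<theta>" for w
    by (rule lookup_in) (use that in \<open>auto simp: us_def\<close>)
  have us_ge: "m + 4 \<le> vidx (lookup \<theta> us w)" if "w \<in> set \<theta>" for w
    using us[OF that] unfolding us_def by (rule vars_from_ge)
  show "evals S (subst \<sigma> (delta \<theta> (LLetTensorT x1 x2 z e))) P \<theta> ?G"
    unfolding delta
  proof (rule evals_let_dual[OF cl])
    show "x \<noteq> f" by (simp add: x_def f_def)
    show "evals S (subst \<sigma> (delta (x1 # x2 # \<theta>') e)) P (x1 # x2 # \<theta>') G"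
      by (rule denotesD[OF d cl _ d' s]) (simp add: \<sigma>)
    fix L assume L: "linear_map S (x1 # x2 # \<theta>') L G" and P: "fv P = {}"
      and cl1: "closed_sub (\<sigma>(f \<mapsto> L, x \<mapsto> P))"
    let ?\<sigma>1 = "\<sigma>(f \<mapsto> L, x \<mapsto> P)"
    let ?K = "Lam (with_pat (m + 4) (map p \<theta>)) M"
    have "linear_map S \<theta> (subst ?\<sigma>1 ?K) ?G"
      unfolding linear_map_def
    proof (intro conjI allI impI)
      have "fv ?K \<subseteq> {f}"
      proof -
        have "\<theta> \<noteq> []" using z\<theta> by auto
        then have "pset (with_pat (m + 4) (map p \<theta>)) = (\<Union>w\<in>set \<theta>. pset (p w))"
          by (simp add: pvars_with_pat)
        moreover have "fv M \<subseteq> {f} \<union> (\<Union>w\<in>set \<theta>. pset (p w))"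
          using z\<theta> by (auto simp: M_def u_def p_def \<theta>'_def)
        ultimately show ?thesis by auto
      qed
      then show "fv (subst ?\<sigma>1 ?K) = {}"
        unfolding fv_subst[OF cl1] by auto
      fix \<rho> :: "tvar \<Rightarrow> 'a tm" and T :: "'a tm"
      assume \<rho>: "\<forall>w\<in>set \<theta>. fv (\<rho> w) = {}" and G: "?G \<rho> T"
      from G obtain a b where ab: "\<rho> z = WPair a b" "G (\<rho>(x1 := a, x2 := b)) T" by blast
      have fab: "fv a = {}" "fv b = {}" using \<rho> z\<theta> ab(1) by force+
      \<comment> \<open>The halves of the pair have indices \<open>m + 2\<close> and
        \<open>m + 3\<close>, and the tuple variables start at \<open>m + 4\<close>; names up to
        \<open>f\<close>, with index \<open>m + 1\<close>, survive.\<close>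
      obtain \<tau> where \<tau>: "reds S (App (subst ?\<sigma>1 ?K) (with_tm (map \<rho> \<theta>))) (subst \<tau> M)"
          "closed_sub \<tau>"
          "\<And>q N v K. (q, N) \<in> set (zip (map p \<theta>) (map \<rho> \<theta>)) \<Longrightarrow> (v, K) \<in> set (bind q N) \<Longrightarrow> \<tau> v = Some K"
          "\<And>v. vidx v < m + 2 \<Longrightarrow> \<tau> v = ?\<sigma>1 v"
      proof (rule apply_with_pat[OF cl1, where M = M and m = "m + 4" and n = "m + 2"])
        show "list_all2 value_for (map p \<theta>) (map \<rho> \<theta>)"
          using ab(1) by (auto simp: list_all2_conv_all_nth p_def)
        show "\<forall>N\<in>set (map \<rho> \<theta>). fv N = {}" using \<rho> by simp
        show "distinct (concat (map pvars (map p \<theta>)))"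
          unfolding p_def by (rule distinct_split_pats[OF dist us_def]) (simp_all add: v1_def v2_def)
        show "\<forall>q\<in>set (map p \<theta>). \<forall>v\<in>pset q. m + 2 \<le> vidx v"
          using us_ge by (fastforce simp: p_def v1_def v2_def)
        show "m + 2 \<le> m + 4" by simp
      qed blast
      have mem: "(p w, \<rho> w) \<in> set (zip (map p \<theta>) (map \<rho> \<theta>))" if w: "w \<in> set \<theta>" for w
      proof -
        obtain i where "i < length \<theta>" "w = \<theta> ! i" using w by (metis in_set_conv_nth)
        then show ?thesis by (auto simp: set_zip intro!: exI[of _ i])
      qed
      have \<tau>12: "\<tau> v1 = Some a" "\<tau> v2 = Some b"
        using \<tau>(3)[OF mem[OF z\<theta>], of v1 a] \<tau>(3)[OF mem[OF z\<theta>], of v2 b] ab(1)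
        by (simp_all add: p_def)
      have \<tau>w: "\<tau> (lookup \<theta> us w) = Some (\<rho> w)" if "w \<in> set \<theta>'" for w
        using \<tau>(3)[OF mem[of w], of "lookup \<theta> us w" "\<rho> w"] that by (simp add: p_def \<theta>'_def)
      have \<tau>f: "\<tau> f = Some L" using \<tau>(4)[of f] by (simp add: f_def x_def)
      let ?\<rho>' = "\<rho>(x1 := a, x2 := b)"
      have "map (subst \<tau>) (map u \<theta>') = map ?\<rho>' \<theta>'" using \<tau>w d' by (auto simp: u_def)
      then have "map (subst \<tau>) (V v1 # V v2 # map u \<theta>') = map ?\<rho>' (x1 # x2 # \<theta>')"
        using \<tau>12 x(3) by (simp only: list.map subst.simps) simp
      then have M: "subst \<tau> M = App L (with_tm (map ?\<rho>' (x1 # x2 # \<theta>')))"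
        using \<tau>f by (simp only: M_def subst.simps subst_with_tm) simp
      have T: "fv T = {} \<and> beta_eq S (subst \<tau> M) T"
        unfolding M by (rule linear_mapD[OF L, where \<rho> = ?\<rho>' and T = T, OF _ ab(2)])
          (use \<rho> fab in \<open>auto simp: \<theta>'_def\<close>)
      show "fv T = {}" by (rule conjunct1[OF T])
      show "beta_eq S (App (subst ?\<sigma>1 ?K) (with_tm (map \<rho> \<theta>))) T"
        by (rule beta_eq_trans[OF reds_beta_eq[OF \<tau>(1)] conjunct2[OF T]])
    qed
    moreover have x: "subst ?\<sigma>1 (V x) = P" by simp
    ultimately show "evals S (subst ?\<sigma>1 (dual_tm (V x) ?K)) P \<theta> ?G"
      unfolding evals_def subst_dual_tm x using P
      by (intro conjI exI[of _ "subst ?\<sigma>1 ?K"] reds_refl)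
  qed
qed

section \<open>Syntactic sugar of Linear A\<close>

lemma fresh_t_notin: "finite Y \<Longrightarrow> fresh_t Y \<le> k \<Longrightarrow> TV k \<tau> \<notin> Y"
  using fresh_t_gt[of Y "TV k \<tau>"] by auto

lemma fresh_p_notin: "finite X \<Longrightarrow> fresh_p X \<le> k \<Longrightarrow> PV k \<tau> \<notin> X"
  using fresh_p_gt[of X "PV k \<tau>"] by auto

lemma FVp_let_p [simp]: "FVp (let_p x e1 e2) = FVp e1 \<union> (FVp e2 - {x})"
  by (simp add: let_p_def Let_def)

lemma FVt_let_p [simp]: "FVt (let_p x e1 e2) = FVt e1 \<union> FVt e2"
  using fresh_t_notin[of "FVt e2", OF finite_FVt order_refl, of LOne] by (simp add: let_p_def Let_def)

lemma FVp_let_t [simp]: "FVp (let_t y e1 e2) = FVp e1 \<union> FVp e2"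
  using fresh_p_notin[of "FVp e2", OF finite_FVp order_refl, of LOne] by (simp add: let_t_def Let_def)

lemma FVt_let_t [simp]: "FVt (let_t y e1 e2) = FVt e1 \<union> (FVt e2 - {y})"
  by (simp add: let_t_def Let_def)

lemma FVp_pair_exp [simp]: "FVp (pair_exp e1 e2) = FVp e1 \<union> FVp e2"
  using fresh_p_notin[of "FVp e2", OF finite_FVp order_refl, of "fst (ety e1)"]
  by (simp add: pair_exp_def Let_def)

lemma FVt_pair_exp [simp]: "FVt (pair_exp e1 e2) = FVt e1 \<union> FVt e2"
  by (simp add: pair_exp_def Let_def)

lemma FVp_plus_exp [simp]: "FVp (plus_exp e1 e2) = FVp e1 \<union> FVp e2"
  by (simp add: plus_exp_def Let_def)

lemma FVt_plus_exp [simp]: "FVt (plus_exp e1 e2) = FVt e1 \<union> FVt e2"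
  using fresh_t_notin[of "FVt e2", OF finite_FVt order_refl, of "snd (ety e1)"]
  by (auto simp: plus_exp_def Let_def)

lemma ety_plus_exp [simp]: "ety (plus_exp e1 e2) = (LOne, snd (ety e1))"
  by (simp add: plus_exp_def let_t_def Let_def)

lemma FV_foldl_plus_exp:
  "FVp (foldl plus_exp e es) = FVp e \<union> (\<Union>e\<in>set es. FVp e)"
  "FVt (foldl plus_exp e es) = FVt e \<union> (\<Union>e\<in>set es. FVt e)"
  by (induction es arbitrary: e) auto

text \<open>The derivative depends only on the tangents in \<open>FVt e\<close>. Closing
  \<open>G\<close> under changes elsewhere strengthens the claim; this is what allows a fresh name
  to be overwritten.\<close>

lemma denotes_agree:
  assumes "denotes S \<pi> e P G"
  shows "denotes S \<pi> e P (\<lambda>\<rho> T. \<exists>\<rho>'. (\<forall>w\<in>FVt e. \<rho>' w = \<rho> w) \<and> G \<rho>' T)"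
  by (rule denotes_mono[OF assms]) (use beta_eq_refl in blast)

lemma denotes_imp:
  assumes "denotes S \<pi> e P G" "\<And>\<rho> T. G' \<rho> T \<Longrightarrow> G \<rho> T"
  shows "denotes S \<pi> e P G'"
  by (rule denotes_mono[OF assms(1)]) (use assms(2) beta_eq_refl in blast)

text \<open>The sugar binds the tangent result to a fresh variable of unit type and discards it. Of
  the derivative of \<open>e1\<close> only its definedness remains in the relation.\<close>

lemma denotes_let_p:
  assumes d1: "denotes S \<pi> e1 P\<^sub>1 G\<^sub>1" and d2: "denotes S (\<pi>(x := P\<^sub>1)) e2 P\<^sub>2 G\<^sub>2"
  shows "denotes S \<pi> (let_p x e1 e2) P\<^sub>2 (\<lambda>\<rho> T. (\<exists>T\<^sub>1. G\<^sub>1 \<rho> T\<^sub>1) \<and> G\<^sub>2 \<rho> T)"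
proof -
  let ?y = "TV (fresh_t (FVt e2)) LOne"
  have y: "?y \<notin> FVt e2" by (rule fresh_t_notin) auto
  have "denotes S \<pi> (LLet x ?y e1 (LLetUnitT ?y e2)) P\<^sub>2 (\<lambda>\<rho> T. \<exists>T\<^sub>1. G\<^sub>1 \<rho> T\<^sub>1 \<and>
      (\<exists>\<rho>'. (\<forall>w\<in>FVt e2. \<rho>' w = (\<rho>(?y := T\<^sub>1)) w) \<and> G\<^sub>2 \<rho>' T))"
    by (rule denotes_LLet[OF d1 denotes_LLetUnitT[OF y denotes_agree[OF d2]]]) simp
  then have "denotes S \<pi> (let_p x e1 e2) P\<^sub>2 (\<lambda>\<rho> T. \<exists>T\<^sub>1. G\<^sub>1 \<rho> T\<^sub>1 \<and>
      (\<exists>\<rho>'. (\<forall>w\<in>FVt e2. \<rho>' w = (\<rho>(?y := T\<^sub>1)) w) \<and> G\<^sub>2 \<rho>' T))"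
    by (simp only: let_p_def Let_def)
  then show ?thesis
  proof (rule denotes_imp)
    fix \<rho> T assume *: "(\<exists>T\<^sub>1. G\<^sub>1 \<rho> T\<^sub>1) \<and> G\<^sub>2 \<rho> T"
    have "\<forall>w\<in>FVt e2. \<rho> w = (\<rho>(?y := T\<^sub>1)) w" for T\<^sub>1 using y by auto
    with * show "\<exists>T\<^sub>1. G\<^sub>1 \<rho> T\<^sub>1 \<and> (\<exists>\<rho>'. (\<forall>w\<in>FVt e2. \<rho>' w = (\<rho>(?y := T\<^sub>1)) w) \<and> G\<^sub>2 \<rho>' T)" by blast
  qed
qed

text \<open>The primal result of \<open>e1\<close> is consumed by an elimination of the unit, hence
  has to be literally \<open>Unit\<close>.\<close>

lemma denotes_let_t:
  assumes d1: "denotes S \<pi> e1 Unit G\<^sub>1" and d2: "denotes S \<pi> e2 P G\<^sub>2" and y: "y \<in> FVt e2"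
  shows "denotes S \<pi> (let_t y e1 e2) P (\<lambda>\<rho> T. \<exists>T\<^sub>1. G\<^sub>1 \<rho> T\<^sub>1 \<and> G\<^sub>2 (\<rho>(y := T\<^sub>1)) T)"
proof -
  let ?x = "PV (fresh_p (FVp e2)) LOne"
  have x: "?x \<notin> FVp e2" by (rule fresh_p_notin) auto
  have "denotes S (\<pi>(?x := Unit)) (LLetUnitP ?x e2) P G\<^sub>2"
    by (rule denotes_LLetUnitP[OF _ denotes_cong[OF d2]]) (use x in auto)
  then have "denotes S \<pi> (LLet ?x y e1 (LLetUnitP ?x e2)) P (\<lambda>\<rho> T. \<exists>T\<^sub>1. G\<^sub>1 \<rho> T\<^sub>1 \<and> G\<^sub>2 (\<rho>(y := T\<^sub>1)) T)"
    by (rule denotes_LLet[OF d1]) (use y in simp)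
  then show ?thesis by (simp only: let_t_def Let_def)
qed

lemma denotes_pair_exp:
  assumes d1: "denotes S \<pi> e1 P G\<^sub>1" and d2: "denotes S \<pi> e2 Unit G\<^sub>2"
  shows "denotes S \<pi> (pair_exp e1 e2) P (\<lambda>\<rho> T. (\<exists>T\<^sub>1. G\<^sub>1 \<rho> T\<^sub>1) \<and> G\<^sub>2 \<rho> T)"
proof -
  let ?x = "PV (fresh_p (FVp e2)) (fst (ety e1))" and ?y = "TV 0 (snd (ety e2))"
  have x: "?x \<notin> FVp e2" by (rule fresh_p_notin) auto
  have "denotes S (\<pi>(?x := P)) e2 Unit G\<^sub>2" by (rule denotes_cong[OF d2]) (use x in auto)
  from denotes_let_t[OF this denotes_LPair[of S "\<pi>(?x := P)" ?x ?y], of ?y]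
  have "denotes S (\<pi>(?x := P)) (let_t ?y e2 (LPair ?x ?y)) P G\<^sub>2" by simp
  from denotes_let_p[OF d1 this] show ?thesis by (simp only: pair_exp_def Let_def)
qed

text \<open>The first summand is already bound while the second is evaluated, so its name must be
  fresh for \<open>e2\<close>; the second name only has to differ from the first.\<close>

lemma denotes_plus_exp:
  assumes d1: "denotes S \<pi> e1 Unit G\<^sub>1" and d2: "denotes S \<pi> e2 Unit G\<^sub>2" and t: "snd (ety e1) = LReal"
  shows "denotes S \<pi> (plus_exp e1 e2) Unit
     (\<lambda>\<rho> T. \<exists>T\<^sub>1 T\<^sub>2. G\<^sub>1 \<rho> T\<^sub>1 \<and> G\<^sub>2 \<rho> T\<^sub>2 \<and> T = App Plus (WPair T\<^sub>1 T\<^sub>2))"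
proof -
  let ?m = "fresh_t (FVt e2)"
  let ?x = "TV ?m (snd (ety e1))" and ?y = "TV (Suc ?m) (snd (ety e2))"
  have x: "?x \<notin> FVt e2" by (rule fresh_t_notin) auto
  have "denotes S \<pi> (let_t ?x e1 (let_t ?y e2 (LPlus ?x ?y))) Unit
     (\<lambda>\<rho> T. \<exists>T\<^sub>1. G\<^sub>1 \<rho> T\<^sub>1 \<and> (\<exists>T\<^sub>2. (\<exists>\<rho>'. (\<forall>w\<in>FVt e2. \<rho>' w = (\<rho>(?x := T\<^sub>1)) w) \<and> G\<^sub>2 \<rho>' T\<^sub>2) \<and>
        T = App Plus (WPair ((\<rho>(?x := T\<^sub>1, ?y := T\<^sub>2)) ?x) ((\<rho>(?x := T\<^sub>1, ?y := T\<^sub>2)) ?y))))"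
    by (intro denotes_let_t d1 denotes_agree[OF d2] denotes_LPlus) (auto simp: t)
  then show ?thesis
    unfolding plus_exp_def Let_def
  proof (rule denotes_imp)
    fix \<rho> T
    assume "\<exists>T\<^sub>1 T\<^sub>2. G\<^sub>1 \<rho> T\<^sub>1 \<and> G\<^sub>2 \<rho> T\<^sub>2 \<and> T = App Plus (WPair T\<^sub>1 T\<^sub>2)"
    then obtain T\<^sub>1 T\<^sub>2 where T: "G\<^sub>1 \<rho> T\<^sub>1" "G\<^sub>2 \<rho> T\<^sub>2" "T = App Plus (WPair T\<^sub>1 T\<^sub>2)" by blast
    have "\<forall>w\<in>FVt e2. \<rho> w = (\<rho>(?x := T\<^sub>1)) w" using x by auto
    moreover have "T = App Plus (WPair ((\<rho>(?x := T\<^sub>1, ?y := T\<^sub>2)) ?x) ((\<rho>(?x := T\<^sub>1, ?y := T\<^sub>2)) ?y))"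
      using T(3) by simp
    ultimately show "\<exists>T\<^sub>1. G\<^sub>1 \<rho> T\<^sub>1 \<and> (\<exists>T\<^sub>2. (\<exists>\<rho>'. (\<forall>w\<in>FVt e2. \<rho>' w = (\<rho>(?x := T\<^sub>1)) w) \<and> G\<^sub>2 \<rho>' T\<^sub>2) \<and>
        T = App Plus (WPair ((\<rho>(?x := T\<^sub>1, ?y := T\<^sub>2)) ?x) ((\<rho>(?x := T\<^sub>1, ?y := T\<^sub>2)) ?y)))"
      using T(1,2) by blast
  qed
qed

text \<open>\<open>sum_exp\<close> and \<open>sum_tm\<close> both associate to the left, so the
  derivative comes out as literally the sum that occurs in the forward transformation.\<close>

lemma denotes_foldl_plus_exp:
  "denotes S \<pi> e Unit (\<lambda>\<rho> T. T = t \<rho>) \<Longrightarrow> snd (ety e) = LReal \<Longrightarrow>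
   (\<And>i. i \<in> set is \<Longrightarrow> denotes S \<pi> (h i) Unit (\<lambda>\<rho> T. T = u i \<rho>)) \<Longrightarrow>
   denotes S \<pi> (foldl plus_exp e (map h is)) Unit
     (\<lambda>\<rho> T. T = foldl (\<lambda>M N. App Plus (WPair M N)) (t \<rho>) (map (\<lambda>i. u i \<rho>) is))"
proof (induction "is" arbitrary: e t)
  case (Cons i "is")
  have "denotes S \<pi> (plus_exp e (h i)) Unit (\<lambda>\<rho> T. T = App Plus (WPair (t \<rho>) (u i \<rho>)))"
    using denotes_plus_exp[OF Cons.prems(1) Cons.prems(3)[of i] Cons.prems(2)] by simp
  from Cons.IH[OF this] show ?case using Cons.prems by simp
qed simp

lemma denotes_sum_exp:
  assumes "is \<noteq> []" "\<And>i. i \<in> set is \<Longrightarrow> denotes S \<pi> (h i) Unit (\<lambda>\<rho> T. T = u i \<rho>)"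
    and "\<And>i. i \<in> set is \<Longrightarrow> snd (ety (h i)) = LReal"
  shows "denotes S \<pi> (sum_exp (map h is)) Unit (\<lambda>\<rho> T. T = sum_tm (map (\<lambda>i. u i \<rho>) is))"
proof -
  obtain i js where "is": "is = i # js" using assms(1) by (cases "is") auto
  have "denotes S \<pi> (foldl plus_exp (h i) (map h js)) Unit
     (\<lambda>\<rho> T. T = foldl (\<lambda>M N. App Plus (WPair M N)) (u i \<rho>) (map (\<lambda>i. u i \<rho>) js))"
    by (rule denotes_foldl_plus_exp) (use assms "is" in auto)
  then show ?thesis by (simp add: "is")
qed

text \<open>\<open>X\<close> collects the variables whose values must persist. Each bound
  \<open>w i\<close> joins it on the way in, so that the innermost body sees all bound values at
  once.\<close>

lemma denotes_foldr_let_p: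
  "(\<And>i \<pi>'. i \<in> set is \<Longrightarrow> \<forall>x\<in>X. \<pi>' x = \<pi> x \<Longrightarrow> denotes S \<pi>' (h i) (Q i) (\<lambda>\<rho> T. T = Empty)) \<Longrightarrow>
   (\<And>\<pi>'. \<forall>x\<in>X. \<pi>' x = \<pi> x \<Longrightarrow> \<forall>i\<in>set is. \<pi>' (w i) = Q i \<Longrightarrow> denotes S \<pi>' e P G) \<Longrightarrow>
   distinct (map w is) \<Longrightarrow> w ` set is \<inter> X = {} \<Longrightarrow>
   denotes S \<pi> (foldr (\<lambda>i. let_p (w i) (h i)) is e) P G"
proof (induction "is" arbitrary: \<pi> X)
  case Nil
  then show ?case by simp
next
  case (Cons i "is")
  have d2: "denotes S (\<pi>(w i := Q i)) (foldr (\<lambda>i. let_p (w i) (h i)) is e) P G"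
  proof (rule Cons.IH[where X = "insert (w i) X"])
    show "denotes S \<pi>' (h j) (Q j) (\<lambda>\<rho> T. T = Empty)"
      if "j \<in> set is" "\<forall>x\<in>insert (w i) X. \<pi>' x = (\<pi>(w i := Q i)) x" for j \<pi>'
      by (rule Cons.prems(1)) (use that Cons.prems(4) in auto)
    show "denotes S \<pi>' e P G"
      if "\<forall>x\<in>insert (w i) X. \<pi>' x = (\<pi>(w i := Q i)) x" "\<forall>j\<in>set is. \<pi>' (w j) = Q j" for \<pi>'
      by (rule Cons.prems(2)) (use that Cons.prems(4) in auto)
  qed (use Cons.prems in auto)
  have d1: "denotes S \<pi> (h i) (Q i) (\<lambda>\<rho> T. T = Empty)" by (rule Cons.prems(1)) simp_all
  from denotes_let_p[OF d1 d2] show ?case by simp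
qed

section \<open>Blocks of duplications of shared tangent variables\<close>

definition dup_src :: "(pvar \<times> tvar \<times> tvar \<times> tvar) list \<Rightarrow> pvar set" where
  "dup_src r = (\<lambda>(z, a, w, v). z) ` set r"

definition dup_tmp :: "(pvar \<times> tvar \<times> tvar \<times> tvar) list \<Rightarrow> tvar set" where
  "dup_tmp r = (\<lambda>(z, a, w, v). a) ` set r"

definition dup_dst :: "(pvar \<times> tvar \<times> tvar \<times> tvar) list \<Rightarrow> tvar set" where
  "dup_dst r = (\<Union>(z, a, w, v)\<in>set r. {w, v})"

lemma dup_simps [simp]:
  "dup_src [] = {}" "dup_tmp [] = {}" "dup_dst [] = {}"
  "dup_src ((z, a, w, v) # r) = insert z (dup_src r)"
  "dup_tmp ((z, a, w, v) # r) = insert a (dup_tmp r)"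
  "dup_dst ((z, a, w, v) # r) = {w, v} \<union> dup_dst r"
  by (auto simp: dup_src_def dup_tmp_def dup_dst_def)

text \<open>The naming conditions for a block in front of a body with free tangents
  \<open>Y\<close>: both copies are consumed by the body, the intermediate pair is not free there,
  no copy is bound twice, and no new name shadows a source treated later.\<close>

fun dup_ok :: "(pvar \<Rightarrow> tvar) \<Rightarrow> (pvar \<times> tvar \<times> tvar \<times> tvar) list \<Rightarrow> tvar set \<Rightarrow> bool" where
  "dup_ok \<phi> [] Y \<longleftrightarrow> True"
| "dup_ok \<phi> ((z, a, w, v) # r) Y \<longleftrightarrow> w \<noteq> v \<and> w \<in> Y \<and> v \<in> Y \<and> a \<notin> Y \<and>
     {w, v} \<inter> dup_dst r = {} \<and> {a, w, v} \<inter> \<phi> ` dup_src r = {} \<and> dup_ok \<phi> r Y"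

lemma FVp_let_dups [simp]: "FVp (let_dups \<phi> r e) = FVp e"
  by (induction \<phi> r e rule: let_dups.induct) auto

lemma FVt_let_dups:
  "dup_ok \<phi> r (FVt e) \<Longrightarrow> FVt (let_dups \<phi> r e) = \<phi> ` dup_src r \<union> (FVt e - dup_dst r)"
  by (induction \<phi> r e rule: let_dups.induct) auto

text \<open>A duplication yields a literal pair, which is what the subsequent unpacking requires.
  Sources treated later keep their values by the shadowing condition in
  \<open>dup_ok\<close>.\<close>

lemma denotes_let_dups:
  assumes d: "denotes S \<pi> e P G"
  shows "dup_ok \<phi> r (FVt e) \<Longrightarrow> denotes S \<pi> (let_dups \<phi> r e) P
     (\<lambda>\<rho> T. \<exists>\<rho>'. (\<forall>(z, a, w, v)\<in>set r. \<rho>' w = \<rho> (\<phi> z) \<and> \<rho>' v = \<rho> (\<phi> z)) \<and>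
        (\<forall>y\<in>FVt e - dup_dst r. \<rho>' y = \<rho> y) \<and> G \<rho>' T)"
proof (induction r)
  case Nil
  then show ?case using denotes_agree[OF d] by simp
next
  case (Cons q r)
  obtain z a w v where q: "q = (z, a, w, v)" by (cases q)
  let ?R = "let_dups \<phi> r e"
  let ?G = "\<lambda>\<rho> T. \<exists>\<rho>'. (\<forall>(z, a, w, v)\<in>set r. \<rho>' w = \<rho> (\<phi> z) \<and> \<rho>' v = \<rho> (\<phi> z)) \<and>
        (\<forall>y\<in>FVt e - dup_dst r. \<rho>' y = \<rho> y) \<and> G \<rho>' T"
  have ok: "dup_ok \<phi> r (FVt e)" "w \<noteq> v" "w \<in> FVt e" "v \<in> FVt e" "a \<notin> FVt e" "{w, v} \<inter> dup_dst r = {}"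
      "{a, w, v} \<inter> \<phi> ` dup_src r = {}"
    using Cons.prems by (auto simp: q)
  have R: "FVt ?R = \<phi> ` dup_src r \<union> (FVt e - dup_dst r)" by (rule FVt_let_dups[OF ok(1)])
  have "denotes S \<pi> (LLetTensorT w v a ?R) P
      (\<lambda>\<rho> T. \<exists>b c. \<rho> a = WPair b c \<and> ?G (\<rho>(w := b, v := c)) T)"
    by (rule denotes_LLetTensorT[OF Cons.IH[OF ok(1)]]) (use R ok in auto)
  from denotes_let_t[OF denotes_LDup[of S \<pi> "\<phi> z"] this, of a]
  have "denotes S \<pi> (let_t a (LDup (\<phi> z)) (LLetTensorT w v a ?R)) P
      (\<lambda>\<rho> T. \<exists>T\<^sub>1. T\<^sub>1 = WPair (\<rho> (\<phi> z)) (\<rho> (\<phi> z)) \<and>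
        (\<exists>b c. (\<rho>(a := T\<^sub>1)) a = WPair b c \<and> ?G (\<rho>(a := T\<^sub>1, w := b, v := c)) T))"
    by simp
  then show ?case unfolding q let_dups.simps
  proof (rule denotes_imp, elim exE conjE)
    fix \<rho> T \<rho>'
    assume 1: "\<forall>(z, a, w, v)\<in>set ((z, a, w, v) # r). \<rho>' w = \<rho> (\<phi> z) \<and> \<rho>' v = \<rho> (\<phi> z)"
      and 2: "\<forall>y\<in>FVt e - dup_dst ((z, a, w, v) # r). \<rho>' y = \<rho> y" and G: "G \<rho>' T"
    let ?u = "\<rho> (\<phi> z)"
    \<comment> \<open>The assignment in force after the first duplication has been unpacked.\<close>
    let ?\<rho>1 = "\<rho>(a := WPair ?u ?u, w := ?u, v := ?u)"
    have "\<forall>(z, a, w, v)\<in>set r. \<rho>' w = ?\<rho>1 (\<phi> z) \<and> \<rho>' v = ?\<rho>1 (\<phi> z)"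
    proof (intro ballI, clarify)
      fix z' a' w' v' assume m: "(z', a', w', v') \<in> set r"
      then have "\<phi> z' \<in> \<phi> ` dup_src r" by (force simp: dup_src_def)
      then have "?\<rho>1 (\<phi> z') = \<rho> (\<phi> z')" using ok(7) by auto
      then show "\<rho>' w' = ?\<rho>1 (\<phi> z') \<and> \<rho>' v' = ?\<rho>1 (\<phi> z')" using 1 m by auto
    qed
    moreover have "\<forall>y\<in>FVt e - dup_dst r. \<rho>' y = ?\<rho>1 y" using 1 2 ok(5) by auto
    ultimately have "?G ?\<rho>1 T" using G by blast
    moreover have "(\<rho>(a := WPair ?u ?u)) a = WPair ?u ?u" by simp
    ultimately show "\<exists>T\<^sub>1. T\<^sub>1 = WPair ?u ?u \<and>
        (\<exists>b c. (\<rho>(a := T\<^sub>1)) a = WPair b c \<and> ?G (\<rho>(a := T\<^sub>1, w := b, v := c)) T)" by blast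
  qed
qed

section \<open>Values of purely primal expressions\<close>

text \<open>Typing directly on \<open>pexp\<close>: the sugar hides auxiliary variables and tangent
  contexts that would burden every induction on \<open>ltyping\<close>. The context is exactly the
  set of free variables.\<close>

inductive btyping :: "'f signat \<Rightarrow> pvar set \<Rightarrow> 'f pexp \<Rightarrow> lty \<Rightarrow> bool" for S where
  bt_Var: "btyping S {x} (BVar x) (plty x)"
| bt_Let: "btyping S \<Gamma>\<^sub>1 e\<^sub>1 (plty x) \<Longrightarrow> btyping S (insert x \<Gamma>\<^sub>2) e\<^sub>2 \<tau> \<Longrightarrow> x \<notin> \<Gamma>\<^sub>2 \<Longrightarrow>
     btyping S (\<Gamma>\<^sub>1 \<union> \<Gamma>\<^sub>2) (BLet x e\<^sub>1 e\<^sub>2) \<tau>"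
| bt_Num: "btyping S {} (BNum r) LReal"
| bt_Fn: "length xs = arity S f \<Longrightarrow> distinct xs \<Longrightarrow> \<forall>x\<in>set xs. plty x = LReal \<Longrightarrow>
     btyping S (set xs) (BFn f xs) LReal"
| bt_Drop: "btyping S \<Gamma> e \<tau> \<Longrightarrow> btyping S \<Gamma> (BDrop e) LOne"
| bt_Unit: "btyping S {} BUnit LOne"
| bt_LetUnit: "btyping S \<Gamma> e \<tau> \<Longrightarrow> plty z = LOne \<Longrightarrow> z \<notin> \<Gamma> \<Longrightarrow>
     btyping S (insert z \<Gamma>) (BLetUnit z e) \<tau>"

inductive_cases ltyping_LLetE: "ltyping S \<Gamma> \<Delta> (LLet x y e1 e2) \<tau> \<sigma>"
inductive_cases ltyping_LLetUnitPE: "ltyping S \<Gamma> \<Delta> (LLetUnitP z e) \<tau> \<sigma>"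
inductive_cases ltyping_LLetUnitTE: "ltyping S \<Gamma> \<Delta> (LLetUnitT z e) \<tau> \<sigma>"
inductive_cases ltyping_LPairE: "ltyping S \<Gamma> \<Delta> (LPair x y) \<tau> \<sigma>"
inductive_cases ltyping_LUnitTE: "ltyping S \<Gamma> \<Delta> LUnitT \<tau> \<sigma>"
inductive_cases ltyping_LUnitPE: "ltyping S \<Gamma> \<Delta> LUnitP \<tau> \<sigma>"
inductive_cases ltyping_LNumE: "ltyping S \<Gamma> \<Delta> (LNum r) \<tau> \<sigma>"
inductive_cases ltyping_LFnE: "ltyping S \<Gamma> \<Delta> (LFn f xs) \<tau> \<sigma>"
inductive_cases ltyping_LDropE: "ltyping S \<Gamma> \<Delta> (LDrop e) \<tau> \<sigma>"

text \<open>By inversion through the sugar: its auxiliary variables are peeled off the contexts,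
  which leaves the primal context of the expression.\<close>

lemma ltyping_desugar: "ltyping S \<Gamma> \<Delta> (desugar e) \<tau> \<sigma> \<Longrightarrow> btyping S \<Gamma> e \<tau>"
proof (induction e arbitrary: \<Gamma> \<Delta> \<tau> \<sigma>)
  case (BVar x)
  let ?y = "TV 0 LOne" and ?z = "PV (fresh_p {x}) LOne"
  from BVar have "ltyping S \<Gamma> \<Delta> (LLet ?z ?y LUnitT (LLetUnitP ?z (LPair x ?y))) \<tau> \<sigma>"
    by (simp only: desugar.simps exp_p_def let_t_def Let_def FVp.simps)
  then obtain \<Gamma>1 \<Gamma>2 \<Delta>1 \<Delta>2 where 1: "\<Gamma> = \<Gamma>1 \<union> \<Gamma>2" "?z \<notin> \<Gamma>2" "ltyping S \<Gamma>1 \<Delta>1 (LUnitT :: 'a lexp) LOne LOne"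
    "ltyping S (insert ?z \<Gamma>2) \<Delta>2 (LLetUnitP ?z (LPair x ?y)) \<tau> \<sigma>"
    by (elim ltyping_LLetE) auto
  from 1(3) have "\<Gamma>1 = {}" by (auto elim: ltyping_LUnitTE)
  moreover from 1(4) obtain \<Gamma>' where \<Gamma>': "insert ?z \<Gamma>2 = insert ?z \<Gamma>'" "?z \<notin> \<Gamma>'"
    "ltyping S \<Gamma>' \<Delta>2 (LPair x ?y :: 'a lexp) \<tau> \<sigma>"
    by (elim ltyping_LLetUnitPE) blast
  \<comment> \<open>Neither context contains the auxiliary variable, so it may be cancelled.\<close>
  have "\<Gamma>2 = \<Gamma>'" using \<Gamma>'(1,2) 1(2) by (metis insert_ident)
  moreover note \<Gamma>'(3)
  ultimately have "\<Gamma> = {x}" "\<tau> = plty x" using 1(1,2) by (auto elim!: ltyping_LPairE)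
  then show ?case by (auto intro: bt_Var)
next
  case (BLet x e1 e2)
  let ?y = "TV (fresh_t (FVt (desugar e2))) LOne"
  from BLet.prems have "ltyping S \<Gamma> \<Delta> (LLet x ?y (desugar e1) (LLetUnitT ?y (desugar e2))) \<tau> \<sigma>"
    by (simp only: desugar.simps let_p_def Let_def)
  then obtain \<Gamma>1 \<Gamma>2 \<Delta>1 \<Delta>2 where 1: "\<Gamma> = \<Gamma>1 \<union> \<Gamma>2" "x \<notin> \<Gamma>2"
    "ltyping S \<Gamma>1 \<Delta>1 (desugar e1) (plty x) LOne"
    "ltyping S (insert x \<Gamma>2) \<Delta>2 (LLetUnitT ?y (desugar e2)) \<tau> \<sigma>"
    by (elim ltyping_LLetE) auto
  from 1(4) obtain \<Delta>' where "ltyping S (insert x \<Gamma>2) \<Delta>' (desugar e2) \<tau> \<sigma>"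
    by (elim ltyping_LLetUnitTE) blast
  with 1 show ?case unfolding 1(1) by (intro bt_Let BLet.IH)
next
  case (BLetUnit z e)
  then obtain \<Gamma>' where "\<Gamma> = insert z \<Gamma>'" "z \<notin> \<Gamma>'" "plty z = LOne" "ltyping S \<Gamma>' \<Delta> (desugar e) \<tau> \<sigma>"
    by (auto elim: ltyping_LLetUnitPE)
  then show ?case using BLetUnit.IH by (auto intro: bt_LetUnit)
next
  case (BDrop e)
  then obtain \<tau>' \<sigma>' where "ltyping S \<Gamma> \<Delta> (desugar e) \<tau>' \<sigma>'" "\<tau> = LOne"
    by (auto elim: ltyping_LDropE)
  then show ?case using BDrop.IH bt_Drop by blast
qed (auto elim!: ltyping_LNumE ltyping_LFnE ltyping_LUnitPE intro: btyping.intros)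

lemma distinct_FVs [simp]: "distinct (FVs e)"
  by (induction e) auto

lemma btyping_FVs: "btyping S \<Gamma> e \<tau> \<Longrightarrow> set (FVs e) = \<Gamma>"
  by (induction rule: btyping.induct) auto

lemma btyping_finite: "btyping S \<Gamma> e \<tau> \<Longrightarrow> finite \<Gamma>"
  using btyping_FVs[of S \<Gamma> e \<tau>] by (metis finite_set)

lemma FVp_exp_p [simp]: "FVp (exp_p x) = {x}"
  by (simp add: exp_p_def Let_def)

lemma btyping_FVp: "btyping S \<Gamma> e \<tau> \<Longrightarrow> FVp (desugar e) = \<Gamma>"
  by (induction rule: btyping.induct) auto

lemma btyping_ety: "btyping S \<Gamma> e \<tau> \<Longrightarrow> fst (ety (desugar e)) = \<tau>"
  by (induction rule: btyping.induct) (auto simp: exp_p_def let_t_def let_p_def Let_def)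

section \<open>Values, derivatives and canonical points\<close>

fun the_num :: "'f tm \<Rightarrow> real" where
  "the_num (Num r) = r"
| "the_num _ = undefined"

text \<open>
  The value of a purely primal expression, and the value of its derivative along \<open>\<rho>\<close>,
  at a point \<open>\<pi>\<close> where variables of type \<open>\<real>\<close> denote numerals.
\<close>

primrec pval :: "'f signat \<Rightarrow> (pvar \<Rightarrow> 'f tm) \<Rightarrow> 'f pexp \<Rightarrow> 'f tm" where
  "pval S \<pi> (BVar x) = \<pi> x"
| "pval S \<pi> (BLet x e1 e2) = pval S (\<pi>(x := pval S \<pi> e1)) e2"
| "pval S \<pi> (BNum r) = Num r"
| "pval S \<pi> (BFn f xs) = Num (den S f (map (\<lambda>x. the_num (\<pi> x)) xs))"
| "pval S \<pi> (BDrop e) = Unit"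
| "pval S \<pi> BUnit = Unit"
| "pval S \<pi> (BLetUnit z e) = pval S \<pi> e"

primrec tval :: "'f signat \<Rightarrow> (pvar \<Rightarrow> 'f tm) \<Rightarrow> (pvar \<Rightarrow> 'f tm) \<Rightarrow> 'f pexp \<Rightarrow> 'f tm" where
  "tval S \<pi> \<rho> (BVar x) = \<rho> x"
| "tval S \<pi> \<rho> (BLet x e1 e2) = tval S (\<pi>(x := pval S \<pi> e1)) (\<rho>(x := tval S \<pi> \<rho> e1)) e2"
| "tval S \<pi> \<rho> (BNum r) = Num 0"
| "tval S \<pi> \<rho> (BFn f xs) =
     sum_tm (map (\<lambda>i. App (App Times (Num (den S (part S f i) (map (\<lambda>x. the_num (\<pi> x)) xs)))) (\<rho> (xs ! i)))
       [0..<length xs])"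
| "tval S \<pi> \<rho> (BDrop e) = Empty"
| "tval S \<pi> \<rho> BUnit = Empty"
| "tval S \<pi> \<rho> (BLetUnit z e) = tval S \<pi> \<rho> e"

text \<open>Evaluation inspects primal inputs only at the types \<real> and 1: function symbols wait
  for numerals, and eliminations of the unit for \<open>Unit\<close>. Values of tensor type are
  merely passed on.\<close>

definition canonical :: "lty \<Rightarrow> 'f tm \<Rightarrow> bool" where
  "canonical \<tau> P \<longleftrightarrow> (\<tau> = LReal \<longrightarrow> (\<exists>r. P = Num r)) \<and> (\<tau> = LOne \<longrightarrow> P = Unit)"

lemma canonical_pval:
  "btyping S \<Gamma> e \<tau> \<Longrightarrow> \<forall>x\<in>\<Gamma>. canonical (plty x) (\<pi> x) \<Longrightarrow> canonical \<tau> (pval S \<pi> e)"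
proof (induction arbitrary: \<pi> rule: btyping.induct)
  case (bt_Let \<Gamma>\<^sub>1 e\<^sub>1 x \<Gamma>\<^sub>2 e\<^sub>2 \<tau>)
  have "canonical (plty x) (pval S \<pi> e\<^sub>1)" using bt_Let by simp
  then have "\<forall>y\<in>insert x \<Gamma>\<^sub>2. canonical (plty y) ((\<pi>(x := pval S \<pi> e\<^sub>1)) y)" using bt_Let.prems by simp
  from bt_Let.IH(2)[OF this] show ?case by (simp only: pval.simps)
qed (auto simp: canonical_def)

text \<open>Renaming at a let changes the assignment at names outside the context; the derivative
  does not notice.\<close>

lemma tval_cong:
  "btyping S \<Gamma> e \<tau> \<Longrightarrow> \<forall>x\<in>\<Gamma>. \<rho> x = \<rho>' x \<Longrightarrow> tval S \<pi> \<rho> e = tval S \<pi> \<rho>' e"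
proof (induction arbitrary: \<pi> \<rho> \<rho>' rule: btyping.induct)
  case (bt_Let \<Gamma>\<^sub>1 e\<^sub>1 x \<Gamma>\<^sub>2 e\<^sub>2 \<tau>)
  have "tval S \<pi> \<rho> e\<^sub>1 = tval S \<pi> \<rho>' e\<^sub>1" by (rule bt_Let.IH(1)) (simp add: bt_Let.prems)
  moreover have "tval S (\<pi>(x := pval S \<pi> e\<^sub>1)) (\<rho>(x := T)) e\<^sub>2 = tval S (\<pi>(x := pval S \<pi> e\<^sub>1)) (\<rho>'(x := T)) e\<^sub>2" for T
    by (rule bt_Let.IH(2)) (simp add: bt_Let.prems)
  ultimately show ?case by simp
next
  case (bt_Fn xs f)
  then show ?case by (auto intro!: arg_cong[where f = sum_tm])
next
  case (bt_LetUnit \<Gamma> e \<tau> z)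
  have "tval S \<pi> \<rho> e = tval S \<pi> \<rho>' e" by (rule bt_LetUnit.IH) (simp add: bt_LetUnit.prems)
  then show ?case by simp
qed auto

section \<open>Choice of tangent names at a let\<close>

lemma nth_tvars_from [simp]: "i < length ts \<Longrightarrow> tvars_from m ts ! i = TV (m + i) (ts ! i)"
  by (simp add: tvars_from_def)

lemma length_tvars_from [simp]: "length (tvars_from m ts) = length ts"
  by (simp add: tvars_from_def)

lemma rename_by_nth:
  "distinct zs \<Longrightarrow> length ws = length zs \<Longrightarrow> i < length zs \<Longrightarrow> rename_by zs ws \<phi> (zs ! i) = ws ! i"
  by (simp add: rename_by_def map_of_zip_nth)

lemma rename_by_other: "z \<notin> set zs \<Longrightarrow> rename_by zs ws \<phi> z = \<phi> z"
  by (auto simp: rename_by_def split: option.split dest!: map_of_SomeD set_zip_leftD)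

text \<open>Names are separated by index. Given tangents lie below m, intermediate pairs occupy the
  k indices from m on, copies for \<open>e1\<close> the k indices from m + k, copies for
  \<open>e2\<close> the k indices from m + 2k, and the bound tangent \<open>y\<close> sits at m +
  3k.\<close>

lemma fjax_BLet:
  assumes \<Gamma>: "set (FVs e1) = \<Gamma>\<^sub>1" "set (FVs e2) = insert x \<Gamma>\<^sub>2" "x \<notin> \<Gamma>\<^sub>2"
    and inj: "inj_on \<phi> (\<Gamma>\<^sub>1 \<union> \<Gamma>\<^sub>2)" and ty: "\<forall>z\<in>\<Gamma>\<^sub>1 \<union> \<Gamma>\<^sub>2. tlty (\<phi> z) = plty z"
  obtains r y \<phi>\<^sub>1 \<phi>\<^sub>2 where
    "fjax S \<phi> (BLet x e1 e2) = let_dups \<phi> r (LLet x y (fjax S \<phi>\<^sub>1 e1) (fjax S \<phi>\<^sub>2 e2))"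
    and "dup_src r = \<Gamma>\<^sub>1 \<inter> \<Gamma>\<^sub>2" and "distinct (map fst r)"
    and "\<And>z a w v. (z, a, w, v) \<in> set r \<Longrightarrow> w = \<phi>\<^sub>1 z \<and> v = \<phi>\<^sub>2 z \<and> tlty a = LTensor (plty z) (plty z)"
    and "\<And>z. z \<in> \<Gamma>\<^sub>1 - \<Gamma>\<^sub>2 \<Longrightarrow> \<phi>\<^sub>1 z = \<phi> z" and "\<And>z. z \<in> \<Gamma>\<^sub>2 - \<Gamma>\<^sub>1 \<Longrightarrow> \<phi>\<^sub>2 z = \<phi> z" and "\<phi>\<^sub>2 x = y"
    and "inj_on \<phi>\<^sub>1 \<Gamma>\<^sub>1" and "inj_on \<phi>\<^sub>2 (insert x \<Gamma>\<^sub>2)"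
    and "\<forall>z\<in>\<Gamma>\<^sub>1. tlty (\<phi>\<^sub>1 z) = plty z" and "\<forall>z\<in>insert x \<Gamma>\<^sub>2. tlty (\<phi>\<^sub>2 z) = plty z"
    and "\<phi>\<^sub>1 ` \<Gamma>\<^sub>1 \<inter> \<phi>\<^sub>2 ` insert x \<Gamma>\<^sub>2 = {}"
    and "dup_tmp r \<inter> (\<phi> ` (\<Gamma>\<^sub>1 \<union> \<Gamma>\<^sub>2) \<union> \<phi>\<^sub>1 ` \<Gamma>\<^sub>1 \<union> \<phi>\<^sub>2 ` insert x \<Gamma>\<^sub>2) = {}"
    and "\<phi>\<^sub>1 ` (\<Gamma>\<^sub>1 \<inter> \<Gamma>\<^sub>2) \<inter> \<phi> ` (\<Gamma>\<^sub>1 \<union> \<Gamma>\<^sub>2) = {}" and "\<phi>\<^sub>2 ` insert x (\<Gamma>\<^sub>1 \<inter> \<Gamma>\<^sub>2) \<inter> \<phi> ` (\<Gamma>\<^sub>1 \<union> \<Gamma>\<^sub>2) = {}"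
proof -
  define zs where "zs = filter (\<lambda>z. z \<in> set (FVs e2) \<and> z \<noteq> x) (FVs e1)"
  define k where "k = length zs"
  define m where "m = fresh_t (\<phi> ` set (FVs (BLet x e1 e2)))"
  define as where "as = tvars_from m (map (\<lambda>z. LTensor (plty z) (plty z)) zs)"
  define ws where "ws = tvars_from (m + k) (map plty zs)"
  define vs where "vs = tvars_from (m + 2 * k) (map plty zs)"
  define y where "y = TV (m + 3 * k) (plty x)"
  define r where "r = zip zs (zip as (zip ws vs))"
  define \<phi>\<^sub>1 where "\<phi>\<^sub>1 = rename_by zs ws \<phi>"
  define \<phi>\<^sub>2 where "\<phi>\<^sub>2 = (rename_by zs vs \<phi>)(x := y)"
  have len: "length as = k" "length ws = k" "length vs = k" "length zs = k"
    by (simp_all add: as_def ws_def vs_def k_def)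
  have zs: "set zs = \<Gamma>\<^sub>1 \<inter> \<Gamma>\<^sub>2" "distinct zs" "x \<notin> set zs" using \<Gamma> by (auto simp: zs_def)
  have lt: "tidx (\<phi> z) < m" if "z \<in> \<Gamma>\<^sub>1 \<union> \<Gamma>\<^sub>2" for z
    unfolding m_def by (rule fresh_t_gt, simp) (use that \<Gamma> in auto)
  \<comment> \<open>A shared variable is addressed by its position in \<open>zs\<close>, which is
    also the offset of its three fresh names.\<close>
  have "\<exists>i. \<forall>z\<in>\<Gamma>\<^sub>1 \<inter> \<Gamma>\<^sub>2. i z < k \<and> zs ! i z = z"
  proof (rule bchoice)
    show "\<forall>z\<in>\<Gamma>\<^sub>1 \<inter> \<Gamma>\<^sub>2. \<exists>i<k. zs ! i = z" unfolding zs(1)[symmetric] k_def by (metis in_set_conv_nth)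
  qed
  then obtain ix where ix: "\<And>z. z \<in> \<Gamma>\<^sub>1 \<inter> \<Gamma>\<^sub>2 \<Longrightarrow> ix z < k \<and> zs ! ix z = z" by blast
  have ix_nth: "ix (zs ! i) = i" if "i < k" for i
    using that ix[of "zs ! i"] zs len by (metis nth_eq_iff_index_eq nth_mem)
  have \<phi>1: "\<phi>\<^sub>1 z = TV (m + k + ix z) (plty z)" if "z \<in> \<Gamma>\<^sub>1 \<inter> \<Gamma>\<^sub>2" for z
  proof -
    have "\<phi>\<^sub>1 (zs ! ix z) = ws ! ix z"
      unfolding \<phi>\<^sub>1_def by (rule rename_by_nth) (use ix[OF that] zs len in auto)
    then show ?thesis using ix[OF that] len by (simp add: ws_def)
  qed
  have \<phi>2: "\<phi>\<^sub>2 z = TV (m + 2 * k + ix z) (plty z)" if "z \<in> \<Gamma>\<^sub>1 \<inter> \<Gamma>\<^sub>2" for z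
  proof -
    have "rename_by zs vs \<phi> (zs ! ix z) = vs ! ix z"
      by (rule rename_by_nth) (use ix[OF that] zs len in auto)
    moreover have "z \<noteq> x" using that \<Gamma>(3) by auto
    ultimately show ?thesis using ix[OF that] len by (simp add: vs_def \<phi>\<^sub>2_def)
  qed
  have \<phi>1': "\<phi>\<^sub>1 z = \<phi> z" if "z \<in> \<Gamma>\<^sub>1 - \<Gamma>\<^sub>2" for z
    using that zs unfolding \<phi>\<^sub>1_def by (intro rename_by_other) auto
  have \<phi>2': "\<phi>\<^sub>2 z = \<phi> z" if "z \<in> \<Gamma>\<^sub>2 - \<Gamma>\<^sub>1" for z
    using that zs \<Gamma>(3) by (auto simp: \<phi>\<^sub>2_def rename_by_other)
  have \<phi>2x: "\<phi>\<^sub>2 x = y" by (simp add: \<phi>\<^sub>2_def)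
  have r: "z \<in> \<Gamma>\<^sub>1 \<inter> \<Gamma>\<^sub>2 \<and> a = TV (m + ix z) (LTensor (plty z) (plty z)) \<and> w = \<phi>\<^sub>1 z \<and> v = \<phi>\<^sub>2 z"
    if "(z, a, w, v) \<in> set r" for z a w v
  proof -
    from that obtain i where i: "i < k" "z = zs ! i" "a = as ! i" "w = ws ! i" "v = vs ! i"
      using len by (auto simp: r_def set_zip)
    have z: "z \<in> \<Gamma>\<^sub>1 \<inter> \<Gamma>\<^sub>2" using i len zs by (metis nth_mem)
    show ?thesis using i z len ix_nth[OF i(1)] by (simp add: \<phi>1 \<phi>2 as_def ws_def vs_def)
  qed
  have fst_r: "map fst r = zs" using len by (simp add: r_def)
  \<comment> \<open>Each name is classified by the interval containing its index. The injectivity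
    and disjointness claims below compare these intervals.\<close>
  have idx1: "z \<in> \<Gamma>\<^sub>1 \<Longrightarrow> z \<in> \<Gamma>\<^sub>2 \<and> m + k \<le> tidx (\<phi>\<^sub>1 z) \<and> tidx (\<phi>\<^sub>1 z) < m + 2 * k \<or>
      z \<notin> \<Gamma>\<^sub>2 \<and> \<phi>\<^sub>1 z = \<phi> z \<and> tidx (\<phi>\<^sub>1 z) < m" for z
    using \<phi>1[of z] \<phi>1'[of z] ix[of z] lt[of z] by (cases "z \<in> \<Gamma>\<^sub>2") simp_all
  have idx2: "z \<in> insert x \<Gamma>\<^sub>2 \<Longrightarrow> z = x \<and> tidx (\<phi>\<^sub>2 z) = m + 3 * k \<or>
      z \<noteq> x \<and> z \<in> \<Gamma>\<^sub>1 \<and> z \<in> \<Gamma>\<^sub>2 \<and> m + 2 * k \<le> tidx (\<phi>\<^sub>2 z) \<and> tidx (\<phi>\<^sub>2 z) < m + 3 * k \<or>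
      z \<noteq> x \<and> z \<in> \<Gamma>\<^sub>2 \<and> z \<notin> \<Gamma>\<^sub>1 \<and> \<phi>\<^sub>2 z = \<phi> z \<and> tidx (\<phi>\<^sub>2 z) < m" for z
    using \<phi>2[of z] \<phi>2'[of z] ix[of z] lt[of z] \<phi>2x \<Gamma>(3)
    by (cases "z = x"; cases "z \<in> \<Gamma>\<^sub>1") (simp_all add: y_def)
  have inj1: "z = z'" if "z \<in> \<Gamma>\<^sub>1 \<inter> \<Gamma>\<^sub>2" "z' \<in> \<Gamma>\<^sub>1 \<inter> \<Gamma>\<^sub>2" "\<phi>\<^sub>1 z = \<phi>\<^sub>1 z'" for z z'
  proof -
    have "ix z = ix z'" using that \<phi>1 by simp
    then show ?thesis using ix[OF that(1)] ix[OF that(2)] by metis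
  qed
  have inj2: "z = z'" if "z \<in> \<Gamma>\<^sub>1 \<inter> \<Gamma>\<^sub>2" "z' \<in> \<Gamma>\<^sub>1 \<inter> \<Gamma>\<^sub>2" "\<phi>\<^sub>2 z = \<phi>\<^sub>2 z'" for z z'
  proof -
    have "ix z = ix z'" using that \<phi>2 by simp
    then show ?thesis using ix[OF that(1)] ix[OF that(2)] by metis
  qed
  show thesis
  proof (rule that[of r y \<phi>\<^sub>1 \<phi>\<^sub>2])
    show "fjax S \<phi> (BLet x e1 e2) = let_dups \<phi> r (LLet x y (fjax S \<phi>\<^sub>1 e1) (fjax S \<phi>\<^sub>2 e2))"
      by (simp only: fjax.simps Let_def r_def y_def \<phi>\<^sub>1_def \<phi>\<^sub>2_def as_def ws_def vs_def m_def k_def zs_def)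
    have "dup_src r = set (map fst r)" unfolding dup_src_def set_map by (rule image_cong) auto
    then show "dup_src r = \<Gamma>\<^sub>1 \<inter> \<Gamma>\<^sub>2" using fst_r zs by simp
    show "distinct (map fst r)" using fst_r zs by simp
    show "w = \<phi>\<^sub>1 z \<and> v = \<phi>\<^sub>2 z \<and> tlty a = LTensor (plty z) (plty z)" if "(z, a, w, v) \<in> set r" for z a w v
      using r[OF that] by simp
    show "\<phi>\<^sub>1 z = \<phi> z" if "z \<in> \<Gamma>\<^sub>1 - \<Gamma>\<^sub>2" for z by (rule \<phi>1'[OF that])
    show "\<phi>\<^sub>2 z = \<phi> z" if "z \<in> \<Gamma>\<^sub>2 - \<Gamma>\<^sub>1" for z by (rule \<phi>2'[OF that])
    show "\<phi>\<^sub>2 x = y" by (rule \<phi>2x)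
    show "inj_on \<phi>\<^sub>1 \<Gamma>\<^sub>1"
    proof (rule inj_onI)
      fix z z' assume z: "z \<in> \<Gamma>\<^sub>1" "z' \<in> \<Gamma>\<^sub>1" "\<phi>\<^sub>1 z = \<phi>\<^sub>1 z'"
      from idx1[OF z(1)] idx1[OF z(2)] z(3)
      have "z \<in> \<Gamma>\<^sub>2 \<and> z' \<in> \<Gamma>\<^sub>2 \<or> \<phi> z = \<phi> z'" by (elim disjE; elim conjE) simp_all
      then show "z = z'" using z inj1[of z z'] inj_onD[OF inj, of z z'] by blast
    qed
    show "inj_on \<phi>\<^sub>2 (insert x \<Gamma>\<^sub>2)"
    proof (rule inj_onI)
      fix z z' assume z: "z \<in> insert x \<Gamma>\<^sub>2" "z' \<in> insert x \<Gamma>\<^sub>2" "\<phi>\<^sub>2 z = \<phi>\<^sub>2 z'"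
      from idx2[OF z(1)] idx2[OF z(2)] z(3)
      have "z = x \<and> z' = x \<or> z \<in> \<Gamma>\<^sub>1 \<inter> \<Gamma>\<^sub>2 \<and> z' \<in> \<Gamma>\<^sub>1 \<inter> \<Gamma>\<^sub>2 \<or>
          z \<in> \<Gamma>\<^sub>2 \<and> z' \<in> \<Gamma>\<^sub>2 \<and> \<phi> z = \<phi> z'" by (elim disjE; elim conjE) simp_all
      then show "z = z'" using z(3) inj2[of z z'] inj_onD[OF inj, of z z'] by blast
    qed
    show "\<forall>z\<in>\<Gamma>\<^sub>1. tlty (\<phi>\<^sub>1 z) = plty z"
    proof
      fix z assume z: "z \<in> \<Gamma>\<^sub>1"
      show "tlty (\<phi>\<^sub>1 z) = plty z"
        by (cases "z \<in> \<Gamma>\<^sub>2") (use z \<phi>1[of z] \<phi>1'[of z] ty in simp_all)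
    qed
    show "\<forall>z\<in>insert x \<Gamma>\<^sub>2. tlty (\<phi>\<^sub>2 z) = plty z"
    proof
      fix z assume "z \<in> insert x \<Gamma>\<^sub>2"
      then consider "z = x" | "z \<in> \<Gamma>\<^sub>1 \<inter> \<Gamma>\<^sub>2" | "z \<in> \<Gamma>\<^sub>2 - \<Gamma>\<^sub>1" by auto
      then show "tlty (\<phi>\<^sub>2 z) = plty z"
        by cases (use \<phi>2x \<phi>2[of z] \<phi>2'[of z] ty in \<open>simp_all add: y_def\<close>)
    qed
    show "\<phi>\<^sub>1 ` \<Gamma>\<^sub>1 \<inter> \<phi>\<^sub>2 ` insert x \<Gamma>\<^sub>2 = {}"
    proof (rule ccontr)
      assume "\<not> ?thesis"
      then obtain z z' where z: "z \<in> \<Gamma>\<^sub>1" "z' \<in> insert x \<Gamma>\<^sub>2" "\<phi>\<^sub>1 z = \<phi>\<^sub>2 z'" by blast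
      \<comment> \<open>The intervals for the two kinds of copies are disjoint, so a clash is
        possible only between given names, where injectivity of \<open>\<phi>\<close> identifies the
        two variables.\<close>
      from idx1[OF z(1)] idx2[OF z(2)] z(3) have "z \<notin> \<Gamma>\<^sub>2" "z' \<in> \<Gamma>\<^sub>2" "\<phi> z = \<phi> z'"
        by (elim disjE; simp)+
      then show False using inj_onD[OF inj, of z z'] z(1) by auto
    qed
    show "dup_tmp r \<inter> (\<phi> ` (\<Gamma>\<^sub>1 \<union> \<Gamma>\<^sub>2) \<union> \<phi>\<^sub>1 ` \<Gamma>\<^sub>1 \<union> \<phi>\<^sub>2 ` insert x \<Gamma>\<^sub>2) = {}"
    proof (rule ccontr)
      assume "\<not> ?thesis"
      then obtain a where a: "a \<in> dup_tmp r" "a \<in> \<phi> ` (\<Gamma>\<^sub>1 \<union> \<Gamma>\<^sub>2) \<union> \<phi>\<^sub>1 ` \<Gamma>\<^sub>1 \<union> \<phi>\<^sub>2 ` insert x \<Gamma>\<^sub>2" by blast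
      then obtain z w v where "(z, a, w, v) \<in> set r" by (auto simp: dup_tmp_def)
      from r[OF this] ix[of z] have "m \<le> tidx a" "tidx a < m + k" by auto
      moreover have "tidx a < m" if "a \<in> \<phi> ` (\<Gamma>\<^sub>1 \<union> \<Gamma>\<^sub>2)" using that lt by auto
      moreover have "tidx a < m \<or> m + k \<le> tidx a" if "z \<in> \<Gamma>\<^sub>1" "a = \<phi>\<^sub>1 z" for z
        using that(2) idx1[OF that(1)] by (elim disjE; elim conjE) simp_all
      moreover have "tidx a < m \<or> m + k \<le> tidx a" if "z \<in> insert x \<Gamma>\<^sub>2" "a = \<phi>\<^sub>2 z" for z
        using that(2) idx2[OF that(1)] by (elim disjE; elim conjE) simp_all
      ultimately show False using a(2) by (metis UnE imageE not_less)
    qed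
    show "\<phi>\<^sub>1 ` (\<Gamma>\<^sub>1 \<inter> \<Gamma>\<^sub>2) \<inter> \<phi> ` (\<Gamma>\<^sub>1 \<union> \<Gamma>\<^sub>2) = {}"
    proof (rule ccontr)
      assume "\<not> ?thesis"
      then obtain z z' where z: "z \<in> \<Gamma>\<^sub>1 \<inter> \<Gamma>\<^sub>2" "z' \<in> \<Gamma>\<^sub>1 \<union> \<Gamma>\<^sub>2" "\<phi>\<^sub>1 z = \<phi> z'" by blast
      from idx1[of z] lt[OF z(2)] z(1,3) show False by simp
    qed
    show "\<phi>\<^sub>2 ` insert x (\<Gamma>\<^sub>1 \<inter> \<Gamma>\<^sub>2) \<inter> \<phi> ` (\<Gamma>\<^sub>1 \<union> \<Gamma>\<^sub>2) = {}"
    proof (rule ccontr)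
      assume "\<not> ?thesis"
      then obtain z z' where z: "z \<in> insert x (\<Gamma>\<^sub>1 \<inter> \<Gamma>\<^sub>2)" "z' \<in> \<Gamma>\<^sub>1 \<union> \<Gamma>\<^sub>2" "\<phi>\<^sub>2 z = \<phi> z'" by blast
      from idx2[of z] lt[OF z(2)] z(1,3) show False by auto
    qed
  qed
qed

section \<open>The forward mode of JAX\<close>

lemma dup_dst_eq:
  "\<forall>(z, a, w, v)\<in>set r. w = \<phi>\<^sub>1 z \<and> v = \<phi>\<^sub>2 z \<Longrightarrow> dup_dst r = \<phi>\<^sub>1 ` dup_src r \<union> \<phi>\<^sub>2 ` dup_src r"
proof (induction r)
  case (Cons q r)
  obtain z a w v where q: "q = (z, a, w, v)" by (cases q)
  have "dup_dst r = \<phi>\<^sub>1 ` dup_src r \<union> \<phi>\<^sub>2 ` dup_src r" by (rule Cons.IH) (use Cons.prems in simp)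
  then show ?case using Cons.prems unfolding q dup_simps by simp blast
qed simp

text \<open>The set \<open>D\<close> stays fixed while the list shrinks; in this form the naming
  hypotheses pass to the tail.\<close>

lemma dup_okI:
  "distinct (map fst r) \<Longrightarrow> \<forall>(z, a, w, v)\<in>set r. w = \<phi>\<^sub>1 z \<and> v = \<phi>\<^sub>2 z \<Longrightarrow> dup_src r \<subseteq> D \<Longrightarrow>
   inj_on \<phi>\<^sub>1 D \<Longrightarrow> inj_on \<phi>\<^sub>2 D \<Longrightarrow> \<phi>\<^sub>1 ` D \<inter> \<phi>\<^sub>2 ` D = {} \<Longrightarrow> \<phi>\<^sub>1 ` D \<union> \<phi>\<^sub>2 ` D \<subseteq> Y \<Longrightarrow>
   dup_tmp r \<inter> Y = {} \<Longrightarrow> (\<phi>\<^sub>1 ` D \<union> \<phi>\<^sub>2 ` D \<union> dup_tmp r) \<inter> \<phi> ` D = {} \<Longrightarrow> dup_ok \<phi> r Y"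
proof (induction r)
  case (Cons q r)
  obtain z a w v where q: "q = (z, a, w, v)" by (cases q)
  have wv: "w = \<phi>\<^sub>1 z" "v = \<phi>\<^sub>2 z" "z \<in> D" "a \<notin> Y" "a \<notin> \<phi> ` D" and r: "dup_src r \<subseteq> D"
    using Cons.prems by (auto simp: q)
  have z: "z \<notin> dup_src r" using Cons.prems(1) by (force simp: q dup_src_def)
  have dst: "dup_dst r = \<phi>\<^sub>1 ` dup_src r \<union> \<phi>\<^sub>2 ` dup_src r"
    by (rule dup_dst_eq) (use Cons.prems(2) in simp)
  have "\<phi>\<^sub>1 z \<notin> \<phi>\<^sub>1 ` dup_src r" "\<phi>\<^sub>2 z \<notin> \<phi>\<^sub>2 ` dup_src r"
    using z inj_on_image_mem_iff[OF Cons.prems(4) wv(3) r] inj_on_image_mem_iff[OF Cons.prems(5) wv(3) r]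
    by simp_all
  moreover have "\<phi>\<^sub>1 z \<notin> \<phi>\<^sub>2 ` dup_src r" "\<phi>\<^sub>2 z \<notin> \<phi>\<^sub>1 ` dup_src r" "\<phi>\<^sub>1 z \<noteq> \<phi>\<^sub>2 z"
    using r wv(3) Cons.prems(6) by blast+
  ultimately have "{w, v} \<inter> dup_dst r = {}" "w \<noteq> v" unfolding dst wv(1,2) by blast+
  moreover have "{a, w, v} \<inter> \<phi> ` dup_src r = {}"
    using wv(3,5) r Cons.prems(9) unfolding wv(1,2) by blast
  moreover have "w \<in> Y" "v \<in> Y" using wv(3) Cons.prems(7) unfolding wv(1,2) by blast+
  moreover have "dup_ok \<phi> r Y" by (rule Cons.IH) (use Cons.prems q in auto)
  ultimately show ?case using wv(4) by (simp add: q)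
qed simp

section \<open>Free variables of the JAX transform\<close>

lemma FV_foldr_let_p:
  "(\<Union>i\<in>set is. FVp (h i)) \<inter> w ` set is = {} \<Longrightarrow>
     FVp (foldr (\<lambda>i. let_p (w i) (h i)) is e) = (\<Union>i\<in>set is. FVp (h i)) \<union> (FVp e - w ` set is)"
  "FVt (foldr (\<lambda>i. let_p (w i) (h i)) is e) = (\<Union>i\<in>set is. FVt (h i)) \<union> FVt e"
proof (induction "is")
  case (Cons i "is")
  {
    case 1
    then have "(\<Union>i\<in>set is. FVp (h i)) \<inter> w ` set is = {}" by auto
    from Cons.IH(1)[OF this] 1 show ?case by auto
  next
    case 2
    then show ?case using Cons.IH(2) by auto
  }
qed auto

lemma FV_sum_exp:
  assumes "is \<noteq> []"
  shows "FVp (sum_exp (map h is)) = (\<Union>i\<in>set is. FVp (h i))"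
    and "FVt (sum_exp (map h is)) = (\<Union>i\<in>set is. FVt (h i))"
  using assms by (cases "is"; simp add: FV_foldl_plus_exp)+

definition tangent_names :: "(pvar \<Rightarrow> tvar) \<Rightarrow> pvar set \<Rightarrow> bool" where
  "tangent_names \<phi> \<Gamma> \<longleftrightarrow> inj_on \<phi> \<Gamma> \<and> (\<forall>z\<in>\<Gamma>. tlty (\<phi> z) = plty z)"

lemma tangent_names_subset: "tangent_names \<phi> \<Gamma> \<Longrightarrow> \<Delta> \<subseteq> \<Gamma> \<Longrightarrow> tangent_names \<phi> \<Delta>"
  by (auto simp: tangent_names_def intro: inj_on_subset)

lemma fjax_BFn_names:
  assumes "m = fresh_p (set xs)" "w = (\<lambda>i. PV (m + i) LReal)"
  shows "w ` I \<inter> set xs = {}" "inj w"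
  using assms by (auto simp: inj_def dest: fresh_p_gt[OF finite_set])

lemma wf_signat_arity: "wf_signat S \<Longrightarrow> 0 < arity S f"
  by (simp add: wf_signat_def Suc_le_eq)

lemma wf_signat_arity_part: "wf_signat S \<Longrightarrow> i < arity S f \<Longrightarrow> arity S (part S f i) = arity S f"
  by (simp add: wf_signat_def)

text \<open>\<open>sum_exp\<close> is unspecified on the empty list, so there must be an argument;
  positive arity supplies one. The names \<open>w i\<close> are free in the sum but bound by the
  surrounding lets.\<close>

lemma FV_fjax_BFn:
  assumes "xs \<noteq> []"
  shows "FVp (fjax S \<phi> (BFn f xs)) = set xs" "FVt (fjax S \<phi> (BFn f xs)) = \<phi> ` set xs"
proof -
  define m where "m = fresh_p (set xs)"
  define w where "w = (\<lambda>i. PV (m + i) LReal)"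
  let ?is = "[0..<length xs]"
  let ?h = "\<lambda>i. LTimes (w i) (\<phi> (xs ! i)) :: 'a lexp"
  let ?e = "pair_exp (LFn f xs) (sum_exp (map ?h ?is))"
  have is_ne: "?is \<noteq> []" using assms by simp
  have eq: "fjax S \<phi> (BFn f xs) = foldr (\<lambda>i. let_p (w i) (LFn (part S f i) xs)) ?is ?e"
    by (simp only: fjax.simps Let_def m_def w_def)
  have w: "w ` set ?is \<inter> set xs = {}" by (rule fjax_BFn_names(1)[OF m_def w_def])
  have e: "FVp ?e = set xs \<union> w ` set ?is" "FVt ?e = \<phi> ` set xs"
    by (auto simp: FV_sum_exp[OF is_ne, where h = ?h] set_conv_nth)
  have 0: "(\<Union>i\<in>set ?is. FVp (LFn (part S f i) xs)) \<inter> w ` set ?is = {}" using w by auto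
  show "FVp (fjax S \<phi> (BFn f xs)) = set xs"
    unfolding eq FV_foldr_let_p(1)[OF 0] e using w by auto
  show "FVt (fjax S \<phi> (BFn f xs)) = \<phi> ` set xs"
    unfolding eq FV_foldr_let_p(2) e by auto
qed

lemma denotes_fjax_BFn:
  assumes wf: "wf_signat S" and xs: "length xs = arity S f" "\<forall>x\<in>set xs. \<exists>r. \<pi> x = Num r"
    and ty: "\<forall>x\<in>set xs. tlty (\<phi> x) = LReal"
  shows "denotes S \<pi> (fjax S \<phi> (BFn f xs)) (pval S \<pi> (BFn f xs)) (\<lambda>\<rho> T. T = tval S \<pi> (\<lambda>x. \<rho> (\<phi> x)) (BFn f xs))"
proof -
  define m where "m = fresh_p (set xs)"
  define w where "w = (\<lambda>i. PV (m + i) LReal)"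
  let ?is = "[0..<length xs]"
  let ?r = "\<lambda>x. the_num (\<pi> x)"
  define Q :: "nat \<Rightarrow> 'a tm" where "Q = (\<lambda>i. Num (den S (part S f i) (map ?r xs)))"
  let ?u = "\<lambda>i \<rho>. App (App Times (Q i)) (\<rho> (\<phi> (xs ! i)))"
  let ?h = "\<lambda>i. LTimes (w i) (\<phi> (xs ! i)) :: 'a lexp"
  let ?e = "pair_exp (LFn f xs) (sum_exp (map ?h ?is))"
  have is_ne: "?is \<noteq> []" using wf_signat_arity[OF wf, of f] xs(1) by auto
  have num: "\<pi> x = Num (?r x)" if "x \<in> set xs" for x using xs(2) that by force
  have eq: "fjax S \<phi> (BFn f xs) = foldr (\<lambda>i. let_p (w i) (LFn (part S f i) xs)) ?is ?e"
    by (simp only: fjax.simps Let_def m_def w_def)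
  have w: "w ` set ?is \<inter> set xs = {}" "inj w" by (rule fjax_BFn_names[OF m_def w_def])+
  show ?thesis unfolding eq
  proof (rule denotes_foldr_let_p[where X = "set xs" and Q = Q])
    show "denotes S \<pi>' (LFn (part S f i) xs) (Q i) (\<lambda>\<rho> T. T = Empty)"
      if "i \<in> set ?is" "\<forall>x\<in>set xs. \<pi>' x = \<pi> x" for i \<pi>'
      unfolding Q_def
    proof (rule denotes_LFn)
      show "length xs = arity S (part S f i)" using wf_signat_arity_part[OF wf, of i f] xs(1) that(1) by simp
      show "\<pi>' x = Num (?r x)" if "x \<in> set xs" for x using num that \<open>\<forall>x\<in>set xs. \<pi>' x = \<pi> x\<close> by metis
    qed
    show "denotes S \<pi>' ?e (pval S \<pi> (BFn f xs)) (\<lambda>\<rho> T. T = tval S \<pi> (\<lambda>x. \<rho> (\<phi> x)) (BFn f xs))"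
      if \<pi>': "\<forall>x\<in>set xs. \<pi>' x = \<pi> x" "\<forall>i\<in>set ?is. \<pi>' (w i) = Q i" for \<pi>'
    proof -
      have 1: "denotes S \<pi>' (LFn f xs) (Num (den S f (map ?r xs))) (\<lambda>\<rho> T. T = Empty)"
        by (rule denotes_LFn[OF xs(1)]) (use num \<pi>'(1) in metis)
      have 2: "denotes S \<pi>' (sum_exp (map ?h ?is)) Unit (\<lambda>\<rho> T. T = sum_tm (map (\<lambda>i. ?u i \<rho>) ?is))"
      proof (rule denotes_sum_exp[OF is_ne])
        fix i assume i: "i \<in> set ?is"
        then have t: "tlty (\<phi> (xs ! i)) = LReal" using ty by simp
        from denotes_LTimes[OF t, of S \<pi>' "w i"] show "denotes S \<pi>' (?h i) Unit (\<lambda>\<rho> T. T = ?u i \<rho>)"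
          using \<pi>'(2) i by simp
        show "snd (ety (?h i)) = LReal" using t by simp
      qed
      from denotes_pair_exp[OF 1 2] show ?thesis by (simp add: Q_def)
    qed
    show "distinct (map w ?is)" using w(2) by (simp add: distinct_map inj_on_def inj_def)
    show "w ` set ?is \<inter> set xs = {}" by (rule w(1))
  qed
qed

text \<open>A repackaging for the inductions. The images of the contexts under
  \<open>\<phi>\<^sub>1\<close> and \<open>\<phi>\<^sub>2\<close> stand in for the free tangents of
  the two transformed parts, which only \<open>FV_fjax\<close> determines; its proof relies on the
  present lemma.\<close>

lemma fjax_BLet_cases:
  assumes "btyping S \<Gamma>\<^sub>1 e1 (plty x)" "btyping S (insert x \<Gamma>\<^sub>2) e2 \<tau>" "x \<notin> \<Gamma>\<^sub>2"
    and "tangent_names \<phi> (\<Gamma>\<^sub>1 \<union> \<Gamma>\<^sub>2)"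
  obtains r y \<phi>\<^sub>1 \<phi>\<^sub>2 where
    "fjax S \<phi> (BLet x e1 e2) = let_dups \<phi> r (LLet x y (fjax S \<phi>\<^sub>1 e1) (fjax S \<phi>\<^sub>2 e2))"
    and "tangent_names \<phi>\<^sub>1 \<Gamma>\<^sub>1" and "tangent_names \<phi>\<^sub>2 (insert x \<Gamma>\<^sub>2)" and "\<phi>\<^sub>2 x = y"
    and "\<phi>\<^sub>1 ` \<Gamma>\<^sub>1 \<inter> \<phi>\<^sub>2 ` insert x \<Gamma>\<^sub>2 = {}"
    and "dup_src r = \<Gamma>\<^sub>1 \<inter> \<Gamma>\<^sub>2"
    and "\<forall>(z, a, w, v)\<in>set r. w = \<phi>\<^sub>1 z \<and> v = \<phi>\<^sub>2 z \<and> tlty a = LTensor (plty z) (plty z)"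
    and "\<forall>z\<in>\<Gamma>\<^sub>1 - \<Gamma>\<^sub>2. \<phi>\<^sub>1 z = \<phi> z" and "\<forall>z\<in>\<Gamma>\<^sub>2 - \<Gamma>\<^sub>1. \<phi>\<^sub>2 z = \<phi> z"
    and "(\<phi>\<^sub>1 ` (\<Gamma>\<^sub>1 \<inter> \<Gamma>\<^sub>2) \<union> \<phi>\<^sub>2 ` (\<Gamma>\<^sub>1 \<inter> \<Gamma>\<^sub>2)) \<inter> \<phi> ` (\<Gamma>\<^sub>1 \<union> \<Gamma>\<^sub>2) = {}"
    and "dup_dst r = \<phi>\<^sub>1 ` (\<Gamma>\<^sub>1 \<inter> \<Gamma>\<^sub>2) \<union> \<phi>\<^sub>2 ` (\<Gamma>\<^sub>1 \<inter> \<Gamma>\<^sub>2)"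
    and "dup_ok \<phi> r (\<phi>\<^sub>1 ` \<Gamma>\<^sub>1 \<union> \<phi>\<^sub>2 ` \<Gamma>\<^sub>2)"
    and "\<phi> ` (\<Gamma>\<^sub>1 \<inter> \<Gamma>\<^sub>2) \<union> (\<phi>\<^sub>1 ` \<Gamma>\<^sub>1 \<union> \<phi>\<^sub>2 ` \<Gamma>\<^sub>2 - dup_dst r) = \<phi> ` (\<Gamma>\<^sub>1 \<union> \<Gamma>\<^sub>2)"
    and "y \<notin> \<phi>\<^sub>2 ` \<Gamma>\<^sub>2"
proof -
  note names = assms(4)[unfolded tangent_names_def]
  show thesis
  proof (rule fjax_BLet[OF btyping_FVs[OF assms(1)] btyping_FVs[OF assms(2)] assms(3)
        conjunct1[OF names] conjunct2[OF names], of S])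
  fix r y \<phi>\<^sub>1 \<phi>\<^sub>2
  assume *:
    "fjax S \<phi> (BLet x e1 e2) = let_dups \<phi> r (LLet x y (fjax S \<phi>\<^sub>1 e1) (fjax S \<phi>\<^sub>2 e2))"
    "dup_src r = \<Gamma>\<^sub>1 \<inter> \<Gamma>\<^sub>2" "distinct (map fst r)"
    "\<And>z a w v. (z, a, w, v) \<in> set r \<Longrightarrow> w = \<phi>\<^sub>1 z \<and> v = \<phi>\<^sub>2 z \<and> tlty a = LTensor (plty z) (plty z)"
    "\<And>z. z \<in> \<Gamma>\<^sub>1 - \<Gamma>\<^sub>2 \<Longrightarrow> \<phi>\<^sub>1 z = \<phi> z" "\<And>z. z \<in> \<Gamma>\<^sub>2 - \<Gamma>\<^sub>1 \<Longrightarrow> \<phi>\<^sub>2 z = \<phi> z" "\<phi>\<^sub>2 x = y"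
    "inj_on \<phi>\<^sub>1 \<Gamma>\<^sub>1" "inj_on \<phi>\<^sub>2 (insert x \<Gamma>\<^sub>2)"
    "\<forall>z\<in>\<Gamma>\<^sub>1. tlty (\<phi>\<^sub>1 z) = plty z" "\<forall>z\<in>insert x \<Gamma>\<^sub>2. tlty (\<phi>\<^sub>2 z) = plty z"
    "\<phi>\<^sub>1 ` \<Gamma>\<^sub>1 \<inter> \<phi>\<^sub>2 ` insert x \<Gamma>\<^sub>2 = {}"
    "dup_tmp r \<inter> (\<phi> ` (\<Gamma>\<^sub>1 \<union> \<Gamma>\<^sub>2) \<union> \<phi>\<^sub>1 ` \<Gamma>\<^sub>1 \<union> \<phi>\<^sub>2 ` insert x \<Gamma>\<^sub>2) = {}"
    "\<phi>\<^sub>1 ` (\<Gamma>\<^sub>1 \<inter> \<Gamma>\<^sub>2) \<inter> \<phi> ` (\<Gamma>\<^sub>1 \<union> \<Gamma>\<^sub>2) = {}" "\<phi>\<^sub>2 ` insert x (\<Gamma>\<^sub>1 \<inter> \<Gamma>\<^sub>2) \<inter> \<phi> ` (\<Gamma>\<^sub>1 \<union> \<Gamma>\<^sub>2) = {}"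
  have r: "\<forall>(z, a, w, v)\<in>set r. w = \<phi>\<^sub>1 z \<and> v = \<phi>\<^sub>2 z \<and> tlty a = LTensor (plty z) (plty z)"
    using *(4) by auto
  have dst: "dup_dst r = \<phi>\<^sub>1 ` (\<Gamma>\<^sub>1 \<inter> \<Gamma>\<^sub>2) \<union> \<phi>\<^sub>2 ` (\<Gamma>\<^sub>1 \<inter> \<Gamma>\<^sub>2)"
    unfolding *(2)[symmetric] by (rule dup_dst_eq) (use r in auto)
  have y: "y \<notin> \<phi>\<^sub>2 ` \<Gamma>\<^sub>2" using *(7,9) assms(3) by (auto simp: inj_on_def)
  show thesis
    proof (rule that[of r y \<phi>\<^sub>1 \<phi>\<^sub>2])
    show "tangent_names \<phi>\<^sub>1 \<Gamma>\<^sub>1" "tangent_names \<phi>\<^sub>2 (insert x \<Gamma>\<^sub>2)"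
      using * by (simp_all add: tangent_names_def)
    show "dup_ok \<phi> r (\<phi>\<^sub>1 ` \<Gamma>\<^sub>1 \<union> \<phi>\<^sub>2 ` \<Gamma>\<^sub>2)"
    proof (rule dup_okI[OF *(3), where D = "\<Gamma>\<^sub>1 \<inter> \<Gamma>\<^sub>2"])
      show "\<forall>(z, a, w, v)\<in>set r. w = \<phi>\<^sub>1 z \<and> v = \<phi>\<^sub>2 z" using r by auto
      show "inj_on \<phi>\<^sub>1 (\<Gamma>\<^sub>1 \<inter> \<Gamma>\<^sub>2)" "inj_on \<phi>\<^sub>2 (\<Gamma>\<^sub>1 \<inter> \<Gamma>\<^sub>2)"
        using *(8,9) by (auto intro: inj_on_subset)
      show "\<phi>\<^sub>1 ` (\<Gamma>\<^sub>1 \<inter> \<Gamma>\<^sub>2) \<inter> \<phi>\<^sub>2 ` (\<Gamma>\<^sub>1 \<inter> \<Gamma>\<^sub>2) = {}" using *(12) by blast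
      show "dup_tmp r \<inter> (\<phi>\<^sub>1 ` \<Gamma>\<^sub>1 \<union> \<phi>\<^sub>2 ` \<Gamma>\<^sub>2) = {}" using *(13) by blast
      show "(\<phi>\<^sub>1 ` (\<Gamma>\<^sub>1 \<inter> \<Gamma>\<^sub>2) \<union> \<phi>\<^sub>2 ` (\<Gamma>\<^sub>1 \<inter> \<Gamma>\<^sub>2) \<union> dup_tmp r) \<inter> \<phi> ` (\<Gamma>\<^sub>1 \<inter> \<Gamma>\<^sub>2) = {}"
        using *(13,14,15) by blast
    qed (use *(2) in auto)
    \<comment> \<open>Tangents of variables that occur on one side only keep their given names, and
      these are never names of copies.\<close>
    have "\<phi>\<^sub>1 ` \<Gamma>\<^sub>1 - dup_dst r = \<phi> ` (\<Gamma>\<^sub>1 - \<Gamma>\<^sub>2)"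
    proof -
      have "\<phi>\<^sub>1 ` \<Gamma>\<^sub>1 = \<phi>\<^sub>1 ` (\<Gamma>\<^sub>1 \<inter> \<Gamma>\<^sub>2) \<union> \<phi> ` (\<Gamma>\<^sub>1 - \<Gamma>\<^sub>2)"
        using *(5) by (metis Int_Diff_Un image_Un image_cong)
      moreover have "\<phi> ` (\<Gamma>\<^sub>1 - \<Gamma>\<^sub>2) \<inter> dup_dst r = {}" unfolding dst using *(14,15) by blast
      ultimately show ?thesis unfolding dst by blast
    qed
    moreover have "\<phi>\<^sub>2 ` \<Gamma>\<^sub>2 - dup_dst r = \<phi> ` (\<Gamma>\<^sub>2 - \<Gamma>\<^sub>1)"
    proof -
      have "\<phi>\<^sub>2 ` \<Gamma>\<^sub>2 = \<phi>\<^sub>2 ` (\<Gamma>\<^sub>2 \<inter> \<Gamma>\<^sub>1) \<union> \<phi> ` (\<Gamma>\<^sub>2 - \<Gamma>\<^sub>1)"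
        using *(6) by (metis Int_Diff_Un image_Un image_cong)
      moreover have "\<phi> ` (\<Gamma>\<^sub>2 - \<Gamma>\<^sub>1) \<inter> dup_dst r = {}" unfolding dst using *(14,15) by blast
      ultimately show ?thesis unfolding dst by blast
    qed
    ultimately show "\<phi> ` (\<Gamma>\<^sub>1 \<inter> \<Gamma>\<^sub>2) \<union> (\<phi>\<^sub>1 ` \<Gamma>\<^sub>1 \<union> \<phi>\<^sub>2 ` \<Gamma>\<^sub>2 - dup_dst r) = \<phi> ` (\<Gamma>\<^sub>1 \<union> \<Gamma>\<^sub>2)"
      unfolding Un_Diff by blast
    show "(\<phi>\<^sub>1 ` (\<Gamma>\<^sub>1 \<inter> \<Gamma>\<^sub>2) \<union> \<phi>\<^sub>2 ` (\<Gamma>\<^sub>1 \<inter> \<Gamma>\<^sub>2)) \<inter> \<phi> ` (\<Gamma>\<^sub>1 \<union> \<Gamma>\<^sub>2) = {}"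
      using *(14,15) by blast
  qed (rule *(1,2,7,12) r dst y | (rule ballI, rule *(5,6), assumption))+
  qed
qed

lemma FV_fjax:
  "btyping S \<Gamma> e \<tau> \<Longrightarrow> wf_signat S \<Longrightarrow> tangent_names \<phi> \<Gamma> \<Longrightarrow>
     FVp (fjax S \<phi> e) = \<Gamma> \<and> FVt (fjax S \<phi> e) = \<phi> ` \<Gamma>"
proof (induction arbitrary: \<phi> rule: btyping.induct)
  case (bt_Let \<Gamma>\<^sub>1 e\<^sub>1 x \<Gamma>\<^sub>2 e\<^sub>2 \<tau>)
  show ?case
  proof (rule fjax_BLet_cases[OF bt_Let.hyps bt_Let.prems(2)])
  fix r y \<phi>\<^sub>1 \<phi>\<^sub>2
  assume *:
    "fjax S \<phi> (BLet x e\<^sub>1 e\<^sub>2) = let_dups \<phi> r (LLet x y (fjax S \<phi>\<^sub>1 e\<^sub>1) (fjax S \<phi>\<^sub>2 e\<^sub>2))"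
    "tangent_names \<phi>\<^sub>1 \<Gamma>\<^sub>1" "tangent_names \<phi>\<^sub>2 (insert x \<Gamma>\<^sub>2)" "\<phi>\<^sub>2 x = y"
    "dup_src r = \<Gamma>\<^sub>1 \<inter> \<Gamma>\<^sub>2" "dup_ok \<phi> r (\<phi>\<^sub>1 ` \<Gamma>\<^sub>1 \<union> \<phi>\<^sub>2 ` \<Gamma>\<^sub>2)"
    "\<phi> ` (\<Gamma>\<^sub>1 \<inter> \<Gamma>\<^sub>2) \<union> (\<phi>\<^sub>1 ` \<Gamma>\<^sub>1 \<union> \<phi>\<^sub>2 ` \<Gamma>\<^sub>2 - dup_dst r) = \<phi> ` (\<Gamma>\<^sub>1 \<union> \<Gamma>\<^sub>2)"
    "y \<notin> \<phi>\<^sub>2 ` \<Gamma>\<^sub>2"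
  let ?E = "LLet x y (fjax S \<phi>\<^sub>1 e\<^sub>1) (fjax S \<phi>\<^sub>2 e\<^sub>2)"
  have "FVp ?E = \<Gamma>\<^sub>1 \<union> \<Gamma>\<^sub>2" and t: "FVt ?E = \<phi>\<^sub>1 ` \<Gamma>\<^sub>1 \<union> \<phi>\<^sub>2 ` \<Gamma>\<^sub>2"
    using bt_Let.IH(1)[OF bt_Let.prems(1) *(2)] bt_Let.IH(2)[OF bt_Let.prems(1) *(3)] bt_Let.hyps(3) *(4,8)
    by auto
  moreover have "FVt (let_dups \<phi> r ?E) = \<phi> ` (\<Gamma>\<^sub>1 \<union> \<Gamma>\<^sub>2)"
    using FVt_let_dups[of \<phi> r ?E] *(5,6,7) t by simp
  ultimately show ?case unfolding *(1) by simp
  qed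
next
  case (bt_Fn xs f)
  then have "xs \<noteq> []" using wf_signat_arity[of S f] by auto
  then show ?case by (intro conjI FV_fjax_BFn)
next
  case (bt_LetUnit \<Gamma> e \<tau> z)
  have "tangent_names \<phi> \<Gamma>" by (rule tangent_names_subset[OF bt_LetUnit.prems(2)]) auto
  from bt_LetUnit.IH[OF bt_LetUnit.prems(1) this] show ?case by simp
qed auto

text \<open>The relation is an equation between terms; conversion is absorbed by
  \<open>linear_map\<close>. Renaming of tangents is accounted for by reading the assignment through
  \<open>\<phi>\<close>.\<close>

lemma denotes_fjax:
  "btyping S \<Gamma> e \<tau> \<Longrightarrow> wf_signat S \<Longrightarrow> tangent_names \<phi> \<Gamma> \<Longrightarrow> \<forall>x\<in>\<Gamma>. canonical (plty x) (\<pi> x) \<Longrightarrow>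
     denotes S \<pi> (fjax S \<phi> e) (pval S \<pi> e) (\<lambda>\<rho> T. T = tval S \<pi> (\<lambda>x. \<rho> (\<phi> x)) e)"
proof (induction arbitrary: \<phi> \<pi> rule: btyping.induct)
  case (bt_Var x)
  then show ?case using denotes_LPair by simp
next
  case (bt_Let \<Gamma>\<^sub>1 e\<^sub>1 x \<Gamma>\<^sub>2 e\<^sub>2 \<tau>)
  show ?case
  proof (rule fjax_BLet_cases[OF bt_Let.hyps bt_Let.prems(2)])
  fix r y \<phi>\<^sub>1 \<phi>\<^sub>2
  assume *:
    "fjax S \<phi> (BLet x e\<^sub>1 e\<^sub>2) = let_dups \<phi> r (LLet x y (fjax S \<phi>\<^sub>1 e\<^sub>1) (fjax S \<phi>\<^sub>2 e\<^sub>2))"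
    "tangent_names \<phi>\<^sub>1 \<Gamma>\<^sub>1" "tangent_names \<phi>\<^sub>2 (insert x \<Gamma>\<^sub>2)" "\<phi>\<^sub>2 x = y"
    "\<phi>\<^sub>1 ` \<Gamma>\<^sub>1 \<inter> \<phi>\<^sub>2 ` insert x \<Gamma>\<^sub>2 = {}" "dup_src r = \<Gamma>\<^sub>1 \<inter> \<Gamma>\<^sub>2"
    "\<forall>(z, a, w, v)\<in>set r. w = \<phi>\<^sub>1 z \<and> v = \<phi>\<^sub>2 z \<and> tlty a = LTensor (plty z) (plty z)"
    "\<forall>z\<in>\<Gamma>\<^sub>1 - \<Gamma>\<^sub>2. \<phi>\<^sub>1 z = \<phi> z" "\<forall>z\<in>\<Gamma>\<^sub>2 - \<Gamma>\<^sub>1. \<phi>\<^sub>2 z = \<phi> z"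
    "(\<phi>\<^sub>1 ` (\<Gamma>\<^sub>1 \<inter> \<Gamma>\<^sub>2) \<union> \<phi>\<^sub>2 ` (\<Gamma>\<^sub>1 \<inter> \<Gamma>\<^sub>2)) \<inter> \<phi> ` (\<Gamma>\<^sub>1 \<union> \<Gamma>\<^sub>2) = {}"
    "dup_dst r = \<phi>\<^sub>1 ` (\<Gamma>\<^sub>1 \<inter> \<Gamma>\<^sub>2) \<union> \<phi>\<^sub>2 ` (\<Gamma>\<^sub>1 \<inter> \<Gamma>\<^sub>2)"
    "dup_ok \<phi> r (\<phi>\<^sub>1 ` \<Gamma>\<^sub>1 \<union> \<phi>\<^sub>2 ` \<Gamma>\<^sub>2)" "y \<notin> \<phi>\<^sub>2 ` \<Gamma>\<^sub>2"
  let ?E = "LLet x y (fjax S \<phi>\<^sub>1 e\<^sub>1) (fjax S \<phi>\<^sub>2 e\<^sub>2)"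
  let ?P = "pval S \<pi> e\<^sub>1"
  let ?\<pi> = "\<pi>(x := ?P)"
  note FV1 = FV_fjax[OF bt_Let.hyps(1) bt_Let.prems(1) *(2)]
  note FV2 = FV_fjax[OF bt_Let.hyps(2) bt_Let.prems(1) *(3)]
  have FV: "FVt ?E = \<phi>\<^sub>1 ` \<Gamma>\<^sub>1 \<union> \<phi>\<^sub>2 ` \<Gamma>\<^sub>2" using FV1 FV2 *(4,13) by auto
  have d1: "denotes S \<pi> (fjax S \<phi>\<^sub>1 e\<^sub>1) ?P (\<lambda>\<rho> T. T = tval S \<pi> (\<lambda>x. \<rho> (\<phi>\<^sub>1 x)) e\<^sub>1)"
    by (rule bt_Let.IH(1)[OF bt_Let.prems(1) *(2)]) (use bt_Let.prems(3) in simp)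
  have "canonical (plty x) ?P"
    by (rule canonical_pval[OF bt_Let.hyps(1)]) (use bt_Let.prems(3) in simp)
  then have "\<forall>z\<in>insert x \<Gamma>\<^sub>2. canonical (plty z) (?\<pi> z)" using bt_Let.prems(3) by simp
  from bt_Let.IH(2)[OF bt_Let.prems(1) *(3) this]
  have d2: "denotes S ?\<pi> (fjax S \<phi>\<^sub>2 e\<^sub>2) (pval S ?\<pi> e\<^sub>2) (\<lambda>\<rho> T. T = tval S ?\<pi> (\<lambda>x. \<rho> (\<phi>\<^sub>2 x)) e\<^sub>2)" .
  have "denotes S \<pi> ?E (pval S ?\<pi> e\<^sub>2) (\<lambda>\<rho> T. \<exists>T\<^sub>1. T\<^sub>1 = tval S \<pi> (\<lambda>x. \<rho> (\<phi>\<^sub>1 x)) e\<^sub>1 \<and>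
      T = tval S ?\<pi> (\<lambda>z. (\<rho>(y := T\<^sub>1)) (\<phi>\<^sub>2 z)) e\<^sub>2)"
    by (rule denotes_LLet[OF d1 d2]) (use FV2 *(4) in auto)
  from denotes_let_dups[OF this, of \<phi> r, unfolded FV, OF *(12)]
  show ?case unfolding *(1) pval.simps
  proof (rule denotes_imp)
    fix \<rho> T assume T: "T = tval S \<pi> (\<lambda>x. \<rho> (\<phi> x)) (BLet x e\<^sub>1 e\<^sub>2)"
    define D where "D = \<Gamma>\<^sub>1 \<inter> \<Gamma>\<^sub>2"
    \<comment> \<open>The witness for the duplication block: a copy takes the value of its source,
      found by inverting the injective renaming, and every other name keeps its value.\<close>
    define \<rho>' where "\<rho>' = (\<lambda>t. if t \<in> \<phi>\<^sub>1 ` D then \<rho> (\<phi> (inv_into D \<phi>\<^sub>1 t))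
      else if t \<in> \<phi>\<^sub>2 ` D then \<rho> (\<phi> (inv_into D \<phi>\<^sub>2 t)) else \<rho> t)"
    have inj: "inj_on \<phi>\<^sub>1 D" "inj_on \<phi>\<^sub>2 D"
      using *(2,3) by (auto simp: tangent_names_def D_def intro: inj_on_subset)
    have 1: "\<rho>' (\<phi>\<^sub>1 z) = \<rho> (\<phi> z)" if "z \<in> D" for z
      using that inj(1) by (simp add: \<rho>'_def)
    have 2: "\<rho>' (\<phi>\<^sub>2 z) = \<rho> (\<phi> z)" if "z \<in> D" for z
    proof -
      have "\<phi>\<^sub>2 z \<notin> \<phi>\<^sub>1 ` D" using that *(5) unfolding D_def by blast
      then show ?thesis using that inj(2) by (simp add: \<rho>'_def)
    qed
    have 3: "\<rho>' t = \<rho> t" if "t \<notin> dup_dst r" for t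
      using that by (simp add: \<rho>'_def D_def *(11))
    \<comment> \<open>Given names are not names of copies.\<close>
    have 4: "\<rho>' (\<phi> z) = \<rho> (\<phi> z)" if "z \<in> \<Gamma>\<^sub>1 \<union> \<Gamma>\<^sub>2" for z
      by (rule 3) (use that *(10,11) in blast)
    have e1: "tval S \<pi> (\<lambda>x. \<rho>' (\<phi>\<^sub>1 x)) e\<^sub>1 = tval S \<pi> (\<lambda>x. \<rho> (\<phi> x)) e\<^sub>1" (is "?T = _")
    proof (rule tval_cong[OF bt_Let.hyps(1)], rule ballI)
      fix z assume z: "z \<in> \<Gamma>\<^sub>1"
      show "\<rho>' (\<phi>\<^sub>1 z) = \<rho> (\<phi> z)"
        by (cases "z \<in> \<Gamma>\<^sub>2") (use z 1[of z] 4[of z] *(8) in \<open>simp_all add: D_def\<close>)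
    qed
    have e2: "tval S ?\<pi> (\<lambda>z. (\<rho>'(y := ?T)) (\<phi>\<^sub>2 z)) e\<^sub>2 = tval S ?\<pi> ((\<lambda>x. \<rho> (\<phi> x))(x := ?T)) e\<^sub>2"
    proof (rule tval_cong[OF bt_Let.hyps(2)], rule ballI)
      fix z assume z: "z \<in> insert x \<Gamma>\<^sub>2"
      show "(\<rho>'(y := ?T)) (\<phi>\<^sub>2 z) = ((\<lambda>x. \<rho> (\<phi> x))(x := ?T)) z"
      proof (cases "z = x")
        case False
        then have z: "z \<in> \<Gamma>\<^sub>2" "\<phi>\<^sub>2 z \<noteq> y" using z *(13) by auto
        have "\<rho>' (\<phi>\<^sub>2 z) = \<rho> (\<phi> z)"
          by (cases "z \<in> \<Gamma>\<^sub>1") (use z 2[of z] 4[of z] *(9) in \<open>simp_all add: D_def\<close>)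
        then show ?thesis using z(2) False by simp
      qed (simp add: *(4))
    qed
    have a: "\<forall>(z, a, w, v)\<in>set r. \<rho>' w = \<rho> (\<phi> z) \<and> \<rho>' v = \<rho> (\<phi> z)"
    proof (intro ballI, clarify)
      fix z a w v assume m: "(z, a, w, v) \<in> set r"
      then have "z \<in> D" unfolding D_def *(6)[symmetric] dup_src_def by force
      moreover have "w = \<phi>\<^sub>1 z" "v = \<phi>\<^sub>2 z" using *(7) m by auto
      ultimately show "\<rho>' w = \<rho> (\<phi> z) \<and> \<rho>' v = \<rho> (\<phi> z)" using 1 2 by simp
    qed
    have b: "\<forall>y\<in>\<phi>\<^sub>1 ` \<Gamma>\<^sub>1 \<union> \<phi>\<^sub>2 ` \<Gamma>\<^sub>2 - dup_dst r. \<rho>' y = \<rho> y" using 3 by simp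
    have c: "T = tval S ?\<pi> (\<lambda>z. (\<rho>'(y := ?T)) (\<phi>\<^sub>2 z)) e\<^sub>2"
      unfolding e2 T tval.simps unfolding e1 ..
    show "\<exists>\<rho>'. (\<forall>(z, a, w, v)\<in>set r. \<rho>' w = \<rho> (\<phi> z) \<and> \<rho>' v = \<rho> (\<phi> z)) \<and>
        (\<forall>y\<in>\<phi>\<^sub>1 ` \<Gamma>\<^sub>1 \<union> \<phi>\<^sub>2 ` \<Gamma>\<^sub>2 - dup_dst r. \<rho>' y = \<rho> y) \<and>
        (\<exists>T\<^sub>1. T\<^sub>1 = tval S \<pi> (\<lambda>x. \<rho>' (\<phi>\<^sub>1 x)) e\<^sub>1 \<and> T = tval S ?\<pi> (\<lambda>z. (\<rho>'(y := T\<^sub>1)) (\<phi>\<^sub>2 z)) e\<^sub>2)"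
      by (intro exI[of _ \<rho>'] conjI a b exI[of _ ?T] refl c)
  qed
  qed
next
  case (bt_Num r)
  from denotes_pair_exp[OF denotes_LNum[of S \<pi> r] denotes_LZero] show ?case by simp
next
  case (bt_Fn xs f)
  show ?case
    by (rule denotes_fjax_BFn) (use bt_Fn in \<open>auto simp: canonical_def tangent_names_def\<close>)
next
  case (bt_Drop \<Gamma> e \<tau>)
  from denotes_LDrop[OF bt_Drop.IH[OF bt_Drop.prems]] show ?case by simp
next
  case bt_Unit
  from denotes_pair_exp[OF denotes_LUnitP[of S \<pi>] denotes_LUnitT] show ?case by simp
next
  case (bt_LetUnit \<Gamma> e \<tau> z)
  have \<phi>: "tangent_names \<phi> \<Gamma>" by (rule tangent_names_subset[OF bt_LetUnit.prems(2)]) auto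
  have \<pi>: "\<forall>x\<in>\<Gamma>. canonical (plty x) (\<pi> x)" and z: "\<pi> z = Unit"
    using bt_LetUnit.prems(3) bt_LetUnit.hyps(2) by (auto simp: canonical_def)
  have "\<phi> z \<notin> FVt (fjax S \<phi> e)"
    using FV_fjax[OF bt_LetUnit.hyps(1) bt_LetUnit.prems(1) \<phi>] bt_LetUnit.hyps(3) bt_LetUnit.prems(2)
    by (auto simp: tangent_names_def inj_on_def)
  from denotes_LLetUnitP[OF z denotes_LLetUnitT[OF this bt_LetUnit.IH[OF bt_LetUnit.prems(1) \<phi> \<pi>]]]
  show ?case by simp
qed

section \<open>The forward transformation\<close>

lemma fv_let_tm [simp]: "fv (let_tm p N M) = (fv M - pset p) \<union> fv N"
  by (simp add: let_tm_def)

lemma pv_image_diff: "pv ` A - {pv x} = pv ` (A - {x})"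
  by auto

lemma btyping_fv: "btyping S \<Gamma> e \<tau> \<Longrightarrow> fv (deltaB e) = pv ` \<Gamma>"
proof (induction rule: btyping.induct)
  case (bt_Let \<Gamma>\<^sub>1 e\<^sub>1 x \<Gamma>\<^sub>2 e\<^sub>2 \<tau>)
  then show ?case by (auto simp: pv_image_diff)
qed (auto simp: fv_tensor_tm)

lemma btyping_fwd_ty: "btyping S \<Gamma> e \<tau> \<Longrightarrow> fwd_ty (deltaB e) = pT \<tau>"
  by (induction rule: btyping.induct) (auto simp: let_tm_def)

lemma arg_vars_tensor: "xs \<noteq> [] \<Longrightarrow> arg_vars (tensor_tm (map (\<lambda>x. Bang (V x)) xs)) = xs"
proof (induction xs)
  case (Cons x xs)
  then show ?case by (cases xs) auto
qed simp

text \<open>The body is evaluated under any \<open>\<sigma>'\<close> with prescribed values on its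
  free variables, because binding the map \<open>f\<close> changes the substitution too. If
  \<open>x\<close> is not free in \<open>P\<close>, it is missing from the enumeration for
  \<open>P\<close>, and the inner map is bound but not applied.\<close>

lemma evals_fwd_let:
  fixes S :: "'f signat"
  assumes cl: "closed_sub \<sigma>" and dist: "distinct \<theta>" and \<theta>: "set \<theta> = fv Q \<union> (fv P - {x})"
    and fin: "finite (fv P)" "finite (fv Q)"
    and d1: "\<And>\<theta>'. distinct \<theta>' \<Longrightarrow> set \<theta>' = fv Q \<Longrightarrow> evals S (subst \<sigma> (fwd S \<theta>' Q)) P\<^sub>1 \<theta>' G\<^sub>1"
    and d2: "\<And>\<sigma>' \<theta>'. closed_sub \<sigma>' \<Longrightarrow> \<sigma>' x = Some P\<^sub>1 \<Longrightarrow> \<forall>v\<in>fv P - {x}. \<sigma>' v = \<sigma> v \<Longrightarrow>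
      distinct \<theta>' \<Longrightarrow> set \<theta>' = fv P \<Longrightarrow> evals S (subst \<sigma>' (fwd S \<theta>' P)) P\<^sub>2 \<theta>' G\<^sub>2"
  shows "evals S (subst \<sigma> (fwd S \<theta> (let_tm (PBang x) Q P))) P\<^sub>2 \<theta> (\<lambda>\<rho> T. \<exists>T\<^sub>1. G\<^sub>1 \<rho> T\<^sub>1 \<and> G\<^sub>2 (\<rho>(x := T\<^sub>1)) T)"
proof -
  define \<theta>1 where "\<theta>1 = filter (\<lambda>w. w \<in> fv Q) \<theta>"
  define \<theta>2 where "\<theta>2 = filter (\<lambda>w. w \<in> fv P - {x}) \<theta>"
  define \<theta>P where "\<theta>P = (if x \<in> fv P then x # \<theta>2 else \<theta>2)"
  define m where "m = fresh_index (vidx ` insert x (fv P \<union> fv Q))"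
  define f where "f = Var m (Lolli (with_ty (map (tL \<circ> vty) \<theta>1)) (tL (vty x)))"
  define y where "y = Var (m + 1) (fwd_ty P)"
  define g where "g = Var (m + 2) (Lolli (with_ty (map (tL \<circ> vty) \<theta>P)) (tL (fwd_ty P)))"
  define us where "us = vars_from (m + 3) (map (tL \<circ> vty) \<theta>)"
  define u where "u = (\<lambda>w. V (lookup \<theta> us w) :: 'f tm)"
  define fu where "fu = App (V f) (with_tm (map u \<theta>1))"
  define args where "args = (if x \<in> fv P then fu # map u \<theta>2 else map u \<theta>2)"
  have fwd: "fwd S \<theta> (let_tm (PBang x) Q P) = let_tm (dual_pat x f) (fwd S \<theta>1 Q)
     (let_tm (dual_pat y g) (fwd S \<theta>P P) (dual_tm (V y) (tuple_lam (m + 3) us (App (V g) (with_tm args)))))"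
    unfolding let_tm_def[of "PBang x" Q P]
    by (simp only: fwd.simps Let_def \<theta>1_def \<theta>2_def \<theta>P_def m_def f_def y_def g_def us_def u_def fu_def args_def)
  have lt: "vidx w < m" if "w \<in> insert x (fv P \<union> fv Q)" for w
    unfolding m_def by (rule fresh_index_gt) (use that fin in auto)
  have ne: "w \<noteq> f" if "w \<in> insert x (fv P \<union> fv Q)" for w
    using lt[OF that] by (metis f_def less_irrefl var.sel(1))
  have s1: "set \<theta>1 = fv Q" and s2: "set \<theta>P = fv P" and d: "distinct \<theta>1" "distinct \<theta>P" and x2: "x \<notin> set \<theta>2"
    using \<theta> dist by (auto simp: \<theta>1_def \<theta>2_def \<theta>P_def)
  have args: "args = map (\<lambda>w. if w = x then App (V f) (with_tm (map u \<theta>1)) else u w) \<theta>P"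
    using x2 by (auto simp: args_def fu_def \<theta>P_def)
  show ?thesis unfolding fwd
  proof (rule evals_let_let[OF cl d1[OF d(1) s1] _ _ _ _ _ _ _ _ _ dist us_def _ args[unfolded u_def]])
    show "x \<noteq> f" by (rule ne) simp
    show "evals S (subst (\<sigma>(f \<mapsto> L, x \<mapsto> P\<^sub>1)) (fwd S \<theta>P P)) P\<^sub>2 \<theta>P G\<^sub>2"
      if "closed_sub (\<sigma>(f \<mapsto> L, x \<mapsto> P\<^sub>1))" for L
      by (rule d2[OF that _ _ d(2) s2]) (use ne in auto)
  qed (simp_all add: f_def g_def y_def, auto simp: \<theta>1_def \<theta>P_def \<theta>2_def)
qed

text \<open>The component of \<open>\<theta>\<close> for the scrutinee is dropped by reindexing
  unless \<open>z\<close> is free in \<open>P\<close>.\<close>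

lemma evals_fwd_let_unit:
  fixes S :: "'f signat"
  assumes cl: "closed_sub \<sigma>" and dist: "distinct \<theta>" and \<theta>: "fv P \<subseteq> set \<theta>" and z: "\<sigma> z = Some Unit"
    and d: "\<And>\<theta>'. distinct \<theta>' \<Longrightarrow> set \<theta>' = fv P \<Longrightarrow> evals S (subst \<sigma> (fwd S \<theta>' P)) P\<^sub>1 \<theta>' G"
  shows "evals S (subst \<sigma> (fwd S \<theta> (let_tm PUnit (V z) P))) P\<^sub>1 \<theta> G"
proof -
  define \<theta>' where "\<theta>' = filter (\<lambda>w. w \<in> fv P) \<theta>"
  define m where "m = fresh_index (vidx ` fv P)"
  define y where "y = Var m (fwd_ty P)"
  define g where "g = Var (m + 1) (Lolli (with_ty (map (tL \<circ> vty) \<theta>')) (tL (fwd_ty P)))"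
  define us where "us = vars_from (m + 2) (map (tL \<circ> vty) \<theta>)"
  define u where "u = (\<lambda>w. V (lookup \<theta> us w) :: 'f tm)"
  have fwd: "fwd S \<theta> (let_tm PUnit (V z) P) = let_tm PUnit (V z) (let_tm (dual_pat y g) (fwd S \<theta>' P)
     (dual_tm (V y) (tuple_lam (m + 2) us (App (V g) (with_tm (map u \<theta>'))))))"
    unfolding let_tm_def[of PUnit "V z" P]
    by (simp only: fwd.simps Let_def \<theta>'_def m_def y_def g_def us_def u_def)
  have s: "set \<theta>' = fv P" and d': "distinct \<theta>'" using \<theta> dist by (auto simp: \<theta>'_def)
  show ?thesis unfolding fwd u_def
    by (rule evals_let_unit[OF cl z], rule evals_let_reindex[OF cl d[OF d' s] _ _ _ dist us_def])
      (auto simp: y_def g_def \<theta>'_def)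
qed

text \<open>Counterpart of \<open>denotes_foldr_let_p\<close> for a cascade of
  \<open>let !y\<close>; the set \<open>X\<close> again protects the values on which the bound terms
  depend.\<close>

lemma evals_foldr_let_bang:
  "closed_sub \<sigma> \<Longrightarrow>
   (\<And>i \<sigma>'. i \<in> set is \<Longrightarrow> closed_sub \<sigma>' \<Longrightarrow> \<forall>v\<in>X. \<sigma>' v = \<sigma> v \<Longrightarrow> reds S (subst \<sigma>' (N i)) (Bang (Q i))) \<Longrightarrow>
   (\<And>\<sigma>'. closed_sub \<sigma>' \<Longrightarrow> \<forall>v\<in>X. \<sigma>' v = \<sigma> v \<Longrightarrow> \<forall>i\<in>set is. \<sigma>' (y i) = Some (Q i) \<Longrightarrow>
      evals S (subst \<sigma>' M) P \<theta> G) \<Longrightarrow>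
   (\<And>i. fv (Q i) = {}) \<Longrightarrow> distinct (map y is) \<Longrightarrow> y ` set is \<inter> X = {} \<Longrightarrow>
   evals S (subst \<sigma> (foldr (\<lambda>i. let_tm (PBang (y i)) (N i)) is M)) P \<theta> G"
proof (induction "is" arbitrary: \<sigma> X)
  case Nil
  then show ?case by simp
next
  case (Cons i "is")
  let ?\<sigma> = "\<sigma>(y i \<mapsto> Q i)"
  have cl: "closed_sub ?\<sigma>" by (rule closed_sub_upd[OF Cons.prems(1,4)])
  have N: "reds S (subst \<sigma> (N i)) (Bang (Q i))" by (rule Cons.prems(2)) (simp_all add: Cons.prems(1))
  have "evals S (subst ?\<sigma> (foldr (\<lambda>i. let_tm (PBang (y i)) (N i)) is M)) P \<theta> G"
  proof (rule Cons.IH[OF cl, where X = "insert (y i) X"])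
    show "reds S (subst \<sigma>' (N j)) (Bang (Q j))"
      if "j \<in> set is" "closed_sub \<sigma>'" "\<forall>v\<in>insert (y i) X. \<sigma>' v = ?\<sigma> v" for j \<sigma>'
      by (rule Cons.prems(2)) (use that Cons.prems(6) in auto)
    show "evals S (subst \<sigma>' M) P \<theta> G"
      if "closed_sub \<sigma>'" "\<forall>v\<in>insert (y i) X. \<sigma>' v = ?\<sigma> v" "\<forall>j\<in>set is. \<sigma>' (y j) = Some (Q j)" for \<sigma>'
      by (rule Cons.prems(3)) (use that Cons.prems(6) in auto)
    show "fv (Q i) = {}" for i by (rule Cons.prems(4))
  qed (use Cons.prems(5,6) in auto)
  moreover have "reds S (subst \<sigma> (let_tm (PBang (y i)) (N i) (foldr (\<lambda>i. let_tm (PBang (y i)) (N i)) is M)))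
      (subst (\<sigma> ++ map_of (bind (PBang (y i)) (Bang (Q i)))) (foldr (\<lambda>i. let_tm (PBang (y i)) (N i)) is M))"
    by (rule reds_let[OF Cons.prems(1) N]) (simp_all add: Cons.prems(4))
  ultimately show ?case by (auto intro: evals_reds)
qed

lemma subst_foldl_Plus:
  "subst \<sigma> (foldl (\<lambda>P N. App Plus (WPair P N)) M Ms) =
     foldl (\<lambda>P N. App Plus (WPair P N)) (subst \<sigma> M) (map (subst \<sigma>) Ms)"
  by (induction Ms arbitrary: M) auto

lemma subst_sum_tm: "Ms \<noteq> [] \<Longrightarrow> subst \<sigma> (sum_tm Ms) = sum_tm (map (subst \<sigma>) Ms)"
  by (cases Ms) (auto simp: subst_foldl_Plus)

lemma fv_foldl_Plus:
  "fv (foldl (\<lambda>P N. App Plus (WPair P N)) M Ms) = fv M \<union> (\<Union>N\<in>set Ms. fv N)"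
  by (induction Ms arbitrary: M) auto

lemma fv_sum_tm: "Ms \<noteq> [] \<Longrightarrow> fv (sum_tm Ms) = (\<Union>N\<in>set Ms. fv N)"
  by (cases Ms) (auto simp: fv_foldl_Plus)

lemma evals_fwd_Fn:
  fixes S :: "'f signat"
  assumes wf: "wf_signat S" and xs: "length xs = arity S f" "\<forall>x\<in>set xs. \<exists>r. \<pi> x = Num r"
    and cl: "closed_sub \<sigma>" and \<sigma>: "\<forall>x\<in>set xs. \<sigma> (pv x) = Some (\<pi> x)"
    and dist: "distinct \<theta>" and \<theta>: "set \<theta> = pv ` set xs"
  shows "evals S (subst \<sigma> (fwd S \<theta> (deltaB (BFn f xs)))) (pval S \<pi> (BFn f xs)) \<theta>
     (\<lambda>\<rho> T. T = tval S \<pi> (\<lambda>x. \<rho> (pv x)) (BFn f xs))"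
proof -
  define vs where "vs = map pv xs"
  define M :: "'f tm" where "M = tensor_tm (map (\<lambda>x. Bang (V x)) vs)"
  define n where "n = length xs"
  define m where "m = fresh_index (vidx ` set vs)"
  define y where "y = (\<lambda>i. Var (m + i) TReal)"
  define us where "us = vars_from (m + n) (map (tL \<circ> vty) \<theta>)"
  define u where "u = (\<lambda>x. V (lookup \<theta> us x) :: 'f tm)"
  define Ms where "Ms = map (\<lambda>i. App (App Times (V (y i))) (u (vs ! i))) [0..<n]"
  have n: "0 < n" "length vs = n" "n = arity S f"
    using wf_signat_arity[OF wf, of f] xs(1) by (simp_all add: n_def vs_def)
  have vs: "vs \<noteq> []" "set vs = set \<theta>" using n \<theta> by (auto simp: vs_def)
  have vsi: "vs ! i \<in> set \<theta>" if "i < n" for i using vs(2) n(2) that by (metis nth_mem)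
  have Ms: "Ms \<noteq> []" using n by (simp add: Ms_def)
  have M: "deltaB (BFn f xs) = App (Fn f) M" by (simp add: M_def vs_def comp_def)
  have args: "arg_vars M = vs" unfolding M_def by (rule arg_vars_tensor[OF vs(1)])
  have fwd: "fwd S \<theta> (deltaB (BFn f xs)) = foldr (\<lambda>i. let_tm (PBang (y i)) (App (Fn (part S f i)) M)) [0..<n]
           (Pair (App (Fn f) M) (sec_tm (tuple_lam (m + n) us (sum_tm Ms))))"
    by (simp only: M fwd.simps Let_def args n(2) m_def y_def us_def
        u_def Ms_def)
  let ?r = "\<lambda>x. the_num (\<pi> x)"
  define r' where "r' = (\<lambda>v. ?r (inv pv v))"
  have r': "r' (pv x) = ?r x" for x by (simp add: r'_def inv_f_f inj_def)
  have map_r': "map r' vs = map ?r xs" by (simp add: vs_def r')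
  have num: "\<pi> x = Num (?r x)" if "x \<in> set xs" for x using xs(2) that by force
  have \<sigma>v: "\<sigma> v = Some (Num (r' v))" if "v \<in> set vs" for v
  proof -
    from that obtain x where "v = pv x" "x \<in> set xs" by (auto simp: vs_def)
    then show ?thesis using \<sigma> num by (simp add: r')
  qed
  define Q :: "nat \<Rightarrow> 'f tm" where "Q = (\<lambda>i. Num (den S (part S f i) (map ?r xs)))"
  have lt: "vidx v < m" if "v \<in> set vs" for v
    unfolding m_def by (rule fresh_index_gt) (use that in auto)
  have us: "lookup \<theta> us w \<in> set us" if "w \<in> set \<theta>" for w
    by (rule lookup_in) (use that in \<open>auto simp: us_def\<close>)
  show ?thesis unfolding fwd
  proof (rule evals_foldr_let_bang[OF cl, where X = "set vs" and Q = Q])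
    show "reds S (subst \<sigma>' (App (Fn (part S f i)) M)) (Bang (Q i))"
      if "i \<in> set [0..<n]" "closed_sub \<sigma>'" "\<forall>v\<in>set vs. \<sigma>' v = \<sigma> v" for i \<sigma>'
      unfolding M_def Q_def map_r'[symmetric]
      by (rule reds_Fn_args) (use that n wf_signat_arity_part[OF wf, of i f] \<sigma>v in auto)
    show "evals S (subst \<sigma>' (Pair (App (Fn f) M) (sec_tm (tuple_lam (m + n) us (sum_tm Ms)))))
        (pval S \<pi> (BFn f xs)) \<theta> (\<lambda>\<rho> T. T = tval S \<pi> (\<lambda>x. \<rho> (pv x)) (BFn f xs))"
      if cl': "closed_sub \<sigma>'" and \<sigma>': "\<forall>v\<in>set vs. \<sigma>' v = \<sigma> v" "\<forall>i\<in>set [0..<n]. \<sigma>' (y i) = Some (Q i)" for \<sigma>'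
    proof -
      have "reds S (subst \<sigma>' (App (Fn f) M)) (Bang (Num (den S f (map r' vs))))"
        unfolding M_def by (rule reds_Fn_args) (use n \<sigma>' \<sigma>v in auto)
      \<comment> \<open>The first component is still an application of \<open>f\<close>; once it is
        reduced, the pair has the shape \<open>dual_tm\<close> expected by
        \<open>evals_dual\<close>.\<close>
      then have red: "reds S (subst \<sigma>' (Pair (App (Fn f) M) (sec_tm (tuple_lam (m + n) us (sum_tm Ms)))))
          (subst \<sigma>' (dual_tm (Num (den S f (map ?r xs))) (tuple_lam (m + n) us (sum_tm Ms))))"
        unfolding map_r' subst_dual_tm sec_tm_def subst.simps(5,6,7,9) by (rule reds_Pair[OF _ reds_refl])
      show ?thesis
      proof (rule evals_reds[OF red], rule evals_dual[OF cl' _ _ dist us_def])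
        show "fv (sum_tm Ms) \<subseteq> dom \<sigma>' \<union> set us"
          unfolding fv_sum_tm[OF Ms] using \<sigma>'(2) us vsi by (auto simp: Ms_def u_def)
        fix \<rho> T \<tau>
        assume \<rho>: "\<forall>w\<in>set \<theta>. fv (\<rho> w) = {}" and T: "T = tval S \<pi> (\<lambda>x. \<rho> (pv x)) (BFn f xs)"
          and \<tau>: "\<And>w. w \<in> set \<theta> \<Longrightarrow> \<tau> (lookup \<theta> us w) = Some (\<rho> w)"
            "\<And>v. vidx v < m + n \<Longrightarrow> \<tau> v = \<sigma>' v"
        have "subst \<tau> (App (App Times (V (y i))) (u (vs ! i))) = App (App Times (Q i)) (\<rho> (pv (xs ! i)))"
          if i: "i < n" for i
        proof -
          have "\<tau> (y i) = Some (Q i)" using \<tau>(2)[of "y i"] \<sigma>'(2) i by (simp add: y_def)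
          moreover have "vs ! i = pv (xs ! i)" using i by (simp add: vs_def n_def)
          ultimately show ?thesis using \<tau>(1)[OF vsi[OF i]] by (simp add: u_def)
        qed
        then have eq: "map (subst \<tau>) Ms = map (\<lambda>i. App (App Times (Q i)) (\<rho> (pv (xs ! i)))) [0..<n]"
          unfolding Ms_def map_map comp_def by (intro map_cong refl) simp
        have "subst \<tau> (sum_tm Ms) = T"
          unfolding subst_sum_tm[OF Ms] eq T by (simp add: Q_def n_def)
        moreover have "fv T = {}"
        proof -
          have "map (\<lambda>i. App (App Times (Q i)) (\<rho> (pv (xs ! i)))) [0..<n] \<noteq> []" using n(1) by simp
          from fv_sum_tm[OF this] have "fv (sum_tm (map (\<lambda>i. App (App Times (Q i)) (\<rho> (pv (xs ! i)))) [0..<n])) =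
              (\<Union>i<n. fv (\<rho> (pv (xs ! i))))"
            by (auto simp: Q_def)
          also have "\<dots> = {}" using \<rho> \<theta> by (simp add: n_def)
          finally show ?thesis unfolding T by (simp add: Q_def n_def)
        qed
        ultimately show "fv T = {} \<and> beta_eq S (subst \<tau> (sum_tm Ms)) T" by simp
      qed simp_all
    qed
    show "distinct (map y [0..<n])" by (simp add: distinct_map inj_on_def y_def)
    show "y ` set [0..<n] \<inter> set vs = {}" using lt by (force simp: y_def)
  qed (simp add: Q_def)
qed

lemma evals_fwd:
  fixes S :: "'f signat"
  shows "btyping S \<Gamma> e \<tau> \<Longrightarrow> wf_signat S \<Longrightarrow> \<forall>x\<in>\<Gamma>. canonical (plty x) (\<pi> x) \<Longrightarrow>
    closed_sub \<sigma> \<Longrightarrow> \<forall>x\<in>\<Gamma>. \<sigma> (pv x) = Some (\<pi> x) \<Longrightarrow> distinct \<theta> \<Longrightarrow> set \<theta> = pv ` \<Gamma> \<Longrightarrow>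
    evals S (subst \<sigma> (fwd S \<theta> (deltaB e))) (pval S \<pi> e) \<theta> (\<lambda>\<rho> T. T = tval S \<pi> (\<lambda>x. \<rho> (pv x)) e)"
proof (induction arbitrary: \<pi> \<sigma> \<theta> rule: btyping.induct)
  case (bt_Var x)
  then have "length \<theta> = 1" by (metis card_insert_disjoint card.empty distinct_card empty_iff finite.emptyI
        image_empty image_insert One_nat_def)
  then have \<theta>: "\<theta> = [pv x]" using bt_Var.prems(6) by (cases \<theta>) auto
  \<comment> \<open>A one-element tuple is its component, so \<open>\<lambda>u. u\<close> is the
    tuple abstraction over the singleton \<open>\<theta>\<close>, starting at index 0.\<close>
  define us where "us = vars_from 0 (map (tL \<circ> vty) \<theta>)"
  have us: "us = [Var 0 (tL (vty (pv x)))]" by (simp add: us_def \<theta> vars_from_def)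
  have "evals S (subst \<sigma> (dual_tm (V (pv x)) (tuple_lam 0 us (V (lookup \<theta> us (pv x)))))) (\<pi> x) \<theta>
      (\<lambda>\<rho> T. T = \<rho> (pv x))"
  proof (rule evals_dual[OF bt_Var.prems(3) _ _ bt_Var.prems(5) us_def])
    show "fv (\<pi> x) = {}" using bt_Var.prems(3,4) by (auto dest: closed_subD)
    show "fv (V (lookup \<theta> us (pv x))) \<subseteq> dom \<sigma> \<union> set us" by (simp add: lookup_def us \<theta>)
  qed (use bt_Var.prems(4) in \<open>auto simp: \<theta>\<close>)
  then show ?case by (simp add: Let_def us \<theta> lookup_def tuple_lam_def)
next
  case (bt_Let \<Gamma>\<^sub>1 e\<^sub>1 x \<Gamma>\<^sub>2 e\<^sub>2 \<tau>)
  let ?P = "pval S \<pi> e\<^sub>1"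
  let ?\<pi> = "\<pi>(x := ?P)"
  note f1 = btyping_fv[OF bt_Let.hyps(1)] and f2 = btyping_fv[OF bt_Let.hyps(2)]
  have "canonical (plty x) ?P"
    by (rule canonical_pval[OF bt_Let.hyps(1)]) (use bt_Let.prems(2) in simp)
  then have c2: "\<forall>z\<in>insert x \<Gamma>\<^sub>2. canonical (plty z) (?\<pi> z)" using bt_Let.prems(2) by simp
  have "evals S (subst \<sigma> (fwd S \<theta> (let_tm (PBang (pv x)) (deltaB e\<^sub>1) (deltaB e\<^sub>2)))) (pval S ?\<pi> e\<^sub>2) \<theta>
    (\<lambda>\<rho> T. \<exists>T\<^sub>1. T\<^sub>1 = tval S \<pi> (\<lambda>x. \<rho> (pv x)) e\<^sub>1 \<and>
       T = tval S ?\<pi> (\<lambda>z. (\<rho>(pv x := T\<^sub>1)) (pv z)) e\<^sub>2)"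
  proof (rule evals_fwd_let[OF bt_Let.prems(3,5)])
    show "set \<theta> = fv (deltaB e\<^sub>1) \<union> (fv (deltaB e\<^sub>2) - {pv x})"
      unfolding f1 f2 pv_image_diff bt_Let.prems(6) using bt_Let.hyps(3) by (simp add: image_Un)
    show "finite (fv (deltaB e\<^sub>2))" "finite (fv (deltaB e\<^sub>1))"
      unfolding f1 f2 using btyping_finite bt_Let.hyps(1,2) by blast+
    show "evals S (subst \<sigma> (fwd S \<theta>' (deltaB e\<^sub>1))) ?P \<theta>' (\<lambda>\<rho> T. T = tval S \<pi> (\<lambda>x. \<rho> (pv x)) e\<^sub>1)"
      if "distinct \<theta>'" "set \<theta>' = fv (deltaB e\<^sub>1)" for \<theta>'
      by (rule bt_Let.IH(1)[OF bt_Let.prems(1) _ bt_Let.prems(3) _ that(1)])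
        (use bt_Let.prems(2,4) that(2) f1 in auto)
    show "evals S (subst \<sigma>' (fwd S \<theta>' (deltaB e\<^sub>2))) (pval S ?\<pi> e\<^sub>2) \<theta>' (\<lambda>\<rho> T. T = tval S ?\<pi> (\<lambda>z. \<rho> (pv z)) e\<^sub>2)"
      if "closed_sub \<sigma>'" "\<sigma>' (pv x) = Some ?P" "\<forall>v\<in>fv (deltaB e\<^sub>2) - {pv x}. \<sigma>' v = \<sigma> v"
        "distinct \<theta>'" "set \<theta>' = fv (deltaB e\<^sub>2)" for \<sigma>' \<theta>'
    proof (rule bt_Let.IH(2)[OF bt_Let.prems(1) c2 that(1) _ that(4)])
      show "set \<theta>' = pv ` insert x \<Gamma>\<^sub>2" using that(5) f2 by simp
      show "\<forall>z\<in>insert x \<Gamma>\<^sub>2. \<sigma>' (pv z) = Some (?\<pi> z)"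
      proof
        fix z assume z: "z \<in> insert x \<Gamma>\<^sub>2"
        show "\<sigma>' (pv z) = Some (?\<pi> z)"
        proof (cases "z = x")
          case False
          then have "pv z \<in> fv (deltaB e\<^sub>2) - {pv x}" using z unfolding f2 by simp
          then show ?thesis using that(3) bt_Let.prems(4) False z by simp
        qed (simp add: that(2))
      qed
    qed
  qed
  \<comment> \<open>Since \<open>pv\<close> is injective, updating at \<open>pv x\<close> and then
    reading through \<open>pv\<close> amounts to updating at \<open>x\<close>.\<close>
  moreover have "(\<lambda>z. (\<rho>(pv x := T)) (pv z)) = (\<lambda>z. \<rho> (pv z))(x := T)" for \<rho> :: "var \<Rightarrow> 'f tm" and T
    by (rule ext) simp
  ultimately show ?case by (simp only: deltaB.simps pval.simps tval.simps) simp
next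
  case (bt_Num r)
  then have "\<theta> = []" by simp
  then show ?case using evals_const[OF bt_Num.prems(3), of "Num r" "Num r" "Num 0"] by simp
next
  case (bt_Fn xs f)
  show ?case
    by (rule evals_fwd_Fn[OF bt_Fn.prems(1) bt_Fn.hyps(1) _ bt_Fn.prems(3,4,5,6)])
      (use bt_Fn in \<open>auto simp: canonical_def\<close>)
next
  case (bt_Drop \<Gamma> e \<tau>)
  let ?x = "Var 0 (pT (fst (ety (desugar e))))"
  note f = btyping_fv[OF bt_Drop.hyps]
  \<comment> \<open>Dropping is a let whose body \<open>!()\<close> has no free variable, so the
    bound index 0 cannot capture anything; the map for \<open>e\<close> is bound but never
    applied.\<close>
  have "evals S (subst \<sigma> (fwd S \<theta> (let_tm (PBang ?x) (deltaB e) (Bang Unit)))) Unit \<theta>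
    (\<lambda>\<rho> T. \<exists>T\<^sub>1. T\<^sub>1 = tval S \<pi> (\<lambda>x. \<rho> (pv x)) e \<and> T = Empty)"
  proof (rule evals_fwd_let[OF bt_Drop.prems(3,5)])
    show "set \<theta> = fv (deltaB e) \<union> (fv (Bang Unit) - {?x})" using bt_Drop.prems(6) f by simp
    show "finite (fv (Bang Unit))" "finite (fv (deltaB e))"
      unfolding f using btyping_finite[OF bt_Drop.hyps] by simp_all
    show "evals S (subst \<sigma> (fwd S \<theta>' (deltaB e))) (pval S \<pi> e) \<theta>' (\<lambda>\<rho> T. T = tval S \<pi> (\<lambda>x. \<rho> (pv x)) e)"
      if "distinct \<theta>'" "set \<theta>' = fv (deltaB e)" for \<theta>'
      by (rule bt_Drop.IH[OF bt_Drop.prems(1,2,3,4) that(1)]) (use that(2) f in simp)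
    show "evals S (subst \<sigma>' (fwd S \<theta>' (Bang Unit))) Unit \<theta>' (\<lambda>\<rho> T. T = Empty)"
      if "closed_sub \<sigma>'" "set \<theta>' = fv (Bang Unit)" for \<sigma>' \<theta>'
      using evals_const[OF that(1), of Unit Unit Empty] that(2) by simp
  qed
  then show ?case by simp
next
  case bt_Unit
  then have "\<theta> = []" by simp
  then show ?case using evals_const[OF bt_Unit.prems(3), of Unit Unit Empty] by simp
next
  case (bt_LetUnit \<Gamma> e \<tau> z)
  note f = btyping_fv[OF bt_LetUnit.hyps(1)]
  have z: "\<sigma> (pv z) = Some Unit"
    using bt_LetUnit.prems(2,4) bt_LetUnit.hyps(2) by (simp add: canonical_def)
  have "evals S (subst \<sigma> (fwd S \<theta> (let_tm PUnit (V (pv z)) (deltaB e)))) (pval S \<pi> e) \<theta>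
      (\<lambda>\<rho> T. T = tval S \<pi> (\<lambda>x. \<rho> (pv x)) e)"
  proof (rule evals_fwd_let_unit[OF bt_LetUnit.prems(3,5) _ z])
    show "fv (deltaB e) \<subseteq> set \<theta>" unfolding f bt_LetUnit.prems(6) by auto
    show "evals S (subst \<sigma> (fwd S \<theta>' (deltaB e))) (pval S \<pi> e) \<theta>' (\<lambda>\<rho> T. T = tval S \<pi> (\<lambda>x. \<rho> (pv x)) e)"
      if "distinct \<theta>'" "set \<theta>' = fv (deltaB e)" for \<theta>'
      by (rule bt_LetUnit.IH[OF bt_LetUnit.prems(1) _ bt_LetUnit.prems(3) _ that(1)])
        (use that(2) f bt_LetUnit.prems(2,4) in auto)
  qed
  then show ?case by simp
qed

section \<open>Logical equivalence\<close>

text \<open>The clauses for \<open>Tensor\<close> and \<open>OfCourse\<close> are existential in the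
  reducts, and those for \<open>TWith\<close> and \<open>Lolli\<close> only put the terms in
  argument or function position, which reduction respects.\<close>

lemma leq_reds: "reds S M M' \<Longrightarrow> reds S N N' \<Longrightarrow> leq S A M' N' \<Longrightarrow> leq S A M N"
proof (induction A arbitrary: M M' N N')
  case TReal
  then show ?case by (auto dest!: reds_beta_eq) (meson beta_eq_sym beta_eq_trans)
next
  case TOne
  then show ?case by (auto dest!: reds_beta_eq) (meson beta_eq_sym beta_eq_trans)
next
  case (Lolli A B)
  show ?case unfolding leq.simps
  proof (intro allI impI)
    fix P Q assume PQ: "typing S {} P A \<and> typing S {} Q A \<and> leq S A P Q"
    show "leq S B (App M P) (App N Q)"
      by (rule Lolli.IH(2)[OF reds_App[OF Lolli.prems(1) reds_refl] reds_App[OF Lolli.prems(2) reds_refl]])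
        (use Lolli.prems(3) PQ in simp)
  qed
next
  case (Tensor A B)
  then show ?case unfolding leq.simps by (meson reds_trans)
next
  case (OfCourse A)
  then show ?case unfolding leq.simps by (meson reds_trans)
next
  case (TWith A B)
  have "leq S A (App (proj1 A B) M) (App (proj1 A B) N)"
    by (rule TWith.IH(1)[OF reds_App[OF reds_refl TWith.prems(1)] reds_App[OF reds_refl TWith.prems(2)]])
      (use TWith.prems(3) in simp)
  moreover have "leq S B (App (proj2 A B) M) (App (proj2 A B) N)"
    by (rule TWith.IH(2)[OF reds_App[OF reds_refl TWith.prems(1)] reds_App[OF reds_refl TWith.prems(2)]])
      (use TWith.prems(3) in simp)
  ultimately show ?case by simp
qed simp

text \<open>The types of tangents and of tuples of tangents. No clause of \<open>leq\<close> at
  these types asks for a reduct of a given shape.\<close>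

fun additive_ty :: "ty \<Rightarrow> bool" where
  "additive_ty TReal = True"
| "additive_ty TTop = True"
| "additive_ty (TWith A B) = (additive_ty A \<and> additive_ty B)"
| "additive_ty _ = False"

lemma additive_tT [simp]: "additive_ty (tT \<tau>)"
  by (induction \<tau>) auto

text \<open>Conversion may be used in both directions here, since \<open>leq\<close> comes down to
  conversion at \<real>. At \<open>Tensor\<close> or \<open>OfCourse\<close> one would have to know
  that convertible terms reach pairs or boxes together.\<close>

lemma leq_beta_eq:
  "additive_ty A \<Longrightarrow> beta_eq S M M' \<Longrightarrow> beta_eq S N N' \<Longrightarrow> leq S A M' N' \<Longrightarrow> leq S A M N"
proof (induction A arbitrary: M M' N N')
  case TReal
  then show ?case unfolding leq.simps by (meson beta_eq_sym beta_eq_trans)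
next
  case (TWith A B)
  have "leq S A (App (proj1 A B) M) (App (proj1 A B) N)"
    by (rule TWith.IH(1)[OF _ beta_eq_App[OF beta_eq_refl TWith.prems(2)] beta_eq_App[OF beta_eq_refl TWith.prems(3)]])
      (use TWith.prems(1,4) in simp_all)
  moreover have "leq S B (App (proj2 A B) M) (App (proj2 A B) N)"
    by (rule TWith.IH(2)[OF _ beta_eq_App[OF beta_eq_refl TWith.prems(2)] beta_eq_App[OF beta_eq_refl TWith.prems(3)]])
      (use TWith.prems(1,4) in simp_all)
  ultimately show ?case by simp
qed auto

lemma red_proj1: "red S (App (proj1 A B) (WPair M N)) M"
  using red_beta[of "PWith (PVar (Var 0 A)) (PVar (Var 1 B))" "WPair M N" "V (Var 0 A)" S]
  by (simp add: proj1_def)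

lemma red_proj2: "red S (App (proj2 A B) (WPair M N)) N"
  using red_beta[of "PWith (PVar (Var 0 A)) (PVar (Var 1 B))" "WPair M N" "V (Var 1 B)" S]
  by (simp add: proj2_def)

lemma beta_eq_proj1: "beta_eq S M (App (proj1 A B) (WPair M N))"
  by (rule beta_eq_sym[OF reds_beta_eq[OF red_reds[OF red_proj1]]])

lemma beta_eq_proj2: "beta_eq S N (App (proj2 A B) (WPair M N))"
  by (rule beta_eq_sym[OF reds_beta_eq[OF red_reds[OF red_proj2]]])

lemma additive_with_ty: "\<forall>A\<in>set As. additive_ty A \<Longrightarrow> additive_ty (with_ty As)"
  by (induction As rule: with_ty.induct) auto

text \<open>Passing from the projections of a literal tuple to its components contracts a redex
  inside \<open>leq\<close>, which the restriction to additive types makes possible.\<close>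

lemma leq_with_tm:
  "length Ms = length As \<Longrightarrow> length Ns = length As \<Longrightarrow> \<forall>A\<in>set As. additive_ty A \<Longrightarrow>
     leq S (with_ty As) (with_tm Ms) (with_tm Ns) \<Longrightarrow> i < length As \<Longrightarrow> leq S (As ! i) (Ms ! i) (Ns ! i)"
proof (induction As arbitrary: Ms Ns i rule: with_ty.induct)
  case 1
  then show ?case by simp
next
  case (2 A)
  then show ?case by (cases Ms; cases Ns) auto
next
  case (3 A B As)
  obtain M Ms' N Ns' where *: "Ms = M # Ms'" "Ns = N # Ns'" "length Ms' = length (B # As)"
    "length Ns' = length (B # As)"
    using 3(2,3) by (cases Ms; cases Ns) auto
  have w: "with_tm Ms = WPair M (with_tm Ms')" "with_tm Ns = WPair N (with_tm Ns')"
    using * by (cases Ms'; cases Ns'; simp)+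
  let ?C = "with_ty (B # As)"
  have l: "leq S A (App (proj1 A ?C) (WPair M (with_tm Ms'))) (App (proj1 A ?C) (WPair N (with_tm Ns')))"
    "leq S ?C (App (proj2 A ?C) (WPair M (with_tm Ms'))) (App (proj2 A ?C) (WPair N (with_tm Ns')))"
    using 3(5) unfolding w by simp_all
  have "leq S A M N"
    by (rule leq_beta_eq[OF _ beta_eq_proj1 beta_eq_proj1 l(1)]) (use 3(4) in simp)
  moreover have "leq S ?C (with_tm Ms') (with_tm Ns')"
    by (rule leq_beta_eq[OF _ beta_eq_proj2 beta_eq_proj2 l(2)])
      (use 3(4) additive_with_ty[of "B # As"] in simp)
  then have "leq S ((B # As) ! j) (Ms' ! j) (Ns' ! j)" if "j < length (B # As)" for j
    using 3(1)[OF *(3,4)] 3(4) that by simp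
  ultimately show ?case using 3(6) unfolding *(1,2) by (cases i) auto
qed

text \<open>Only the spine of the tuple is produced; a single component is left as it is.\<close>

lemma computable_with_ty:
  "computable S (with_ty As) M \<Longrightarrow> \<exists>Ms. length Ms = length As \<and> reds S M (with_tm Ms)"
proof (induction As arbitrary: M rule: with_ty.induct)
  case 1
  then show ?case by simp
next
  case (2 A)
  then show ?case by (intro exI[of _ "[M]"]) simp
next
  case (3 A B As)
  then obtain M1 M2 where M: "reds S M (WPair M1 M2)" "computable S (with_ty (B # As)) M2" by auto
  from 3(1)[OF M(2)] obtain Ms where Ms: "length Ms = length (B # As)" "reds S M2 (with_tm Ms)" by blast
  have "reds S M (WPair M1 (with_tm Ms))"
    using M(1) reds_WPair[OF reds_refl Ms(2)] by (rule reds_trans)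
  moreover have "WPair M1 (with_tm Ms) = with_tm (M1 # Ms)" using Ms(1) by (cases Ms) auto
  ultimately show ?case using Ms(1) by (intro exI[of _ "M1 # Ms"]) simp
qed

text \<open>Conversion is a congruence, so both sides can be unboxed by applying
  \<open>\<lambda>!x. x\<close> to them.\<close>

lemma beta_eq_Bang_inv: "beta_eq S (Bang M) (Bang N) \<Longrightarrow> beta_eq S M N"
proof -
  assume MN: "beta_eq S (Bang M) (Bang N)"
  \<comment> \<open>Reduction ignores types, so the type of the bound variable is arbitrary.\<close>
  let ?I = "Lam (PBang (Var 0 TOne)) (V (Var 0 TOne))"
  have I: "beta_eq S (App ?I (Bang M)) M" for M
    using red_beta[of "PBang (Var 0 TOne)" "Bang M" "V (Var 0 TOne)" S]
    by (intro reds_beta_eq red_reds) simp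
  show ?thesis
    using beta_eq_trans[OF beta_eq_sym[OF I] beta_eq_trans[OF beta_eq_App[OF beta_eq_refl MN] I]] .
qed

lemma beta_eq_tensor_tm: "list_all2 (beta_eq S) Ms Ns \<Longrightarrow> beta_eq S (tensor_tm Ms) (tensor_tm Ns)"
proof (induction rule: list_all2_induct)
  case (Cons M Ms N Ns)
  then show ?case by (cases Ms; cases Ns) (auto intro: beta_eq_Pair)
qed simp

lemma beta_eq_Num_den:
  assumes "length rs = arity S f" "list_all2 (\<lambda>r s. beta_eq S (Num r) (Num s)) rs ss"
  shows "beta_eq S (Num (den S f rs)) (Num (den S f ss))"
proof -
  let ?t = "\<lambda>rs. tensor_tm (map (\<lambda>r. Bang (Num r)) rs)"
  have len: "length ss = arity S f" using assms list_all2_lengthD by metis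
  have F: "beta_eq S (App (Fn f) (?t rs)) (Bang (Num (den S f rs)))" if "length rs = arity S f" for rs
    by (intro reds_beta_eq red_reds red_Fn that)
  have "list_all2 (beta_eq S) (map (\<lambda>r. Bang (Num r)) rs) (map (\<lambda>r. Bang (Num r)) ss)"
    using assms(2) by (simp add: list_all2_conv_all_nth beta_eq_Bang)
  from beta_eq_App[OF beta_eq_refl beta_eq_tensor_tm[OF this]]
  have "beta_eq S (App (Fn f) (?t rs)) (App (Fn f) (?t ss))" .
  from beta_eq_trans[OF beta_eq_sym[OF F[OF assms(1)]] beta_eq_trans[OF this F[OF len]]]
  show ?thesis by (rule beta_eq_Bang_inv)
qed

lemma beta_eq_sum_tm:
  assumes "list_all2 (beta_eq S) Ms Ns" "Ms \<noteq> []"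
  shows "beta_eq S (sum_tm Ms) (sum_tm Ns)"
proof -
  have "list_all2 (beta_eq S) Ms Ns \<Longrightarrow> beta_eq S M N \<Longrightarrow>
      beta_eq S (foldl (\<lambda>P N. App Plus (WPair P N)) M Ms) (foldl (\<lambda>P N. App Plus (WPair P N)) N Ns)" for M N Ms Ns
  proof (induction arbitrary: M N rule: list_all2_induct)
    case (Cons A As B Bs)
    have "beta_eq S (App Plus (WPair M A)) (App Plus (WPair N B))"
      by (intro beta_eq_App beta_eq_WPair beta_eq_refl Cons)
    from Cons.IH[OF this] show ?case by simp
  qed simp
  with assms show ?thesis by (cases Ms; cases Ns) auto
qed

lemma beta_eq_num_args:
  assumes "\<forall>x\<in>set xs. plty x = LReal" "\<forall>x\<in>set xs. canonical (plty x) (\<pi> x)"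
    "\<forall>x\<in>set xs. canonical (plty x) (\<pi>' x)" "\<forall>x\<in>set xs. leq S (pT (plty x)) (\<pi> x) (\<pi>' x)"
  shows "list_all2 (\<lambda>r s. beta_eq S (Num r) (Num s)) (map (\<lambda>x. the_num (\<pi> x)) xs) (map (\<lambda>x. the_num (\<pi>' x)) xs)"
proof -
  have "beta_eq S (Num (the_num (\<pi> x))) (Num (the_num (\<pi>' x)))" if x: "x \<in> set xs" for x
  proof -
    have "\<exists>r. \<pi> x = Num r" "\<exists>r. \<pi>' x = Num r" using assms(1-3) x by (auto simp: canonical_def)
    then obtain r s where "\<pi> x = Num r" "\<pi>' x = Num s" by blast
    moreover have "beta_eq S (\<pi> x) (\<pi>' x)" using assms(1,4) x by auto
    ultimately show ?thesis by simp
  qed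
  then show ?thesis by (simp add: list_all2_conv_all_nth)
qed

text \<open>For canonical values at \<real> relatedness is convertibility of numerals, which
  \<open>beta_eq_Num_den\<close> carries through each function symbol; elsewhere values are only
  moved around.\<close>

lemma leq_pval:
  "btyping S \<Gamma> e \<tau> \<Longrightarrow> \<forall>x\<in>\<Gamma>. canonical (plty x) (\<pi> x) \<Longrightarrow> \<forall>x\<in>\<Gamma>. canonical (plty x) (\<pi>' x) \<Longrightarrow>
     \<forall>x\<in>\<Gamma>. leq S (pT (plty x)) (\<pi> x) (\<pi>' x) \<Longrightarrow> leq S (pT \<tau>) (pval S \<pi> e) (pval S \<pi>' e)"
proof (induction arbitrary: \<pi> \<pi>' rule: btyping.induct)
  case (bt_Let \<Gamma>\<^sub>1 e\<^sub>1 x \<Gamma>\<^sub>2 e\<^sub>2 \<tau>)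
  let ?P = "pval S \<pi> e\<^sub>1" and ?P' = "pval S \<pi>' e\<^sub>1"
  have "canonical (plty x) ?P" "canonical (plty x) ?P'"
    by (rule canonical_pval[OF bt_Let.hyps(1)], use bt_Let.prems in simp)+
  moreover have "leq S (pT (plty x)) ?P ?P'"
    by (rule bt_Let.IH(1)) (use bt_Let.prems in simp_all)
  ultimately have "leq S (pT \<tau>) (pval S (\<pi>(x := ?P)) e\<^sub>2) (pval S (\<pi>'(x := ?P')) e\<^sub>2)"
    by (intro bt_Let.IH(2)) (use bt_Let.prems in simp_all)
  then show ?case by simp
next
  case (bt_Fn xs f)
  have "beta_eq S (Num (den S f (map (\<lambda>x. the_num (\<pi> x)) xs))) (Num (den S f (map (\<lambda>x. the_num (\<pi>' x)) xs)))"
    by (rule beta_eq_Num_den[OF _ beta_eq_num_args]) (use bt_Fn in auto)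
  then show ?case by simp
qed auto

text \<open>Both the coefficients, which depend on the point, and the directions vary. They meet in
  the products at a function symbol, where everything is real and conversion is a
  congruence.\<close>

lemma leq_tval:
  "btyping S \<Gamma> e \<tau> \<Longrightarrow> wf_signat S \<Longrightarrow> \<forall>x\<in>\<Gamma>. canonical (plty x) (\<pi> x) \<Longrightarrow> \<forall>x\<in>\<Gamma>. canonical (plty x) (\<pi>' x) \<Longrightarrow>
     \<forall>x\<in>\<Gamma>. leq S (pT (plty x)) (\<pi> x) (\<pi>' x) \<Longrightarrow> \<forall>x\<in>\<Gamma>. leq S (tT (plty x)) (\<rho> x) (\<rho>' x) \<Longrightarrow>
     leq S (tT \<tau>) (tval S \<pi> \<rho> e) (tval S \<pi>' \<rho>' e)"
proof (induction arbitrary: \<pi> \<pi>' \<rho> \<rho>' rule: btyping.induct)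
  case (bt_Let \<Gamma>\<^sub>1 e\<^sub>1 x \<Gamma>\<^sub>2 e\<^sub>2 \<tau>)
  let ?P = "pval S \<pi> e\<^sub>1" and ?P' = "pval S \<pi>' e\<^sub>1"
  have "canonical (plty x) ?P" "canonical (plty x) ?P'"
    by (rule canonical_pval[OF bt_Let.hyps(1)], use bt_Let.prems in simp)+
  moreover have "leq S (pT (plty x)) ?P ?P'"
    by (rule leq_pval[OF bt_Let.hyps(1)]) (use bt_Let.prems in simp_all)
  moreover have "leq S (tT (plty x)) (tval S \<pi> \<rho> e\<^sub>1) (tval S \<pi>' \<rho>' e\<^sub>1)"
    by (rule bt_Let.IH(1)) (use bt_Let.prems in simp_all)
  ultimately have "leq S (tT \<tau>) (tval S (\<pi>(x := ?P)) (\<rho>(x := tval S \<pi> \<rho> e\<^sub>1)) e\<^sub>2)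
      (tval S (\<pi>'(x := ?P')) (\<rho>'(x := tval S \<pi>' \<rho>' e\<^sub>1)) e\<^sub>2)"
    by (intro bt_Let.IH(2)) (use bt_Let.prems in simp_all)
  then show ?case by simp
next
  case (bt_Fn xs f)
  let ?Q = "\<lambda>\<pi> i. Num (den S (part S f i) (map (\<lambda>x. the_num (\<pi> x)) xs))"
  let ?Ms = "\<lambda>\<pi> \<rho>. map (\<lambda>i. App (App Times (?Q \<pi> i)) (\<rho> (xs ! i))) [0..<length xs]"
  have n: "0 < length xs" using bt_Fn wf_signat_arity by metis
  have "beta_eq S (App (App Times (?Q \<pi> i)) (\<rho> (xs ! i))) (App (App Times (?Q \<pi>' i)) (\<rho>' (xs ! i)))"
    if i: "i < length xs" for i
  proof (intro beta_eq_App beta_eq_refl)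
    show "beta_eq S (?Q \<pi> i) (?Q \<pi>' i)"
      by (rule beta_eq_Num_den[OF _ beta_eq_num_args])
        (use bt_Fn wf_signat_arity_part[OF bt_Fn.prems(1), of i f] i in auto)
    show "beta_eq S (\<rho> (xs ! i)) (\<rho>' (xs ! i))"
      using bt_Fn.prems(5) bt_Fn.hyps(3) i nth_mem by fastforce
  qed
  then have "list_all2 (beta_eq S) (?Ms \<pi> \<rho>) (?Ms \<pi>' \<rho>')" by (simp add: list_all2_conv_all_nth)
  from beta_eq_sum_tm[OF this] n show ?case by simp
next
  case (bt_LetUnit \<Gamma> e \<tau> z)
  then show ?case by simp
qed auto

text \<open>Reduction is allowed under binders and under \<open>!\<close>, so inputs can be
  normalized inside the terms into which they have been substituted.\<close>

lemma reds_subst_pointwise: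
  "\<forall>x. rel_option (reds S) (\<sigma> x) (\<tau> x) \<Longrightarrow> reds S (subst \<sigma> M) (subst \<tau> M)"
proof (induction M arbitrary: \<sigma> \<tau>)
  case (V x)
  then have "rel_option (reds S) (\<sigma> x) (\<tau> x)" by blast
  then show ?case by (cases rule: option.rel_cases) auto
next
  case (Lam p M)
  have "\<forall>x. rel_option (reds S) ((\<sigma> |` (- pset p)) x) ((\<tau> |` (- pset p)) x)"
    using Lam.prems by (auto simp: restrict_map_def)
  from Lam.IH[OF this] show ?case by (simp add: reds_Lam)
next
  case (Bang M)
  from reds_Bang[OF Bang.IH[OF Bang.prems]] show ?case by simp
next
  case (App M N)
  from reds_App[OF App.IH(1)[OF App.prems] App.IH(2)[OF App.prems]] show ?case by simp
next
  case (Pair M N)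
  from reds_Pair[OF Pair.IH(1)[OF Pair.prems] Pair.IH(2)[OF Pair.prems]] show ?case by simp
next
  case (WPair M N)
  from reds_WPair[OF WPair.IH(1)[OF WPair.prems] WPair.IH(2)[OF WPair.prems]] show ?case by simp
qed simp_all

text \<open>At \<real> the numerals are convertible because the original terms are; at tensor types
  no particular form is asked for and the terms are kept.\<close>

lemma computable_canonical:
  assumes "computable S (pT \<tau>) A" "computable S (pT \<tau>) B" "leq S (pT \<tau>) A B"
  shows "\<exists>P Q. reds S A P \<and> reds S B Q \<and> canonical \<tau> P \<and> canonical \<tau> Q \<and> leq S (pT \<tau>) P Q"
proof (cases \<tau>)
  case LReal
  with assms obtain r s where *: "reds S A (Num r)" "reds S B (Num s)" "beta_eq S A B" by auto
  have "beta_eq S (Num r) (Num s)"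
    using beta_eq_trans[OF beta_eq_sym[OF reds_beta_eq[OF *(1)]] beta_eq_trans[OF *(3) reds_beta_eq[OF *(2)]]] .
  with * LReal show ?thesis by (auto simp: canonical_def)
next
  case LOne
  with assms show ?thesis by (auto simp: canonical_def)
next
  case (LTensor \<tau>1 \<tau>2)
  with assms show ?thesis by (intro exI[of _ A] exI[of _ B]) (simp add: canonical_def del: leq.simps)
qed

text \<open>The pair and the box are reached by reduction, and the linear maps are tested on
  arguments that normalization has turned into literal tuples.\<close>

lemma leq_evals:
  assumes "evals S M P \<theta> G" "evals S N Q \<theta>' G'" "leq S A P Q" "additive_ty C" "\<forall>B\<in>set Bs. additive_ty B"
    and "\<And>Ms Ns. length Ms = length Bs \<Longrightarrow> length Ns = length Bs \<Longrightarrow>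
      \<forall>i<length Bs. leq S (Bs ! i) (Ms ! i) (Ns ! i) \<Longrightarrow> \<forall>K\<in>set Ms \<union> set Ns. fv K = {} \<Longrightarrow>
      \<exists>\<rho> T \<rho>' T'. map \<rho> \<theta> = Ms \<and> G \<rho> T \<and> map \<rho>' \<theta>' = Ns \<and> G' \<rho>' T' \<and> leq S C T T'"
  shows "leq S (Tensor (OfCourse A) (sec_ty (Lolli (with_ty Bs) C))) M N"
proof -
  from assms(1) obtain L where L: "reds S M (Pair (Bang P) (WPair Unit L))" "linear_map S \<theta> L G"
    by (auto simp: evals_def)
  from assms(2) obtain K where K: "reds S N (Pair (Bang Q) (WPair Unit K))" "linear_map S \<theta>' K G'"
    by (auto simp: evals_def)
  have bang: "leq S (OfCourse A) (Bang P) (Bang Q)" using assms(3) by (auto intro: reds_refl)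
  let ?F = "Lolli (with_ty Bs) C"
  have unit: "leq S TOne (App (proj1 TOne ?F) (WPair Unit L)) (App (proj1 TOne ?F) (WPair Unit K))"
    using leq_reds[OF red_reds[OF red_proj1] red_reds[OF red_proj1], of S TOne Unit Unit] by simp
  have "leq S ?F L K" unfolding leq.simps
  proof (intro allI impI, elim conjE)
    fix U W assume UW: "typing S {} U (with_ty Bs)" "typing S {} W (with_ty Bs)" "leq S (with_ty Bs) U W"
    obtain Ms where Ms: "length Ms = length Bs" "reds S U (with_tm Ms)"
      using computable_with_ty[OF typing_closed_computable[OF UW(1)]] by blast
    obtain Ns where Ns: "length Ns = length Bs" "reds S W (with_tm Ns)"
      using computable_with_ty[OF typing_closed_computable[OF UW(2)]] by blast
    \<comment> \<open>Relatedness is known for the arguments before reduction; it passes to their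
      tuples because the type is additive.\<close>
    have "leq S (with_ty Bs) (with_tm Ms) (with_tm Ns)"
      by (rule leq_beta_eq[OF additive_with_ty[OF assms(5)] beta_eq_sym[OF reds_beta_eq[OF Ms(2)]]
            beta_eq_sym[OF reds_beta_eq[OF Ns(2)]] UW(3)])
    then have comp: "\<forall>i<length Bs. leq S (Bs ! i) (Ms ! i) (Ns ! i)"
      using leq_with_tm[OF Ms(1) Ns(1) assms(5)] by blast
    have fv: "fv (with_tm Ms) = {}" "fv (with_tm Ns) = {}"
      using reds_closed[OF Ms(2) typing_closed_fv[OF UW(1)]] reds_closed[OF Ns(2) typing_closed_fv[OF UW(2)]]
      by blast+
    then have cl: "\<forall>K\<in>set Ms \<union> set Ns. fv K = {}" by auto
    from assms(6)[OF Ms(1) Ns(1) comp cl] obtain \<rho> T \<rho>' T' where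
      *: "map \<rho> \<theta> = Ms" "G \<rho> T" "map \<rho>' \<theta>' = Ns" "G' \<rho>' T'" "leq S C T T'" by blast
    have "\<forall>w\<in>set \<theta>. fv (\<rho> w) = {}" "\<forall>w\<in>set \<theta>'. fv (\<rho>' w) = {}"
      using cl unfolding *(1,3)[symmetric] by auto
    then have LT: "beta_eq S (App L (with_tm Ms)) T" and KT: "beta_eq S (App K (with_tm Ns)) T'"
      using linear_mapD[OF L(2) _ *(2)] linear_mapD[OF K(2) _ *(4)] *(1,3) by auto
    show "leq S C (App L U) (App K W)"
    proof (rule leq_beta_eq[OF assms(4) _ _ *(5)])
      show "beta_eq S (App L U) T"
        by (rule beta_eq_trans[OF beta_eq_App[OF beta_eq_refl reds_beta_eq[OF Ms(2)]] LT])
      show "beta_eq S (App K W) T'"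
        by (rule beta_eq_trans[OF beta_eq_App[OF beta_eq_refl reds_beta_eq[OF Ns(2)]] KT])
    qed
  qed
  then have "leq S ?F (App (proj2 TOne ?F) (WPair Unit L)) (App (proj2 TOne ?F) (WPair Unit K))"
    by (rule leq_reds[OF red_reds[OF red_proj2] red_reds[OF red_proj2]])
  with unit have "leq S (sec_ty ?F) (WPair Unit L) (WPair Unit K)" unfolding sec_ty_def leq.simps(6) ..
  with L(1) K(1) bang show ?thesis unfolding leq.simps(3) by blast
qed

lemma assignment_exists:
  assumes "distinct xs" "length Ms = length xs"
  shows "\<exists>\<rho>. map \<rho> xs = Ms"
proof -
  have "map (\<lambda>x. the (map_of (zip xs Ms) x)) xs = Ms"
    using assms by (intro nth_equalityI) (simp_all add: map_of_zip_nth)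
  then show ?thesis by blast
qed

lemma bind_all_bang:
  assumes "distinct xs" "length Ms = length xs"
  shows "bind_all (map PBang xs) (map Bang Ms) = map_of (zip xs Ms)"
proof -
  have "concat (map2 bind (map PBang xs) (map Bang Ms)) = zip xs Ms"
    using assms(2)[symmetric] by (induction xs Ms rule: list_induct2) auto
  then show ?thesis by (simp add: bind_all_def)
qed

lemma value_for_bangs:
  assumes "\<forall>i<length Ws. value_for (PBang (x i)) (Ws ! i)"
  shows "\<exists>As. Ws = map Bang As"
  unfolding ex_map_conv
proof
  fix W assume "W \<in> set Ws"
  then obtain i where "i < length Ws" "Ws ! i = W" unfolding in_set_conv_nth by blast
  then have "value_for (PBang (x i)) W" using assms by blast
  then show "\<exists>A. W = Bang A" by (cases W) simp_all
qed

lemma forward_sound_values: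
  fixes S :: "'f signat"
  assumes wf: "wf_signat S" and bt: "btyping S (set \<theta>) e \<tau>" and dist: "distinct \<theta>"
    and \<phi>: "tangent_names \<phi> (set \<theta>)"
    and len: "length Ws = length \<theta>" "length Ws' = length \<theta>"
    and vals: "\<forall>i<length \<theta>. leq_values S (PBang (pv (\<theta> ! i))) (Ws ! i) (Ws' ! i)"
  shows "leq S (Tensor (OfCourse (pT \<tau>)) (sec_ty (Lolli (with_ty (map (\<lambda>x. tT (plty x)) \<theta>)) (tT \<tau>))))
     (subst (bind_all (map (\<lambda>x. PBang (pv x)) \<theta>) Ws) (fwd S (map pv \<theta>) (deltaB e)))
     (subst (bind_all (map (\<lambda>x. PBang (pv x)) \<theta>) Ws') (delta (map \<phi> \<theta>) (fjax S \<phi> e)))"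
proof -
  obtain As where As: "Ws = map Bang As" using value_for_bangs[of Ws "\<lambda>i. pv (\<theta> ! i)"] len(1) vals
    unfolding leq_values_def by metis
  obtain As' where As': "Ws' = map Bang As'" using value_for_bangs[of Ws' "\<lambda>i. pv (\<theta> ! i)"] len(2) vals
    unfolding leq_values_def by metis
  have lenA: "length As = length \<theta>" "length As' = length \<theta>" using len As As' by auto
  have dpv: "distinct (map pv \<theta>)" using dist by (simp add: distinct_map inj_on_def)
  define \<sigma> where "\<sigma> = map_of (zip (map pv \<theta>) As)"
  define \<sigma>' where "\<sigma>' = map_of (zip (map pv \<theta>) As')"
  have bind: "bind_all (map (\<lambda>x. PBang (pv x)) \<theta>) Ws = \<sigma>" "bind_all (map (\<lambda>x. PBang (pv x)) \<theta>) Ws' = \<sigma>'"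
    using bind_all_bang[OF dpv, of As] bind_all_bang[OF dpv, of As'] lenA
    by (simp_all add: As As' \<sigma>_def \<sigma>'_def comp_def)
  have dom: "dom \<sigma> = pv ` set \<theta>" "dom \<sigma>' = pv ` set \<theta>" using lenA by (simp_all add: \<sigma>_def \<sigma>'_def)
  \<comment> \<open>Computability of the box gives that of some reduct of its content, and expansion
    brings it back to \<open>B\<close>.\<close>
  have comp: "computable S A B \<and> fv B = {}" if t: "typing S {} (Bang B) (OfCourse A)" for A B
  proof -
    obtain B' where B': "reds S (Bang B) (Bang B')" "computable S A B'"
      using typing_closed_computable[OF t] by auto
    have "reds S B B'" using reds_Bang_inv[OF B'(1)] by simp
    then show ?thesis using typing_closed_fv[OF t] computable_reds[OF _ B'(2)] by simp
  qed
  have leq_bang: "leq S A B C" if l: "leq S (OfCourse A) (Bang B) (Bang C)" for A B C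
  proof -
    from l obtain B' C' where *: "reds S (Bang B) (Bang B')" "reds S (Bang C) (Bang C')" "leq S A B' C'" by auto
    have "reds S B B'" "reds S C C'" using reds_Bang_inv[OF *(1)] reds_Bang_inv[OF *(2)] by simp_all
    then show ?thesis using *(3) by (rule leq_reds)
  qed
  \<comment> \<open>\<open>R x P P'\<close> collects what a simultaneous normalization of the two
    inputs for \<open>x\<close> has to provide.\<close>
  define R where "R = (\<lambda>x P P'. (\<exists>A. \<sigma> (pv x) = Some A \<and> reds S A P) \<and> (\<exists>A. \<sigma>' (pv x) = Some A \<and> reds S A P') \<and>
      fv P = {} \<and> fv P' = {} \<and> canonical (plty x) P \<and> canonical (plty x) P' \<and> leq S (pT (plty x)) P P')"
  have "\<exists>P P'. R x P P'" if "x \<in> set \<theta>" for x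
  proof -
    obtain i where i: "i < length \<theta>" "x = \<theta> ! i" using \<open>x \<in> set \<theta>\<close> by (metis in_set_conv_nth)
    have \<sigma>x: "\<sigma> (pv x) = Some (As ! i)" "\<sigma>' (pv x) = Some (As' ! i)"
      using map_of_zip_nth[OF _ dpv, of As i] map_of_zip_nth[OF _ dpv, of As' i] i lenA
      by (simp_all add: \<sigma>_def \<sigma>'_def)
    have "leq_values S (PBang (pv x)) (Bang (As ! i)) (Bang (As' ! i))"
      using vals i len by (simp add: As As')
    then have v: "typing S {} (Bang (As ! i)) (OfCourse (pT (plty x)))"
      "typing S {} (Bang (As' ! i)) (OfCourse (pT (plty x)))"
      "leq S (OfCourse (pT (plty x))) (Bang (As ! i)) (Bang (As' ! i))"
      unfolding leq_values_def by simp_all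
    have c: "computable S (pT (plty x)) (As ! i)" "fv (As ! i) = {}"
      "computable S (pT (plty x)) (As' ! i)" "fv (As' ! i) = {}"
      using comp[OF v(1)] comp[OF v(2)] by auto
    from computable_canonical[OF c(1,3) leq_bang[OF v(3)]] obtain P P' where
      P: "reds S (As ! i) P" "reds S (As' ! i) P'" "canonical (plty x) P" "canonical (plty x) P'"
        "leq S (pT (plty x)) P P'" by blast
    then have "R x P P'" unfolding R_def using \<sigma>x reds_closed[OF P(1) c(2)] reds_closed[OF P(2) c(4)] by blast
    then show ?thesis by blast
  qed
  then obtain \<pi> \<pi>' where R: "\<forall>x\<in>set \<theta>. R x (\<pi> x) (\<pi>' x)" by metis
  \<comment> \<open>The substitution by canonical inputs, as a function of the point so that it
    serves both sides.\<close>
  define can where "can = (\<lambda>(\<pi> :: pvar \<Rightarrow> 'f tm) v. if v \<in> pv ` set \<theta> then Some (\<pi> (inv pv v)) else None)"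
  have inv: "inv pv (pv x) = x" for x by (simp add: inv_f_f inj_def)
  have can: "can \<pi> (pv x) = Some (\<pi> x)" if "x \<in> set \<theta>" for x \<pi> using that by (simp add: can_def inv)
  have cl: "closed_sub (can \<pi>)" "closed_sub (can \<pi>')"
    using R by (auto simp: closed_sub_def can_def inv R_def)
  have "rel_option (reds S) (\<sigma> v) (can \<pi> v)" "rel_option (reds S) (\<sigma>' v) (can \<pi>' v)" for v
  proof -
    show "rel_option (reds S) (\<sigma> v) (can \<pi> v)"
    proof (cases "v \<in> pv ` set \<theta>")
      case True
      then obtain x where x: "x \<in> set \<theta>" "v = pv x" by blast
      with R obtain A where "\<sigma> (pv x) = Some A" "reds S A (\<pi> x)" unfolding R_def by blast
      then show ?thesis using can[OF x(1), of \<pi>] x(2) by simp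
    next
      case False
      moreover from False have "\<sigma> v = None" unfolding dom(1)[symmetric] by (simp add: domIff)
      ultimately show ?thesis by (simp add: can_def)
    qed
    show "rel_option (reds S) (\<sigma>' v) (can \<pi>' v)"
    proof (cases "v \<in> pv ` set \<theta>")
      case True
      then obtain x where x: "x \<in> set \<theta>" "v = pv x" by blast
      with R obtain A where "\<sigma>' (pv x) = Some A" "reds S A (\<pi>' x)" unfolding R_def by blast
      then show ?thesis using can[OF x(1), of \<pi>'] x(2) by simp
    next
      case False
      moreover from False have "\<sigma>' v = None" unfolding dom(2)[symmetric] by (simp add: domIff)
      ultimately show ?thesis by (simp add: can_def)
    qed
  qed
  then have red: "reds S (subst \<sigma> M) (subst (can \<pi>) M)" "reds S (subst \<sigma>' M) (subst (can \<pi>') M)" for M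
    by (simp_all add: reds_subst_pointwise)
  have canon: "\<forall>x\<in>set \<theta>. canonical (plty x) (\<pi> x)" "\<forall>x\<in>set \<theta>. canonical (plty x) (\<pi>' x)"
    and rel: "\<forall>x\<in>set \<theta>. leq S (pT (plty x)) (\<pi> x) (\<pi>' x)" using R by (simp_all add: R_def)
  have e1: "evals S (subst (can \<pi>) (fwd S (map pv \<theta>) (deltaB e))) (pval S \<pi> e) (map pv \<theta>)
      (\<lambda>\<rho> T. T = tval S \<pi> (\<lambda>x. \<rho> (pv x)) e)"
    by (rule evals_fwd[OF bt wf canon(1) cl(1) _ dpv]) (use can in auto)
  have fv: "FVp (fjax S \<phi> e) = set \<theta>" "FVt (fjax S \<phi> e) = \<phi> ` set \<theta>" using FV_fjax[OF bt wf \<phi>] by auto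
  have d\<phi>: "distinct (map \<phi> \<theta>)" using dist \<phi> by (simp add: distinct_map tangent_names_def)
  have e2: "evals S (subst (can \<pi>') (delta (map \<phi> \<theta>) (fjax S \<phi> e))) (pval S \<pi>' e) (map \<phi> \<theta>)
      (\<lambda>\<rho> T. T = tval S \<pi>' (\<lambda>x. \<rho> (\<phi> x)) e)"
    by (rule denotesD[OF denotes_fjax[OF bt wf \<phi> canon(2)] cl(2) _ d\<phi>]) (use can fv in auto)
  show ?thesis unfolding bind
  proof (rule leq_reds[OF red], rule leq_evals[OF e1 e2 leq_pval[OF bt canon rel]])
    show "additive_ty (tT \<tau>)" by simp
    show "\<forall>B\<in>set (map (\<lambda>x. tT (plty x)) \<theta>). additive_ty B" by simp
    fix Ms Ns :: "'f tm list"
    let ?Bs = "map (\<lambda>x. tT (plty x)) \<theta>"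
    assume *: "length Ms = length ?Bs" "length Ns = length ?Bs" "\<forall>i<length ?Bs. leq S (?Bs ! i) (Ms ! i) (Ns ! i)"
    obtain \<rho> where \<rho>: "map \<rho> (map pv \<theta>) = Ms" using assignment_exists[OF dpv] *(1) by auto
    obtain \<rho>' where \<rho>': "map \<rho>' (map \<phi> \<theta>) = Ns" using assignment_exists[OF d\<phi>] *(2) by auto
    have "\<forall>x\<in>set \<theta>. leq S (tT (plty x)) (\<rho> (pv x)) (\<rho>' (\<phi> x))"
    proof
      fix x assume "x \<in> set \<theta>"
      then obtain i where i: "i < length \<theta>" "x = \<theta> ! i" by (metis in_set_conv_nth)
      then have "Ms ! i = \<rho> (pv x)" "Ns ! i = \<rho>' (\<phi> x)" unfolding \<rho>[symmetric] \<rho>'[symmetric] by simp_all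
      then show "leq S (tT (plty x)) (\<rho> (pv x)) (\<rho>' (\<phi> x))" using *(3) i by auto
    qed
    from leq_tval[OF bt wf canon rel this] \<rho> \<rho>'
    show "\<exists>\<rho> T \<rho>' T'. map \<rho> (map pv \<theta>) = Ms \<and> T = tval S \<pi> (\<lambda>x. \<rho> (pv x)) e \<and>
        map \<rho>' (map \<phi> \<theta>) = Ns \<and> T' = tval S \<pi>' (\<lambda>x. \<rho>' (\<phi> x)) e \<and> leq S (tT \<tau>) T T'" by blast
  qed
qed

section \<open>Typing\<close>

abbreviation bangs :: "var set \<Rightarrow> pat set" where
  "bangs A \<equiv> PBang ` A"

abbreviation secs :: "var set \<Rightarrow> pat set" where
  "secs F \<equiv> (\<lambda>f. sec_pat (PVar f)) ` F"

lemma evars_bangs [simp]: "evars (bangs A) = A"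
  by (auto simp: evars_def)

lemma pvars_sec_pat [simp]: "pvars (sec_pat (PVar f)) = [f]"
  by (simp add: sec_pat_def)

lemma pvars_dual_pat [simp]: "pvars (dual_pat x f) = [x, f]"
  by (simp add: dual_pat_def)

lemma evars_secs [simp]: "evars (secs F) = F"
  by (auto simp: evars_def)

lemma bang_env_bangs [simp]: "finite A \<Longrightarrow> bang_env (bangs A)"
  by (auto simp: bang_env_def)

section \<open>Weakening and selection of tuple components\<close>

lemma typing_bangs_weaken:
  "finite C \<Longrightarrow> typing S \<Delta> M B \<Longrightarrow> C \<inter> evars \<Delta> = {} \<Longrightarrow> typing S (bangs C \<union> \<Delta>) M B"
proof (induction rule: finite_induct)
  case (insert x C)
  have "typing S (bangs C \<union> \<Delta>) M B" using insert by auto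
  then have "typing S (insert (PBang x) (bangs C \<union> \<Delta>)) M B"
    by (rule ty_weak[rotated]) (use insert in auto)
  then show ?case by simp
qed simp

lemma typing_bangs_mono:
  assumes "typing S (bangs A) M T" "A \<subseteq> B" "finite B"
  shows "typing S (bangs B) M T"
proof -
  have "typing S (bangs (B - A) \<union> bangs A) M T"
    by (rule typing_bangs_weaken) (use assms in auto)
  moreover have "bangs (B - A) \<union> bangs A = bangs B" using assms(2) by blast
  ultimately show ?thesis by simp
qed

text \<open>The component \<open>1\<close> of \<open>\<section>A\<close> is what makes an unused variable of this type harmless.\<close>

lemma typing_sec_weaken:
  assumes "typing S \<Delta> M B" "f \<notin> evars \<Delta>"
  shows "typing S (insert (sec_pat (PVar f)) \<Delta>) M B"
  unfolding sec_pat_def by (rule ty_withL1[OF _ _ ty_unitL[OF assms(1)]]) (use assms(2) in auto)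

lemma typing_sec_use:
  assumes "typing S (insert (PVar f) \<Delta>) M B" "f \<notin> evars \<Delta>"
  shows "typing S (insert (sec_pat (PVar f)) \<Delta>) M B"
  unfolding sec_pat_def by (rule ty_withL2[OF _ _ assms(1)]) (use assms(2) in auto)

lemma typing_secs_weaken:
  "finite F \<Longrightarrow> typing S \<Delta> M B \<Longrightarrow> F \<inter> evars \<Delta> = {} \<Longrightarrow> typing S (secs F \<union> \<Delta>) M B"
proof (induction rule: finite_induct)
  case (insert f F)
  have "typing S (secs F \<union> \<Delta>) M B" using insert by auto
  then have "typing S (insert (sec_pat (PVar f)) (secs F \<union> \<Delta>)) M B"
    by (rule typing_sec_weaken) (use insert in auto)
  then show ?case by simp
qed simp

lemma typing_weaken:
  assumes "typing S \<Delta> M B" "finite C" "finite F" "C \<inter> F = {}" "(C \<union> F) \<inter> evars \<Delta> = {}"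
  shows "typing S (bangs C \<union> secs F \<union> \<Delta>) M B"
proof -
  have "typing S (secs F \<union> \<Delta>) M B" by (rule typing_secs_weaken) (use assms in auto)
  then have "typing S (bangs C \<union> (secs F \<union> \<Delta>)) M B"
    by (rule typing_bangs_weaken[OF assms(2)]) (use assms in auto)
  then show ?thesis by (simp add: Un_assoc)
qed

text \<open>The left rules for & keep one half of a pair pattern; walking down the right-nested
  tuple, they isolate the component \<open>p\<close>.\<close>

lemma typing_select:
  "p \<in> set ps \<Longrightarrow> distinct (concat (map pvars ps)) \<Longrightarrow> (\<Union>p\<in>set ps. pset p) \<inter> evars \<Delta> = {} \<Longrightarrow>
     typing S (insert p \<Delta>) M B \<Longrightarrow> typing S (insert (with_pat m ps) \<Delta>) M B"
proof (induction m ps rule: with_pat.induct)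
  case (3 m q q' ps)
  let ?w = "with_pat m (q' # ps)"
  have pv: "pvars ?w = concat (map pvars (q' # ps))" by (simp add: pvars_with_pat)
  have wf: "wf_pat (PWith q ?w)" using 3(3) by (simp add: pv)
  have dis: "pset (PWith q ?w) \<inter> evars \<Delta> = {}" using 3(4) by (simp add: pv)
  show ?case
  proof (cases "p = q")
    case True
    then show ?thesis using ty_withL1[OF wf dis] 3(5) by simp
  next
    case False
    have "typing S (insert ?w \<Delta>) M B"
      by (rule 3(1)) (use 3 False in auto)
    from ty_withL2[OF wf dis this] show ?thesis by simp
  qed
qed auto

text \<open>The rule for & shares the environment, so each component must be able to ignore what the
  others use. The first premise serves the empty tuple.\<close>

lemma typing_with_tm:
  "typing S \<Delta> Empty TTop \<Longrightarrow> list_all2 (typing S \<Delta>) Ms As \<Longrightarrow> typing S \<Delta> (with_tm Ms) (with_ty As)"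
proof (induction Ms arbitrary: As rule: with_tm.induct)
  case (2 M)
  then show ?case by (auto simp: list_all2_Cons1)
next
  case (3 M N Ms)
  then show ?case by (auto simp: list_all2_Cons1 intro!: ty_WPair)
qed simp

lemma pty_with_pat: "pty (with_pat m ps) = with_ty (map pty ps)"
  by (induction m ps rule: with_pat.induct) auto

lemma wf_with_pat_vars: "us = vars_from m As \<Longrightarrow> wf_pat (with_pat m (map PVar us))"
proof -
  assume us: "us = vars_from m As"
  have "concat (map pvars (map PVar us)) = us" by (induction us) auto
  then show ?thesis using us by (simp add: pvars_with_pat)
qed

lemma with_pat_vars_ge: "us = vars_from m As \<Longrightarrow> v \<in> pset (with_pat m (map PVar us)) \<Longrightarrow> m \<le> vidx v"
  by (auto simp: pvars_with_pat split: if_splits dest: vars_from_ge)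

lemma typing_tuple_lam:
  assumes "typing S (insert (with_pat m (map PVar us)) \<Delta>) M B" "us = vars_from m As"
    and "\<forall>v\<in>evars \<Delta>. vidx v < m"
  shows "typing S \<Delta> (tuple_lam m us M) (Lolli (with_ty As) B)"
proof -
  let ?p = "with_pat m (map PVar us)"
  have "pset ?p \<inter> evars \<Delta> = {}" using assms(2,3) with_pat_vars_ge by fastforce
  from ty_Lam[OF wf_with_pat_vars[OF assms(2)] this assms(1)]
  show ?thesis using assms(2) by (simp add: pty_with_pat tuple_lam_def comp_def)
qed

text \<open>Environments of the form \<open>!C, \<section>F, \<langle>us\<rangle>\<close> in which the bodies of the linear maps are typed.\<close>

locale tuple_env =
  fixes S :: "'f signat" and m :: nat and \<theta> :: "'v list" and t :: "'v \<Rightarrow> ty" and us :: "var list"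
    and C F :: "var set"
  assumes us: "us = vars_from m (map t \<theta>)" and dist: "distinct \<theta>"
    and fin: "finite C" "finite F" and CF: "C \<inter> F = {}" and lt: "\<forall>v\<in>C \<union> F. vidx v < m"
begin

abbreviation up :: pat where "up \<equiv> with_pat m (map PVar us)"

lemma disj: "(C \<union> F) \<inter> pset up = {}"
  using lt with_pat_vars_ge[OF us] by (meson disjoint_iff not_less)

lemma typing_Empty_tuple: "typing S (insert up (bangs C \<union> secs F)) Empty TTop"
proof -
  have "env {up}" using wf_with_pat_vars[OF us] by (simp add: env_def)
  then have "typing S {up} Empty TTop" by (rule ty_Empty)
  from typing_weaken[OF this fin CF] disj show ?thesis by (simp add: Un_commute)
qed

lemma typing_lookup:
  assumes "w \<in> set \<theta>"
  shows "typing S (insert up (bangs C \<union> secs F)) (V (lookup \<theta> us w)) (t w)"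
proof -
  obtain i where i: "i < length \<theta>" "w = \<theta> ! i" using assms by (metis in_set_conv_nth)
  have l: "lookup \<theta> us w = us ! i" using i dist us by (simp add: lookup_nth)
  have ty: "vty (us ! i) = t w" using i us by simp
  have "length us = length \<theta>" using us by simp
  then have in_us: "us ! i \<in> set us" using i by simp
  then have ge: "m \<le> vidx (us ! i)" using us vars_from_ge by blast
  have "typing S (bangs C \<union> secs F \<union> {PVar (us ! i)}) (V (us ! i)) (vty (us ! i))"
    by (rule typing_weaken[OF ty_var fin CF]) (use ge lt in force)
  then have "typing S (insert (PVar (us ! i)) (bangs C \<union> secs F)) (V (us ! i)) (t w)"
    unfolding ty by (simp add: Un_commute)
  moreover have "concat (map pvars (map PVar us)) = us" by (induction us) auto
  moreover have "set us \<inter> (C \<union> F) = {}"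
    using us lt vars_from_ge by (meson disjoint_iff not_less)
  moreover have "distinct us" using us by simp
  ultimately show ?thesis unfolding l
    by (intro typing_select[of "PVar (us ! i)"]) (use in_us in \<open>simp_all add: Int_Un_distrib\<close>)
qed

lemma typing_lookups:
  assumes "set \<theta>' \<subseteq> set \<theta>"
  shows "typing S (insert up (bangs C \<union> secs F)) (with_tm (map (\<lambda>w. V (lookup \<theta> us w)) \<theta>')) (with_ty (map t \<theta>'))"
  by (rule typing_with_tm[OF typing_Empty_tuple])
    (use assms in \<open>auto simp: list_all2_conv_all_nth intro!: typing_lookup\<close>)

end

section \<open>Derived typing rules\<close>

lemma typing_App_sec:
  assumes "typing S \<Delta> M A" "vty f = Lolli A B" "f \<notin> evars \<Delta>"
  shows "typing S (insert (sec_pat (PVar f)) \<Delta>) (App (V f) M) B"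
proof (rule typing_sec_use[OF _ assms(3)])
  have "typing S ({} \<union> {PVar f}) (V f) (Lolli A B)" using ty_var[of S f] assms(2) by simp
  moreover have "split_env {} {PVar f} {} \<Delta>"
    using assms(3) by (simp add: split_env_def bang_env_def)
  ultimately have "typing S ({} \<union> {} \<union> {PVar f} \<union> \<Delta>) (App (V f) M) B"
    using ty_App assms(1) by (metis Un_empty_left)
  then show "typing S (insert (PVar f) \<Delta>) (App (V f) M) B" by simp
qed

text \<open>Duplicable variables may be shared between \<open>N\<close> and \<open>M\<close>, while
  the linear maps in \<open>F\<close> all go to the body: this is how the environment splits at the
  application.\<close>

lemma typing_let_dual:
  assumes N: "typing S (bangs A) N (Tensor (OfCourse (vty x)) (sec_ty (vty f)))"
    and M: "typing S (insert (PBang x) (insert (sec_pat (PVar f)) (bangs C \<union> secs F))) M B"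
    and "x \<noteq> f" "{x, f} \<inter> (C \<union> F) = {}" "(A \<union> C) \<inter> F = {}" "finite A" "finite C"
    and E: "E = bangs A \<union> bangs C \<union> secs F"
  shows "typing S E (let_tm (dual_pat x f) N M) B"
proof -
  have "typing S (insert (dual_pat x f) (bangs C \<union> secs F)) M B"
    unfolding dual_pat_def by (rule ty_pairL[OF _ _ M]) (use assms(3,4) in auto)
  then have "typing S (bangs C \<union> secs F) (Lam (dual_pat x f) M) (Lolli (pty (dual_pat x f)) B)"
    by (intro ty_Lam) (use assms(3,4) in auto)
  then have L: "typing S (bangs C \<union> secs F) (Lam (dual_pat x f) M)
      (Lolli (Tensor (OfCourse (vty x)) (sec_ty (vty f))) B)"
    by (simp add: dual_pat_def sec_pat_def sec_ty_def)
  have "split_env (bangs C) (secs F) (bangs A) {}"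
    using assms(5-7) by (auto simp: split_env_def)
  from ty_App[OF this L] N have "typing S (bangs C \<union> bangs A \<union> secs F \<union> {}) (App (Lam (dual_pat x f) M) N) B"
    by simp
  moreover have "bangs C \<union> bangs A \<union> secs F \<union> {} = E" using E by auto
  ultimately show ?thesis by (simp add: let_tm_def)
qed

text \<open>The unit component is typed in the same environment as \<open>K\<close>, so it has to
  discard every variable, the linear maps included.\<close>

lemma typing_sec_tm:
  assumes "typing S (bangs C \<union> secs F) K U" "finite C" "finite F" "C \<inter> F = {}"
  shows "typing S (bangs C \<union> secs F) (sec_tm K) (sec_ty U)"
proof -
  have "typing S (bangs C \<union> secs F \<union> {}) Unit TOne"
    by (rule typing_weaken[OF ty_Unit assms(2-4)]) simp
  then show ?thesis unfolding sec_tm_def sec_ty_def using assms(1) by (intro ty_WPair) simp_all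
qed

text \<open>The primal part uses duplicable variables only; the linear maps all go to the tangent
  part.\<close>

lemma typing_Pair_sec:
  assumes N: "typing S (bangs A) N T" and K: "typing S (bangs C \<union> secs F) K U"
    and "finite A" "finite C" "finite F" "(A \<union> C) \<inter> F = {}" and E: "E = bangs A \<union> bangs C \<union> secs F"
  shows "typing S E (Pair N (sec_tm K)) (Tensor T (sec_ty U))"
proof -
  have s: "typing S (bangs C \<union> secs F) (sec_tm K) (sec_ty U)"
    by (rule typing_sec_tm) (use assms in auto)
  have "split_env (bangs A) {} (bangs C) (secs F)" using assms(3-6) by (auto simp: split_env_def)
  from ty_Pair[OF this _ s] N have "typing S (bangs A \<union> bangs C \<union> {} \<union> secs F) (Pair N (sec_tm K)) (Tensor T (sec_ty U))"
    by simp
  then show ?thesis using E by simp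
qed

lemma typing_dual_tm:
  assumes "typing S (bangs A) N T" "typing S (bangs C \<union> secs F) K U"
    and "finite A" "finite C" "finite F" "(A \<union> C) \<inter> F = {}" "E = bangs A \<union> bangs C \<union> secs F"
  shows "typing S E (dual_tm N K) (Tensor (OfCourse T) (sec_ty U))"
  unfolding dual_tm_def by (rule typing_Pair_sec[OF ty_Bang]) (use assms in auto)

lemma typing_bvar: "typing S (bangs {x}) (V x) (vty x)"
  using ty_bvar[of S x] by simp

lemma typing_App_bangs:
  assumes "typing S (bangs A) M (Lolli T U)" "typing S (bangs B) N T" "finite A" "finite B"
  shows "typing S (bangs (A \<union> B)) (App M N) U"
proof -
  have "split_env (bangs A) {} (bangs B) {}" using assms(3,4) by (simp add: split_env_def)
  from ty_App[OF this] assms(1,2) show ?thesis by (simp add: image_Un)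
qed

lemma typing_Pair_bangs:
  assumes "typing S (bangs A) M T" "typing S (bangs B) N U" "finite A" "finite B"
  shows "typing S (bangs (A \<union> B)) (Pair M N) (Tensor T U)"
proof -
  have "split_env (bangs A) {} (bangs B) {}" using assms(3,4) by (simp add: split_env_def)
  from ty_Pair[OF this] assms(1,2) show ?thesis by (simp add: image_Un)
qed

lemma typing_tensor_args:
  "typing S (bangs (set xs)) (tensor_tm (map (\<lambda>x. Bang (V x)) xs)) (tensor_ty (map (\<lambda>x. OfCourse (vty x)) xs))"
proof (induction xs)
  case Nil
  then show ?case by (simp add: ty_Unit)
next
  case (Cons x xs)
  have x: "typing S (bangs {x}) (Bang (V x)) (OfCourse (vty x))"
    by (rule ty_Bang[OF bang_env_bangs typing_bvar]) simp
  show ?case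
  proof (cases xs)
    case Nil
    then show ?thesis using x by simp
  next
    case (Cons y ys)
    from typing_Pair_bangs[OF x Cons.IH] have "typing S (bangs ({x} \<union> set xs))
        (Pair (Bang (V x)) (tensor_tm (map (\<lambda>x. Bang (V x)) xs)))
        (Tensor (OfCourse (vty x)) (tensor_ty (map (\<lambda>x. OfCourse (vty x)) xs)))" by simp
    then show ?thesis by (simp add: Cons insert_commute)
  qed
qed

lemma typing_Fn_args:
  assumes "length xs = arity S f" "\<forall>x\<in>set xs. vty x = TReal"
  shows "typing S (bangs (set xs)) (App (Fn f) (tensor_tm (map (\<lambda>x. Bang (V x)) xs))) (OfCourse TReal)"
proof -
  have "map (\<lambda>x. OfCourse (vty x)) xs = replicate (arity S f) (OfCourse TReal)"
    using assms by (simp add: list_eq_iff_nth_eq)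
  then have "typing S (bangs (set xs)) (tensor_tm (map (\<lambda>x. Bang (V x)) xs))
      (tensor_ty (replicate (arity S f) (OfCourse TReal)))" using typing_tensor_args[of S xs] by simp
  from typing_App_bangs[OF _ this, of "{}" "Fn f"] ty_Fn[of S f] show ?thesis by simp
qed

lemma typing_let_unit:
  assumes "typing S (bangs A) M T" "vty z = TOne" "finite A"
  shows "typing S (bangs (insert z A)) (let_tm PUnit (V z) M) T"
proof -
  have "typing S (bangs A) (Lam PUnit M) (Lolli (pty PUnit) T)"
    by (rule ty_Lam) (use assms(1) ty_unitL in auto)
  from typing_App_bangs[OF this, of "{z}" "V z"] typing_bvar[of S z] assms(2,3) show ?thesis
    by (simp add: let_tm_def)
qed

lemma typing_Lam_const:
  assumes "typing S {PVar (Var 0 TTop)} M T"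
  shows "typing S {} (Lam (PVar (Var 0 TTop)) M) (Lolli TTop T)"
  using ty_Lam[of "PVar (Var 0 TTop)" "{}" S M T] assms by simp

lemma typing_dual_const:
  assumes "typing S (bangs A) N T" "typing S {PVar (Var 0 TTop)} M U" "finite A"
  shows "typing S (bangs A) (dual_tm N (Lam (PVar (Var 0 TTop)) M)) (Tensor (OfCourse T) (sec_ty (Lolli TTop U)))"
  by (rule typing_dual_tm[OF assms(1), where C = "{}" and F = "{}"])
    (use assms typing_Lam_const in auto)

lemma env_var: "env {PVar x}"
  by (simp add: env_def)

abbreviation (input) dual_ty :: "ty \<Rightarrow> ty list \<Rightarrow> ty \<Rightarrow> ty" where
  "dual_ty A Bs C \<equiv> Tensor (OfCourse A) (sec_ty (Lolli (with_ty Bs) C))"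

text \<open>The equation for \<open>ety\<close> belongs to the invariant because
  \<open>delta\<close> annotates the variables it binds with the types computed by
  \<open>ety\<close>.\<close>

definition delta_typed :: "'f signat \<Rightarrow> 'f lexp \<Rightarrow> lty \<Rightarrow> lty \<Rightarrow> bool" where
  "delta_typed S e \<tau> \<sigma> \<longleftrightarrow> ety e = (\<tau>, \<sigma>) \<and> (\<forall>\<theta>. distinct \<theta> \<longrightarrow> set \<theta> = FVt e \<longrightarrow>
     typing S (bangs (pv ` FVp e)) (delta \<theta> e) (dual_ty (pT \<tau>) (map (tT \<circ> tlty) \<theta>) (tT \<sigma>)))"

lemma delta_typedI:
  "ety e = (\<tau>, \<sigma>) \<Longrightarrow> (\<And>\<theta>. distinct \<theta> \<Longrightarrow> set \<theta> = FVt e \<Longrightarrow>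
     typing S (bangs (pv ` FVp e)) (delta \<theta> e) (dual_ty (pT \<tau>) (map (tT \<circ> tlty) \<theta>) (tT \<sigma>))) \<Longrightarrow>
   delta_typed S e \<tau> \<sigma>"
  by (simp add: delta_typed_def)

lemma delta_typedD:
  "delta_typed S e \<tau> \<sigma> \<Longrightarrow> distinct \<theta> \<Longrightarrow> set \<theta> = FVt e \<Longrightarrow>
     typing S (bangs (pv ` FVp e)) (delta \<theta> e) (dual_ty (pT \<tau>) (map (tT \<circ> tlty) \<theta>) (tT \<sigma>))"
  by (simp add: delta_typed_def)

lemma delta_typed_ety: "delta_typed S e \<tau> \<sigma> \<Longrightarrow> ety e = (\<tau>, \<sigma>)"
  by (simp add: delta_typed_def)

lemma typing_tuple_dual:
  assumes N: "typing S (bangs A) N T" and te: "tuple_env m \<theta> t us C F"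
    and K: "typing S (insert (with_pat m (map PVar us)) (bangs C \<union> secs F)) K U"
    and "finite A" "A \<inter> F = {}" "E = bangs A \<union> bangs C \<union> secs F"
  shows "typing S E (dual_tm N (tuple_lam m us K)) (dual_ty T (map t \<theta>) U)"
proof (rule typing_dual_tm[OF N _ assms(4) _ _ _ assms(6)])
  interpret tuple_env S m \<theta> t us C F by (rule te)
  show "typing S (bangs C \<union> secs F) (tuple_lam m us K) (Lolli (with_ty (map t \<theta>)) U)"
    by (rule typing_tuple_lam[OF K us]) (use lt in auto)
  show "finite C" "finite F" by (rule fin)+
  show "(A \<union> C) \<inter> F = {}" using CF assms(5) by blast
qed

text \<open>Typing counterpart of \<open>evals_let_reindex\<close>; besides the tuple, the map
  \<open>f\<close> is the only resource that is not duplicable.\<close>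

lemma typing_let_reindex:
  assumes N: "typing S (bangs A) N (Tensor (OfCourse (vty x)) (sec_ty (vty f)))"
    and f: "vty f = Lolli (with_ty (map t \<theta>')) U" "vidx f < m" "f \<notin> A" "x \<noteq> f"
    and "finite A" "set \<theta>' \<subseteq> set \<theta>" "distinct \<theta>" and us: "us = vars_from m (map t \<theta>)"
  shows "typing S (bangs A) (let_tm (dual_pat x f) N (dual_tm (V x) (tuple_lam m us
     (App (V f) (with_tm (map (\<lambda>w. V (lookup \<theta> us w)) \<theta>')))))) (dual_ty (vty x) (map t \<theta>) U)"
proof -
  let ?M = "with_tm (map (\<lambda>w. V (lookup \<theta> us w)) \<theta>')"
  \<comment> \<open>Two environments are in play: the arguments of \<open>f\<close> are typed
    without \<open>f\<close>, the body of the abstraction with it.\<close>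
  interpret t: tuple_env S m \<theta> t us "{}" "{}" by unfold_locales (simp_all add: us assms)
  interpret tf: tuple_env S m \<theta> t us "{}" "{f}" by unfold_locales (simp_all add: us assms)
  have "typing S (insert (sec_pat (PVar f)) (insert t.up {})) (App (V f) ?M) U"
    by (rule typing_App_sec[OF _ f(1)]) (use t.typing_lookups[OF assms(7)] tf.disj in simp_all)
  then have "typing S (insert t.up (bangs {} \<union> secs {f})) (App (V f) ?M) U" by (simp add: insert_commute)
  from typing_tuple_dual[OF typing_bvar[of S x] tf.tuple_env_axioms this]
  have "typing S (insert (PBang x) (insert (sec_pat (PVar f)) (bangs {} \<union> secs {})))
      (dual_tm (V x) (tuple_lam m us (App (V f) ?M))) (dual_ty (vty x) (map t \<theta>) U)"
    using f(4) by (simp add: insert_commute)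
  from typing_let_dual[OF N this] f(3,4) assms(6) show ?thesis by simp
qed

text \<open>Typing counterpart of \<open>evals_let_let\<close>. The variable \<open>f\<close> occurs
  in at most one kind of component, the one for \<open>y\<close>; all others discard it by means of
  the component 1 of its \<section> type.\<close>

lemma typing_let_let:
  fixes S :: "'f signat" and \<theta> :: "'v list"
  defines "u \<equiv> \<lambda>\<theta> us w. V (lookup \<theta> us w) :: 'f tm"
  assumes N1: "typing S (bangs A) N\<^sub>1 (Tensor (OfCourse (vty x)) (sec_ty (vty f)))"
    and N2: "typing S (bangs (insert x C)) N\<^sub>2 (Tensor (OfCourse (vty z)) (sec_ty (vty g)))"
    and f: "vty f = Lolli (with_ty (map t \<theta>\<^sub>1)) (t y)" and g: "vty g = Lolli (with_ty (map t \<theta>\<^sub>2)) U"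
    and ne: "f \<noteq> z" "f \<noteq> g" "z \<noteq> g" "{f, g} \<inter> insert x (A \<union> C) = {}" and lt: "vidx f < m" "vidx g < m"
    and fin: "finite A" "finite C" and sub: "set \<theta>\<^sub>1 \<subseteq> set \<theta>" "set \<theta>\<^sub>2 \<subseteq> insert y (set \<theta>)"
    and dist: "distinct \<theta>" and us: "us = vars_from m (map t \<theta>)"
    and args: "args = map (\<lambda>w. if w = y then App (V f) (with_tm (map (u \<theta> us) \<theta>\<^sub>1)) else u \<theta> us w) \<theta>\<^sub>2"
  shows "typing S (bangs (A \<union> (C - {x}))) (let_tm (dual_pat x f) N\<^sub>1 (let_tm (dual_pat z g) N\<^sub>2
     (dual_tm (V z) (tuple_lam m us (App (V g) (with_tm args)))))) (dual_ty (vty z) (map t \<theta>) U)"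
proof -
  let ?body = "dual_tm (V z) (tuple_lam m us (App (V g) (with_tm args)))"
  let ?T = "dual_ty (vty z) (map t \<theta>) U"
  interpret t: tuple_env S m \<theta> t us "{}" "{}" by unfold_locales (simp_all add: us dist)
  interpret tf: tuple_env S m \<theta> t us "{}" "{f}" by unfold_locales (simp_all add: us dist lt)
  interpret tfg: tuple_env S m \<theta> t us "{}" "{f, g}" by unfold_locales (simp_all add: us dist lt)
  have "typing S (insert (sec_pat (PVar f)) (insert t.up {})) (App (V f) (with_tm (map (u \<theta> us) \<theta>\<^sub>1))) (t y)"
    unfolding u_def by (rule typing_App_sec[OF _ f]) (use t.typing_lookups[OF sub(1)] tf.disj in simp_all)
  then have fu: "typing S (insert t.up (bangs {} \<union> secs {f})) (App (V f) (with_tm (map (u \<theta> us) \<theta>\<^sub>1))) (t y)"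
    by (simp add: insert_commute)
  have "list_all2 (typing S (insert t.up (bangs {} \<union> secs {f}))) args (map t \<theta>\<^sub>2)"
    unfolding args list_all2_map1 list_all2_map2
  proof (rule list.rel_refl_strong)
    fix w assume "w \<in> set \<theta>\<^sub>2"
    then show "typing S (insert t.up (bangs {} \<union> secs {f}))
        (if w = y then App (V f) (with_tm (map (u \<theta> us) \<theta>\<^sub>1)) else u \<theta> us w) (t w)"
      using fu tf.typing_lookup[of w] sub(2) by (cases "w = y") (auto simp: u_def)
  qed
  from typing_with_tm[OF tf.typing_Empty_tuple this]
  have "typing S (insert (sec_pat (PVar g)) (insert t.up (bangs {} \<union> secs {f}))) (App (V g) (with_tm args)) U"
    by (rule typing_App_sec[OF _ g]) (use tfg.disj ne(2) in auto)
  then have "typing S (insert t.up (bangs {} \<union> secs {f, g})) (App (V g) (with_tm args)) U"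
    by (simp add: insert_commute)
  from typing_tuple_dual[OF typing_bvar[of S z] tfg.tuple_env_axioms this]
  have body: "typing S (insert (PBang z) (insert (sec_pat (PVar g)) (bangs {} \<union> secs {f}))) ?body ?T"
    using ne(1,3) by (simp add: insert_commute)
  have "typing S (insert (PBang x) (insert (sec_pat (PVar f)) (bangs (C - {x}) \<union> secs {})))
     (let_tm (dual_pat z g) N\<^sub>2 ?body) ?T"
    by (rule typing_let_dual[OF N2 body]) (use ne fin in auto)
  then show ?thesis by (rule typing_let_dual[OF N1]) (use ne(4) fin in auto)
qed

section \<open>Typing of \<open>delta\<close>\<close>

lemma delta_typed_LPair: "delta_typed S (LPair x y) (plty x) (tlty y)"
proof (rule delta_typedI)
  fix \<theta> assume \<theta>: "distinct \<theta>" "set \<theta> = FVt (LPair x y)"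
  define us where "us = vars_from (fresh_p {x}) (map (tT \<circ> tlty) \<theta>)"
  interpret tuple_env S "fresh_p {x}" \<theta> "tT \<circ> tlty" us "{}" "{}"
    by unfold_locales (simp_all add: us_def \<theta>)
  have "typing S (bangs (pv ` FVp (LPair x y))) (dual_tm (V (pv x)) (tuple_lam (fresh_p {x}) us (V (lookup \<theta> us y))))
      (dual_ty (vty (pv x)) (map (tT \<circ> tlty) \<theta>) ((tT \<circ> tlty) y))"
    by (rule typing_tuple_dual[OF typing_bvar tuple_env_axioms typing_lookup]) (auto simp: \<theta>)
  then show "typing S (bangs (pv ` FVp (LPair x y))) (delta \<theta> (LPair x y))
     (dual_ty (pT (plty x)) (map (tT \<circ> tlty) \<theta>) (tT (tlty y)))"
    by (simp add: Let_def us_def)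
qed simp

lemma delta_typed_LLet:
  assumes d1: "delta_typed S e1 (plty x) (tlty y)" and d2: "delta_typed S e2 \<tau> \<sigma>" and y: "y \<in> FVt e2"
  shows "delta_typed S (LLet x y e1 e2) \<tau> \<sigma>"
proof (rule delta_typedI)
  show "ety (LLet x y e1 e2) = (\<tau>, \<sigma>)" using delta_typed_ety[OF d2] by simp
  fix \<theta> assume dist: "distinct \<theta>" and \<theta>: "set \<theta> = FVt (LLet x y e1 e2)"
  define \<theta>1 where "\<theta>1 = filter (\<lambda>w. w \<in> FVt e1) \<theta>"
  define \<theta>2 where "\<theta>2 = filter (\<lambda>w. w \<in> FVt e2 - {y}) \<theta>"
  define m where "m = fresh_p (insert x (FVp e1 \<union> FVp e2))"
  define f where "f = Var m (Lolli (with_ty (map (tT \<circ> tlty) \<theta>1)) (tT (tlty y)))"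
  define z where "z = Var (m + 1) (pT \<tau>)"
  define g where "g = Var (m + 2) (Lolli (with_ty (map (tT \<circ> tlty) (y # \<theta>2))) (tT \<sigma>))"
  define us where "us = vars_from (m + 3) (map (tT \<circ> tlty) \<theta>)"
  define u where "u = (\<lambda>w. V (lookup \<theta> us w) :: 'a tm)"
  define args where "args = App (V f) (with_tm (map u \<theta>1)) # map u \<theta>2"
  let ?body = "dual_tm (V z) (tuple_lam (m + 3) us (App (V g) (with_tm args)))"
  let ?T = "dual_ty (pT \<tau>) (map (tT \<circ> tlty) \<theta>) (tT \<sigma>)"
  have delta: "delta \<theta> (LLet x y e1 e2) = let_tm (dual_pat (pv x) f) (delta \<theta>1 e1)
     (let_tm (dual_pat z g) (delta (y # \<theta>2) e2) ?body)"
    by (simp add: Let_def delta_typed_ety[OF d2] \<theta>1_def \<theta>2_def m_def f_def z_def g_def us_def u_def args_def)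
  have lt: "pidx w < m" if "w \<in> insert x (FVp e1 \<union> FVp e2)" for w
    unfolding m_def by (rule fresh_p_gt) (use that in auto)
  have s1: "set \<theta>1 = FVt e1" and s2: "set (y # \<theta>2) = FVt e2" and d: "distinct \<theta>1" "distinct (y # \<theta>2)"
    using \<theta> y dist by (auto simp: \<theta>1_def \<theta>2_def)
  have args: "args = map (\<lambda>w. if w = y then App (V f) (with_tm (map u \<theta>1)) else u w) (y # \<theta>2)"
    by (auto simp: args_def \<theta>2_def)
  \<comment> \<open>The bound \<open>x\<close> may be absent from \<open>FVp e2\<close>; weakening
    then provides \<open>!x\<close> for the let.\<close>
  have "typing S (bangs (pv ` insert x (FVp e2))) (delta (y # \<theta>2) e2) (dual_ty (pT \<tau>) (map (tT \<circ> tlty) (y # \<theta>2)) (tT \<sigma>))"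
    by (rule typing_bangs_mono[OF delta_typedD[OF d2 d(2) s2]]) auto
  then have t2: "typing S (bangs (insert (pv x) (pv ` FVp e2))) (delta (y # \<theta>2) e2) (Tensor (OfCourse (vty z)) (sec_ty (vty g)))"
    by (simp add: z_def g_def)
  have t1: "typing S (bangs (pv ` FVp e1)) (delta \<theta>1 e1) (Tensor (OfCourse (vty (pv x))) (sec_ty (vty f)))"
    using delta_typedD[OF d1 d(1) s1] by (simp add: f_def)
  have ge: "v \<notin> insert (pv x) (pv ` FVp e1 \<union> pv ` FVp e2)" if "m \<le> vidx v" for v
    using lt that by (auto simp: not_less[symmetric])
  have "typing S (bangs (pv ` FVp e1 \<union> (pv ` FVp e2 - {pv x}))) (delta \<theta> (LLet x y e1 e2)) (dual_ty (vty z) (map (tT \<circ> tlty) \<theta>) (tT \<sigma>))"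
    unfolding delta
  proof (rule typing_let_let[OF t1 t2 _ _ _ _ _ _ _ _ _ _ _ _ dist us_def args[unfolded u_def]])
    show "{f, g} \<inter> insert (pv x) (pv ` FVp e1 \<union> pv ` FVp e2) = {}"
      using ge[of f] ge[of g] by (simp add: f_def g_def)
  qed (simp_all add: f_def g_def z_def, auto simp: \<theta>1_def \<theta>2_def)
  then show "typing S (bangs (pv ` FVp (LLet x y e1 e2))) (delta \<theta> (LLet x y e1 e2)) ?T"
    by (simp add: pv_image_diff image_Un z_def)
qed

lemma delta_typed_const:
  assumes "typing S (bangs (pv ` FVp e)) N (pT \<tau>)" "typing S {PVar (Var 0 TTop)} M (tT \<sigma>)"
    and "FVt e = {}" "ety e = (\<tau>, \<sigma>)" "delta [] e = dual_tm N (Lam (PVar (Var 0 TTop)) M)"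
  shows "delta_typed S e \<tau> \<sigma>"
  by (rule delta_typedI) (use typing_dual_const[OF assms(1,2)] assms(3-5) in auto)

lemma delta_typed_LUnitP: "delta_typed S LUnitP LOne LOne"
  by (rule delta_typed_const) (use ty_Unit ty_Empty[OF env_var] in auto)

lemma delta_typed_LUnitT: "delta_typed S LUnitT LOne LOne"
  by (rule delta_typed_const) (use ty_Unit ty_Empty[OF env_var] in auto)

lemma delta_typed_LZero: "delta_typed S (LZero LReal) LOne LReal"
  by (rule delta_typed_const) (use ty_Unit ty_zero[OF env_var] in auto)

lemma delta_typed_LNum: "delta_typed S (LNum r) LReal LOne"
  by (rule delta_typed_const) (use ty_Num ty_Empty[OF env_var] in auto)

lemma delta_typed_LFn:
  assumes "length xs = arity S f" "\<forall>x\<in>set xs. plty x = LReal"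
  shows "delta_typed S (LFn f xs) LReal LOne"
proof (rule delta_typedI)
  fix \<theta> assume \<theta>: "set \<theta> = FVt (LFn f xs)"
  have "typing S (bangs (set (map pv xs))) (App (Fn f) (tensor_tm (map (\<lambda>x. Bang (V x)) (map pv xs)))) (OfCourse TReal)"
    by (rule typing_Fn_args) (use assms in auto)
  then have N: "typing S (bangs (pv ` set xs)) (App (Fn f) (tensor_tm (map (\<lambda>x. Bang (V (pv x))) xs))) (OfCourse TReal)"
    by (simp add: comp_def)
  have K: "typing S (bangs {} \<union> secs {}) (Lam (PVar (Var 0 TTop)) Empty) (Lolli TTop TTop)"
    using typing_Lam_const[OF ty_Empty[OF env_var]] by simp
  have "typing S (bangs (pv ` set xs)) (Pair (App (Fn f) (tensor_tm (map (\<lambda>x. Bang (V (pv x))) xs)))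
      (sec_tm (Lam (PVar (Var 0 TTop)) Empty))) (Tensor (OfCourse TReal) (sec_ty (Lolli TTop TTop)))"
    by (rule typing_Pair_sec[OF N K]) auto
  then show "typing S (bangs (pv ` FVp (LFn f xs))) (delta \<theta> (LFn f xs))
      (dual_ty (pT LReal) (map (tT \<circ> tlty) \<theta>) (tT LOne))"
    using \<theta> by simp
qed simp

lemma delta_typed_LPlus:
  assumes "tlty y1 = LReal" "tlty y2 = LReal"
  shows "delta_typed S (LPlus y1 y2) LOne LReal"
proof (rule delta_typedI)
  fix \<theta> assume \<theta>: "distinct \<theta>" "set \<theta> = FVt (LPlus y1 y2)"
  define us where "us = vars_from 0 (map (tT \<circ> tlty) \<theta>)"
  interpret tuple_env S 0 \<theta> "tT \<circ> tlty" us "{}" "{}"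
    by unfold_locales (simp_all add: us_def \<theta>)
  let ?K = "App Plus (WPair (V (lookup \<theta> us y1)) (V (lookup \<theta> us y2)))"
  have "typing S (insert up {}) (WPair (V (lookup \<theta> us y1)) (V (lookup \<theta> us y2))) (TWith TReal TReal)"
    using typing_lookup[of y1] typing_lookup[of y2] assms \<theta>(2) by (intro ty_WPair) simp_all
  moreover have "split_env {} {} {} {up}" by (simp add: split_env_def bang_env_def)
  ultimately have "typing S ({} \<union> {} \<union> {} \<union> {up}) ?K TReal"
    using ty_App ty_Plus by (metis Un_empty_left)
  then have K: "typing S (insert up (bangs {} \<union> secs {})) ?K TReal" by simp
  have "typing S {} (dual_tm Unit (tuple_lam 0 us ?K)) (dual_ty TOne (map (tT \<circ> tlty) \<theta>) TReal)"
    by (rule typing_tuple_dual[OF _ tuple_env_axioms K, where A = "{}"]) (use ty_Unit in auto)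
  then show "typing S (bangs (pv ` FVp (LPlus y1 y2))) (delta \<theta> (LPlus y1 y2))
     (dual_ty (pT LOne) (map (tT \<circ> tlty) \<theta>) (tT LReal))"
    using assms by (simp add: Let_def us_def)
qed (simp add: assms)

lemma typing_Times:
  assumes "typing S {p} N TReal" "x \<notin> pset p" "vty x = TReal"
  shows "typing S (insert p (bangs {x})) (App (App Times (V x)) N) TReal"
proof -
  have "typing S (bangs {x}) (App Times (V x)) (Lolli TReal TReal)"
    using typing_App_bangs[of S "{}" Times TReal "Lolli TReal TReal" "{x}" "V x"] ty_Times[of S]
      typing_bvar[of S x] assms(3) by simp
  moreover have "split_env (bangs {x}) {} {} {p}"
    using assms(2) by (auto simp: split_env_def bang_env_def)
  ultimately have "typing S (bangs {x} \<union> {} \<union> {} \<union> {p}) (App (App Times (V x)) N) TReal"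
    using ty_App assms(1) by (metis Un_empty_left Un_empty_right)
  then show ?thesis by (simp add: insert_commute)
qed

lemma delta_typed_LTimes:
  assumes "plty x = LReal" "tlty y = LReal"
  shows "delta_typed S (LTimes x y) LOne LReal"
proof (rule delta_typedI)
  fix \<theta> assume \<theta>: "distinct \<theta>" "set \<theta> = FVt (LTimes x y)"
  let ?m = "fresh_p {x}"
  define us where "us = vars_from ?m (map (tT \<circ> tlty) \<theta>)"
  have x: "pidx x < ?m" by (rule fresh_p_gt) auto
  \<comment> \<open>The tangent factor is typed in the tuple alone, since the application splits the
    environment and sends \<open>!x\<close> to the other factor.\<close>
  interpret t: tuple_env S ?m \<theta> "tT \<circ> tlty" us "{}" "{}"
    by unfold_locales (simp_all add: us_def \<theta>)
  interpret tuple_env S ?m \<theta> "tT \<circ> tlty" us "{pv x}" "{}"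
    by unfold_locales (simp_all add: us_def \<theta> x)
  let ?K = "App (App Times (V (pv x))) (V (lookup \<theta> us y))"
  have "typing S {t.up} (V (lookup \<theta> us y)) TReal"
    using t.typing_lookup[of y] assms \<theta>(2) by simp
  then have "typing S (insert up (bangs {pv x})) ?K TReal"
    by (rule typing_Times) (use disj assms in auto)
  then have K: "typing S (insert up (bangs {pv x} \<union> secs {})) ?K TReal" by simp
  have "typing S (bangs {pv x}) (dual_tm Unit (tuple_lam ?m us ?K)) (dual_ty TOne (map (tT \<circ> tlty) \<theta>) TReal)"
    by (rule typing_tuple_dual[OF _ tuple_env_axioms K, where A = "{}"]) (use ty_Unit in auto)
  then show "typing S (bangs (pv ` FVp (LTimes x y))) (delta \<theta> (LTimes x y))
     (dual_ty (pT LOne) (map (tT \<circ> tlty) \<theta>) (tT LReal))"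
    using assms by (simp add: Let_def us_def)
qed (simp add: assms)

lemma delta_typed_LDup: "delta_typed S (LDup y) LOne (LTensor (tlty y) (tlty y))"
proof (rule delta_typedI)
  fix \<theta> assume \<theta>: "distinct \<theta>" "set \<theta> = FVt (LDup y)"
  define us where "us = vars_from 0 (map (tT \<circ> tlty) \<theta>)"
  interpret tuple_env S 0 \<theta> "tT \<circ> tlty" us "{}" "{}"
    by unfold_locales (simp_all add: us_def \<theta>)
  let ?K = "WPair (V (lookup \<theta> us y)) (V (lookup \<theta> us y))"
  have K: "typing S (insert up (bangs {} \<union> secs {})) ?K (TWith (tT (tlty y)) (tT (tlty y)))"
    using typing_lookup[of y] \<theta>(2) by (intro ty_WPair) simp_all
  have "typing S {} (dual_tm Unit (tuple_lam 0 us ?K)) (dual_ty TOne (map (tT \<circ> tlty) \<theta>) (TWith (tT (tlty y)) (tT (tlty y))))"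
    by (rule typing_tuple_dual[OF _ tuple_env_axioms K, where A = "{}"]) (use ty_Unit in auto)
  then show "typing S (bangs (pv ` FVp (LDup y))) (delta \<theta> (LDup y))
     (dual_ty (pT LOne) (map (tT \<circ> tlty) \<theta>) (tT (LTensor (tlty y) (tlty y))))"
    by (simp add: Let_def us_def)
qed simp

lemma delta_typed_LLetUnitP:
  assumes "delta_typed S e \<tau> \<sigma>" "plty z = LOne"
  shows "delta_typed S (LLetUnitP z e) \<tau> \<sigma>"
proof (rule delta_typedI)
  show "ety (LLetUnitP z e) = (\<tau>, \<sigma>)" using delta_typed_ety[OF assms(1)] by simp
  fix \<theta> assume "distinct \<theta>" "set \<theta> = FVt (LLetUnitP z e)"
  then show "typing S (bangs (pv ` FVp (LLetUnitP z e))) (delta \<theta> (LLetUnitP z e))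
     (dual_ty (pT \<tau>) (map (tT \<circ> tlty) \<theta>) (tT \<sigma>))"
    using typing_let_unit[OF delta_typedD[OF assms(1)], of \<theta> "pv z"] assms(2) by simp
qed

lemma delta_typed_LLetUnitT:
  assumes d: "delta_typed S e \<tau> \<sigma>" and z: "z \<notin> FVt e"
  shows "delta_typed S (LLetUnitT z e) \<tau> \<sigma>"
proof (rule delta_typedI)
  show "ety (LLetUnitT z e) = (\<tau>, \<sigma>)" using delta_typed_ety[OF d] by simp
  fix \<theta> assume dist: "distinct \<theta>" and \<theta>: "set \<theta> = FVt (LLetUnitT z e)"
  define \<theta>' where "\<theta>' = filter (\<lambda>w. w \<noteq> z) \<theta>"
  define m where "m = fresh_p (FVp e)"
  define x where "x = Var m (pT \<tau>)"
  define f where "f = Var (m + 1) (Lolli (with_ty (map (tT \<circ> tlty) \<theta>')) (tT \<sigma>))"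
  define us where "us = vars_from (m + 2) (map (tT \<circ> tlty) \<theta>)"
  define u where "u = (\<lambda>w. V (lookup \<theta> us w) :: 'a tm)"
  let ?T = "dual_ty (pT \<tau>) (map (tT \<circ> tlty) \<theta>) (tT \<sigma>)"
  have delta: "delta \<theta> (LLetUnitT z e) = let_tm (dual_pat x f) (delta \<theta>' e)
     (dual_tm (V x) (tuple_lam (m + 2) us (App (V f) (with_tm (map u \<theta>')))))"
    by (simp add: Let_def delta_typed_ety[OF d] \<theta>'_def m_def f_def x_def us_def u_def)
  have s: "set \<theta>' = FVt e" and d': "distinct \<theta>'"
    using \<theta> z dist by (auto simp: \<theta>'_def)
  have N: "typing S (bangs (pv ` FVp e)) (delta \<theta>' e) (Tensor (OfCourse (vty x)) (sec_ty (vty f)))"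
    using delta_typedD[OF d d' s] by (simp add: x_def f_def)
  have ge: "v \<notin> pv ` FVp e" if "m \<le> vidx v" for v
    using fresh_p_gt[OF finite_FVp, of _ e] that by (auto simp: m_def not_less[symmetric])
  have "f \<notin> pv ` FVp e" by (rule ge) (simp add: f_def)
  then have "typing S (bangs (pv ` FVp e)) (delta \<theta> (LLetUnitT z e)) (dual_ty (vty x) (map (tT \<circ> tlty) \<theta>) (tT \<sigma>))"
    unfolding delta u_def
    by (intro typing_let_reindex[OF N _ _ _ _ _ _ dist us_def]) (auto simp: x_def f_def \<theta>'_def)
  then show "typing S (bangs (pv ` FVp (LLetUnitT z e))) (delta \<theta> (LLetUnitT z e)) ?T"
    by (simp add: x_def)
qed

lemma delta_typed_LDrop:
  assumes d: "delta_typed S e \<tau> \<sigma>"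
  shows "delta_typed S (LDrop e) LOne LOne"
proof (rule delta_typedI)
  fix \<theta> assume dist: "distinct \<theta>" and \<theta>: "set \<theta> = FVt (LDrop e)"
  define A where "A = with_ty (map (tT \<circ> tlty) \<theta>)"
  define x where "x = Var 0 (pT \<tau>)"
  define f where "f = Var 1 (Lolli A (tT \<sigma>))"
  define y where "y = Var 2 A"
  define z where "z = Var 3 (tT \<sigma>)"
  define B :: "'a tm" where "B = let_tm (PVar z) (App (V f) (V y)) Empty"
  have delta: "delta \<theta> (LDrop e) = let_tm (dual_pat x f) (delta \<theta> e) (dual_tm Unit (Lam (PVar y) B))"
    by (simp add: Let_def delta_typed_ety[OF d] A_def f_def x_def y_def z_def B_def)
  have "typing S {PVar y} (V y) A" using ty_var[of S y] by (simp add: y_def)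
  then have "typing S (insert (sec_pat (PVar f)) {PVar y}) (App (V f) (V y)) (tT \<sigma>)"
    by (rule typing_App_sec) (simp_all add: f_def y_def)
  \<comment> \<open>Binding the discarded result to \<open>z\<close> is what consumes
    \<open>f\<close> and \<open>y\<close>; \<open>Empty\<close> then absorbs
    \<open>z\<close>.\<close>
  moreover have "typing S {} (Lam (PVar z) Empty) (Lolli (tT \<sigma>) TTop)"
    using ty_Lam[of "PVar z" "{}" S Empty TTop] ty_Empty[OF env_var[of z], of S] by (simp add: z_def)
  moreover have "split_env {} {} {} (insert (sec_pat (PVar f)) {PVar y})"
    by (simp add: split_env_def bang_env_def)
  ultimately have "typing S ({} \<union> {} \<union> {} \<union> insert (sec_pat (PVar f)) {PVar y}) B TTop"
    unfolding B_def let_tm_def using ty_App by (metis Un_empty_left)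
  then have "typing S (insert (PVar y) {sec_pat (PVar f)}) B TTop" by (simp add: insert_commute)
  then have K: "typing S (bangs {} \<union> secs {f}) (Lam (PVar y) B) (Lolli A TTop)"
    using ty_Lam[of "PVar y" "{sec_pat (PVar f)}" S B TTop] by (simp add: y_def f_def)
  have "typing S (insert (sec_pat (PVar f)) {}) (dual_tm Unit (Lam (PVar y) B)) (Tensor (OfCourse TOne) (sec_ty (Lolli A TTop)))"
    by (rule typing_dual_tm[OF _ K, where A = "{}"]) (use ty_Unit in auto)
  \<comment> \<open>The primal result is discarded as well; being duplicable, it enters by
    weakening.\<close>
  then have body: "typing S (insert (PBang x) (insert (sec_pat (PVar f)) (bangs {} \<union> secs {})))
      (dual_tm Unit (Lam (PVar y) B)) (Tensor (OfCourse TOne) (sec_ty (Lolli A TTop)))"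
    using ty_weak[of x "{sec_pat (PVar f)}"] by (simp add: x_def f_def)
  have "typing S (bangs (pv ` FVp e)) (delta \<theta> e) (Tensor (OfCourse (vty x)) (sec_ty (vty f)))"
    using delta_typedD[OF d dist] \<theta> by (simp add: x_def f_def A_def)
  from typing_let_dual[OF this body, of "bangs (pv ` FVp (LDrop e))"]
  show "typing S (bangs (pv ` FVp (LDrop e))) (delta \<theta> (LDrop e))
      (dual_ty (pT LOne) (map (tT \<circ> tlty) \<theta>) (tT LOne))"
    unfolding delta by (simp add: x_def f_def A_def)
qed simp

lemma delta_typed_LLetTensorT:
  assumes d: "delta_typed S e \<tau> \<sigma>" and x: "x1 \<in> FVt e" "x2 \<in> FVt e" "x1 \<noteq> x2"
    and z: "z \<notin> FVt e - {x1, x2}" "tlty z = LTensor (tlty x1) (tlty x2)"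
  shows "delta_typed S (LLetTensorT x1 x2 z e) \<tau> \<sigma>"
proof (rule delta_typedI)
  show "ety (LLetTensorT x1 x2 z e) = (\<tau>, \<sigma>)" using delta_typed_ety[OF d] by simp
  fix \<theta> assume dist: "distinct \<theta>" and \<theta>: "set \<theta> = FVt (LLetTensorT x1 x2 z e)"
  let ?t = "tT \<circ> tlty"
  define \<theta>' where "\<theta>' = filter (\<lambda>w. w \<noteq> z) \<theta>"
  define m where "m = fresh_p (FVp e)"
  define x where "x = Var m (pT \<tau>)"
  define f where "f = Var (m + 1) (Lolli (with_ty (map (tT \<circ> tlty) (x1 # x2 # \<theta>'))) (tT \<sigma>))"
  define v1 where "v1 = Var (m + 2) (tT (tlty x1))"
  define v2 where "v2 = Var (m + 3) (tT (tlty x2))"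
  define us where "us = vars_from (m + 4) (map (tT \<circ> tlty) \<theta>)"
  define u where "u = (\<lambda>w. V (lookup \<theta> us w) :: 'a tm)"
  define p where "p = (\<lambda>w. if w = z then PWith (PVar v1) (PVar v2) else PVar (lookup \<theta> us w))"
  define M where "M = App (V f) (with_tm (V v1 # V v2 # map u \<theta>'))"
  let ?w = "with_pat (m + 4) (map p \<theta>)"
  let ?body = "dual_tm (V x) (Lam ?w M)"
  let ?T = "dual_ty (pT \<tau>) (map ?t \<theta>) (tT \<sigma>)"
  have delta: "delta \<theta> (LLetTensorT x1 x2 z e) = let_tm (dual_pat x f) (delta (x1 # x2 # \<theta>') e) ?body"
    by (simp only: delta.simps Let_def delta_typed_ety[OF d] prod.case \<theta>'_def m_def f_def x_def us_def u_def
        v1_def v2_def p_def M_def)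
  have s: "set (x1 # x2 # \<theta>') = FVt e" and d': "distinct (x1 # x2 # \<theta>')"
    using \<theta> x z(1) dist by (auto simp: \<theta>'_def)
  have z\<theta>: "z \<in> set \<theta>" using \<theta> by simp
  have us: "lookup \<theta> us w \<in> set us" if "w \<in> set \<theta>" for w
    by (rule lookup_in) (use that in \<open>auto simp: us_def\<close>)
  have us_ge: "m + 4 \<le> vidx (lookup \<theta> us w)" if "w \<in> set \<theta>" for w
    using us[OF that] unfolding us_def by (rule vars_from_ge)
  have vty_us: "vty (lookup \<theta> us w) = ?t w" if w: "w \<in> set \<theta>" for w
  proof -
    obtain i where "i < length \<theta>" "w = \<theta> ! i" using w by (metis in_set_conv_nth)
    then show ?thesis using dist by (simp add: lookup_nth us_def)
  qed
  have dc: "distinct (concat (map pvars (map p \<theta>)))"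
    unfolding p_def by (rule distinct_split_pats[OF dist us_def]) (simp_all add: v1_def v2_def)
  have p_ge: "m + 2 \<le> vidx v" if "w \<in> set \<theta>" "v \<in> pset (p w)" for v w
    using that us_ge[OF that(1)] by (auto simp: p_def v1_def v2_def split: if_splits)
  have pset_w: "pset ?w = (\<Union>w\<in>set \<theta>. pset (p w))" using z\<theta> by (auto simp: pvars_with_pat)
  have f_w: "f \<notin> pset ?w" using p_ge unfolding pset_w by (force simp: f_def)
  have select: "typing S {?w} K A" if "w \<in> set \<theta>" "typing S {p w} K A" for w K A
    by (rule typing_select[where p = "p w" and \<Delta> = "{}"]) (use that dc in auto)
  \<comment> \<open>Two selections are combined: first the component for \<open>z\<close> in the
    tuple, then one half of its pair pattern.\<close>
  have v: "typing S {?w} (V v1) (?t x1)" "typing S {?w} (V v2) (?t x2)"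
    using select[OF z\<theta>, of "V v1" "?t x1"] select[OF z\<theta>, of "V v2" "?t x2"]
      ty_withL1[of "PVar v1" "PVar v2" "{}" S "V v1"] ty_withL2[of "PVar v1" "PVar v2" "{}" S "V v2"]
      ty_var[of S v1] ty_var[of S v2]
    by (simp_all add: p_def v1_def v2_def)
  have u: "typing S {?w} (u w) (?t w)" if "w \<in> set \<theta>'" for w
    using select[of w "V (lookup \<theta> us w)"] ty_var[of S "lookup \<theta> us w"] vty_us[of w] that
    by (simp add: u_def p_def \<theta>'_def)
  have wf: "wf_pat ?w" using dc z\<theta> by (auto simp: pvars_with_pat)
  then have E: "typing S {?w} Empty TTop" by (intro ty_Empty) (simp add: env_def)
  have "typing S {?w} (with_tm (V v1 # V v2 # map u \<theta>')) (with_ty (map ?t (x1 # x2 # \<theta>')))"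
    by (rule typing_with_tm[OF E]) (use v u in \<open>simp add: list_all2_map1 list_all2_map2 list.rel_refl_strong\<close>)
  then have "typing S (insert (sec_pat (PVar f)) {?w}) M (tT \<sigma>)"
    unfolding M_def by (rule typing_App_sec) (use f_w in \<open>simp_all add: f_def\<close>)
  then have "typing S (insert ?w {sec_pat (PVar f)}) M (tT \<sigma>)" by (simp add: insert_commute)
  then have "typing S {sec_pat (PVar f)} (Lam ?w M) (Lolli (pty ?w) (tT \<sigma>))"
    by (intro ty_Lam wf) (use f_w in auto)
  \<comment> \<open>The pair pattern has the type translated from \<open>tlty z\<close>, because
    \<open>tT\<close> sends a tensor to an & of the translated parts.\<close>
  moreover have "pty ?w = with_ty (map ?t \<theta>)"
    unfolding pty_with_pat map_map
    by (intro arg_cong[where f = with_ty] map_cong refl)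
      (use vty_us z(2) in \<open>auto simp: p_def v1_def v2_def\<close>)
  ultimately have K: "typing S (bangs {} \<union> secs {f}) (Lam ?w M) (Lolli (with_ty (map ?t \<theta>)) (tT \<sigma>))" by simp
  have body: "typing S (insert (PBang x) (insert (sec_pat (PVar f)) (bangs {} \<union> secs {}))) ?body
      (Tensor (OfCourse (vty x)) (sec_ty (Lolli (with_ty (map ?t \<theta>)) (tT \<sigma>))))"
    by (rule typing_dual_tm[OF typing_bvar K]) (auto simp: x_def f_def)
  have "typing S (bangs (pv ` FVp e)) (delta (x1 # x2 # \<theta>') e) (Tensor (OfCourse (vty x)) (sec_ty (vty f)))"
    using delta_typedD[OF d d' s] by (simp add: x_def f_def)
  from typing_let_dual[OF this body, of "bangs (pv ` FVp e)"]
  show "typing S (bangs (pv ` FVp (LLetTensorT x1 x2 z e))) (delta \<theta> (LLetTensorT x1 x2 z e)) ?T"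
    unfolding delta by (simp add: x_def f_def)
qed

section \<open>Typing of the sugar and of the JAX transform\<close>

lemma delta_typed_let_p:
  assumes "delta_typed S e1 (plty x) LOne" "delta_typed S e2 \<tau> \<sigma>"
  shows "delta_typed S (let_p x e1 e2) \<tau> \<sigma>"
proof -
  let ?y = "TV (fresh_t (FVt e2)) LOne"
  have "?y \<notin> FVt e2" by (rule fresh_t_notin) auto
  from delta_typed_LLet[OF _ delta_typed_LLetUnitT[OF assms(2) this], of e1 x ?y] assms(1)
  show ?thesis by (simp add: let_p_def Let_def)
qed

lemma delta_typed_let_t:
  assumes "delta_typed S e1 LOne (tlty y)" "delta_typed S e2 \<tau> \<sigma>" "y \<in> FVt e2"
  shows "delta_typed S (let_t y e1 e2) \<tau> \<sigma>"
  unfolding let_t_def Let_def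
  by (rule delta_typed_LLet[OF _ delta_typed_LLetUnitP[OF assms(2)]]) (use assms in simp_all)

lemma delta_typed_pair_exp:
  assumes "delta_typed S e1 \<tau> LOne" "delta_typed S e2 LOne \<sigma>"
  shows "delta_typed S (pair_exp e1 e2) \<tau> \<sigma>"
proof -
  let ?x = "PV (fresh_p (FVp e2)) (fst (ety e1))" and ?y = "TV 0 (snd (ety e2))"
  have "ety e1 = (\<tau>, LOne)" "ety e2 = (LOne, \<sigma>)" using assms by (auto intro: delta_typed_ety)
  then have "delta_typed S (let_p ?x e1 (let_t ?y e2 (LPair ?x ?y))) (plty ?x) (tlty ?y)"
    by (intro delta_typed_let_p delta_typed_let_t delta_typed_LPair) (use assms in simp_all)
  then show ?thesis using \<open>ety e1 = _\<close> \<open>ety e2 = _\<close> by (simp add: pair_exp_def Let_def)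
qed

lemma delta_typed_plus_exp:
  assumes "delta_typed S e1 LOne LReal" "delta_typed S e2 LOne LReal"
  shows "delta_typed S (plus_exp e1 e2) LOne LReal"
proof -
  have "ety e1 = (LOne, LReal)" "ety e2 = (LOne, LReal)" using assms by (auto intro: delta_typed_ety)
  then show ?thesis unfolding plus_exp_def Let_def
    by (intro delta_typed_let_t delta_typed_LPlus) (use assms in simp_all)
qed

lemma delta_typed_foldl_plus_exp:
  "delta_typed S e LOne LReal \<Longrightarrow> \<forall>e\<in>set es. delta_typed S e LOne LReal \<Longrightarrow>
     delta_typed S (foldl plus_exp e es) LOne LReal"
  by (induction es arbitrary: e) (simp_all add: delta_typed_plus_exp)

lemma delta_typed_sum_exp:
  "es \<noteq> [] \<Longrightarrow> \<forall>e\<in>set es. delta_typed S e LOne LReal \<Longrightarrow> delta_typed S (sum_exp es) LOne LReal"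
  by (cases es) (simp_all add: delta_typed_foldl_plus_exp)

lemma delta_typed_foldr_let_p:
  "\<forall>i\<in>set is. delta_typed S (h i) (plty (w i)) LOne \<Longrightarrow> delta_typed S e \<tau> \<sigma> \<Longrightarrow>
     delta_typed S (foldr (\<lambda>i. let_p (w i) (h i)) is e) \<tau> \<sigma>"
  by (induction "is") (simp_all add: delta_typed_let_p)

lemma delta_typed_let_dups:
  "delta_typed S e \<tau> \<sigma> \<Longrightarrow> dup_ok \<phi> r (FVt e) \<Longrightarrow>
   \<forall>(z, a, w, v)\<in>set r. tlty w = tlty (\<phi> z) \<and> tlty v = tlty (\<phi> z) \<and> tlty a = LTensor (tlty (\<phi> z)) (tlty (\<phi> z)) \<Longrightarrow>
     delta_typed S (let_dups \<phi> r e) \<tau> \<sigma>"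
proof (induction r)
  case (Cons q r)
  obtain z a w v where q: "q = (z, a, w, v)" by (cases q)
  have ok: "dup_ok \<phi> r (FVt e)" "w \<noteq> v" "w \<in> FVt e" "v \<in> FVt e" "a \<notin> FVt e" "{w, v} \<inter> dup_dst r = {}"
      "{a, w, v} \<inter> \<phi> ` dup_src r = {}"
    using Cons.prems(2) by (auto simp: q)
  have t: "tlty w = tlty (\<phi> z)" "tlty v = tlty (\<phi> z)" "tlty a = LTensor (tlty (\<phi> z)) (tlty (\<phi> z))"
    using Cons.prems(3) by (auto simp: q)
  let ?R = "let_dups \<phi> r e"
  have R: "FVt ?R = \<phi> ` dup_src r \<union> (FVt e - dup_dst r)" by (rule FVt_let_dups[OF ok(1)])
  have "delta_typed S ?R \<tau> \<sigma>" by (rule Cons.IH[OF Cons.prems(1) ok(1)]) (use Cons.prems(3) in simp)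
  then have "delta_typed S (LLetTensorT w v a ?R) \<tau> \<sigma>"
    by (rule delta_typed_LLetTensorT) (use R ok t in auto)
  then have "delta_typed S (let_t a (LDup (\<phi> z)) (LLetTensorT w v a ?R)) \<tau> \<sigma>"
    using delta_typed_LDup[of S "\<phi> z"] t(3) by (intro delta_typed_let_t) simp_all
  then show ?case by (simp add: q)
qed simp

lemma delta_typed_fjax:
  "btyping S \<Gamma> e \<tau> \<Longrightarrow> wf_signat S \<Longrightarrow> tangent_names \<phi> \<Gamma> \<Longrightarrow> delta_typed S (fjax S \<phi> e) \<tau> \<tau>"
proof (induction arbitrary: \<phi> rule: btyping.induct)
  case (bt_Var x)
  then show ?case using delta_typed_LPair[of S x "\<phi> x"] by (simp add: tangent_names_def)
next
  case (bt_Let \<Gamma>\<^sub>1 e\<^sub>1 x \<Gamma>\<^sub>2 e\<^sub>2 \<tau>)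
  show ?case
  proof (rule fjax_BLet_cases[OF bt_Let.hyps bt_Let.prems(2)])
    fix r y \<phi>\<^sub>1 \<phi>\<^sub>2
    assume *:
      "fjax S \<phi> (BLet x e\<^sub>1 e\<^sub>2) = let_dups \<phi> r (LLet x y (fjax S \<phi>\<^sub>1 e\<^sub>1) (fjax S \<phi>\<^sub>2 e\<^sub>2))"
      "tangent_names \<phi>\<^sub>1 \<Gamma>\<^sub>1" "tangent_names \<phi>\<^sub>2 (insert x \<Gamma>\<^sub>2)" "\<phi>\<^sub>2 x = y"
      "dup_src r = \<Gamma>\<^sub>1 \<inter> \<Gamma>\<^sub>2" "dup_ok \<phi> r (\<phi>\<^sub>1 ` \<Gamma>\<^sub>1 \<union> \<phi>\<^sub>2 ` \<Gamma>\<^sub>2)" "y \<notin> \<phi>\<^sub>2 ` \<Gamma>\<^sub>2"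
      "\<forall>(z, a, w, v)\<in>set r. w = \<phi>\<^sub>1 z \<and> v = \<phi>\<^sub>2 z \<and> tlty a = LTensor (plty z) (plty z)"
    let ?E = "LLet x y (fjax S \<phi>\<^sub>1 e\<^sub>1) (fjax S \<phi>\<^sub>2 e\<^sub>2)"
    note FV1 = FV_fjax[OF bt_Let.hyps(1) bt_Let.prems(1) *(2)]
    note FV2 = FV_fjax[OF bt_Let.hyps(2) bt_Let.prems(1) *(3)]
    have FV: "FVt ?E = \<phi>\<^sub>1 ` \<Gamma>\<^sub>1 \<union> \<phi>\<^sub>2 ` \<Gamma>\<^sub>2" using FV1 FV2 *(4,7) by auto
    have y: "tlty y = plty x" using *(3,4) by (auto simp: tangent_names_def)
    have E: "delta_typed S ?E \<tau> \<tau>"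
      by (rule delta_typed_LLet[OF _ bt_Let.IH(2)[OF bt_Let.prems(1) *(3)]])
        (use bt_Let.IH(1)[OF bt_Let.prems(1) *(2)] y FV2 *(4) in auto)
    show ?case unfolding *(1)
    proof (rule delta_typed_let_dups[OF E])
      show "dup_ok \<phi> r (FVt ?E)" unfolding FV by (rule *(6))
      show "\<forall>(z, a, w, v)\<in>set r. tlty w = tlty (\<phi> z) \<and> tlty v = tlty (\<phi> z) \<and> tlty a = LTensor (tlty (\<phi> z)) (tlty (\<phi> z))"
      proof (intro ballI, clarify)
        fix z a w v assume m: "(z, a, w, v) \<in> set r"
        then have "z \<in> \<Gamma>\<^sub>1 \<inter> \<Gamma>\<^sub>2" unfolding *(5)[symmetric] dup_src_def by force
        moreover have "w = \<phi>\<^sub>1 z" "v = \<phi>\<^sub>2 z" "tlty a = LTensor (plty z) (plty z)" using *(8) m by auto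
        ultimately show "tlty w = tlty (\<phi> z) \<and> tlty v = tlty (\<phi> z) \<and> tlty a = LTensor (tlty (\<phi> z)) (tlty (\<phi> z))"
          using *(2,3) bt_Let.prems(2) by (simp add: tangent_names_def)
      qed
    qed
  qed
next
  case (bt_Num r)
  then show ?case using delta_typed_pair_exp[OF delta_typed_LNum delta_typed_LZero] by simp
next
  case (bt_Fn xs f)
  define w where "w = (\<lambda>i. PV (fresh_p (set xs) + i) LReal)"
  let ?is = "[0..<length xs]"
  let ?h = "\<lambda>i. LTimes (w i) (\<phi> (xs ! i)) :: 'a lexp"
  have eq: "fjax S \<phi> (BFn f xs) = foldr (\<lambda>i. let_p (w i) (LFn (part S f i) xs)) ?is
      (pair_exp (LFn f xs) (sum_exp (map ?h ?is)))"
    by (simp only: fjax.simps Let_def w_def)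
  have "?is \<noteq> []" using wf_signat_arity[OF bt_Fn.prems(1), of f] bt_Fn.hyps(1) by auto
  moreover have "delta_typed S (?h i) LOne LReal" if "i < length xs" for i
    by (rule delta_typed_LTimes) (use bt_Fn that in \<open>auto simp: w_def tangent_names_def\<close>)
  ultimately have sum: "delta_typed S (sum_exp (map ?h ?is)) LOne LReal"
    by (intro delta_typed_sum_exp) auto
  show ?case unfolding eq
  proof (rule delta_typed_foldr_let_p)
    show "\<forall>i\<in>set ?is. delta_typed S (LFn (part S f i) xs) (plty (w i)) LOne"
    proof
      fix i assume "i \<in> set ?is"
      then have "length xs = arity S (part S f i)"
        using wf_signat_arity_part[OF bt_Fn.prems(1), of i f] bt_Fn.hyps(1) by simp
      from delta_typed_LFn[OF this bt_Fn.hyps(3)] show "delta_typed S (LFn (part S f i) xs) (plty (w i)) LOne"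
        by (simp add: w_def)
    qed
    show "delta_typed S (pair_exp (LFn f xs) (sum_exp (map ?h ?is))) LReal LReal"
      by (rule delta_typed_pair_exp[OF delta_typed_LFn[OF bt_Fn.hyps(1,3)] sum])
  qed
next
  case (bt_Drop \<Gamma> e \<tau>)
  from delta_typed_LDrop[OF bt_Drop.IH[OF bt_Drop.prems]] show ?case by simp
next
  case bt_Unit
  then show ?case using delta_typed_pair_exp[OF delta_typed_LUnitP delta_typed_LUnitT] by simp
next
  case (bt_LetUnit \<Gamma> e \<tau> z)
  have \<phi>: "tangent_names \<phi> \<Gamma>" by (rule tangent_names_subset[OF bt_LetUnit.prems(2)]) auto
  have "\<phi> z \<notin> FVt (fjax S \<phi> e)"
    using FV_fjax[OF bt_LetUnit.hyps(1) bt_LetUnit.prems(1) \<phi>] bt_LetUnit.hyps(3) bt_LetUnit.prems(2)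
    by (auto simp: tangent_names_def inj_on_def)
  from delta_typed_LLetUnitP[OF delta_typed_LLetUnitT[OF bt_LetUnit.IH[OF bt_LetUnit.prems(1) \<phi>] this]
      bt_LetUnit.hyps(2)]
  show ?case by simp
qed

section \<open>Typing of the forward transformation\<close>

lemma tL_pT [simp]: "tL (pT \<tau>) = tT \<tau>"
  by (induction \<tau>) auto

lemma typing_fwd_let:
  fixes S :: "'f signat"
  assumes dist: "distinct \<theta>" and \<theta>: "set \<theta> = fv Q \<union> (fv P - {x})"
    and fin: "finite (fv P)" "finite (fv Q)"
    and Q: "\<And>\<theta>'. distinct \<theta>' \<Longrightarrow> set \<theta>' = fv Q \<Longrightarrow>
      typing S (bangs (fv Q)) (fwd S \<theta>' Q) (dual_ty (vty x) (map (tL \<circ> vty) \<theta>') (tL (vty x)))"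
    and P: "\<And>\<theta>'. distinct \<theta>' \<Longrightarrow> set \<theta>' = fv P \<Longrightarrow>
      typing S (bangs (fv P)) (fwd S \<theta>' P) (dual_ty (fwd_ty P) (map (tL \<circ> vty) \<theta>') (tL (fwd_ty P)))"
  shows "typing S (bangs (set \<theta>)) (fwd S \<theta> (let_tm (PBang x) Q P))
     (dual_ty (fwd_ty P) (map (tL \<circ> vty) \<theta>) (tL (fwd_ty P)))"
proof -
  let ?t = "tL \<circ> vty"
  define \<theta>1 where "\<theta>1 = filter (\<lambda>w. w \<in> fv Q) \<theta>"
  define \<theta>2 where "\<theta>2 = filter (\<lambda>w. w \<in> fv P - {x}) \<theta>"
  define \<theta>P where "\<theta>P = (if x \<in> fv P then x # \<theta>2 else \<theta>2)"
  define m where "m = fresh_index (vidx ` insert x (fv P \<union> fv Q))"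
  define f where "f = Var m (Lolli (with_ty (map (tL \<circ> vty) \<theta>1)) (tL (vty x)))"
  define y where "y = Var (m + 1) (fwd_ty P)"
  define g where "g = Var (m + 2) (Lolli (with_ty (map (tL \<circ> vty) \<theta>P)) (tL (fwd_ty P)))"
  define us where "us = vars_from (m + 3) (map (tL \<circ> vty) \<theta>)"
  define u where "u = (\<lambda>w. V (lookup \<theta> us w) :: 'f tm)"
  define fu where "fu = App (V f) (with_tm (map u \<theta>1))"
  define args where "args = (if x \<in> fv P then fu # map u \<theta>2 else map u \<theta>2)"
  let ?body = "dual_tm (V y) (tuple_lam (m + 3) us (App (V g) (with_tm args)))"
  have fwd: "fwd S \<theta> (let_tm (PBang x) Q P) = let_tm (dual_pat x f) (fwd S \<theta>1 Q)
     (let_tm (dual_pat y g) (fwd S \<theta>P P) ?body)"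
    unfolding let_tm_def[of "PBang x" Q P]
    by (simp only: fwd.simps Let_def \<theta>1_def \<theta>2_def \<theta>P_def m_def f_def y_def g_def us_def u_def fu_def args_def)
  have lt: "vidx w < m" if "w \<in> insert x (fv P \<union> fv Q)" for w
    unfolding m_def by (rule fresh_index_gt) (use that fin in auto)
  have s1: "set \<theta>1 = fv Q" and s2: "set \<theta>P = fv P" and d: "distinct \<theta>1" "distinct \<theta>P"
    using \<theta> dist by (auto simp: \<theta>1_def \<theta>2_def \<theta>P_def)
  have ge: "v \<notin> insert x (fv P \<union> fv Q)" if "m \<le> vidx v" for v using lt[of v] that by auto
  have args: "args = map (\<lambda>w. if w = x then App (V f) (with_tm (map u \<theta>1)) else u w) \<theta>P"
    by (auto simp: args_def fu_def \<theta>P_def \<theta>2_def)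
  have t1: "typing S (bangs (fv Q)) (fwd S \<theta>1 Q) (Tensor (OfCourse (vty x)) (sec_ty (vty f)))"
    using Q[OF d(1) s1] by (simp add: f_def)
  \<comment> \<open>If \<open>x\<close> is not free in \<open>P\<close>, its entry comes from
    weakening.\<close>
  have t2: "typing S (bangs (insert x (fv P))) (fwd S \<theta>P P) (Tensor (OfCourse (vty y)) (sec_ty (vty g)))"
    by (rule typing_bangs_mono[where A = "fv P"]) (use P[OF d(2) s2] fin in \<open>auto simp: y_def g_def\<close>)
  have "typing S (bangs (fv Q \<union> (fv P - {x}))) (fwd S \<theta> (let_tm (PBang x) Q P))
      (dual_ty (vty y) (map ?t \<theta>) (tL (fwd_ty P)))"
    unfolding fwd
  proof (rule typing_let_let[OF t1 t2 _ _ _ _ _ _ _ _ fin(2,1) _ _ dist us_def args[unfolded u_def]])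
    show "{f, g} \<inter> insert x (fv Q \<union> fv P) = {}"
      using ge[of f] ge[of g] by (auto simp: f_def g_def)
  qed (simp_all add: f_def g_def y_def, auto simp: \<theta>1_def \<theta>P_def \<theta>2_def)
  then show ?thesis unfolding \<theta> by (simp add: y_def)
qed

lemma typing_fwd_let_unit:
  fixes S :: "'f signat"
  assumes dist: "distinct \<theta>" and \<theta>: "set \<theta> = insert z (fv P)" and z: "vty z = TOne"
    and P: "\<And>\<theta>'. distinct \<theta>' \<Longrightarrow> set \<theta>' = fv P \<Longrightarrow>
      typing S (bangs (fv P)) (fwd S \<theta>' P) (dual_ty (fwd_ty P) (map (tL \<circ> vty) \<theta>') (tL (fwd_ty P)))"
  shows "typing S (bangs (set \<theta>)) (fwd S \<theta> (let_tm PUnit (V z) P))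
     (dual_ty (fwd_ty P) (map (tL \<circ> vty) \<theta>) (tL (fwd_ty P)))"
proof -
  let ?t = "tL \<circ> vty"
  define \<theta>' where "\<theta>' = filter (\<lambda>w. w \<in> fv P) \<theta>"
  define m where "m = fresh_index (vidx ` fv P)"
  define y where "y = Var m (fwd_ty P)"
  define g where "g = Var (m + 1) (Lolli (with_ty (map (tL \<circ> vty) \<theta>')) (tL (fwd_ty P)))"
  define us where "us = vars_from (m + 2) (map (tL \<circ> vty) \<theta>)"
  define u where "u = (\<lambda>w. V (lookup \<theta> us w) :: 'f tm)"
  let ?body = "dual_tm (V y) (tuple_lam (m + 2) us (App (V g) (with_tm (map u \<theta>'))))"
  have fwd: "fwd S \<theta> (let_tm PUnit (V z) P) = let_tm PUnit (V z) (let_tm (dual_pat y g) (fwd S \<theta>' P) ?body)"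
    unfolding let_tm_def[of PUnit "V z" P]
    by (simp only: fwd.simps Let_def \<theta>'_def m_def y_def g_def us_def u_def)
  have s: "set \<theta>' = fv P" and d': "distinct \<theta>'" using \<theta> dist by (auto simp: \<theta>'_def)
  have fin: "finite (fv P)" using \<theta> by (metis finite_insert finite_set)
  have lt: "vidx w < m" if "w \<in> fv P" for w
    unfolding m_def by (rule fresh_index_gt) (use that fin in auto)
  have ge: "v \<notin> fv P" if "m \<le> vidx v" for v using lt[of v] that by auto
  have N: "typing S (bangs (fv P)) (fwd S \<theta>' P) (Tensor (OfCourse (vty y)) (sec_ty (vty g)))"
    using P[OF d' s] by (simp add: y_def g_def)
  have "typing S (bangs (fv P)) (let_tm (dual_pat y g) (fwd S \<theta>' P) ?body) (dual_ty (vty y) (map ?t \<theta>) (tL (fwd_ty P)))"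
    unfolding u_def
    by (rule typing_let_reindex[OF N _ _ ge _ fin _ dist us_def]) (auto simp: y_def g_def \<theta>'_def)
  from typing_let_unit[OF this z fin] show ?thesis unfolding fwd \<theta> by (simp add: y_def)
qed

lemma typing_let_bang:
  assumes "typing S (bangs A) N (OfCourse (vty y))" "typing S (bangs (insert y A)) M T" "y \<notin> A" "finite A"
  shows "typing S (bangs A) (let_tm (PBang y) N M) T"
proof -
  have "typing S (bangs A) (Lam (PBang y) M) (Lolli (OfCourse (vty y)) T)"
    using ty_Lam[of "PBang y" "bangs A" S M T] assms(2,3) by simp
  from typing_App_bangs[OF this assms(1,4,4)] show ?thesis by (simp add: let_tm_def)
qed

text \<open>The environment grows by one duplicable variable per let, and weakening carries the
  typings of the remaining bound terms along.\<close>

lemma typing_foldr_let_bang: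
  assumes "finite A"
  shows "\<forall>i\<in>set is. typing S (bangs A) (N i) (OfCourse (vty (y i))) \<Longrightarrow> y ` set is \<inter> A = {} \<Longrightarrow>
   typing S (bangs (A \<union> y ` set is)) M T \<Longrightarrow> distinct (map y is) \<Longrightarrow>
   typing S (bangs A) (foldr (\<lambda>i. let_tm (PBang (y i)) (N i)) is M) T"
  using assms
proof (induction "is" arbitrary: A)
  case (Cons i "is")
  have "typing S (bangs (insert (y i) A)) (foldr (\<lambda>i. let_tm (PBang (y i)) (N i)) is M) T"
  proof (rule Cons.IH)
    show "\<forall>j\<in>set is. typing S (bangs (insert (y i) A)) (N j) (OfCourse (vty (y j)))"
    proof
      fix j assume "j \<in> set is"
      then have "typing S (bangs A) (N j) (OfCourse (vty (y j)))" using Cons.prems(1) by simp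
      then show "typing S (bangs (insert (y i) A)) (N j) (OfCourse (vty (y j)))"
        by (rule typing_bangs_mono) (use Cons.prems(5) in auto)
    qed
    show "y ` set is \<inter> insert (y i) A = {}" using Cons.prems(2,4) by auto
    show "typing S (bangs (insert (y i) A \<union> y ` set is)) M T" using Cons.prems(3) by (simp add: Un_insert_left)
  qed (use Cons.prems(4,5) in simp_all)
  then show ?case using typing_let_bang[of S A "N i" "y i"] Cons.prems(1,2,5) by simp
qed simp

lemma typing_sum_tm:
  assumes "Ms \<noteq> []" "\<forall>M\<in>set Ms. typing S \<Delta> M TReal"
  shows "typing S \<Delta> (sum_tm Ms) TReal"
proof -
  have Plus: "typing S \<Delta> (App Plus (WPair M N)) TReal" if "typing S \<Delta> M TReal" "typing S \<Delta> N TReal" for M N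
  proof -
    have "split_env {} {} {} \<Delta>" by (simp add: split_env_def bang_env_def)
    from ty_App[OF this, of S Plus "TWith TReal TReal" TReal "WPair M N"] ty_Plus[of S] ty_WPair[OF that]
    show ?thesis by simp
  qed
  have "typing S \<Delta> M TReal \<Longrightarrow> \<forall>M\<in>set Ms. typing S \<Delta> M TReal \<Longrightarrow>
      typing S \<Delta> (foldl (\<lambda>P N. App Plus (WPair P N)) M Ms) TReal" for M Ms
    by (induction Ms arbitrary: M) (simp_all add: Plus)
  then show ?thesis using assms by (cases Ms) auto
qed

lemma typing_fwd_Fn:
  fixes S :: "'f signat"
  assumes wf: "wf_signat S" and xs: "length xs = arity S f" "\<forall>x\<in>set xs. plty x = LReal"
    and dist: "distinct \<theta>" and \<theta>: "set \<theta> = pv ` set xs"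
  shows "typing S (bangs (set \<theta>)) (fwd S \<theta> (deltaB (BFn f xs))) (dual_ty TReal (map (tL \<circ> vty) \<theta>) TReal)"
proof -
  let ?t = "tL \<circ> vty"
  define vs where "vs = map pv xs"
  define M :: "'f tm" where "M = tensor_tm (map (\<lambda>x. Bang (V x)) vs)"
  define n where "n = length xs"
  define m where "m = fresh_index (vidx ` set vs)"
  define y where "y = (\<lambda>i. Var (m + i) TReal)"
  define us where "us = vars_from (m + n) (map (tL \<circ> vty) \<theta>)"
  define u where "u = (\<lambda>x. V (lookup \<theta> us x) :: 'f tm)"
  define Ms where "Ms = map (\<lambda>i. App (App Times (V (y i))) (u (vs ! i))) [0..<n]"
  have n: "0 < n" "length vs = n" "n = arity S f"
    using wf_signat_arity[OF wf, of f] xs(1) by (simp_all add: n_def vs_def)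
  have vs: "vs \<noteq> []" "set vs = set \<theta>" using n \<theta> by (auto simp: vs_def)
  have vsi: "vs ! i \<in> set \<theta>" if "i < n" for i using vs(2) n(2) that by (metis nth_mem)
  have Ms: "Ms \<noteq> []" using n by (simp add: Ms_def)
  have M: "deltaB (BFn f xs) = App (Fn f) M" by (simp add: M_def vs_def comp_def)
  have args: "arg_vars M = vs" unfolding M_def by (rule arg_vars_tensor[OF vs(1)])
  have fwd: "fwd S \<theta> (deltaB (BFn f xs)) = foldr (\<lambda>i. let_tm (PBang (y i)) (App (Fn (part S f i)) M)) [0..<n]
           (Pair (App (Fn f) M) (sec_tm (tuple_lam (m + n) us (sum_tm Ms))))"
    by (simp only: M fwd.simps Let_def args n(2) m_def y_def us_def u_def Ms_def)
  have vty: "\<forall>v\<in>set vs. vty v = TReal" using xs(2) by (simp add: vs_def)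
  have lt: "vidx v < m" if "v \<in> set vs" for v
    unfolding m_def by (rule fresh_index_gt) (use that in auto)
  \<comment> \<open>The variables holding the partial derivatives; being duplicable, they may all be
    visible to every summand.\<close>
  let ?Y = "y ` {0..<n}"
  interpret t: tuple_env S "m + n" \<theta> ?t us "{}" "{}"
    by unfold_locales (simp_all add: us_def dist)
  interpret tY: tuple_env S "m + n" \<theta> ?t us ?Y "{}"
    by unfold_locales (auto simp: us_def dist y_def)
  have "typing S (insert t.up (bangs ?Y)) (App (App Times (V (y i))) (u (vs ! i))) TReal" if i: "i < n" for i
  proof -
    have "typing S {t.up} (u (vs ! i)) TReal"
      using t.typing_lookup[OF vsi[OF i]] vty n(2) i by (simp add: u_def)
    then have "typing S (insert t.up (bangs {y i})) (App (App Times (V (y i))) (u (vs ! i))) TReal"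
    proof (rule typing_Times)
      have "y i \<in> ?Y" using i by simp
      then show "y i \<notin> pset t.up" using tY.disj by blast
    qed (simp add: y_def)
    \<comment> \<open>The summand uses only its own coefficient; the others are added by
      weakening.\<close>
    then have "typing S (bangs (?Y - {y i}) \<union> insert t.up (bangs {y i})) (App (App Times (V (y i))) (u (vs ! i))) TReal"
      by (rule typing_bangs_weaken[rotated]) (use tY.disj in auto)
    moreover have "bangs (?Y - {y i}) \<union> insert t.up (bangs {y i}) = insert t.up (bangs ?Y)"
      using i by auto
    ultimately show ?thesis by simp
  qed
  then have "typing S (insert t.up (bangs ?Y \<union> secs {})) (sum_tm Ms) TReal"
    by (intro typing_sum_tm[OF Ms]) (auto simp: Ms_def)
  from typing_tuple_lam[OF this us_def]
  have K: "typing S (bangs ?Y \<union> secs {}) (tuple_lam (m + n) us (sum_tm Ms)) (Lolli (with_ty (map ?t \<theta>)) TReal)"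
    by (auto simp: y_def)
  have F: "typing S (bangs (set \<theta>)) (App (Fn h) M) (OfCourse TReal)" if "arity S h = arity S f" for h
    unfolding M_def vs(2)[symmetric] by (rule typing_Fn_args) (use that n vty in auto)
  show ?thesis unfolding fwd
  proof (rule typing_foldr_let_bang)
    show "\<forall>i\<in>set [0..<n]. typing S (bangs (set \<theta>)) (App (Fn (part S f i)) M) (OfCourse (vty (y i)))"
      using F wf_signat_arity_part[OF wf] n(3) by (simp add: y_def)
    show "y ` set [0..<n] \<inter> set \<theta> = {}" using lt vs(2) by (force simp: y_def)
    show "typing S (bangs (set \<theta> \<union> y ` set [0..<n])) (Pair (App (Fn f) M) (sec_tm (tuple_lam (m + n) us (sum_tm Ms))))
        (dual_ty TReal (map ?t \<theta>) TReal)"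
      by (rule typing_Pair_sec[OF F[OF refl] K]) auto
    show "distinct (map y [0..<n])" by (simp add: distinct_map inj_on_def y_def)
  qed simp
qed

lemma typing_fwd:
  fixes S :: "'f signat"
  shows "btyping S \<Gamma> e \<tau> \<Longrightarrow> wf_signat S \<Longrightarrow> distinct \<theta> \<Longrightarrow> set \<theta> = pv ` \<Gamma> \<Longrightarrow>
    typing S (bangs (set \<theta>)) (fwd S \<theta> (deltaB e)) (dual_ty (pT \<tau>) (map (tL \<circ> vty) \<theta>) (tT \<tau>))"
proof (induction arbitrary: \<theta> rule: btyping.induct)
  case (bt_Var x)
  then have "length \<theta> = 1" by (metis card_insert_disjoint card.empty distinct_card empty_iff finite.emptyI
        image_empty image_insert One_nat_def)
  then have \<theta>: "\<theta> = [pv x]" using bt_Var.prems(3) by (cases \<theta>) auto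
  let ?u = "Var 0 (tL (vty (pv x)))"
  have "typing S {} (Lam (PVar ?u) (V ?u)) (Lolli (tL (vty (pv x))) (tL (vty (pv x))))"
    using ty_Lam[of "PVar ?u" "{}"] ty_var[of S ?u] by simp
  from typing_dual_tm[OF typing_bvar[of S "pv x"], of "{}" "{}", simplified, OF this]
  show ?case by (simp add: \<theta> Let_def)
next
  case (bt_Let \<Gamma>\<^sub>1 e\<^sub>1 x \<Gamma>\<^sub>2 e\<^sub>2 \<tau>)
  note f1 = btyping_fv[OF bt_Let.hyps(1)] and f2 = btyping_fv[OF bt_Let.hyps(2)]
  note ft = btyping_fwd_ty[OF bt_Let.hyps(2)]
  have "typing S (bangs (set \<theta>)) (fwd S \<theta> (let_tm (PBang (pv x)) (deltaB e\<^sub>1) (deltaB e\<^sub>2)))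
     (dual_ty (fwd_ty (deltaB e\<^sub>2)) (map (tL \<circ> vty) \<theta>) (tL (fwd_ty (deltaB e\<^sub>2))))"
  proof (rule typing_fwd_let[OF bt_Let.prems(2)])
    show "set \<theta> = fv (deltaB e\<^sub>1) \<union> (fv (deltaB e\<^sub>2) - {pv x})"
      unfolding f1 f2 pv_image_diff bt_Let.prems(3) using bt_Let.hyps(3) by (simp add: image_Un)
    show "finite (fv (deltaB e\<^sub>2))" "finite (fv (deltaB e\<^sub>1))"
      unfolding f1 f2 using btyping_finite bt_Let.hyps(1,2) by blast+
    show "typing S (bangs (fv (deltaB e\<^sub>1))) (fwd S \<theta>' (deltaB e\<^sub>1))
        (dual_ty (vty (pv x)) (map (tL \<circ> vty) \<theta>') (tL (vty (pv x))))"
      if "distinct \<theta>'" "set \<theta>' = fv (deltaB e\<^sub>1)" for \<theta>'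
      using bt_Let.IH(1)[OF bt_Let.prems(1) that(1)] by (simp only: that(2) f1 vty_pv tL_pT)
    show "typing S (bangs (fv (deltaB e\<^sub>2))) (fwd S \<theta>' (deltaB e\<^sub>2))
        (dual_ty (fwd_ty (deltaB e\<^sub>2)) (map (tL \<circ> vty) \<theta>') (tL (fwd_ty (deltaB e\<^sub>2))))"
      if "distinct \<theta>'" "set \<theta>' = fv (deltaB e\<^sub>2)" for \<theta>'
      using bt_Let.IH(2)[OF bt_Let.prems(1) that(1)] by (simp only: that(2) f2 ft tL_pT)
  qed
  then show ?case by (simp only: deltaB.simps ft tL_pT)
next
  case (bt_Num r)
  then have "\<theta> = []" by simp
  then show ?case
    using typing_dual_const[of S "{}" "Num r" TReal "Num 0" TReal] ty_Num[of S r] ty_zero[OF env_var, of S] by simp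
next
  case (bt_Fn xs f)
  from typing_fwd_Fn[OF bt_Fn.prems(1) bt_Fn.hyps(1,3) bt_Fn.prems(2,3)] show ?case
    by (simp only: pT.simps tT.simps)
next
  case (bt_Drop \<Gamma> e \<tau>)
  let ?P = "Bang Unit :: 'f tm"
  let ?x = "Var 0 (pT (fst (ety (desugar e))))"
  note f = btyping_fv[OF bt_Drop.hyps]
  have "typing S (bangs (set \<theta>)) (fwd S \<theta> (let_tm (PBang ?x) (deltaB e) ?P))
     (dual_ty (fwd_ty ?P) (map (tL \<circ> vty) \<theta>) (tL (fwd_ty ?P)))"
  proof (rule typing_fwd_let[OF bt_Drop.prems(2)])
    show "set \<theta> = fv (deltaB e) \<union> (fv ?P - {?x})" using bt_Drop.prems(3) f by simp
    show "finite (fv ?P)" "finite (fv (deltaB e))"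
      unfolding f using btyping_finite[OF bt_Drop.hyps] by simp_all
    show "typing S (bangs (fv (deltaB e))) (fwd S \<theta>' (deltaB e)) (dual_ty (vty ?x) (map (tL \<circ> vty) \<theta>') (tL (vty ?x)))"
      if "distinct \<theta>'" "set \<theta>' = fv (deltaB e)" for \<theta>'
      \<comment> \<open>\<open>btyping_ety\<close> identifies the annotation of the discarded
        variable with the type of \<open>e\<close>.\<close>
      using bt_Drop.IH[OF bt_Drop.prems(1) that(1)]
      by (simp only: that(2) f btyping_ety[OF bt_Drop.hyps] var.sel(2) tL_pT)
    show "typing S (bangs (fv ?P)) (fwd S \<theta>' ?P)
        (dual_ty (fwd_ty ?P) (map (tL \<circ> vty) \<theta>') (tL (fwd_ty ?P)))"
      if "set \<theta>' = fv ?P" for \<theta>'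
      using typing_dual_const[of S "{}" Unit TOne Empty TTop] ty_Unit[of S] ty_Empty[OF env_var, of S] that by simp
  qed
  then show ?case by (simp only: deltaB.simps fwd_ty.simps tL.simps pT.simps tT.simps)
next
  case bt_Unit
  then have "\<theta> = []" by simp
  then show ?case
    using typing_dual_const[of S "{}" Unit TOne Empty TTop] ty_Unit[of S] ty_Empty[OF env_var, of S] by simp
next
  case (bt_LetUnit \<Gamma> e \<tau> z)
  note f = btyping_fv[OF bt_LetUnit.hyps(1)] and ft = btyping_fwd_ty[OF bt_LetUnit.hyps(1)]
  have "typing S (bangs (set \<theta>)) (fwd S \<theta> (let_tm PUnit (V (pv z)) (deltaB e)))
     (dual_ty (fwd_ty (deltaB e)) (map (tL \<circ> vty) \<theta>) (tL (fwd_ty (deltaB e))))"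
  proof (rule typing_fwd_let_unit[OF bt_LetUnit.prems(2)])
    show "set \<theta> = insert (pv z) (fv (deltaB e))" unfolding f bt_LetUnit.prems(3) by simp
    show "vty (pv z) = TOne" using bt_LetUnit.hyps(2) by simp
    show "typing S (bangs (fv (deltaB e))) (fwd S \<theta>' (deltaB e))
        (dual_ty (fwd_ty (deltaB e)) (map (tL \<circ> vty) \<theta>') (tL (fwd_ty (deltaB e))))"
      if "distinct \<theta>'" "set \<theta>' = fv (deltaB e)" for \<theta>'
      using bt_LetUnit.IH[OF bt_LetUnit.prems(1) that(1)] by (simp only: that(2) f ft tL_pT)
  qed
  then show ?case by (simp only: deltaB.simps ft tL_pT)
qed

theorem theorem5p2:
  fixes S :: "'f signat"
    and e :: "'f pexp"
    and \<Gamma> :: "pvar set"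
    and \<tau> :: lty
    and \<theta> :: "pvar list"
    and \<phi> :: "pvar \<Rightarrow> tvar"
  assumes "wf_signat S"
    and "ltyping S \<Gamma> {} (desugar e) \<tau> LOne"
    and "distinct \<theta>" and "set \<theta> = FVp (desugar e)"
    and "inj_on \<phi> (set \<theta>)" and "\<forall>x\<in>set \<theta>. tlty (\<phi> x) = plty x"
  shows "log_equiv S
           (map (\<lambda>x. PBang (pv x)) \<theta>)
           (Tensor (OfCourse (pT \<tau>))
              (sec_ty (Lolli (with_ty (map (\<lambda>x. tT (plty x)) \<theta>)) (tT \<tau>))))
           (fwd S (map pv \<theta>) (deltaB e))
           (delta (map \<phi> \<theta>) (fjax S \<phi> e))"
proof -
  have "btyping S \<Gamma> e \<tau>" using assms(2) by (rule ltyping_desugar)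
  \<comment> \<open>Contexts contain nothing but free variables, so \<open>\<theta>\<close>
    enumerates the whole context.\<close>
  then have bt: "btyping S (set \<theta>) e \<tau>" using btyping_FVp assms(4) by metis
  have \<phi>: "tangent_names \<phi> (set \<theta>)" using assms(5,6) by (simp add: tangent_names_def)
  have env: "set (map (\<lambda>x. PBang (pv x)) \<theta>) = bangs (pv ` set \<theta>)" by auto
  have "typing S (bangs (pv ` set \<theta>)) (fwd S (map pv \<theta>) (deltaB e))
      (dual_ty (pT \<tau>) (map (\<lambda>x. tT (plty x)) \<theta>) (tT \<tau>))"
    using typing_fwd[OF bt assms(1), of "map pv \<theta>"] assms(3) by (simp add: distinct_map inj_on_def comp_def)
  moreover have "typing S (bangs (pv ` set \<theta>)) (delta (map \<phi> \<theta>) (fjax S \<phi> e))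
      (dual_ty (pT \<tau>) (map (\<lambda>x. tT (plty x)) \<theta>) (tT \<tau>))"
  proof -
    have fv: "FVp (fjax S \<phi> e) = set \<theta>" "FVt (fjax S \<phi> e) = \<phi> ` set \<theta>"
      using FV_fjax[OF bt assms(1) \<phi>] by simp_all
    have eq: "map (tT \<circ> tlty) (map \<phi> \<theta>) = map (\<lambda>x. tT (plty x)) \<theta>" using assms(6) by simp
    have "distinct (map \<phi> \<theta>)" "set (map \<phi> \<theta>) = FVt (fjax S \<phi> e)"
      using assms(3,5) by (simp_all add: distinct_map fv)
    from delta_typedD[OF delta_typed_fjax[OF bt assms(1) \<phi>] this] show ?thesis
      by (simp only: eq fv)
  qed
  moreover have "\<forall>Ws Ws'. length Ws = length (map (\<lambda>x. PBang (pv x)) \<theta>) \<and>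
      length Ws' = length (map (\<lambda>x. PBang (pv x)) \<theta>) \<and>
      (\<forall>i<length (map (\<lambda>x. PBang (pv x)) \<theta>). leq_values S (map (\<lambda>x. PBang (pv x)) \<theta> ! i) (Ws ! i) (Ws' ! i)) \<longrightarrow>
      leq S (dual_ty (pT \<tau>) (map (\<lambda>x. tT (plty x)) \<theta>) (tT \<tau>))
        (subst (bind_all (map (\<lambda>x. PBang (pv x)) \<theta>) Ws) (fwd S (map pv \<theta>) (deltaB e)))
        (subst (bind_all (map (\<lambda>x. PBang (pv x)) \<theta>) Ws') (delta (map \<phi> \<theta>) (fjax S \<phi> e)))"
    using forward_sound_values[OF assms(1) bt assms(3) \<phi>] by simp
  ultimately show ?thesis unfolding log_equiv_def env by blast
qed

end
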